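(* Let $p\in(1,\infty)$. The operator ideal $\overline{\mathcal{G}}_{G_p}(J_p)$ lies strictly between $\overline{\mathcal{G}}_{\ell_p}(J_p)$ and $\mathcal{W}(J_p)$. Hence the lattice of closed ideals in $\mathcal{B}(J_p)$ has at least six distinct elements, namely \[ \{0\}\subsetneq \mathcal{K}(J_p)\subsetneq\overline{\mathcal{G}}_{\ell_p}(J_p)\subsetneq \overline{\mathcal{G}}_{G_p}(J_p)\subsetneq \mathcal{W}(J_p)\subsetneq \mathcal{B}(J_p). \]
   Context: Let $\mathbb{K}=\mathbb{R}$ or $\mathbb{K}=\mathbb{C}$ be the scalar field. Write $\mathbb{N}_0$ and $\mathbb{N}$ for the sets of non-negative and positive integers, respectively; sequences are indexed by $\mathbb{N}_0$, and $x(n)$ denotes the $n^{\text{th}}$ element of the sequence $x$. For $p\in(1,\infty)$ and $x\in\mathbb{K}^{\mathbb{N}_0}$, put \[ \|x\|_{J_p} = \sup\biggl\{ \Bigl(\sum_{j=1}^k | x(n_j) - x(n_{j+1})|^p\Bigr)^{1/p} : k\in\mathbb{N},\ n_1,\ldots,n_{k+1}\in \mathbb{N}_0,\ n_1 <\cdots < n_{k+1}\biggr\}. \] The $p^{\text{th}}$ James space is the Banach space $J_p = \{ x\in c_0 : \| x\|_{J_p} < \infty\}$ with the norm $\|\cdot\|_{J_p}$. For a family $(X_j)_{j\in\mathbb{J}}$ of Banach spaces, $\bigl(\bigoplus_{j\in\mathbb{J}} X_j\bigr)_p$ is the Banach space of all $(x_j)_{j\in\mathbb{J}}$ with $x_j\in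 X_j$ and $\sum_{j}\|x_j\|^p<\infty$, with norm $\bigl(\sum_j\|x_j\|^p\bigr)^{1/p}$. Put $G_p = \bigl(\bigoplus_{n\in\mathbb{N}} \ell_\infty^n\bigr)_p$, where $\ell_\infty^n$ is $\mathbb{K}^n$ with the maximum norm. For Banach spaces $X$ and $Y$, $\mathcal{B}(X,Y)$ is the space of bounded linear operators from $X$ to $Y$, and $\mathcal{B}(X)=\mathcal{B}(X,X)$. The set of operators on $X$ that factor through $Y$ is \[ \mathcal{G}_Y(X) = \{ ST : T\in\mathcal{B}(X,Y),\ S\in\mathcal{B}(Y,X)\}, \] and $\overline{\mathcal{G}}_Y(X)$ denotes its closure in the operator norm. (When $Y$ contains a complemented subspace isomorphic to $Y\oplus Y$, as is the case for $Y=\ell_p$ and $Y=G_p$, $\mathcal{G}_Y(X)$ is a two-sided ideal of $\mathcal{B}(X)$.) "Closed ideal" means norm-closed two-sided ideal. $\mathcal{K}(X)$ and $\mathcal{W}(X)$ denote the ideals of compact and of weakly compact operators on $X$, respectively. *)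

theory Defs
  imports
    "HOL-Analysis.Analysis"
    "HOL-Algebra.Ideal"
    "HOL-Library.Function_Algebras"
begin

no_notation eq_closure_of (\<open>closure'_of\<index>\<close>)

text \<open>
  The spaces depend on the real parameter \<open>p\<close>, so a normed space over \<open>'k\<close> is given by a carrier
  inside an ambient abelian group \<open>'a\<close> (for sequences and operators: functions with the pointwise
  operations of \<^theory>\<open>HOL-Library.Function_Algebras\<close>), a scalar multiplication and a norm.
  Values of \<open>nrm\<close> outside \<open>vecs\<close> are irrelevant.
\<close>

record ('k, 'a) nspace =
  vecs :: "'a set"
  scal :: "'k \<Rightarrow> 'a \<Rightarrow> 'a"
  nrm :: "'a \<Rightarrow> real"

definition unit_ball :: "('k, 'a) nspace \<Rightarrow> 'a set" where
  "unit_ball X = {x \<in> vecs X. nrm X x \<le> 1}"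

text \<open>The locale \<^locale>\<open>Metric_space\<close> wants a nonnegative symmetric distance on the whole ambient
  type, hence the value 0 off the carrier.\<close>

definition norm_topology :: "('k, 'a::ab_group_add) nspace \<Rightarrow> 'a topology" where
  "norm_topology X = Metric_space.mtopology (vecs X)
     (\<lambda>x y. if x \<in> vecs X \<and> y \<in> vecs X then nrm X (x - y) else 0)"

definition scalar_space :: "('k::real_normed_field, 'k) nspace" where
  "scalar_space = \<lparr>vecs = UNIV, scal = (*), nrm = norm\<rparr>"

text \<open>Bounded linear operators are set to 0 outside the carrier of the domain, so that equality of
  operators is equality of functions.\<close>

definition bounded_ops ::
  "('k, 'a::ab_group_add) nspace \<Rightarrow> ('k, 'b::ab_group_add) nspace \<Rightarrow> ('a \<Rightarrow> 'b) set" where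
  "bounded_ops X Y = {T.
     (\<forall>x\<in>vecs X. T x \<in> vecs Y) \<and>
     (\<forall>x\<in>vecs X. \<forall>y\<in>vecs X. T (x + y) = T x + T y) \<and>
     (\<forall>c. \<forall>x\<in>vecs X. T (scal X c x) = scal Y c (T x)) \<and>
     (\<exists>C. \<forall>x\<in>vecs X. nrm Y (T x) \<le> C * nrm X x) \<and>
     (\<forall>x. x \<notin> vecs X \<longrightarrow> T x = 0)}"

definition op_space ::
  "('k, 'a::ab_group_add) nspace \<Rightarrow> ('k, 'b::ab_group_add) nspace \<Rightarrow> ('k, 'a \<Rightarrow> 'b) nspace" where
  "op_space X Y = \<lparr>vecs = bounded_ops X Y,
     scal = (\<lambda>c T x. scal Y c (T x)),
     nrm = (\<lambda>T. SUP x\<in>unit_ball X. nrm Y (T x))\<rparr>"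

definition op_ring :: "('k, 'a::ab_group_add) nspace \<Rightarrow> ('a \<Rightarrow> 'a) ring" where
  "op_ring X = \<lparr>carrier = bounded_ops X X, mult = (\<circ>),
     one = (\<lambda>x. if x \<in> vecs X then x else 0), zero = 0, add = (+)\<rparr>"

definition closed_ideals :: "('k, 'a::ab_group_add) nspace \<Rightarrow> ('a \<Rightarrow> 'a) set set" where
  "closed_ideals X = {I. ideal I (op_ring X) \<and> closedin (norm_topology (op_space X X)) I}"

definition factor_ops ::
  "('k, 'b::ab_group_add) nspace \<Rightarrow> ('k, 'a::ab_group_add) nspace \<Rightarrow> ('a \<Rightarrow> 'a) set" where
  "factor_ops Y X = {S \<circ> T | S T. T \<in> bounded_ops X Y \<and> S \<in> bounded_ops Y X}"

definition closed_factor_ops ::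
  "('k, 'b::ab_group_add) nspace \<Rightarrow> ('k, 'a::ab_group_add) nspace \<Rightarrow> ('a \<Rightarrow> 'a) set" where
  "closed_factor_ops Y X = norm_topology (op_space X X) closure_of factor_ops Y X"

definition compact_ops :: "('k, 'a::ab_group_add) nspace \<Rightarrow> ('a \<Rightarrow> 'a) set" where
  "compact_ops X = {T \<in> bounded_ops X X.
     compactin (norm_topology X) (norm_topology X closure_of (T ` unit_ball X))}"

definition weak_topology :: "('k::real_normed_field, 'a::ab_group_add) nspace \<Rightarrow> 'a topology" where
  "weak_topology X = topology_generated_by
     {{x \<in> vecs X. f x \<in> U} | f U. f \<in> bounded_ops X scalar_space \<and> open U}"

definition weakly_compact_ops ::
  "('k::real_normed_field, 'a::ab_group_add) nspace \<Rightarrow> ('a \<Rightarrow> 'a) set" where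
  "weakly_compact_ops X = {T \<in> bounded_ops X X.
     compactin (weak_topology X) (weak_topology X closure_of (T ` unit_ball X))}"

text \<open>The \<open>p\<close>-direct sum of the family \<open>X\<close> over the index set \<open>J\<close>; coordinates outside \<open>J\<close> are 0.\<close>

definition direct_sum ::
  "real \<Rightarrow> 'j set \<Rightarrow> ('j \<Rightarrow> ('k, 'a::ab_group_add) nspace) \<Rightarrow> ('k, 'j \<Rightarrow> 'a) nspace" where
  "direct_sum p J X = \<lparr>
     vecs = {x. (\<forall>j\<in>J. x j \<in> vecs (X j)) \<and> (\<forall>j. j \<notin> J \<longrightarrow> x j = 0) \<and>
                (\<lambda>j. nrm (X j) (x j) powr p) summable_on J},
     scal = (\<lambda>c x j. scal (X j) c (x j)),
     nrm = (\<lambda>x. (\<Sum>\<^sub>\<infinity>j\<in>J. nrm (X j) (x j) powr p) powr (1 / p))\<rparr>"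

definition lp_space :: "real \<Rightarrow> ('k::real_normed_field, nat \<Rightarrow> 'k) nspace" where
  "lp_space p = direct_sum p UNIV (\<lambda>_. scalar_space)"

text \<open>\<open>\<ell>\<^sub>\<infinity>\<^sup>n\<close>, to be used for \<open>n \<ge> 1\<close>: vectors are functions supported on \<open>{..<n}\<close>.\<close>

definition linf_space :: "nat \<Rightarrow> ('k::real_normed_field, nat \<Rightarrow> 'k) nspace" where
  "linf_space n = \<lparr>vecs = {x. \<forall>i\<ge>n. x i = 0},
     scal = (\<lambda>c x i. c * x i),
     nrm = (\<lambda>x. Max ((\<lambda>i. norm (x i)) ` {..<n}))\<rparr>"

definition G_space :: "real \<Rightarrow> ('k::real_normed_field, nat \<Rightarrow> nat \<Rightarrow> 'k) nspace" where
  "G_space p = direct_sum p {1..} linf_space"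

definition james_sums :: "real \<Rightarrow> (nat \<Rightarrow> 'k::real_normed_field) \<Rightarrow> real set" where
  "james_sums p x = {(\<Sum>j=1..k. norm (x (n j) - x (n (j + 1))) powr p) powr (1 / p) |
     (k::nat) (n::nat \<Rightarrow> nat).
     1 \<le> k \<and> strict_mono_on {1..k + 1} n}"

definition james_space :: "real \<Rightarrow> ('k::real_normed_field, nat \<Rightarrow> 'k) nspace" where
  "james_space p = \<lparr>vecs = {x. x \<longlonglongrightarrow> 0 \<and> bdd_above (james_sums p x)},
     scal = (\<lambda>c x i. c * x i),
     nrm = (\<lambda>x. Sup (james_sums p x))\<rparr>"

end

theory Submission
  imports Defs "HOL-Complex_Analysis.Great_Picard"
begin

text \<open>
  Write \<open>J\<close> for the James space, \<open>L\<close> for \<open>\<ell>\<^sub>p\<close> and \<open>G\<close> for \<open>G\<^sub>p\<close>, and let \<open>q\<close> be the conjugate exponent of \<open>p\<close>. The norm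
  of \<open>J\<close> satisfies an upper and a lower \<open>p\<close>-estimate for successive blocks of coordinates
  (\<open>james_upper_estimate\<close>, \<open>james_lower_estimate\<close>), so that \<open>J\<close> resembles an \<open>\<ell>\<^sub>p\<close>-sum of its blocks.

  Inclusions. On a block of length \<open>2 ^ n\<close>, a series of tent functions of all dyadic scales, scaled as in
  Weierstrass's nowhere differentiable function, is Hoelder continuous with exponent \<open>1 / p\<close> if its coefficients
  are bounded; hence it has bounded \<open>p\<close>-variation, however large \<open>n\<close> is. Its coefficients are recovered by averaged
  second differences. This gives a copy of \<open>\<ell>\<^sub>\<infinity>\<^sup>n\<close> in the block, complemented uniformly in \<open>n\<close>, and so a
  complemented copy of \<open>G\<close> in \<open>J\<close> (\<open>embed\<close>, \<open>coefs\<close>, \<open>coefs_embed\<close>). It lies in the range of the projection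
  \<open>block_proj\<close> onto the sequences that vanish at the ends of all blocks. As bounded pointwise limits of
  such sequences are null sequences, this projection is weakly compact; hence so is everything that
  factors through \<open>G\<close>. Weak compactness is handled by the criterion that pointwise limits of images of the unit
  ball tend to 0 (\<open>weakly_compact_ops_iff\<close>), which is valid because the unit vector basis of \<open>J\<close> is shrinking
  (\<open>functional_tail\<close>). Compact operators are uniform limits of their truncations, which factor through \<open>L\<close>.

  Strictness. The operators that separate neighbouring ideals are: the projection onto a copy of \<open>L\<close>, for the compact
  operators; the projection \<open>embed \<circ> coefs\<close> onto the copy of \<open>G\<close>, for \<open>L\<close>; the projection \<open>block_proj\<close>, for \<open>G\<close>; and
  the identity, for the weakly compact operators, since the vectors \<open>(1, \<dots>, 1, 0, 0, \<dots>)\<close> are bounded in \<open>J\<close>. In the second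
  case, signs can be chosen such that sums of vectors of \<open>L\<close> that are bounded below become arbitrarily large
  (\<open>signed_sums_unbounded\<close>), whereas sums of unit vectors of \<open>\<ell>\<^sub>\<infinity>\<^sup>n\<close> do not.

  The third case is the heart of the matter. An operator \<open>S \<circ> T\<close> close to \<open>block_proj\<close> would yield vectors \<open>b j\<close> of
  bounded norm in \<open>G\<close> that \<open>S\<close> maps close to the indicators of the initial segments of a long block. This
  is impossible (\<open>summing_basis_not_factored\<close>): on the one hand, differences of averages of the rows of the matrix
  of \<open>S\<close> over the two halves of any dyadic interval would be bounded below in the dual of \<open>G\<close>, since the
  indicator that drops from 1 to 0 at the midpoint tests them. On the other hand they have to be small for most
  intervals. The norms of the averaged rows, measured in each summand of \<open>G\<close>, are bounded, increase on average under
  refinement, and hence are almost constant on some window of consecutive dyadic generations (\<open>window_bound\<close>); there, single entries of bounded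
  relative size oscillate little because martingale differences are orthogonal. Entries that are much
  larger than their mean occur on sets of few points, and carry little mass in total by a chaining argument
  (\<open>small_sets_mass_le\<close>): picking for each column of \<open>S\<close> its own one among \<open>2 ^ r\<close> rows costs only a factor
  of order \<open>2 powr (r / q)\<close>, since the columns combine to elements of \<open>J\<close>, which have bounded \<open>p\<close>-variation.
\<close>

section \<open>Finite Hoelder and Minkowski inequalities\<close>

lemma powr_convex_combination:
  fixes u v s t p :: real
  assumes "1 \<le> p" "0 \<le> u" "0 \<le> v" "0 \<le> s" "0 \<le> t" "s + t = 1"
  shows "(s * u + t * v) powr p \<le> s * u powr p + t * v powr p"
proof -
  have scale: "(r * w) powr p \<le> r * w powr p" if "0 \<le> r" "r \<le> 1" "0 \<le> w" for r w :: real
  proof -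
    have "r powr p \<le> r"
      using powr_mono'[of 1 p r] that assms(1) by (cases "r = 0") auto
    then show ?thesis
      using that by (simp add: powr_mult mult_right_mono)
  qed
  consider "u = 0" | "v = 0" | "u > 0" "v > 0"
    using assms by linarith
  then show ?thesis
  proof cases
    case 1
    then show ?thesis using scale[of t v] assms by simp
  next
    case 2
    then show ?thesis using scale[of s u] assms by simp
  next
    case 3
    then show ?thesis
      using convex_onD[OF powr_convex[OF assms(1)], of t u v] assms
      unfolding eq_diff_eq[symmetric, of s] by simp
  qed
qed

lemma powr_add_le:
  fixes u v p :: real
  assumes "1 \<le> p" "0 \<le> u" "0 \<le> v"
  shows "(u + v) powr p \<le> 2 powr (p - 1) * (u powr p + v powr p)"
proof -
  have "(u + v) powr p = 2 powr p * ((1/2) * u + (1/2) * v) powr p"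
    using assms by (subst powr_mult[symmetric]) (auto simp: algebra_simps)
  also have "\<dots> \<le> 2 powr p * ((1/2) * u powr p + (1/2) * v powr p)"
    using assms by (intro mult_left_mono powr_convex_combination) auto
  also have "\<dots> = 2 powr (p - 1) * (u powr p + v powr p)"
    by (simp add: powr_diff field_simps)
  finally show ?thesis .
qed

lemma Minkowski_sum:
  fixes a b :: "'i \<Rightarrow> real"
  assumes p: "1 \<le> p" and a: "\<And>i. i \<in> A \<Longrightarrow> 0 \<le> a i" and b: "\<And>i. i \<in> A \<Longrightarrow> 0 \<le> b i"
  shows "(\<Sum>i\<in>A. (a i + b i) powr p) powr (1 / p)
    \<le> (\<Sum>i\<in>A. a i powr p) powr (1 / p) + (\<Sum>i\<in>A. b i powr p) powr (1 / p)"
proof (cases "finite A")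
  case fin: True
  define s where "s = (\<Sum>i\<in>A. a i powr p) powr (1 / p)"
  define t where "t = (\<Sum>i\<in>A. b i powr p) powr (1 / p)"
  have sp: "s powr p = (\<Sum>i\<in>A. a i powr p)" and tp: "t powr p = (\<Sum>i\<in>A. b i powr p)"
    using p by (auto simp: s_def t_def powr_powr sum_nonneg)
  have s0: "0 \<le> s" and t0: "0 \<le> t" by (auto simp: s_def t_def)
  have zero: "f i = 0" if "(\<Sum>i\<in>A. f i powr p) = 0" "i \<in> A" for f :: "'i \<Rightarrow> real" and i
    using that fin by (subst (asm) sum_nonneg_eq_0_iff) auto
  consider "s = 0" | "t = 0" | "s > 0" "t > 0"
    using s0 t0 by linarith
  then show ?thesis
  proof cases
    case 1
    then have "a i = 0" if "i \<in> A" for i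
      using zero[where f = a] sp that p by simp
    then show ?thesis
      by (simp add: sum.cong[of A A "\<lambda>i. (a i + b i) powr p" "\<lambda>i. b i powr p"])
  next
    case 2
    then have "b i = 0" if "i \<in> A" for i
      using zero[where f = b] tp that p by simp
    then show ?thesis
      by (simp add: sum.cong[of A A "\<lambda>i. (a i + b i) powr p" "\<lambda>i. a i powr p"])
  next
    case 3
    have "(a i + b i) powr p \<le> (s + t) powr p * (s / (s + t) * (a i / s) powr p
        + t / (s + t) * (b i / t) powr p)" if "i \<in> A" for i
    proof -
      have "(a i + b i) powr p = ((s + t) * (s / (s + t) * (a i / s) + t / (s + t) * (b i / t))) powr p"
      proof -
        have "(s + t) * (s / (s + t) * (a i / s) + t / (s + t) * (b i / t)) = a i + b i"
          using 3 by (simp add: distrib_left)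
        then show ?thesis by simp
      qed
      also have "\<dots> = (s + t) powr p * (s / (s + t) * (a i / s) + t / (s + t) * (b i / t)) powr p"
        using 3 a[OF that] b[OF that] by (subst powr_mult) auto
      also have "\<dots> \<le> (s + t) powr p * (s / (s + t) * (a i / s) powr p + t / (s + t) * (b i / t) powr p)"
        using 3 a[OF that] b[OF that] p
        by (intro mult_left_mono powr_convex_combination) (auto simp: add_divide_distrib[symmetric])
      finally show ?thesis .
    qed
    then have "(\<Sum>i\<in>A. (a i + b i) powr p) \<le> (\<Sum>i\<in>A. (s + t) powr p * (s / (s + t) * (a i / s) powr p
        + t / (s + t) * (b i / t) powr p))"
      by (intro sum_mono)
    also have "\<dots> = (s + t) powr p * (s / (s + t) * ((\<Sum>i\<in>A. a i powr p) / s powr p)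
        + t / (s + t) * ((\<Sum>i\<in>A. b i powr p) / t powr p))"
    proof -
      have "(\<Sum>i\<in>A. (a i / s) powr p) = (\<Sum>i\<in>A. a i powr p) / s powr p"
           "(\<Sum>i\<in>A. (b i / t) powr p) = (\<Sum>i\<in>A. b i powr p) / t powr p"
        using a b 3 by (auto simp: powr_divide sum_divide_distrib intro!: sum.cong)
      then show ?thesis
        by (simp only: sum.distrib sum_distrib_left[symmetric])
    qed
    also have "\<dots> = (s + t) powr p"
    proof -
      have "s powr p / s powr p = 1" "t powr p / t powr p = 1" "s / (s + t) + t / (s + t) = 1"
        using 3 by (auto simp: add_divide_distrib[symmetric])
      then show ?thesis unfolding sp[symmetric] tp[symmetric] by simp
    qed
    finally have "(\<Sum>i\<in>A. (a i + b i) powr p) powr (1 / p) \<le> ((s + t) powr p) powr (1 / p)"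
      using p by (intro powr_mono2) (auto simp: sum_nonneg)
    also have "\<dots> = s + t"
      using 3 p by (simp add: powr_powr)
    finally show ?thesis by (simp add: s_def t_def)
  qed
qed simp

lemma Hoelder_sum:
  fixes a b :: "'i \<Rightarrow> real"
  assumes p: "1 < p" and pq: "1 / p + 1 / q = 1"
    and a: "\<And>i. i \<in> A \<Longrightarrow> 0 \<le> a i" and b: "\<And>i. i \<in> A \<Longrightarrow> 0 \<le> b i"
  shows "(\<Sum>i\<in>A. a i * b i) \<le> (\<Sum>i\<in>A. a i powr p) powr (1 / p) * (\<Sum>i\<in>A. b i powr q) powr (1 / q)"
proof (cases "finite A")
  case fin: True
  have q: "1 < q"
  proof -
    have "1 / p < 1" "0 < 1 / p" using p by auto
    then have "0 < 1 / q" "1 / q < 1" using pq by linarith+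
    then show ?thesis by (simp add: divide_less_eq split: if_splits)
  qed
  define s where "s = (\<Sum>i\<in>A. a i powr p) powr (1 / p)"
  define t where "t = (\<Sum>i\<in>A. b i powr q) powr (1 / q)"
  have sp: "s powr p = (\<Sum>i\<in>A. a i powr p)" and tp: "t powr q = (\<Sum>i\<in>A. b i powr q)"
    using p q by (auto simp: s_def t_def powr_powr sum_nonneg)
  have s0: "0 \<le> s" and t0: "0 \<le> t" by (auto simp: s_def t_def)
  have zero: "f i = 0" if "(\<Sum>i\<in>A. f i powr r) = 0" "i \<in> A" for f :: "'i \<Rightarrow> real" and i r
    using that fin by (subst (asm) sum_nonneg_eq_0_iff) auto
  consider "s = 0" | "t = 0" | "s > 0" "t > 0"
    using s0 t0 by linarith
  then show ?thesis
  proof cases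
    case 1
    then have "a i = 0" if "i \<in> A" for i
      using zero[where f = a and r = p] sp that p by simp
    then show ?thesis by simp
  next
    case 2
    then have "b i = 0" if "i \<in> A" for i
      using zero[where f = b and r = q] tp that q by simp
    then show ?thesis by simp
  next
    case 3
    have "(\<Sum>i\<in>A. a i * b i) = s * t * (\<Sum>i\<in>A. (a i / s) * (b i / t))"
      using 3 by (simp add: sum_distrib_left)
    also have "(\<Sum>i\<in>A. (a i / s) * (b i / t)) \<le> (\<Sum>i\<in>A. (a i / s) powr p / p + (b i / t) powr q / q)"
      using a b 3 p q pq by (intro sum_mono Youngs_inequality) auto
    also have "\<dots> = 1"
    proof -
      have "(\<Sum>i\<in>A. (a i / s) powr p) = (\<Sum>i\<in>A. a i powr p) / s powr p"
           "(\<Sum>i\<in>A. (b i / t) powr q) = (\<Sum>i\<in>A. b i powr q) / t powr q"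
        using a b 3 by (auto simp: powr_divide sum_divide_distrib intro!: sum.cong)
      then show ?thesis
        using 3 pq unfolding sp[symmetric] tp[symmetric] by (simp add: sum.distrib sum_divide_distrib[symmetric])
    qed
    finally show ?thesis
      using 3 unfolding s_def[symmetric] t_def[symmetric] by simp
  qed
qed simp

lemma sum_le_card_powr:
  fixes a :: "'i \<Rightarrow> real"
  assumes p: "1 < p" and pq: "1 / p + 1 / q = 1" and a: "\<And>i. i \<in> A \<Longrightarrow> 0 \<le> a i" and fin: "finite A"
  shows "(\<Sum>i\<in>A. a i) \<le> real (card A) powr (1 / q) * (\<Sum>i\<in>A. a i powr p) powr (1 / p)"
  using Hoelder_sum[OF p pq, of A a "\<lambda>_. 1"] a fin by (simp add: mult.commute)

section \<open>Normed spaces and bounded operators\<close>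

locale normed_nspace =
  fixes X :: "('k::real_normed_field, 'a::ab_group_add) nspace"
  assumes zero_vecs: "0 \<in> vecs X"
    and add_vecs: "\<lbrakk>x \<in> vecs X; y \<in> vecs X\<rbrakk> \<Longrightarrow> x + y \<in> vecs X"
    and scal_vecs: "x \<in> vecs X \<Longrightarrow> scal X c x \<in> vecs X"
    and scal_add: "\<lbrakk>x \<in> vecs X; y \<in> vecs X\<rbrakk> \<Longrightarrow> scal X c (x + y) = scal X c x + scal X c y"
    and scal_minus1: "x \<in> vecs X \<Longrightarrow> scal X (- 1) x = - x"
    and scal_scal: "x \<in> vecs X \<Longrightarrow> scal X c (scal X d x) = scal X (c * d) x"
    and nrm_triangle: "\<lbrakk>x \<in> vecs X; y \<in> vecs X\<rbrakk> \<Longrightarrow> nrm X (x + y) \<le> nrm X x + nrm X y"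
    and nrm_scal: "x \<in> vecs X \<Longrightarrow> nrm X (scal X c x) = norm c * nrm X x"
    and nrm_eq_0: "\<lbrakk>x \<in> vecs X; nrm X x = 0\<rbrakk> \<Longrightarrow> x = 0"
begin

lemma uminus_vecs: "x \<in> vecs X \<Longrightarrow> - x \<in> vecs X"
  using scal_vecs[of x "- 1"] scal_minus1 by simp

lemma diff_vecs: "\<lbrakk>x \<in> vecs X; y \<in> vecs X\<rbrakk> \<Longrightarrow> x - y \<in> vecs X"
  using add_vecs[of x "- y"] uminus_vecs by simp

lemma scal_0: "x \<in> vecs X \<Longrightarrow> scal X 0 x = 0"
  using nrm_eq_0[of "scal X 0 x"] scal_vecs nrm_scal[of x 0] by simp

lemma nrm_0: "nrm X 0 = 0"
  using nrm_scal[OF zero_vecs, of 0] scal_0[OF zero_vecs] by simp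

lemma scal_zero_vec: "scal X c 0 = 0"
  using nrm_eq_0[of "scal X c 0"] scal_vecs zero_vecs nrm_scal[OF zero_vecs, of c] nrm_0 by simp

lemma nrm_minus: "x \<in> vecs X \<Longrightarrow> nrm X (- x) = nrm X x"
  using nrm_scal[of x "- 1"] scal_minus1 by simp

lemma nrm_ge_0: "x \<in> vecs X \<Longrightarrow> 0 \<le> nrm X x"
  using nrm_triangle[of x "- x"] uminus_vecs nrm_minus nrm_0 by simp

lemma nrm_diff_commute: "\<lbrakk>x \<in> vecs X; y \<in> vecs X\<rbrakk> \<Longrightarrow> nrm X (x - y) = nrm X (y - x)"
  using nrm_minus[of "x - y"] diff_vecs by simp

lemma nrm_diff_triangle:
  "\<lbrakk>x \<in> vecs X; y \<in> vecs X; z \<in> vecs X\<rbrakk> \<Longrightarrow> nrm X (x - z) \<le> nrm X (x - y) + nrm X (y - z)"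
  using nrm_triangle[of "x - y" "y - z"] diff_vecs by simp

lemma nrm_diff_le: "\<lbrakk>x \<in> vecs X; y \<in> vecs X\<rbrakk> \<Longrightarrow> nrm X (x - y) \<le> nrm X x + nrm X y"
  using nrm_triangle[of x "- y"] uminus_vecs nrm_minus by simp

lemma nrm_triangle_sub: "\<lbrakk>x \<in> vecs X; y \<in> vecs X\<rbrakk> \<Longrightarrow> nrm X x \<le> nrm X y + nrm X (x - y)"
  using nrm_triangle[of y "x - y"] diff_vecs by simp

lemma sum_vecs: "(\<And>i. i \<in> A \<Longrightarrow> f i \<in> vecs X) \<Longrightarrow> (\<Sum>i\<in>A. f i) \<in> vecs X"
  by (induction A rule: infinite_finite_induct) (auto simp: zero_vecs add_vecs)

definition ndist :: "'a \<Rightarrow> 'a \<Rightarrow> real" where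
  "ndist x y = (if x \<in> vecs X \<and> y \<in> vecs X then nrm X (x - y) else 0)"

lemma Metric_space_ndist: "Metric_space (vecs X) ndist"
proof
  show "ndist x y = 0 \<longleftrightarrow> x = y" if "x \<in> vecs X" "y \<in> vecs X" for x y
    using that nrm_eq_0[of "x - y"] diff_vecs by (auto simp: ndist_def nrm_0)
qed (auto simp: ndist_def nrm_ge_0 diff_vecs nrm_diff_commute nrm_diff_triangle)

sublocale metric: Metric_space "vecs X" ndist
  by (rule Metric_space_ndist)

lemma norm_topology_eq: "norm_topology X = metric.mtopology"
proof -
  have "ndist = (\<lambda>x y. if x \<in> vecs X \<and> y \<in> vecs X then nrm X (x - y) else 0)"
    by (intro ext) (simp add: ndist_def)
  then show ?thesis
    unfolding norm_topology_def by simp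
qed

lemma norm_closure_iff:
  "x \<in> norm_topology X closure_of S \<longleftrightarrow> x \<in> vecs X \<and> (\<forall>e>0. \<exists>y\<in>S \<inter> vecs X. nrm X (x - y) < e)"
  unfolding norm_topology_eq metric.metric_closure_of
  by (auto simp: metric.in_mball ndist_def Bex_def)

lemma closedin_norm_iff:
  "closedin (norm_topology X) S \<longleftrightarrow>
    S \<subseteq> vecs X \<and> (\<forall>x\<in>vecs X. (\<forall>e>0. \<exists>y\<in>S. nrm X (x - y) < e) \<longrightarrow> x \<in> S)"
proof -
  have "closedin (norm_topology X) S \<longleftrightarrow> S \<subseteq> vecs X \<and> norm_topology X closure_of S \<subseteq> S"
    using closure_of_subset_eq[of S "norm_topology X"] by (simp add: norm_topology_eq)
  also have "\<dots> \<longleftrightarrow> S \<subseteq> vecs X \<and> (\<forall>x\<in>vecs X. (\<forall>e>0. \<exists>y\<in>S. nrm X (x - y) < e) \<longrightarrow> x \<in> S)"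
  proof (rule conj_cong[OF refl])
    assume "S \<subseteq> vecs X"
    then have "S \<inter> vecs X = S" by blast
    then show "norm_topology X closure_of S \<subseteq> S \<longleftrightarrow>
        (\<forall>x\<in>vecs X. (\<forall>e>0. \<exists>y\<in>S. nrm X (x - y) < e) \<longrightarrow> x \<in> S)"
      by (simp add: norm_closure_iff subset_iff Ball_def) blast
  qed
  finally show ?thesis .
qed

end

lemma bounded_opsI:
  assumes "\<And>x. x \<in> vecs X \<Longrightarrow> T x \<in> vecs Y"
    and "\<And>x y. \<lbrakk>x \<in> vecs X; y \<in> vecs X\<rbrakk> \<Longrightarrow> T (x + y) = T x + T y"
    and "\<And>c x. x \<in> vecs X \<Longrightarrow> T (scal X c x) = scal Y c (T x)"
    and "\<And>x. x \<in> vecs X \<Longrightarrow> nrm Y (T x) \<le> C * nrm X x"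
    and "\<And>x. x \<notin> vecs X \<Longrightarrow> T x = 0"
  shows "T \<in> bounded_ops X Y"
  using assms unfolding bounded_ops_def by blast

definition restrict_op :: "('k, 'a) nspace \<Rightarrow> ('a \<Rightarrow> 'b::zero) \<Rightarrow> 'a \<Rightarrow> 'b" where
  "restrict_op X f = (\<lambda>x. if x \<in> vecs X then f x else 0)"

lemma restrict_op_apply [simp]: "x \<in> vecs X \<Longrightarrow> restrict_op X f x = f x"
  by (simp add: restrict_op_def)

lemma (in normed_nspace) restrict_op_bounded:
  assumes "\<And>x. x \<in> vecs X \<Longrightarrow> f x \<in> vecs Y"
    and "\<And>x y. \<lbrakk>x \<in> vecs X; y \<in> vecs X\<rbrakk> \<Longrightarrow> f (x + y) = f x + f y"
    and "\<And>c x. x \<in> vecs X \<Longrightarrow> f (scal X c x) = scal Y c (f x)"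
    and "\<And>x. x \<in> vecs X \<Longrightarrow> nrm Y (f x) \<le> C * nrm X x"
  shows "restrict_op X f \<in> bounded_ops X Y"
  using assms add_vecs scal_vecs by (intro bounded_opsI[where C = C]) (auto simp: restrict_op_def)

lemma (in normed_nspace) sum_restrict_op:
  fixes f :: "'i \<Rightarrow> 'a" and T :: "'a \<Rightarrow> 'b::ab_group_add"
  assumes "\<And>x y. \<lbrakk>x \<in> vecs X; y \<in> vecs X\<rbrakk> \<Longrightarrow> T (x + y) = T x + T y"
    and "\<And>i. i \<in> A \<Longrightarrow> f i \<in> vecs X"
  shows "T (\<Sum>i\<in>A. f i) = (\<Sum>i\<in>A. T (f i))"
proof -
  have "T 0 = 0"
    using assms(1)[OF zero_vecs zero_vecs] by simp
  with assms(2) show ?thesis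
    by (induction A rule: infinite_finite_induct) (auto simp: assms(1) sum_vecs)
qed

lemma bounded_ops_vecs: "\<lbrakk>T \<in> bounded_ops X Y; x \<in> vecs X\<rbrakk> \<Longrightarrow> T x \<in> vecs Y"
  and bounded_ops_add: "\<lbrakk>T \<in> bounded_ops X Y; x \<in> vecs X; y \<in> vecs X\<rbrakk> \<Longrightarrow> T (x + y) = T x + T y"
  and bounded_ops_scal: "\<lbrakk>T \<in> bounded_ops X Y; x \<in> vecs X\<rbrakk> \<Longrightarrow> T (scal X c x) = scal Y c (T x)"
  and bounded_ops_off: "\<lbrakk>T \<in> bounded_ops X Y; x \<notin> vecs X\<rbrakk> \<Longrightarrow> T x = 0"
  by (auto simp: bounded_ops_def)

locale normed_pair = X: normed_nspace X + Y: normed_nspace Y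
  for X :: "('k::real_normed_field, 'a::ab_group_add) nspace"
    and Y :: "('k, 'b::ab_group_add) nspace"
begin

lemma bounded_ops_zero: "T \<in> bounded_ops X Y \<Longrightarrow> T 0 = 0"
  using bounded_ops_add[of T X Y 0 0] X.zero_vecs by simp

lemma bounded_ops_minus: "\<lbrakk>T \<in> bounded_ops X Y; x \<in> vecs X\<rbrakk> \<Longrightarrow> T (- x) = - T x"
  using bounded_ops_scal[of T X Y x "- 1"] X.scal_minus1 Y.scal_minus1 bounded_ops_vecs by fastforce

lemma bounded_ops_diff:
  "\<lbrakk>T \<in> bounded_ops X Y; x \<in> vecs X; y \<in> vecs X\<rbrakk> \<Longrightarrow> T (x - y) = T x - T y"
  using bounded_ops_add[of T X Y x "- y"] bounded_ops_minus X.uminus_vecs by simp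

lemma bounded_ops_bound:
  assumes "T \<in> bounded_ops X Y"
  obtains C where "0 < C" "\<And>x. x \<in> vecs X \<Longrightarrow> nrm Y (T x) \<le> C * nrm X x"
proof -
  obtain C where C: "\<And>x. x \<in> vecs X \<Longrightarrow> nrm Y (T x) \<le> C * nrm X x"
    using assms unfolding bounded_ops_def by blast
  have "nrm Y (T x) \<le> (\<bar>C\<bar> + 1) * nrm X x" if "x \<in> vecs X" for x
  proof -
    have "C * nrm X x \<le> (\<bar>C\<bar> + 1) * nrm X x"
      using X.nrm_ge_0[OF that] by (intro mult_right_mono) auto
    then show ?thesis using C[OF that] by simp
  qed
  then show thesis
    by (intro that[of "\<bar>C\<bar> + 1"]) auto
qed

abbreviation opnorm :: "('a \<Rightarrow> 'b) \<Rightarrow> real" where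
  "opnorm T \<equiv> nrm (op_space X Y) T"

lemma zero_in_unit_ball: "0 \<in> unit_ball X"
  by (simp add: unit_ball_def X.zero_vecs X.nrm_0)

lemma opnorm_bdd: "T \<in> bounded_ops X Y \<Longrightarrow> bdd_above ((\<lambda>x. nrm Y (T x)) ` unit_ball X)"
proof -
  assume T: "T \<in> bounded_ops X Y"
  obtain C where C: "0 < C" "\<And>x. x \<in> vecs X \<Longrightarrow> nrm Y (T x) \<le> C * nrm X x"
    using bounded_ops_bound[OF T] by blast
  have "nrm Y (T x) \<le> C" if "x \<in> unit_ball X" for x
  proof -
    have "C * nrm X x \<le> C * 1"
      using that C(1) by (intro mult_left_mono) (auto simp: unit_ball_def)
    then show ?thesis using C(2)[of x] that by (auto simp: unit_ball_def)
  qed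
  then show ?thesis by (auto simp: bdd_above_def)
qed

lemma opnorm_ge_0: "T \<in> bounded_ops X Y \<Longrightarrow> 0 \<le> opnorm T"
  using cSUP_upper[OF zero_in_unit_ball opnorm_bdd, of T] bounded_ops_zero[of T] Y.nrm_0
  by (simp add: op_space_def)

lemma opnorm_bound:
  assumes T: "T \<in> bounded_ops X Y" and x: "x \<in> vecs X"
  shows "nrm Y (T x) \<le> opnorm T * nrm X x"
proof (cases "nrm X x = 0")
  case True
  then have "x = 0" using X.nrm_eq_0 x by simp
  then show ?thesis using bounded_ops_zero[OF T] Y.nrm_0 X.nrm_0 by simp
next
  case False
  then have pos: "nrm X x > 0" using X.nrm_ge_0[OF x] by simp
  define y where "y = scal X (of_real (1 / nrm X x)) x"
  have y: "y \<in> unit_ball X"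
    using pos x by (simp add: y_def unit_ball_def X.scal_vecs X.nrm_scal norm_divide)
  have "nrm Y (T y) \<le> opnorm T"
    using cSUP_upper[OF y opnorm_bdd[OF T]] by (simp add: op_space_def)
  moreover have "nrm Y (T y) = nrm Y (T x) / nrm X x"
    using pos x T by (simp add: y_def bounded_ops_scal Y.nrm_scal bounded_ops_vecs norm_divide)
  ultimately show ?thesis using pos by (simp add: field_simps)
qed

lemma opnorm_le:
  assumes "0 \<le> C" "\<And>x. x \<in> vecs X \<Longrightarrow> nrm Y (T x) \<le> C * nrm X x"
  shows "opnorm T \<le> C"
  unfolding op_space_def nspace.simps
proof (rule cSUP_least)
  show "unit_ball X \<noteq> {}" using zero_in_unit_ball by blast
  fix x assume x: "x \<in> unit_ball X"
  have "nrm Y (T x) \<le> C * nrm X x" "C * nrm X x \<le> C * 1"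
    using x assms mult_left_mono[of "nrm X x" 1 C] by (auto simp: unit_ball_def)
  then show "nrm Y (T x) \<le> C" by simp
qed

lemma bounded_ops_0: "0 \<in> bounded_ops X Y"
  by (rule bounded_opsI[where C = 0]) (auto simp: Y.zero_vecs Y.scal_zero_vec Y.nrm_0)

lemma bounded_ops_plus:
  assumes S: "S \<in> bounded_ops X Y" and T: "T \<in> bounded_ops X Y"
  shows "S + T \<in> bounded_ops X Y"
proof (rule bounded_opsI[where C = "opnorm S + opnorm T"])
  fix x assume x: "x \<in> vecs X"
  show "nrm Y ((S + T) x) \<le> (opnorm S + opnorm T) * nrm X x"
    using Y.nrm_triangle[of "S x" "T x"] opnorm_bound[OF S x] opnorm_bound[OF T x]
      bounded_ops_vecs[OF S x] bounded_ops_vecs[OF T x] by (simp add: algebra_simps)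
qed (use S T in \<open>auto simp: Y.add_vecs bounded_ops_vecs bounded_ops_add bounded_ops_scal
      bounded_ops_off Y.scal_add algebra_simps\<close>)

lemma bounded_ops_smult:
  assumes T: "T \<in> bounded_ops X Y"
  shows "(\<lambda>x. scal Y c (T x)) \<in> bounded_ops X Y"
proof (rule bounded_opsI[where C = "norm c * opnorm T"])
  fix x assume x: "x \<in> vecs X"
  show "nrm Y (scal Y c (T x)) \<le> norm c * opnorm T * nrm X x"
    using opnorm_bound[OF T x] bounded_ops_vecs[OF T x]
    by (simp add: Y.nrm_scal mult_left_mono mult.assoc)
qed (use T in \<open>auto simp: Y.scal_vecs Y.scal_scal Y.scal_add bounded_ops_vecs bounded_ops_add
      bounded_ops_scal bounded_ops_off Y.scal_zero_vec mult.commute\<close>)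

lemma bounded_ops_uminus:
  assumes T: "T \<in> bounded_ops X Y"
  shows "- T \<in> bounded_ops X Y"
proof -
  have "(\<lambda>x. scal Y (- 1) (T x)) = - T"
  proof
    show "scal Y (- 1) (T x) = (- T) x" for x
      using T bounded_ops_vecs[OF T, of x] bounded_ops_off[OF T, of x]
      by (cases "x \<in> vecs X") (auto simp: Y.scal_minus1 Y.scal_zero_vec)
  qed
  then show ?thesis using bounded_ops_smult[OF T, of "- 1"] by simp
qed

lemma bounded_ops_eqI:
  assumes "S \<in> bounded_ops X Y" "T \<in> bounded_ops X Y" "\<And>x. x \<in> vecs X \<Longrightarrow> S x = T x"
  shows "S = T"
proof
  show "S x = T x" for x
    using assms bounded_ops_off[of S X Y x] bounded_ops_off[of T X Y x] by (cases "x \<in> vecs X") auto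
qed

lemma normed_op_space: "normed_nspace (op_space X Y)"
proof
  show "0 \<in> vecs (op_space X Y)" by (simp add: op_space_def bounded_ops_0)
  show "S + T \<in> vecs (op_space X Y)" if "S \<in> vecs (op_space X Y)" "T \<in> vecs (op_space X Y)" for S T
    using that by (simp add: op_space_def bounded_ops_plus)
  show "scal (op_space X Y) c T \<in> vecs (op_space X Y)" if "T \<in> vecs (op_space X Y)" for c T
    using that by (simp add: op_space_def bounded_ops_smult)
  show "scal (op_space X Y) c (S + T) = scal (op_space X Y) c S + scal (op_space X Y) c T"
    if S: "S \<in> vecs (op_space X Y)" and T: "T \<in> vecs (op_space X Y)" for c S T
  proof
    have ST: "S \<in> bounded_ops X Y" "T \<in> bounded_ops X Y" using S T by (auto simp: op_space_def)
    show "scal (op_space X Y) c (S + T) x = (scal (op_space X Y) c S + scal (op_space X Y) c T) x" for x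
      using ST by (cases "x \<in> vecs X")
        (auto simp: op_space_def Y.scal_add bounded_ops_vecs bounded_ops_off Y.scal_zero_vec)
  qed
  show "scal (op_space X Y) (- 1) T = - T" if "T \<in> vecs (op_space X Y)" for T
  proof
    have T: "T \<in> bounded_ops X Y" using that by (auto simp: op_space_def)
    show "scal (op_space X Y) (- 1) T x = (- T) x" for x
      using T by (cases "x \<in> vecs X")
        (auto simp: op_space_def Y.scal_minus1 bounded_ops_vecs bounded_ops_off Y.scal_zero_vec)
  qed
  show "scal (op_space X Y) c (scal (op_space X Y) d T) = scal (op_space X Y) (c * d) T"
    if "T \<in> vecs (op_space X Y)" for c d T
  proof
    have T: "T \<in> bounded_ops X Y" using that by (auto simp: op_space_def)
    show "scal (op_space X Y) c (scal (op_space X Y) d T) x = scal (op_space X Y) (c * d) T x" for x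
      using T by (cases "x \<in> vecs X")
        (auto simp: op_space_def Y.scal_scal bounded_ops_vecs bounded_ops_off Y.scal_zero_vec)
  qed
  show "opnorm (S + T) \<le> opnorm S + opnorm T"
    if "S \<in> vecs (op_space X Y)" "T \<in> vecs (op_space X Y)" for S T
  proof (rule opnorm_le)
    have S: "S \<in> bounded_ops X Y" and T: "T \<in> bounded_ops X Y" using that by (auto simp: op_space_def)
    show "0 \<le> opnorm S + opnorm T" using opnorm_ge_0 S T by simp
    fix x assume x: "x \<in> vecs X"
    show "nrm Y ((S + T) x) \<le> (opnorm S + opnorm T) * nrm X x"
      using Y.nrm_triangle[of "S x" "T x"] opnorm_bound[OF S x] opnorm_bound[OF T x]
        bounded_ops_vecs[OF S x] bounded_ops_vecs[OF T x] by (simp add: algebra_simps)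
  qed
  show "opnorm (scal (op_space X Y) c T) = norm c * opnorm T"
    if "T \<in> vecs (op_space X Y)" for c T
  proof -
    have T: "T \<in> bounded_ops X Y" using that by (auto simp: op_space_def)
    have le: "opnorm (scal (op_space X Y) c T) \<le> norm c * opnorm T" if T: "T \<in> bounded_ops X Y" for c T
    proof (rule opnorm_le)
      show "0 \<le> norm c * opnorm T" using opnorm_ge_0[OF T] by simp
      fix x assume x: "x \<in> vecs X"
      show "nrm Y (scal (op_space X Y) c T x) \<le> norm c * opnorm T * nrm X x"
        using opnorm_bound[OF T x] bounded_ops_vecs[OF T x]
        by (simp add: op_space_def Y.nrm_scal mult_left_mono mult.assoc)
    qed
    show ?thesis
    proof (cases "c = 0")
      case True
      have "0 \<le> opnorm (scal (op_space X Y) c T)"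
        using opnorm_ge_0[OF bounded_ops_smult[OF T]] by (simp add: op_space_def)
      then show ?thesis using le[OF T, of c] True by simp
    next
      case False
      have cT: "scal (op_space X Y) c T \<in> bounded_ops X Y"
        using bounded_ops_smult[OF T] by (simp add: op_space_def)
      have inv: "scal Y (inverse c) (scal Y c (T x)) = T x" if "x \<in> vecs X" for x
      proof -
        have "scal Y (inverse c) (scal Y c (T x)) = scal Y 1 (T x)"
          using False bounded_ops_vecs[OF T that] by (simp add: Y.scal_scal)
        also have "\<dots> = T x"
          using bounded_ops_vecs[OF T that] Y.uminus_vecs Y.scal_scal[of "T x" "- 1" "- 1"]
          by (simp add: Y.scal_minus1)
        finally show ?thesis .
      qed
      have "scal (op_space X Y) (inverse c) (scal (op_space X Y) c T) = T"
      proof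
        show "scal (op_space X Y) (inverse c) (scal (op_space X Y) c T) x = T x" for x
          using inv[of x] bounded_ops_off[OF T, of x]
          by (cases "x \<in> vecs X") (auto simp: op_space_def Y.scal_zero_vec)
      qed
      then have "opnorm T \<le> norm (inverse c) * opnorm (scal (op_space X Y) c T)"
        using le[OF cT, of "inverse c"] by simp
      then have "norm c * opnorm T \<le> opnorm (scal (op_space X Y) c T)"
        using False mult_left_mono[of "opnorm T" _ "norm c"] by (simp add: norm_inverse mult.assoc[symmetric]) (simp add: norm_divide field_simps)
      then show ?thesis using le[OF T, of c] by simp
    qed
  qed
  show "T = 0" if "T \<in> vecs (op_space X Y)" "opnorm T = 0" for T
  proof
    have T: "T \<in> bounded_ops X Y" using that by (auto simp: op_space_def)
    show "T x = 0 x" for x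
    proof (cases "x \<in> vecs X")
      case True
      then have "nrm Y (T x) = 0"
        using opnorm_bound[OF T True] that(2) Y.nrm_ge_0[OF bounded_ops_vecs[OF T True]] by simp
      then show ?thesis using Y.nrm_eq_0[OF bounded_ops_vecs[OF T True]] by simp
    qed (use bounded_ops_off[OF T] in simp)
  qed
qed

end

lemma bounded_ops_comp:
  assumes X: "normed_nspace X" and Y: "normed_nspace Y" and Z: "normed_nspace Z"
    and S: "S \<in> bounded_ops Y Z" and T: "T \<in> bounded_ops X Y"
  shows "S \<circ> T \<in> bounded_ops X Z"
    and "nrm (op_space X Z) (S \<circ> T) \<le> nrm (op_space Y Z) S * nrm (op_space X Y) T"
proof -
  interpret XY: normed_pair X Y using X Y by (simp add: normed_pair_def)
  interpret YZ: normed_pair Y Z using Y Z by (simp add: normed_pair_def)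
  interpret XZ: normed_pair X Z using X Z by (simp add: normed_pair_def)
  have b: "nrm Z ((S \<circ> T) x) \<le> YZ.opnorm S * XY.opnorm T * nrm X x" if x: "x \<in> vecs X" for x
  proof -
    have "nrm Z (S (T x)) \<le> YZ.opnorm S * nrm Y (T x)"
      using YZ.opnorm_bound[OF S] bounded_ops_vecs[OF T x] by simp
    also have "\<dots> \<le> YZ.opnorm S * (XY.opnorm T * nrm X x)"
      by (intro mult_left_mono XY.opnorm_bound T x YZ.opnorm_ge_0 S)
    finally show ?thesis by (simp add: mult.assoc)
  qed
  show "S \<circ> T \<in> bounded_ops X Z"
    by (rule bounded_opsI[OF _ _ _ b])
      (use S T YZ.bounded_ops_zero in \<open>auto simp: bounded_ops_vecs bounded_ops_add bounded_ops_scal bounded_ops_off\<close>)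
  show "XZ.opnorm (S \<circ> T) \<le> YZ.opnorm S * XY.opnorm T"
    by (intro XZ.opnorm_le b mult_nonneg_nonneg YZ.opnorm_ge_0 S XY.opnorm_ge_0 T)
qed

subsection \<open>Ideals of operators\<close>

text \<open>What has to be checked for an ideal of \<open>op_ring X\<close>, freed of the ring record; closure under negatives follows.\<close>

definition op_ideal :: "('k::real_normed_field, 'a::ab_group_add) nspace \<Rightarrow> ('a \<Rightarrow> 'a) set \<Rightarrow> bool" where
  "op_ideal X I \<longleftrightarrow> I \<subseteq> bounded_ops X X \<and> 0 \<in> I \<and> (\<forall>S\<in>I. \<forall>T\<in>I. S + T \<in> I) \<and>
     (\<forall>T\<in>I. \<forall>S\<in>bounded_ops X X. S \<circ> T \<in> I \<and> T \<circ> S \<in> I)"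

text \<open>A locale of its own, since \<open>normed_nspace\<close> cannot be interpreted for \<open>op_space X X\<close> within itself without a loop.\<close>

locale op_algebra = normed_nspace X
  for X :: "('k::real_normed_field, 'a::ab_group_add) nspace"

sublocale op_algebra \<subseteq> self: normed_pair X X ..

sublocale op_algebra \<subseteq> ops: normed_nspace "op_space X X"
  by (rule self.normed_op_space)

context op_algebra
begin

lemma vecs_op_space [simp]: "vecs (op_space X X) = bounded_ops X X"
  by (simp add: op_space_def)

lemma id_bounded_ops: "restrict_op X (\<lambda>x. x) \<in> bounded_ops X X"
  by (rule restrict_op_bounded[where C = 1]) auto

lemma comp_bounded_ops: "\<lbrakk>S \<in> bounded_ops X X; T \<in> bounded_ops X X\<rbrakk> \<Longrightarrow> S \<circ> T \<in> bounded_ops X X"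
  by (rule bounded_ops_comp(1)[OF normed_nspace_axioms normed_nspace_axioms normed_nspace_axioms])

lemma opnorm_comp: "\<lbrakk>S \<in> bounded_ops X X; T \<in> bounded_ops X X\<rbrakk> \<Longrightarrow>
    self.opnorm (S \<circ> T) \<le> self.opnorm S * self.opnorm T"
  by (rule bounded_ops_comp(2)[OF normed_nspace_axioms normed_nspace_axioms normed_nspace_axioms])

lemma ring_op_ring: "ring (op_ring X)"
proof (intro ringI abelian_groupI monoidI)
  fix S T R assume "S \<in> carrier (op_ring X)" "T \<in> carrier (op_ring X)" "R \<in> carrier (op_ring X)"
  then have S: "S \<in> bounded_ops X X" and T: "T \<in> bounded_ops X X" and R: "R \<in> bounded_ops X X"
    by (auto simp: op_ring_def)
  show "(S \<oplus>\<^bsub>op_ring X\<^esub> T) \<otimes>\<^bsub>op_ring X\<^esub> R = S \<otimes>\<^bsub>op_ring X\<^esub> R \<oplus>\<^bsub>op_ring X\<^esub> T \<otimes>\<^bsub>op_ring X\<^esub> R"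
    by (auto simp: op_ring_def fun_eq_iff)
  show "R \<otimes>\<^bsub>op_ring X\<^esub> (S \<oplus>\<^bsub>op_ring X\<^esub> T) = R \<otimes>\<^bsub>op_ring X\<^esub> S \<oplus>\<^bsub>op_ring X\<^esub> R \<otimes>\<^bsub>op_ring X\<^esub> T"
  proof
    show "(R \<otimes>\<^bsub>op_ring X\<^esub> (S \<oplus>\<^bsub>op_ring X\<^esub> T)) x = (R \<otimes>\<^bsub>op_ring X\<^esub> S \<oplus>\<^bsub>op_ring X\<^esub> R \<otimes>\<^bsub>op_ring X\<^esub> T) x" for x
      using S T R self.bounded_ops_zero[OF R]
      by (cases "x \<in> vecs X") (auto simp: op_ring_def bounded_ops_add bounded_ops_vecs bounded_ops_off)
  qed
next
  fix S assume "S \<in> carrier (op_ring X)"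
  then have S: "S \<in> bounded_ops X X" by (simp add: op_ring_def)
  show "\<one>\<^bsub>op_ring X\<^esub> \<otimes>\<^bsub>op_ring X\<^esub> S = S" "S \<otimes>\<^bsub>op_ring X\<^esub> \<one>\<^bsub>op_ring X\<^esub> = S"
    using S bounded_ops_vecs[OF S] bounded_ops_off[OF S] self.bounded_ops_zero[OF S]
    by (auto simp: op_ring_def fun_eq_iff)
  show "\<exists>T\<in>carrier (op_ring X). T \<oplus>\<^bsub>op_ring X\<^esub> S = \<zero>\<^bsub>op_ring X\<^esub>"
    using self.bounded_ops_uminus[OF S] by (intro bexI[of _ "- S"]) (auto simp: op_ring_def)
qed (use id_bounded_ops in \<open>auto simp: op_ring_def self.bounded_ops_plus self.bounded_ops_0
      comp_bounded_ops algebra_simps comp_assoc restrict_op_def\<close>)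

text \<open>Negation is composition with minus the identity.\<close>

lemma op_ideal_uminus:
  assumes I: "op_ideal X I" and T: "T \<in> I"
  shows "- T \<in> I"
proof -
  have TB: "T \<in> bounded_ops X X" using I T by (auto simp: op_ideal_def)
  have m: "- restrict_op X (\<lambda>x. x) \<in> bounded_ops X X"
    by (rule self.bounded_ops_uminus[OF id_bounded_ops])
  have "(- restrict_op X (\<lambda>x. x)) \<circ> T = - T"
    using bounded_ops_vecs[OF TB] bounded_ops_off[OF TB]
    by (auto simp: fun_eq_iff restrict_op_def)
  then show ?thesis using I T m unfolding op_ideal_def by metis
qed

lemma op_ideal_imp_ideal:
  assumes I: "op_ideal X I"
  shows "ideal I (op_ring X)"
proof (rule idealI[OF ring_op_ring])
  interpret R: ring "op_ring X" by (rule ring_op_ring)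
  show "subgroup I (add_monoid (op_ring X))"
  proof
    show "I \<subseteq> carrier (add_monoid (op_ring X))" using I by (auto simp: op_ideal_def op_ring_def)
    show "\<one>\<^bsub>add_monoid (op_ring X)\<^esub> \<in> I" using I by (auto simp: op_ideal_def op_ring_def)
    fix S T assume S: "S \<in> I" and "T \<in> I"
    then show "S \<otimes>\<^bsub>add_monoid (op_ring X)\<^esub> T \<in> I" using I by (auto simp: op_ideal_def op_ring_def)
    have "inv\<^bsub>add_monoid (op_ring X)\<^esub> S = - S"
      unfolding a_inv_def[symmetric]
    proof (rule R.minus_equality)
      show "- S \<oplus>\<^bsub>op_ring X\<^esub> S = \<zero>\<^bsub>op_ring X\<^esub>" by (simp add: op_ring_def)
      show "S \<in> carrier (op_ring X)" "- S \<in> carrier (op_ring X)"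
        using I S op_ideal_uminus[OF I S] by (auto simp: op_ideal_def op_ring_def)
    qed
    then show "inv\<^bsub>add_monoid (op_ring X)\<^esub> S \<in> I" using op_ideal_uminus[OF I S] by simp
  qed
qed (use I in \<open>auto simp: op_ideal_def op_ring_def\<close>)

lemma closed_idealsI:
  assumes I: "op_ideal X I"
    and cl: "\<And>T. \<lbrakk>T \<in> bounded_ops X X; \<And>e. e > 0 \<Longrightarrow> \<exists>S\<in>I. self.opnorm (T - S) < e\<rbrakk> \<Longrightarrow> T \<in> I"
  shows "I \<in> closed_ideals X"
  using op_ideal_imp_ideal[OF I] I cl
  by (auto simp: closed_ideals_def ops.closedin_norm_iff op_ideal_def)

text \<open>Composition with a fixed operator is Lipschitz for the operator norm, hence it preserves closures.\<close>

lemma closure_op_ideal: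
  assumes I: "op_ideal X I"
  shows "norm_topology (op_space X X) closure_of I \<in> closed_ideals X"
    and "op_ideal X (norm_topology (op_space X X) closure_of I)"
proof -
  let ?C = "norm_topology (op_space X X) closure_of I"
  have IB: "I \<subseteq> bounded_ops X X" using I by (simp add: op_ideal_def)
  have iff: "T \<in> ?C \<longleftrightarrow> T \<in> bounded_ops X X \<and> (\<forall>e>0. \<exists>S\<in>I. self.opnorm (T - S) < e)" for T
    unfolding ops.norm_closure_iff using IB by (auto simp: Bex_def) blast
  have sub: "I \<subseteq> ?C"
  proof
    fix T assume "T \<in> I"
    then show "T \<in> ?C"
      unfolding iff using IB ops.nrm_0 by (auto intro!: bexI[of _ T])
  qed
  show C: "op_ideal X ?C"
    unfolding op_ideal_def
  proof (intro conjI ballI)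
    show "?C \<subseteq> bounded_ops X X" by (auto simp: iff)
    show "0 \<in> ?C" using sub I by (auto simp: op_ideal_def)
    show "S + T \<in> ?C" if S: "S \<in> ?C" and T: "T \<in> ?C" for S T
      unfolding iff
    proof (intro conjI allI impI)
      show "S + T \<in> bounded_ops X X" using S T by (auto simp: iff self.bounded_ops_plus)
      fix e :: real assume e: "e > 0"
      obtain S' T' where S': "S' \<in> I" "self.opnorm (S - S') < e / 2"
        and T': "T' \<in> I" "self.opnorm (T - T') < e / 2"
        using S T e unfolding iff by (meson half_gt_zero)
      have "self.opnorm ((S + T) - (S' + T')) \<le> self.opnorm (S - S') + self.opnorm (T - T')"
        using ops.nrm_triangle[of "S - S'" "T - T'"] ops.diff_vecs S T S' T' IB
        by (auto simp: iff algebra_simps subset_iff)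
      then show "\<exists>R\<in>I. self.opnorm (S + T - R) < e"
        using S' T' I by (intro bexI[of _ "S' + T'"]) (auto simp: op_ideal_def)
    qed
    fix T S assume T: "T \<in> ?C" and S: "S \<in> bounded_ops X X"
    have TB: "T \<in> bounded_ops X X" using T by (simp add: iff)
    have approx: "\<exists>T'\<in>I. self.opnorm (T - T') * self.opnorm S < e" if e: "e > 0" for e
    proof -
      have n: "0 \<le> self.opnorm S" by (rule self.opnorm_ge_0[OF S])
      then obtain T' where T': "T' \<in> I" "self.opnorm (T - T') < e / (self.opnorm S + 1)"
        using T e unfolding iff by (meson add_nonneg_pos divide_pos_pos zero_less_one)
      have "self.opnorm (T - T') * self.opnorm S \<le> self.opnorm (T - T') * (self.opnorm S + 1)"
        using T' IB TB by (intro mult_left_mono ops.nrm_ge_0 ops.diff_vecs) auto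
      also have "\<dots> < e" using T'(2) n by (simp add: field_simps)
      finally show ?thesis using T'(1) by blast
    qed
    show "S \<circ> T \<in> ?C"
      unfolding iff
    proof (intro conjI allI impI)
      show "S \<circ> T \<in> bounded_ops X X" by (rule comp_bounded_ops[OF S TB])
      fix e :: real assume "e > 0"
      then obtain T' where T': "T' \<in> I" "self.opnorm (T - T') * self.opnorm S < e"
        using approx by blast
      have T'B: "T' \<in> bounded_ops X X" using T' IB by blast
      have "(S \<circ> T) - (S \<circ> T') = S \<circ> (T - T')"
      proof
        show "((S \<circ> T) - (S \<circ> T')) x = (S \<circ> (T - T')) x" for x
          using self.bounded_ops_diff[OF S] bounded_ops_vecs[OF TB] bounded_ops_vecs[OF T'B]
            bounded_ops_off[OF TB] bounded_ops_off[OF T'B] self.bounded_ops_zero[OF S]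
          by (cases "x \<in> vecs X") auto
      qed
      then have "self.opnorm ((S \<circ> T) - (S \<circ> T')) \<le> self.opnorm S * self.opnorm (T - T')"
        using opnorm_comp[OF S, of "T - T'"] ops.diff_vecs TB T'B by simp
      then show "\<exists>R\<in>I. self.opnorm ((S \<circ> T) - R) < e"
        using T' I S by (intro bexI[of _ "S \<circ> T'"]) (auto simp: op_ideal_def mult.commute)
    qed
    show "T \<circ> S \<in> ?C"
      unfolding iff
    proof (intro conjI allI impI)
      show "T \<circ> S \<in> bounded_ops X X" by (rule comp_bounded_ops[OF TB S])
      fix e :: real assume "e > 0"
      then obtain T' where T': "T' \<in> I" "self.opnorm (T - T') * self.opnorm S < e"
        using approx by blast
      have T'B: "T' \<in> bounded_ops X X" using T' IB by blast
      have "(T \<circ> S) - (T' \<circ> S) = (T - T') \<circ> S" by (simp add: fun_eq_iff)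
      then have "self.opnorm ((T \<circ> S) - (T' \<circ> S)) \<le> self.opnorm (T - T') * self.opnorm S"
        using opnorm_comp[of "T - T'" S] ops.diff_vecs TB T'B S by simp
      then show "\<exists>R\<in>I. self.opnorm ((T \<circ> S) - R) < e"
        using T' I S by (intro bexI[of _ "T' \<circ> S"]) (auto simp: op_ideal_def)
    qed
  qed
  show "?C \<in> closed_ideals X"
    using op_ideal_imp_ideal[OF C] by (simp add: closed_ideals_def)
qed

lemma closed_factor_ops_iff:
  assumes "normed_nspace Y"
  shows "T \<in> closed_factor_ops Y X \<longleftrightarrow> T \<in> bounded_ops X X \<and>
    (\<forall>e>0. \<exists>A\<in>bounded_ops X Y. \<exists>B\<in>bounded_ops Y X. self.opnorm (T - (B \<circ> A)) < e)"
proof -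
  have "factor_ops Y X \<subseteq> bounded_ops X X"
    using bounded_ops_comp(1)[OF normed_nspace_axioms assms normed_nspace_axioms]
    by (auto simp: factor_ops_def)
  then have "T \<in> closed_factor_ops Y X \<longleftrightarrow> T \<in> bounded_ops X X \<and>
      (\<forall>e>0. \<exists>S\<in>factor_ops Y X. self.opnorm (T - S) < e)"
    unfolding closed_factor_ops_def ops.norm_closure_iff by (simp add: Int_absorb2)
  also have "\<dots> \<longleftrightarrow> T \<in> bounded_ops X X \<and>
    (\<forall>e>0. \<exists>A\<in>bounded_ops X Y. \<exists>B\<in>bounded_ops Y X. self.opnorm (T - (B \<circ> A)) < e)"
  proof -
    have "(\<exists>S\<in>factor_ops Y X. P S) \<longleftrightarrow> (\<exists>A\<in>bounded_ops X Y. \<exists>B\<in>bounded_ops Y X. P (B \<circ> A))" for P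
      by (auto simp: factor_ops_def)
    then show ?thesis by simp
  qed
  finally show ?thesis .
qed

text \<open>The maps \<open>U\<^sub>1, U\<^sub>2\<close> embed two copies of \<open>Y\<close> into \<open>Y\<close> and \<open>V\<^sub>1, V\<^sub>2\<close> recover them. Hence the sum of two
  operators that factor through \<open>Y\<close>, which factors through the sum of two copies, factors through \<open>Y\<close>.\<close>

lemma factor_op_ideal:
  assumes Y: "normed_nspace Y"
    and U: "U\<^sub>1 \<in> bounded_ops Y Y" "U\<^sub>2 \<in> bounded_ops Y Y"
    and V: "V\<^sub>1 \<in> bounded_ops Y Y" "V\<^sub>2 \<in> bounded_ops Y Y"
    and VU: "\<And>y. y \<in> vecs Y \<Longrightarrow> V\<^sub>1 (U\<^sub>1 y) = y" "\<And>y. y \<in> vecs Y \<Longrightarrow> V\<^sub>2 (U\<^sub>2 y) = y"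
      "\<And>y. y \<in> vecs Y \<Longrightarrow> V\<^sub>1 (U\<^sub>2 y) = 0" "\<And>y. y \<in> vecs Y \<Longrightarrow> V\<^sub>2 (U\<^sub>1 y) = 0"
  shows "op_ideal X (factor_ops Y X)"
proof -
  interpret Y: normed_nspace Y by (rule Y)
  interpret XY: normed_pair X Y ..
  interpret YX: normed_pair Y X ..
  note comp = bounded_ops_comp(1)
  note XN = normed_nspace_axioms
  have FB: "factor_ops Y X \<subseteq> bounded_ops X X"
    using comp[OF XN Y XN] by (auto simp: factor_ops_def)
  show ?thesis
    unfolding op_ideal_def
  proof (intro conjI ballI FB)
    have "0 = (0 :: 'b \<Rightarrow> 'a) \<circ> (0 :: 'a \<Rightarrow> 'b)" by (simp add: fun_eq_iff)
    then show "0 \<in> factor_ops Y X"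
      unfolding factor_ops_def using XY.bounded_ops_0 YX.bounded_ops_0 by blast
  next
    fix P Q assume "P \<in> factor_ops Y X" "Q \<in> factor_ops Y X"
    then obtain S T S' T' where P: "P = S \<circ> T" "T \<in> bounded_ops X Y" "S \<in> bounded_ops Y X"
      and Q: "Q = S' \<circ> T'" "T' \<in> bounded_ops X Y" "S' \<in> bounded_ops Y X"
      by (auto simp: factor_ops_def)
    let ?S = "(S \<circ> V\<^sub>1) + (S' \<circ> V\<^sub>2)" and ?T = "(U\<^sub>1 \<circ> T) + (U\<^sub>2 \<circ> T')"
    have "?S \<in> bounded_ops Y X" "?T \<in> bounded_ops X Y"
      using P Q U V by (auto intro!: YX.bounded_ops_plus XY.bounded_ops_plus
          comp[OF Y Y XN] comp[OF XN Y Y])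
    moreover have "P + Q = ?S \<circ> ?T"
    proof (rule self.bounded_ops_eqI)
      show "P + Q \<in> bounded_ops X X" "?S \<circ> ?T \<in> bounded_ops X X"
        using P Q calculation by (auto intro!: self.bounded_ops_plus comp[OF XN Y XN])
      fix x assume x: "x \<in> vecs X"
      have v: "T x \<in> vecs Y" "T' x \<in> vecs Y" "U\<^sub>1 (T x) \<in> vecs Y" "U\<^sub>2 (T' x) \<in> vecs Y"
        using P Q U x by (auto simp: bounded_ops_vecs)
      then show "(P + Q) x = (?S \<circ> ?T) x"
        using VU bounded_ops_add[OF V(1) v(3,4)] bounded_ops_add[OF V(2) v(3,4)] P Q by simp
    qed
    ultimately show "P + Q \<in> factor_ops Y X" unfolding factor_ops_def by blast
  next
    fix P R assume "P \<in> factor_ops Y X" and R: "R \<in> bounded_ops X X"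
    then obtain S T where P: "P = S \<circ> T" "T \<in> bounded_ops X Y" "S \<in> bounded_ops Y X"
      by (auto simp: factor_ops_def)
    have "R \<circ> P = (R \<circ> S) \<circ> T" "P \<circ> R = S \<circ> (T \<circ> R)" by (simp_all add: P comp_assoc)
    moreover have "R \<circ> S \<in> bounded_ops Y X" "T \<circ> R \<in> bounded_ops X Y"
      using P R comp[OF Y XN XN] comp[OF XN XN Y] by auto
    ultimately show "R \<circ> P \<in> factor_ops Y X" "P \<circ> R \<in> factor_ops Y X"
      using P unfolding factor_ops_def by blast+
  qed
qed

end

section \<open>The James spaces\<close>

text \<open>The \<open>p\<close>-th power of the variation of \<open>x\<close> along a list of indices. Lists have concatenation and
  induction, which is what the two \<open>p\<close>-estimates below rest on.\<close>

fun list_var :: "real \<Rightarrow> (nat \<Rightarrow> 'k::real_normed_field) \<Rightarrow> nat list \<Rightarrow> real" where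
  "list_var p x (a # b # ns) = norm (x a - x b) powr p + list_var p x (b # ns)"
| "list_var p x ns = 0"

lemma list_var_eq_sum:
  "list_var p x ns = (\<Sum>j<length ns - 1. norm (x (ns ! j) - x (ns ! Suc j)) powr p)"
proof (induction p x ns rule: list_var.induct)
  case (1 p x a b ns)
  then show ?case by (simp add: sum.lessThan_Suc_shift del: sum.lessThan_Suc)
qed auto

lemma list_var_nonneg: "0 \<le> list_var p x ns"
  by (simp add: list_var_eq_sum sum_nonneg)

lemma list_var_cong: "(\<And>i. i \<in> set ns \<Longrightarrow> x i = y i) \<Longrightarrow> list_var p x ns = list_var p y ns"
  by (induction p x ns rule: list_var.induct) auto

lemma list_var_append:
  "xs \<noteq> [] \<Longrightarrow> ys \<noteq> [] \<Longrightarrow>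
    list_var p x (xs @ ys) = list_var p x xs + norm (x (last xs) - x (hd ys)) powr p + list_var p x ys"
proof (induction p x xs rule: list_var.induct)
  case ("2_2" p x a)
  then show ?case by (cases ys) auto
qed auto

lemma list_var_append_ge: "list_var p x xs + list_var p x ys \<le> list_var p x (xs @ ys)"
  by (cases "xs = []"; cases "ys = []") (auto simp: list_var_append)

lemma list_var_add:
  assumes "1 \<le> p"
  shows "list_var p (\<lambda>i. x i + y i) ns powr (1 / p) \<le> list_var p x ns powr (1 / p) + list_var p y ns powr (1 / p)"
proof -
  let ?a = "\<lambda>j. norm (x (ns ! j) - x (ns ! Suc j))" and ?b = "\<lambda>j. norm (y (ns ! j) - y (ns ! Suc j))"
  have "list_var p (\<lambda>i. x i + y i) ns \<le> (\<Sum>j<length ns - 1. (?a j + ?b j) powr p)"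
    unfolding list_var_eq_sum
  proof (intro sum_mono powr_mono2)
    show "norm (x (ns ! j) + y (ns ! j) - (x (ns ! Suc j) + y (ns ! Suc j))) \<le> ?a j + ?b j" for j
      using norm_triangle_ineq[of "x (ns ! j) - x (ns ! Suc j)" "y (ns ! j) - y (ns ! Suc j)"]
      by (simp add: algebra_simps)
  qed (use assms in auto)
  then have "list_var p (\<lambda>i. x i + y i) ns powr (1 / p) \<le> (\<Sum>j<length ns - 1. (?a j + ?b j) powr p) powr (1 / p)"
    using assms by (intro powr_mono2) (auto simp: list_var_nonneg)
  also have "\<dots> \<le> list_var p x ns powr (1 / p) + list_var p y ns powr (1 / p)"
    unfolding list_var_eq_sum using assms by (intro Minkowski_sum) auto
  finally show ?thesis .
qed

lemma list_var_scale: "list_var p (\<lambda>i. c * x i) ns = norm c powr p * list_var p x ns"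
proof -
  have "norm (c * x i - c * x j) powr p = norm c powr p * norm (x i - x j) powr p" for i j
    by (simp add: norm_mult powr_mult flip: right_diff_distrib)
  then show ?thesis by (simp add: list_var_eq_sum sum_distrib_left)
qed

lemma tendsto_list_var:
  assumes "p > 0" "\<And>i. (\<lambda>n. y n i) \<longlonglongrightarrow> x i"
  shows "(\<lambda>n. list_var p (y n) ns) \<longlonglongrightarrow> list_var p x ns"
  unfolding list_var_eq_sum
proof (intro tendsto_sum tendsto_powr2)
  show "(\<lambda>n. norm (y n (ns ! i) - y n (ns ! Suc i))) \<longlonglongrightarrow> norm (x (ns ! i) - x (ns ! Suc i))" for i
    by (intro tendsto_norm tendsto_diff assms)
qed (use assms in auto)

lemma james_sums_eq:
  "james_sums p x = {list_var p x ns powr (1 / p) | ns. sorted_wrt (<) ns \<and> 2 \<le> length ns}"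
proof (intro equalityI subsetI)
  fix r assume "r \<in> james_sums p x"
  then obtain k and n :: "nat \<Rightarrow> nat"
    where r: "r = (\<Sum>j=1..k. norm (x (n j) - x (n (j + 1))) powr p) powr (1 / p)"
      and k: "1 \<le> k" and n: "strict_mono_on {1..k + 1} n"
    unfolding james_sums_def by blast
  define ns where "ns = map n [1..<k + 2]"
  have "sorted_wrt (<) ns"
    using n by (auto simp: ns_def sorted_wrt_iff_nth_less strict_mono_on_def simp del: upt_Suc)
  moreover have "length ns = k + 1" by (simp add: ns_def)
  moreover have "list_var p x ns = (\<Sum>j=1..k. norm (x (n j) - x (n (j + 1))) powr p)"
  proof -
    have "list_var p x ns = (\<Sum>j<k. norm (x (n (Suc j)) - x (n (Suc j + 1))) powr p)"
      unfolding list_var_eq_sum by (rule sum.cong) (auto simp: ns_def simp del: upt_Suc)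
    also have "\<dots> = (\<Sum>j=1..k. norm (x (n j) - x (n (j + 1))) powr p)"
      by (rule sum.reindex_bij_witness[of _ "\<lambda>j. j - 1" Suc]) auto
    finally show ?thesis .
  qed
  ultimately show "r \<in> {list_var p x ns powr (1 / p) | ns. sorted_wrt (<) ns \<and> 2 \<le> length ns}"
    using r k by (intro CollectI exI[of _ ns]) auto
next
  fix r assume "r \<in> {list_var p x ns powr (1 / p) | ns. sorted_wrt (<) ns \<and> 2 \<le> length ns}"
  then obtain ns where r: "r = list_var p x ns powr (1 / p)" and ns: "sorted_wrt (<) ns" "2 \<le> length ns"
    by blast
  define n where "n = (\<lambda>j. ns ! (j - 1))"
  have "strict_mono_on {1..length ns - 1 + 1} n"
    using ns by (auto simp: strict_mono_on_def n_def intro!: sorted_wrt_nth_less[OF ns(1)])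
  moreover have "list_var p x ns = (\<Sum>j=1..length ns - 1. norm (x (n j) - x (n (j + 1))) powr p)"
    unfolding list_var_eq_sum n_def
    by (rule sum.reindex_bij_witness[of _ "\<lambda>j. j - 1" Suc]) auto
  moreover have "1 \<le> length ns - 1" using ns by simp
  ultimately show "r \<in> james_sums p x"
    unfolding james_sums_def r by (intro CollectI exI[of _ "length ns - 1"] exI[of _ n]) simp
qed

text \<open>Upper \<open>p\<close>-estimate: the variation of \<open>x\<close> is controlled by the variations \<open>c n\<close> within the blocks and the
  values \<open>d n\<close> on them. By convexity a jump between two blocks costs at most \<open>2 powr (p - 1)\<close> times the
  \<open>p\<close>-th powers of the two values at its ends, and each block has at most one jump in and one jump out;
  this accounts for \<open>2 powr p * d n\<close>. The second summand on the left is the share of the first block in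
  the jump that leads into it, which the induction along the list needs.\<close>

lemma list_var_le_blocks_aux:
  assumes p: "1 \<le> p" and \<beta>: "mono \<beta>"
    and c: "\<forall>ns n. sorted_wrt (<) ns \<longrightarrow> (\<forall>i\<in>set ns. \<beta> i = n) \<longrightarrow> list_var p x ns \<le> c n"
    and d: "\<And>i. norm (x i) powr p \<le> d (\<beta> i)"
    and cd: "\<And>n::nat. 0 \<le> c n" "\<And>n. 0 \<le> d n"
    and ns: "sorted_wrt (<) ns" "ns \<noteq> []" "\<And>i. i \<in> set ns \<Longrightarrow> \<beta> i < M"
  shows "list_var p x ns + 2 powr (p - 1) * norm (x (hd ns)) powr p
    \<le> (\<Sum>n\<in>{\<beta> (hd ns)..<M}. c n + 2 powr p * d n)"
  using ns
proof (induction ns rule: length_induct)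
  case (1 ns)
  define b where "b = \<beta> (hd ns)"
  define xs where "xs = takeWhile (\<lambda>i. \<beta> i = b) ns"
  define ys where "ys = dropWhile (\<lambda>i. \<beta> i = b) ns"
  have nsxy: "ns = xs @ ys" by (simp add: xs_def ys_def)
  have xs: "xs \<noteq> []" "hd xs = hd ns"
    using 1(3) by (cases ns; simp add: xs_def b_def)+
  have xb: "\<beta> i = b" if "i \<in> set xs" for i
    using that set_takeWhileD unfolding xs_def by fast
  have sx: "sorted_wrt (<) xs" "sorted_wrt (<) ys" and sxy: "\<And>i j. i \<in> set xs \<Longrightarrow> j \<in> set ys \<Longrightarrow> i < j"
    using 1(2) unfolding nsxy by (auto simp: sorted_wrt_append)
  have cx: "list_var p x xs \<le> c b" using c sx(1) xb by blast
  have bM: "b < M" using 1(3,4) by (auto simp: b_def)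
  have dh: "norm (x (hd ns)) powr p \<le> d b" using d[of "hd ns"] by (simp add: b_def)
  have dl: "norm (x (last xs)) powr p \<le> d b" using d[of "last xs"] xb[OF last_in_set[OF xs(1)]] by simp
  have two': "2 powr p * d b = 2 powr (p - 1) * d b + 2 powr (p - 1) * d b"
    by (simp add: powr_diff)
  let ?f = "\<lambda>n. c n + 2 powr p * d n"
  have split: "(\<Sum>n\<in>{b..<M}. ?f n) = ?f b + (\<Sum>n\<in>{Suc b..<M}. ?f n)"
    using bM by (simp add: sum.atLeast_Suc_lessThan)
  have hdle: "2 powr (p - 1) * norm (x (hd ns)) powr p \<le> 2 powr (p - 1) * d b"
    "2 powr (p - 1) * norm (x (last xs)) powr p \<le> 2 powr (p - 1) * d b"
    using dh dl by (auto intro!: mult_left_mono)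
  show ?case
  proof (cases "ys = []")
    case True
    then have "list_var p x ns \<le> c b" using cx nsxy by simp
    moreover have "0 \<le> (\<Sum>n\<in>{Suc b..<M}. ?f n)" using cd by (intro sum_nonneg) auto
    moreover have "2 powr (p - 1) * d b \<le> 2 powr p * d b"
      using cd by (intro mult_right_mono powr_mono) auto
    ultimately show ?thesis using hdle split unfolding b_def[symmetric] by linarith
  next
    case False
    have "b \<le> \<beta> (hd ys)"
      using monoD[OF \<beta>, of "hd xs" "hd ys"] sxy[of "hd xs" "hd ys"] hd_in_set[OF xs(1)] False
        xb[of "hd xs"] by simp
    moreover have "\<beta> (hd ys) \<noteq> b" using False hd_dropWhile[of "\<lambda>i. \<beta> i = b" ns] by (simp add: ys_def)
    ultimately have bys: "Suc b \<le> \<beta> (hd ys)" by simp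
    have "length ys < length ns" using xs nsxy by simp
    then have IH: "list_var p x ys + 2 powr (p - 1) * norm (x (hd ys)) powr p \<le> (\<Sum>n\<in>{\<beta> (hd ys)..<M}. ?f n)"
      using 1(1) sx(2) False 1(4) unfolding nsxy by auto
    also have "\<dots> \<le> (\<Sum>n\<in>{Suc b..<M}. ?f n)"
      using bys cd by (intro sum_mono2) auto
    finally have IH': "list_var p x ys + 2 powr (p - 1) * norm (x (hd ys)) powr p \<le> (\<Sum>n\<in>{Suc b..<M}. ?f n)" .
    have "norm (x (last xs) - x (hd ys)) powr p \<le> (norm (x (last xs)) + norm (x (hd ys))) powr p"
      using p by (intro powr_mono2 norm_triangle_ineq4) auto
    also have "\<dots> \<le> 2 powr (p - 1) * (norm (x (last xs)) powr p + norm (x (hd ys)) powr p)"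
      using p by (intro powr_add_le) auto
    finally have jump: "norm (x (last xs) - x (hd ys)) powr p
        \<le> 2 powr (p - 1) * d b + 2 powr (p - 1) * norm (x (hd ys)) powr p"
      using hdle unfolding distrib_left by linarith
    have "list_var p x ns = list_var p x xs + norm (x (last xs) - x (hd ys)) powr p + list_var p x ys"
      unfolding nsxy using xs False by (intro list_var_append)
    then show ?thesis
      using cx jump IH' hdle split two' unfolding b_def[symmetric] by linarith
  qed
qed

lemma list_var_le_blocks:
  assumes p: "1 \<le> p" and \<beta>: "mono \<beta>"
    and c: "\<forall>ns n. sorted_wrt (<) ns \<longrightarrow> (\<forall>i\<in>set ns. \<beta> i = n) \<longrightarrow> list_var p x ns \<le> c n"
    and d: "\<And>i. norm (x i) powr p \<le> d (\<beta> i)"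
    and cd: "\<And>n::nat. 0 \<le> c n" "\<And>n. 0 \<le> d n"
    and D: "\<And>M. (\<Sum>n<M. c n + 2 powr p * d n) \<le> D"
    and ns: "sorted_wrt (<) ns"
  shows "list_var p x ns \<le> D"
proof (cases "ns = []")
  case True
  then show ?thesis using D[of 0] by simp
next
  case False
  define M where "M = Suc (Max (\<beta> ` set ns))"
  have "\<beta> i < M" if "i \<in> set ns" for i
    using that Max_ge[of "\<beta> ` set ns" "\<beta> i"] by (auto simp: M_def less_Suc_eq_le)
  then have "list_var p x ns + 2 powr (p - 1) * norm (x (hd ns)) powr p
    \<le> (\<Sum>n\<in>{\<beta> (hd ns)..<M}. c n + 2 powr p * d n)"
    by (rule list_var_le_blocks_aux[OF p \<beta> c d cd ns False])
  also have "\<dots> \<le> (\<Sum>n<M. c n + 2 powr p * d n)"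
    using cd by (intro sum_mono2) auto
  also have "\<dots> \<le> D" by (rule D)
  finally show ?thesis
    by (smt (verit) mult_nonneg_nonneg powr_ge_zero)
qed

definition block_var :: "real \<Rightarrow> (nat \<Rightarrow> 'k::real_normed_field) \<Rightarrow> nat set \<Rightarrow> real" where
  "block_var p x S = (SUP ns\<in>{ns. sorted_wrt (<) ns \<and> set ns \<subseteq> S}. list_var p x ns)"

text \<open>The proofs cover real and complex scalars at once. Normed fields that are Euclidean spaces provide both what
  analysis needs of the scalars, compactness of balls and the parallelogram law.\<close>

locale james_setting =
  fixes p :: real and K :: "'k::{real_normed_field, euclidean_space} itself"
  assumes p1: "1 < p"
begin

abbreviation J :: "('k, nat \<Rightarrow> 'k) nspace" where
  "J \<equiv> james_space p"

lemma james_sums_nonempty: "james_sums p (x :: nat \<Rightarrow> 'k) \<noteq> {}"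
  unfolding james_sums_eq by (auto intro!: exI[of _ "[0, 1]"])

lemma list_var_bound_iff:
  assumes "0 \<le> C" "sorted_wrt (<) ns"
  shows "list_var p (x :: nat \<Rightarrow> 'k) ns powr (1 / p) \<le> C \<longleftrightarrow> list_var p x ns \<le> C powr p"
proof
  assume "list_var p x ns powr (1 / p) \<le> C"
  then have "(list_var p x ns powr (1 / p)) powr p \<le> C powr p"
    using p1 by (intro powr_mono2) auto
  then show "list_var p x ns \<le> C powr p"
    using p1 by (simp add: powr_powr list_var_nonneg)
next
  assume "list_var p x ns \<le> C powr p"
  then have "list_var p x ns powr (1 / p) \<le> (C powr p) powr (1 / p)"
    using p1 by (intro powr_mono2) (auto simp: list_var_nonneg)
  then show "list_var p x ns powr (1 / p) \<le> C"
    using p1 assms by (simp add: powr_powr)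
qed

lemma james_vecs_tendsto: "x \<in> vecs J \<Longrightarrow> x \<longlonglongrightarrow> 0"
  by (simp add: james_space_def)

lemma james_upper:
  assumes "x \<in> vecs J" "sorted_wrt (<) ns"
  shows "list_var p x ns powr (1 / p) \<le> nrm J x"
proof (cases "2 \<le> length ns")
  case True
  then show ?thesis
    using assms by (auto simp: james_space_def james_sums_eq intro!: cSup_upper)
next
  case False
  have "list_var p x [0, 1] powr (1 / p) \<in> james_sums p x"
    unfolding james_sums_eq by (intro CollectI exI[of _ "[0, 1]"]) simp
  then have "list_var p x [0, 1] powr (1 / p) \<le> nrm J x"
    using assms by (simp add: james_space_def cSup_upper)
  moreover have "list_var p x ns = 0"
    using False by (simp add: list_var_eq_sum)
  ultimately show ?thesis
    using order_trans[OF powr_ge_zero] by simp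
qed

lemma james_norm_ge_0: "x \<in> vecs J \<Longrightarrow> 0 \<le> nrm J x"
  using james_upper[of x "[]"] by simp

lemma james_upper_powr:
  assumes "x \<in> vecs J" "sorted_wrt (<) ns"
  shows "list_var p x ns \<le> nrm J x powr p"
  using list_var_bound_iff[OF james_norm_ge_0 assms(2)] james_upper assms by blast

lemma james_boundI:
  assumes "x \<longlonglongrightarrow> 0" "0 \<le> C" "\<And>ns. sorted_wrt (<) ns \<Longrightarrow> list_var p x ns \<le> C powr p"
  shows "x \<in> vecs J" "nrm J x \<le> C"
proof -
  have le: "s \<le> C" if "s \<in> james_sums p x" for s
    using that assms list_var_bound_iff unfolding james_sums_eq by auto
  show "x \<in> vecs J" using assms le by (auto simp: james_space_def bdd_above_def)
  show "nrm J x \<le> C" using le james_sums_nonempty by (auto simp: james_space_def intro!: cSup_least)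
qed

text \<open>Vectors are null sequences, so every value is the limit of two-point differences.\<close>

lemma james_coord_le:
  assumes x: "x \<in> vecs J"
  shows "norm (x i) \<le> nrm J x"
proof -
  have "norm (x i - x j) \<le> nrm J x" if "i < j" for j
  proof -
    have "list_var p x [i, j] powr (1 / p) \<le> nrm J x" using james_upper[OF x, of "[i, j]"] that by simp
    then show ?thesis using p1 by (simp add: powr_powr)
  qed
  moreover have "(\<lambda>j. norm (x i - x j)) \<longlonglongrightarrow> norm (x i - 0)"
    by (intro tendsto_intros james_vecs_tendsto x)
  ultimately show ?thesis
    by (intro tendsto_upperbound[where F = sequentially and f = "\<lambda>j. norm (x i - x j)"])
      (auto simp: eventually_at_top_dense)
qed

lemma normed_james: "normed_nspace J"
proof
  have two: "x + y \<in> vecs J \<and> nrm J (x + y) \<le> nrm J x + nrm J y" if x: "x \<in> vecs J" and y: "y \<in> vecs J" for x y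
  proof -
    have "list_var p (x + y) ns \<le> (nrm J x + nrm J y) powr p" if ns: "sorted_wrt (<) ns" for ns
    proof -
      have "list_var p (x + y) ns powr (1 / p) \<le> nrm J x + nrm J y"
        using list_var_add[of p x y ns] james_upper[OF x ns] james_upper[OF y ns] p1
        by (simp add: plus_fun_def)
      then show ?thesis
        using list_var_bound_iff[OF _ ns] james_norm_ge_0[OF x] james_norm_ge_0[OF y] by simp
    qed
    moreover have "(x + y) \<longlonglongrightarrow> 0"
      using tendsto_add[OF james_vecs_tendsto[OF x] james_vecs_tendsto[OF y]] by (simp add: plus_fun_def)
    ultimately show ?thesis
      using james_boundI[of "x + y" "nrm J x + nrm J y"] james_norm_ge_0[OF x] james_norm_ge_0[OF y] by simp
  qed
  show "x + y \<in> vecs J" "nrm J (x + y) \<le> nrm J x + nrm J y" if "x \<in> vecs J" "y \<in> vecs J" for x y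
    using two[OF that] by auto
  have sc: "scal J c x \<in> vecs J \<and> nrm J (scal J c x) \<le> norm c * nrm J x" if x: "x \<in> vecs J" for c x
  proof -
    have "list_var p (scal J c x) ns \<le> (norm c * nrm J x) powr p" if ns: "sorted_wrt (<) ns" for ns
      using james_upper_powr[OF x ns] james_norm_ge_0[OF x]
      by (simp add: james_space_def list_var_scale powr_mult mult_left_mono)
    moreover have "scal J c x \<longlonglongrightarrow> 0"
      using tendsto_mult[OF tendsto_const[of c] james_vecs_tendsto[OF x]] by (simp add: james_space_def)
    ultimately show ?thesis
      using james_boundI[of "scal J c x" "norm c * nrm J x"] james_norm_ge_0[OF x] by simp
  qed
  show "scal J c x \<in> vecs J" if "x \<in> vecs J" for c x
    using sc[OF that] by simp
  have s1: "scal J (inverse c) (scal J c x) = x" if "c \<noteq> 0" for c x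
    using that by (simp add: james_space_def fun_eq_iff)
  have z: "0 \<in> vecs J \<and> nrm J 0 \<le> 0"
  proof -
    have "list_var p (0 :: nat \<Rightarrow> 'k) ns = 0" for ns by (simp add: list_var_eq_sum)
    moreover have "(0 :: nat \<Rightarrow> 'k) \<longlonglongrightarrow> 0" by (simp add: zero_fun_def)
    ultimately show ?thesis using james_boundI[of 0 0] by simp
  qed
  then show "0 \<in> vecs J" by simp
  show "nrm J (scal J c x) = norm c * nrm J x" if x: "x \<in> vecs J" for c x
  proof (cases "c = 0")
    case True
    have "scal J 0 x = 0" by (simp add: james_space_def fun_eq_iff)
    then show ?thesis using True z james_norm_ge_0[of 0] by simp
  next
    case False
    have "nrm J x \<le> norm (inverse c) * nrm J (scal J c x)"
      using sc[of "scal J c x" "inverse c"] sc[OF x, of c] s1[OF False, of x] by simp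
    then have "norm c * nrm J x \<le> norm c * (norm (inverse c) * nrm J (scal J c x))"
      by (intro mult_left_mono) auto
    also have "\<dots> = nrm J (scal J c x)"
      using False by (simp add: norm_inverse mult.assoc[symmetric])
    finally show ?thesis using sc[OF x, of c] by simp
  qed
  show "x = 0" if "x \<in> vecs J" "nrm J x = 0" for x
    using james_coord_le[OF that(1)] that(2) by (auto simp: fun_eq_iff)
qed (auto simp: james_space_def algebra_simps fun_eq_iff)

sublocale J: op_algebra J
  by (simp add: op_algebra_def normed_james)

lemma scal_james: "scal J c x = (\<lambda>i. c * x i)"
  by (simp add: james_space_def)

abbreviation blockc :: real where
  "blockc \<equiv> (1 + 2 powr p) powr (1 / p)"

lemma blockc_powr: "0 \<le> r \<Longrightarrow> (blockc * r) powr p = (1 + 2 powr p) * r powr p"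
  using p1 by (simp add: powr_mult powr_powr add_nonneg_nonneg)

text \<open>With one bound \<open>c n\<close> for the variation and for the values on block \<open>n\<close>, the sum of the \<open>c n\<close> controls the
  norm up to the factor \<open>blockc\<close>. Together with \<open>james_lower_estimate\<close> it makes \<open>J\<close> behave like an
  \<open>\<ell>\<^sub>p\<close>-sum over any decomposition into successive blocks.\<close>

lemma james_upper_estimate:
  assumes \<beta>: "mono \<beta>" and x0: "x \<longlonglongrightarrow> 0"
    and c: "\<forall>ns n. sorted_wrt (<) ns \<longrightarrow> (\<forall>i\<in>set ns. \<beta> i = n) \<longrightarrow> list_var p x ns \<le> c n"
    and d: "\<And>i. norm (x i) powr p \<le> c (\<beta> i)"
    and c0: "\<And>n::nat. 0 \<le> c n"
    and D: "\<And>M. (\<Sum>n<M. c n) \<le> D powr p" "0 \<le> D"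
  shows "x \<in> vecs J" "nrm J x \<le> blockc * D"
proof -
  have sumle: "(\<Sum>n<M. c n + 2 powr p * c n) \<le> (blockc * D) powr p" for M
  proof -
    have "(\<Sum>n<M. c n + 2 powr p * c n) = (1 + 2 powr p) * (\<Sum>n<M. c n)"
      by (simp add: sum.distrib sum_distrib_left[symmetric] distrib_right)
    also have "\<dots> \<le> (1 + 2 powr p) * D powr p"
      by (intro mult_left_mono D) (simp add: add_nonneg_nonneg)
    finally show ?thesis using blockc_powr D(2) by simp
  qed
  have "list_var p x ns \<le> (blockc * D) powr p" if "sorted_wrt (<) ns" for ns
    by (rule list_var_le_blocks[OF _ \<beta> c d c0 c0 sumle that]) (use p1 in auto)
  then show "x \<in> vecs J" "nrm J x \<le> blockc * D"
    using james_boundI[OF x0, of "blockc * D"] D by simp_all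
qed

lemma block_var_bdd:
  assumes x: "x \<in> vecs J"
  shows "bdd_above (list_var p x ` {ns. sorted_wrt (<) ns \<and> set ns \<subseteq> S})"
  using james_upper_powr[OF x] by (auto simp: bdd_above_def)

lemma list_var_le_block_var:
  assumes x: "x \<in> vecs J" and "sorted_wrt (<) ns" "set ns \<subseteq> S"
  shows "list_var p x ns \<le> block_var p x S"
  unfolding block_var_def using assms by (intro cSUP_upper block_var_bdd) auto

lemma block_var_nonneg: "x \<in> vecs J \<Longrightarrow> 0 \<le> block_var p x S"
  using list_var_le_block_var[of x "[]" S] by simp

text \<open>Lists from successive blocks can be concatenated, and concatenation only adds to the variation.\<close>

lemma james_lower_estimate:
  fixes \<beta> :: "nat \<Rightarrow> nat"
  assumes \<beta>: "mono \<beta>" and x: "x \<in> vecs J"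
  shows "(\<Sum>n<M. block_var p x {i. \<beta> i = n}) \<le> nrm J x powr p"
proof -
  have "(\<Sum>n<M. block_var p x {i. \<beta> i = n}) + list_var p x ns \<le> nrm J x powr p"
    if "sorted_wrt (<) ns" "\<And>i. i \<in> set ns \<Longrightarrow> M \<le> \<beta> i" for ns
    using that
  proof (induction M arbitrary: ns)
    case 0
    then show ?case using james_upper_powr[OF x] by simp
  next
    case (Suc M)
    have "block_var p x {i. \<beta> i = M} \<le> nrm J x powr p - list_var p x ns - (\<Sum>n<M. block_var p x {i. \<beta> i = n})"
      unfolding block_var_def[of p x "{i. \<beta> i = M}"]
    proof (rule cSUP_least)
      show "{ns. sorted_wrt (<) ns \<and> set ns \<subseteq> {i. \<beta> i = M}} \<noteq> {}"
        by (auto intro!: exI[of _ "[]"])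
      fix ms assume "ms \<in> {ns. sorted_wrt (<) ns \<and> set ns \<subseteq> {i. \<beta> i = M}}"
      then have ms: "sorted_wrt (<) ms" "\<And>i. i \<in> set ms \<Longrightarrow> \<beta> i = M" by auto
      have "i < j" if "i \<in> set ms" "j \<in> set ns" for i j
      proof (rule ccontr)
        assume "\<not> i < j"
        then have "\<beta> j \<le> \<beta> i" using \<beta> by (simp add: monoD)
        then show False using ms(2)[OF that(1)] Suc.prems(2)[OF that(2)] by simp
      qed
      then have "sorted_wrt (<) (ms @ ns)"
        using ms Suc.prems by (auto simp: sorted_wrt_append)
      then have "(\<Sum>n<M. block_var p x {i. \<beta> i = n}) + list_var p x (ms @ ns) \<le> nrm J x powr p"
        using Suc.prems ms(2) by (intro Suc.IH) (auto dest: Suc_leD)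
      then show "list_var p x ms \<le> nrm J x powr p - list_var p x ns - (\<Sum>n<M. block_var p x {i. \<beta> i = n})"
        using list_var_append_ge[of p x ms ns] by simp
    qed
    then show ?case by simp
  qed
  from this[of "[]"] show ?thesis by simp
qed

subsection \<open>Truncations\<close>

definition trunc :: "nat \<Rightarrow> (nat \<Rightarrow> 'k) \<Rightarrow> nat \<Rightarrow> 'k" where
  "trunc n x = (\<lambda>i. if i < n then x i else 0)"

lemma trunc_add: "trunc n (x + y) = trunc n x + trunc n y"
  and trunc_scal: "trunc n (scal J c x) = scal J c (trunc n x)"
  by (auto simp: trunc_def fun_eq_iff scal_james)

lemma trunc_vecs:
  assumes x: "x \<in> vecs J"
  shows "trunc n x \<in> vecs J" "nrm J (trunc n x) \<le> blockc * nrm J x"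
proof -
  define \<beta> :: "nat \<Rightarrow> nat" where "\<beta> = (\<lambda>i. if i < n then 0 else 1)"
  define c :: "nat \<Rightarrow> real" where "c = (\<lambda>m. if m = 0 then nrm J x powr p else 0)"
  have \<beta>: "mono \<beta>" by (auto simp: \<beta>_def mono_def)
  have t0: "trunc n x \<longlonglongrightarrow> 0"
    by (rule tendsto_eventually) (auto simp: trunc_def eventually_sequentially intro!: exI[of _ n])
  have lv: "list_var p (trunc n x) ns \<le> c m" if ns: "sorted_wrt (<) ns" "\<And>i. i \<in> set ns \<Longrightarrow> \<beta> i = m" for ns m
  proof (cases "m = 0")
    case True
    have "list_var p (trunc n x) ns = list_var p x ns"
    proof (rule list_var_cong)
      fix i assume "i \<in> set ns"
      then show "trunc n x i = x i"
        using ns(2)[of i] True by (auto simp: trunc_def \<beta>_def split: if_splits)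
    qed
    then show ?thesis using james_upper_powr[OF x ns(1)] True by (simp add: c_def)
  next
    case False
    have "list_var p (trunc n x) ns = list_var p (\<lambda>_. 0 :: 'k) ns"
    proof (rule list_var_cong)
      fix i assume "i \<in> set ns"
      then show "trunc n x i = 0"
        using ns(2)[of i] False by (auto simp: trunc_def \<beta>_def split: if_splits)
    qed
    then show ?thesis by (simp add: list_var_eq_sum c_def)
  qed
  have d: "norm (trunc n x i) powr p \<le> c (\<beta> i)" for i
    using james_coord_le[OF x] p1 by (auto simp: trunc_def c_def \<beta>_def intro!: powr_mono2)
  have D: "(\<Sum>m<M. c m) \<le> nrm J x powr p" for M
    by (cases M) (auto simp: c_def sum.lessThan_Suc_shift simp del: sum.lessThan_Suc)
  show "trunc n x \<in> vecs J" "nrm J (trunc n x) \<le> blockc * nrm J x"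
    using james_upper_estimate[OF \<beta> t0 _ d _ D james_norm_ge_0[OF x]] lv by (auto simp: c_def)
qed

text \<open>A list that nearly exhausts the \<open>p\<close>-variation of \<open>x\<close> leaves little variation beyond its last entry.\<close>

lemma trunc_tendsto:
  assumes x: "x \<in> vecs J" and e: "0 < e"
  shows "\<exists>n. \<forall>m\<ge>n. nrm J (x - trunc m x) < e"
proof -
  have bpos: "0 < blockc" using powr_ge_zero[of 2 p] by (simp add: add_pos_nonneg order_less_imp_not_eq2)
  define \<delta> where "\<delta> = (e / (2 * blockc)) powr p"
  have \<delta>: "0 < \<delta>" using e bpos by (simp add: \<delta>_def)
  have "\<exists>ns. sorted_wrt (<) ns \<and> block_var p x UNIV - \<delta> < list_var p x ns"
  proof (rule ccontr)
    assume "\<not> ?thesis"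
    then have "list_var p x ns \<le> block_var p x UNIV - \<delta>" if "sorted_wrt (<) ns" for ns
      using that by (auto simp: not_less)
    then have "block_var p x UNIV \<le> block_var p x UNIV - \<delta>"
      unfolding block_var_def[of p x UNIV] by (intro cSUP_least) (auto intro!: exI[of _ "[]"])
    then show False using \<delta> by simp
  qed
  then obtain ns where ns: "sorted_wrt (<) ns" "block_var p x UNIV - \<delta> < list_var p x ns" by blast
  define n where "n = Suc (Max (insert 0 (set ns)))"
  have nsn: "i < n" if "i \<in> set ns" for i
    using that Max_ge[of "insert 0 (set ns)" i] by (simp add: n_def less_Suc_eq_le)
  have tail: "list_var p x ms \<le> \<delta>" if "sorted_wrt (<) ms" "\<And>i. i \<in> set ms \<Longrightarrow> n \<le> i" for ms
  proof -
    have "sorted_wrt (<) (ns @ ms)" using that ns nsn by (fastforce simp: sorted_wrt_append)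
    then have "list_var p x ns + list_var p x ms \<le> block_var p x UNIV"
      using list_var_append_ge[of p x ns ms] list_var_le_block_var[OF x, of "ns @ ms" UNIV] by simp
    then show ?thesis using ns by simp
  qed
  have coord: "norm (x i) powr p \<le> \<delta>" if "n \<le> i" for i
  proof -
    have "(\<lambda>j. norm (x i - x j) powr p) \<longlonglongrightarrow> norm (x i - 0) powr p"
      using p1 by (intro tendsto_intros tendsto_powr2 james_vecs_tendsto x) auto
    moreover have "norm (x i - x j) powr p \<le> \<delta>" if "i < j" for j
    proof -
      have "list_var p x [i, j] \<le> \<delta>" using that \<open>n \<le> i\<close> by (intro tail) auto
      then show ?thesis by simp
    qed
    ultimately show ?thesis
      by (intro tendsto_upperbound[where F = sequentially and f = "\<lambda>j. norm (x i - x j) powr p"])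
        (auto simp: eventually_at_top_dense)
  qed
  have "nrm J (x - trunc m x) < e" if m: "n \<le> m" for m
  proof -
    define \<beta> :: "nat \<Rightarrow> nat" where "\<beta> = (\<lambda>i. if i < m then 0 else 1)"
    define c :: "nat \<Rightarrow> real" where "c = (\<lambda>k. if k = 1 then \<delta> else 0)"
    have \<beta>: "mono \<beta>" by (auto simp: \<beta>_def mono_def)
    let ?y = "x - trunc m x"
    have y0: "?y \<longlonglongrightarrow> 0"
      by (rule J.diff_vecs[OF x trunc_vecs(1)[OF x], THEN james_vecs_tendsto])
    have lv: "list_var p ?y ms \<le> c k" if ms: "sorted_wrt (<) ms" "\<And>i. i \<in> set ms \<Longrightarrow> \<beta> i = k" for ms k
    proof (cases "k = 1")
      case True
      have "list_var p ?y ms = list_var p x ms"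
      proof (rule list_var_cong)
        fix i assume "i \<in> set ms"
        then have "\<beta> i = 1" using ms(2) True by simp
        then have "\<not> i < m" by (simp add: \<beta>_def split: if_splits)
        then show "?y i = x i" by (simp add: trunc_def)
      qed
      moreover have "n \<le> i" if "i \<in> set ms" for i
      proof -
        have "\<beta> i = 1" using ms(2)[OF that] True by simp
        then have "\<not> i < m" by (simp add: \<beta>_def split: if_splits)
        then show ?thesis using m by simp
      qed
      ultimately show ?thesis using tail[OF ms(1)] True by (simp add: c_def)
    next
      case False
      have "list_var p ?y ms = list_var p (\<lambda>_. 0 :: 'k) ms"
      proof (rule list_var_cong)
        fix i assume "i \<in> set ms"
        then have "\<beta> i \<noteq> 1" using ms(2) False by simp
        then have "i < m" by (simp add: \<beta>_def split: if_splits)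
        then show "?y i = 0" by (simp add: trunc_def)
      qed
      then show ?thesis using \<delta> by (simp add: list_var_eq_sum c_def)
    qed
    have d: "norm (?y i) powr p \<le> c (\<beta> i)" for i
      using coord[of i] m by (auto simp: trunc_def c_def \<beta>_def)
    have D: "(\<Sum>k<M. c k) \<le> (e / (2 * blockc)) powr p" for M
    proof -
      have "(\<Sum>k<M. c k) \<le> (\<Sum>k\<in>{..<M} \<union> {1}. c k)" using \<delta> by (intro sum_mono2) (auto simp: c_def)
      also have "\<dots> = \<delta>" unfolding c_def by (subst sum.delta) auto
      finally show ?thesis by (simp add: \<delta>_def)
    qed
    have lv': "\<forall>ms k. sorted_wrt (<) ms \<longrightarrow> (\<forall>i\<in>set ms. \<beta> i = k) \<longrightarrow> list_var p ?y ms \<le> c k"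
      using lv by blast
    have "nrm J ?y \<le> blockc * (e / (2 * blockc))"
      by (rule james_upper_estimate(2)[OF \<beta> y0 lv' d _ D]) (use \<delta> e bpos in \<open>auto simp: c_def\<close>)
    also have "\<dots> < e" using e bpos by simp
    finally show ?thesis .
  qed
  then show ?thesis by blast
qed

end

section \<open>Operators from finite sums of \<open>\<ell>\<^sub>\<infinity>\<close>-spaces into the James space\<close>

text \<open>The multiplier of absolute value at most 1 that makes \<open>z\<close> real and nonnegative.\<close>

definition phase :: "'k::real_normed_field \<Rightarrow> 'k" where
  "phase z = (if z = 0 then 0 else of_real (norm z) / z)"

lemma norm_phase: "norm (phase z) \<le> 1"
  by (simp add: phase_def norm_divide)

lemma phase_mult: "phase z * z = of_real (norm z)"
  by (simp add: phase_def)

lemma of_real_inner_1: "(of_real r :: 'k::{real_normed_field, euclidean_space}) \<bullet> 1 = r"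
proof -
  have "(1::'k) \<bullet> 1 = 1" by (simp add: dot_square_norm)
  then show ?thesis by (simp add: of_real_def)
qed

lemma inner_1_le_norm: "(z :: 'k::{real_normed_field, euclidean_space}) \<bullet> 1 \<le> norm z"
  using norm_cauchy_schwarz[of z "1 :: 'k"] by simp

text \<open>The average of a quadratic form over all signs is the sum of its diagonal, so some choice of signs attains at
  least this value. The signs can be chosen one after the other.\<close>

lemma sign_choice:
  fixes m :: "nat \<Rightarrow> nat \<Rightarrow> real"
  shows "\<exists>\<epsilon>. (\<forall>i. \<bar>\<epsilon> i\<bar> = 1) \<and> (\<Sum>i<L. m i i) \<le> (\<Sum>i<L. \<Sum>k<L. \<epsilon> i * \<epsilon> k * m i k)"
proof (induction L)
  case 0
  show ?case by (intro exI[of _ "\<lambda>_. 1"]) simp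
next
  case (Suc L)
  then obtain \<epsilon> where \<epsilon>: "\<And>i. \<bar>\<epsilon> i\<bar> = 1" "(\<Sum>i<L. m i i) \<le> (\<Sum>i<L. \<Sum>k<L. \<epsilon> i * \<epsilon> k * m i k)" by blast
  define c where "c = (\<Sum>i<L. \<epsilon> i * (m i L + m L i))"
  define s :: real where "s = (if c \<ge> 0 then 1 else - 1)"
  define \<eta> where "\<eta> = \<epsilon>(L := s)"
  have s: "s * s = 1" "0 \<le> s * c" by (auto simp: s_def)
  have "(\<Sum>i<Suc L. \<Sum>k<Suc L. \<eta> i * \<eta> k * m i k)
      = (\<Sum>i<L. \<Sum>k<L. \<eta> i * \<eta> k * m i k) + (\<Sum>i<L. \<eta> i * \<eta> L * m i L) + (\<Sum>k<L. \<eta> L * \<eta> k * m L k) + \<eta> L * \<eta> L * m L L"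
    by (simp add: sum.distrib)
  also have "(\<Sum>i<L. \<Sum>k<L. \<eta> i * \<eta> k * m i k) = (\<Sum>i<L. \<Sum>k<L. \<epsilon> i * \<epsilon> k * m i k)"
    by (intro sum.cong) (auto simp: \<eta>_def)
  also have "(\<Sum>i<L. \<eta> i * \<eta> L * m i L) = s * (\<Sum>i<L. \<epsilon> i * m i L)"
    unfolding sum_distrib_left by (intro sum.cong) (auto simp: \<eta>_def)
  also have "(\<Sum>k<L. \<eta> L * \<eta> k * m L k) = s * (\<Sum>i<L. \<epsilon> i * m L i)"
    unfolding sum_distrib_left by (intro sum.cong) (auto simp: \<eta>_def)
  also have "(\<Sum>i<L. \<Sum>k<L. \<epsilon> i * \<epsilon> k * m i k) + s * (\<Sum>i<L. \<epsilon> i * m i L) + s * (\<Sum>i<L. \<epsilon> i * m L i)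
      + \<eta> L * \<eta> L * m L L = (\<Sum>i<L. \<Sum>k<L. \<epsilon> i * \<epsilon> k * m i k) + s * c + m L L"
    using s by (simp add: c_def \<eta>_def sum.distrib distrib_left)
  finally show ?case
    using \<epsilon> s by (intro exI[of _ \<eta>]) (auto simp: \<eta>_def s_def)
qed

context james_setting
begin

definition q :: real where "q = p / (p - 1)"

lemma q1: "1 < q" and pq: "1 / p + 1 / q = 1" and pq': "(q - 1) * p = q" and qp: "q / p = q - 1"
  using p1 by (auto simp: q_def field_simps)

text \<open>The image of the finitely supported vector \<open>g\<close> of \<open>G\<^sub>p\<close> under the operator with matrix \<open>a\<close>.\<close>

definition comb :: "nat set \<Rightarrow> (nat \<Rightarrow> nat \<Rightarrow> nat \<Rightarrow> 'k) \<Rightarrow> (nat \<Rightarrow> nat \<Rightarrow> 'k) \<Rightarrow> nat \<Rightarrow> 'k" where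
  "comb I a g = (\<lambda>t. \<Sum>\<kappa>\<in>I. \<Sum>l<\<kappa>. g \<kappa> l * a \<kappa> l t)"

end

text \<open>The matrix of an operator of norm at most \<open>C\<close> into \<open>J\<close> from the \<open>p\<close>-sum of the spaces \<open>\<ell>\<^sub>\<infinity>\<^sup>\<kappa>\<close> with
  \<open>\<kappa> \<in> I\<close>; the entry \<open>a \<kappa> l t\<close> is coordinate \<open>t\<close> of the image of unit vector \<open>l\<close> of summand \<open>\<kappa>\<close>. The norm
  of \<open>g\<close> is at most \<open>D\<close> if the entries in summand \<open>\<kappa>\<close> are bounded by \<open>y \<kappa>\<close> and the \<open>\<ell>\<^sub>p\<close>-norm of \<open>y\<close> is at most \<open>D\<close>.\<close>

locale operator_matrix = james_setting p K
  for p :: real and K :: "'k::{real_normed_field, euclidean_space} itself" +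
  fixes I :: "nat set" and a :: "nat \<Rightarrow> nat \<Rightarrow> nat \<Rightarrow> 'k" and C :: real
  assumes fin: "finite I" and C0: "0 < C"
    and var_bound: "\<lbrakk>0 \<le> D; \<And>\<kappa>. \<kappa> \<in> I \<Longrightarrow> 0 \<le> y \<kappa>; \<And>\<kappa> l. \<lbrakk>\<kappa> \<in> I; l < \<kappa>\<rbrakk> \<Longrightarrow> norm (g \<kappa> l) \<le> y \<kappa>;
        (\<Sum>\<kappa>\<in>I. y \<kappa> powr p) \<le> D powr p; sorted_wrt (<) ns\<rbrakk>
      \<Longrightarrow> list_var p (comb I a g) ns \<le> (C * D) powr p"
    and coord_bound: "\<lbrakk>0 \<le> D; \<And>\<kappa>. \<kappa> \<in> I \<Longrightarrow> 0 \<le> y \<kappa>; \<And>\<kappa> l. \<lbrakk>\<kappa> \<in> I; l < \<kappa>\<rbrakk> \<Longrightarrow> norm (g \<kappa> l) \<le> y \<kappa>;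
        (\<Sum>\<kappa>\<in>I. y \<kappa> powr p) \<le> D powr p\<rbrakk>
      \<Longrightarrow> norm (comb I a g t) \<le> C * D"
begin

text \<open>The norm of coordinate \<open>t\<close> of the operator as a functional on the summand \<open>\<ell>\<^sub>\<infinity>\<^sup>\<kappa>\<close>.\<close>

definition profile :: "nat \<Rightarrow> nat \<Rightarrow> real" where
  "profile t \<kappa> = (\<Sum>l<\<kappa>. norm (a \<kappa> l t))"

lemma profile_nonneg: "0 \<le> profile t \<kappa>"
  by (simp add: profile_def sum_nonneg)

definition weight :: "(nat \<Rightarrow> real) \<Rightarrow> real \<Rightarrow> bool" where
  "weight y D \<longleftrightarrow> 0 \<le> D \<and> (\<forall>\<kappa>\<in>I. 0 \<le> y \<kappa>) \<and> (\<Sum>\<kappa>\<in>I. y \<kappa> powr p) \<le> D powr p"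

text \<open>Give all entries of row \<open>t\<close> the same phase: a vector with entries of absolute value \<open>y \<kappa>\<close> in summand \<open>\<kappa>\<close>
  then attains the left-hand side at coordinate \<open>t\<close>.\<close>

lemma weight_profile_le:
  assumes "weight y D"
  shows "(\<Sum>\<kappa>\<in>I. y \<kappa> * profile t \<kappa>) \<le> C * D"
proof -
  define g where "g = (\<lambda>\<kappa> l. of_real (y \<kappa>) * phase (a \<kappa> l t))"
  have y0: "0 \<le> y \<kappa>" if "\<kappa> \<in> I" for \<kappa> using assms that by (auto simp: weight_def)
  have "comb I a g t = (\<Sum>\<kappa>\<in>I. \<Sum>l<\<kappa>. of_real (y \<kappa>) * (phase (a \<kappa> l t) * a \<kappa> l t))"
    by (simp add: comb_def g_def mult.assoc)
  also have "\<dots> = of_real (\<Sum>\<kappa>\<in>I. y \<kappa> * profile t \<kappa>)"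
    by (simp add: phase_mult profile_def sum_distrib_left)
  finally have eq: "comb I a g t = of_real (\<Sum>\<kappa>\<in>I. y \<kappa> * profile t \<kappa>)" .
  have "norm (comb I a g t) = (\<Sum>\<kappa>\<in>I. y \<kappa> * profile t \<kappa>)"
    unfolding eq norm_of_real using y0 profile_nonneg by (intro abs_of_nonneg sum_nonneg) simp
  moreover have "norm (comb I a g t) \<le> C * D"
  proof (rule coord_bound[where y = y])
    show "norm (g \<kappa> l) \<le> y \<kappa>" if "\<kappa> \<in> I" for \<kappa> l
      using mult_left_mono[OF norm_phase[of "a \<kappa> l t"] y0[OF that]] y0[OF that] by (simp add: g_def norm_mult)
  qed (use assms in \<open>auto simp: weight_def\<close>)
  ultimately show ?thesis by simp
qed

text \<open>By duality each profile lies in the ball of radius \<open>C\<close> of \<open>\<ell>\<^sub>q\<close>: test with the weight for which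
  Hoelder's inequality is an equality.\<close>

lemma profile_powr_le: "(\<Sum>\<kappa>\<in>I. profile t \<kappa> powr q) \<le> C powr q"
proof -
  define S where "S = (\<Sum>\<kappa>\<in>I. profile t \<kappa> powr q)"
  have S0: "0 \<le> S" by (simp add: S_def sum_nonneg)
  have w: "weight (\<lambda>\<kappa>. profile t \<kappa> powr (q - 1)) (S powr (1 / p))"
    using p1 S0 by (simp add: weight_def powr_powr pq' S_def)
  have "S = (\<Sum>\<kappa>\<in>I. profile t \<kappa> powr (q - 1) * profile t \<kappa>)"
    unfolding S_def
  proof (rule sum.cong[OF refl])
    show "profile t \<kappa> powr q = profile t \<kappa> powr (q - 1) * profile t \<kappa>" for \<kappa>
      using profile_nonneg[of t \<kappa>] powr_mult_base[of "profile t \<kappa>" "q - 1"] by (simp add: mult.commute)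
  qed
  then have le: "S \<le> C * S powr (1 / p)" using weight_profile_le[OF w, of t] by simp
  show ?thesis
  proof (cases "S = 0")
    case True
    then show ?thesis by (simp add: S_def)
  next
    case False
    then have pos: "S > 0" using S0 by simp
    have "S powr (1 / p) * S powr (1 / q) = S" using pos pq by (simp flip: powr_add)
    then have "S powr (1 / p) * S powr (1 / q) \<le> S powr (1 / p) * C" using le by (simp add: mult.commute)
    then have "S powr (1 / q) \<le> C" using pos by simp
    then have "(S powr (1 / q)) powr q \<le> C powr q" using q1 by (intro powr_mono2) auto
    then show ?thesis using q1 pos by (simp add: powr_powr S_def)
  qed
qed

text \<open>Let every pair \<open>(\<kappa>, l)\<close> select one of \<open>L\<close> disjoint intervals. With suitable signs, one for each interval,
  a single vector of the range has increments over the \<open>L\<close> intervals whose sum dominates all selected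
  increments, although each entry was allowed to choose its own interval. The bounded \<open>p\<close>-variation of
  this vector turns the trivial bound \<open>L\<close> into \<open>L powr (1 / q)\<close>. This is where the target being the
  James space, and not an arbitrary sequence space, is essential.\<close>

lemma selected_increments_le:
  fixes t :: "nat \<Rightarrow> nat"
  assumes w: "weight y D"
    and t: "\<And>i j. i < j \<Longrightarrow> j < 2 * L \<Longrightarrow> t i < t j"
    and j: "\<And>\<kappa> l. \<lbrakk>\<kappa> \<in> I; l < \<kappa>\<rbrakk> \<Longrightarrow> j \<kappa> l < L"
  shows "(\<Sum>\<kappa>\<in>I. \<Sum>l<\<kappa>. y \<kappa> * norm (a \<kappa> l (t (2 * j \<kappa> l + 1)) - a \<kappa> l (t (2 * j \<kappa> l))))
    \<le> C * D * real L powr (1 / q)"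
proof -
  have y0: "0 \<le> y \<kappa>" if "\<kappa> \<in> I" for \<kappa> using w that by (auto simp: weight_def)
  have D0: "0 \<le> D" using w by (simp add: weight_def)
  define d where "d = (\<lambda>i \<kappa> l. a \<kappa> l (t (2 * i + 1)) - a \<kappa> l (t (2 * i)))"
  define h where "h = (\<lambda>\<kappa> l. of_real (y \<kappa>) * phase (d (j \<kappa> l) \<kappa> l))"
  define m where "m = (\<lambda>i k. \<Sum>\<kappa>\<in>I. \<Sum>l<\<kappa>. if j \<kappa> l = k then (h \<kappa> l * d i \<kappa> l) \<bullet> 1 else 0)"
  obtain \<epsilon> where \<epsilon>: "\<And>i. \<bar>\<epsilon> i\<bar> = 1" and \<epsilon>m: "(\<Sum>i<L. m i i) \<le> (\<Sum>i<L. \<Sum>k<L. \<epsilon> i * \<epsilon> k * m i k)"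
    using sign_choice[of m L] by blast
  define g where "g = (\<lambda>\<kappa> l. of_real (\<epsilon> (j \<kappa> l)) * h \<kappa> l)"
  define X where "X = comb I a g"
  \<comment> \<open>The diagonal of \<open>m\<close> collects the selected increments; entry \<open>(i, k)\<close> is the effect on interval \<open>i\<close> of the pairs that selected \<open>k\<close>.\<close>
  have diag: "(\<Sum>i<L. m i i) = (\<Sum>\<kappa>\<in>I. \<Sum>l<\<kappa>. y \<kappa> * norm (d (j \<kappa> l) \<kappa> l))"
  proof -
    have "(\<Sum>i<L. m i i) = (\<Sum>\<kappa>\<in>I. \<Sum>l<\<kappa>. \<Sum>i<L. if j \<kappa> l = i then (h \<kappa> l * d i \<kappa> l) \<bullet> 1 else 0)"
      unfolding m_def by (subst sum.swap, rule sum.cong[OF refl], rule sum.swap)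
    also have "\<dots> = (\<Sum>\<kappa>\<in>I. \<Sum>l<\<kappa>. (h \<kappa> l * d (j \<kappa> l) \<kappa> l) \<bullet> 1)"
      using j by (intro sum.cong refl) (simp add: sum.delta')
    also have "\<dots> = (\<Sum>\<kappa>\<in>I. \<Sum>l<\<kappa>. y \<kappa> * norm (d (j \<kappa> l) \<kappa> l))"
    proof (intro sum.cong refl)
      fix \<kappa> l
      have "h \<kappa> l * d (j \<kappa> l) \<kappa> l = of_real (y \<kappa> * norm (d (j \<kappa> l) \<kappa> l))"
        by (simp add: h_def mult.assoc phase_mult)
      then show "(h \<kappa> l * d (j \<kappa> l) \<kappa> l) \<bullet> 1 = y \<kappa> * norm (d (j \<kappa> l) \<kappa> l)"
        by (simp only: of_real_inner_1)
    qed
    finally show ?thesis .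
  qed
  have row: "(\<Sum>k<L. \<epsilon> k * m i k) = (X (t (2 * i + 1)) - X (t (2 * i))) \<bullet> 1" for i
  proof -
    have "(\<Sum>k<L. \<epsilon> k * m i k)
        = (\<Sum>\<kappa>\<in>I. \<Sum>l<\<kappa>. \<Sum>k<L. if j \<kappa> l = k then \<epsilon> k * ((h \<kappa> l * d i \<kappa> l) \<bullet> 1) else 0)"
      unfolding m_def sum_distrib_left
      by (subst sum.swap, rule sum.cong[OF refl], subst sum.swap, intro sum.cong refl) auto
    also have "\<dots> = (\<Sum>\<kappa>\<in>I. \<Sum>l<\<kappa>. \<epsilon> (j \<kappa> l) * ((h \<kappa> l * d i \<kappa> l) \<bullet> 1))"
      using j by (intro sum.cong refl) (simp add: sum.delta')
    also have "\<dots> = (\<Sum>\<kappa>\<in>I. \<Sum>l<\<kappa>. (g \<kappa> l * d i \<kappa> l) \<bullet> 1)"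
    proof (intro sum.cong refl)
      fix \<kappa> l
      have "g \<kappa> l * d i \<kappa> l = \<epsilon> (j \<kappa> l) *\<^sub>R (h \<kappa> l * d i \<kappa> l)"
        by (simp add: g_def scaleR_conv_of_real mult.assoc)
      then show "\<epsilon> (j \<kappa> l) * ((h \<kappa> l * d i \<kappa> l) \<bullet> 1) = (g \<kappa> l * d i \<kappa> l) \<bullet> 1" by simp
    qed
    also have "\<dots> = (X (t (2 * i + 1)) - X (t (2 * i))) \<bullet> 1"
    proof -
      have "X (t (2 * i + 1)) - X (t (2 * i)) = (\<Sum>\<kappa>\<in>I. \<Sum>l<\<kappa>. g \<kappa> l * d i \<kappa> l)"
        by (simp add: X_def comb_def d_def sum_subtractf right_diff_distrib)
      then show ?thesis by (simp add: inner_sum_left)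
    qed
    finally show ?thesis .
  qed
  have "(\<Sum>\<kappa>\<in>I. \<Sum>l<\<kappa>. y \<kappa> * norm (d (j \<kappa> l) \<kappa> l)) \<le> (\<Sum>i<L. \<epsilon> i * (\<Sum>k<L. \<epsilon> k * m i k))"
    using \<epsilon>m unfolding diag by (simp add: sum_distrib_left mult.assoc)
  also have "\<dots> \<le> (\<Sum>i<L. norm (X (t (2 * i + 1)) - X (t (2 * i))))"
  proof (intro sum_mono)
    fix i
    have "\<epsilon> i * ((X (t (2 * i + 1)) - X (t (2 * i))) \<bullet> 1) = (\<epsilon> i *\<^sub>R (X (t (2 * i + 1)) - X (t (2 * i)))) \<bullet> 1"
      by simp
    also have "\<dots> \<le> norm (\<epsilon> i *\<^sub>R (X (t (2 * i + 1)) - X (t (2 * i))))" by (rule inner_1_le_norm)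
    finally show "\<epsilon> i * (\<Sum>k<L. \<epsilon> k * m i k) \<le> norm (X (t (2 * i + 1)) - X (t (2 * i)))"
      unfolding row using \<epsilon>[of i] by simp
  qed
  also have "\<dots> \<le> real L powr (1 / q) * (\<Sum>i<L. norm (X (t (2 * i + 1)) - X (t (2 * i))) powr p) powr (1 / p)"
    using sum_le_card_powr[OF p1 pq, of "{..<L}" "\<lambda>i. norm (X (t (2 * i + 1)) - X (t (2 * i)))"] by simp
  also have "\<dots> \<le> real L powr (1 / q) * (C * D)"
  proof (intro mult_left_mono)
    let ?ns = "map t [0..<2 * L]"
    have sorted: "sorted_wrt (<) ?ns"
      using t by (auto simp: sorted_wrt_iff_nth_less)
    have "(\<Sum>i<L. norm (X (t (2 * i + 1)) - X (t (2 * i))) powr p)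
        = (\<Sum>i\<in>(\<lambda>i. 2 * i) ` {..<L}. norm (X (t i) - X (t (Suc i))) powr p)"
      by (subst sum.reindex) (auto simp: inj_on_def norm_minus_commute)
    also have "\<dots> \<le> (\<Sum>i<2 * L - 1. norm (X (t i) - X (t (Suc i))) powr p)"
      by (intro sum_mono2) auto
    also have "\<dots> = list_var p X ?ns"
      unfolding list_var_eq_sum by (intro sum.cong) auto
    also have "\<dots> \<le> (C * D) powr p"
      unfolding X_def
    proof (rule var_bound[where y = y])
      show "norm (g \<kappa> l) \<le> y \<kappa>" if "\<kappa> \<in> I" for \<kappa> l
        using mult_left_mono[OF norm_phase[of "d (j \<kappa> l) \<kappa> l"] y0[OF that]] y0[OF that] \<epsilon>[of "j \<kappa> l"]
        by (simp add: g_def h_def norm_mult)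
    qed (use w sorted in \<open>auto simp: weight_def\<close>)
    finally have "(\<Sum>i<L. norm (X (t (2 * i + 1)) - X (t (2 * i))) powr p) powr (1 / p) \<le> ((C * D) powr p) powr (1 / p)"
      using p1 by (intro powr_mono2) (auto simp: sum_nonneg)
    also have "\<dots> = C * D" using p1 C0 D0 by (simp add: powr_powr)
    finally show "(\<Sum>i<L. norm (X (t (2 * i + 1)) - X (t (2 * i))) powr p) powr (1 / p) \<le> C * D" .
  qed auto
  finally show ?thesis by (simp add: d_def mult_ac)
qed

definition chain_const :: "nat \<Rightarrow> real" where
  "chain_const r = 1 + (\<Sum>i<r. 2 powr (real i / q))"

text \<open>Chaining: the value at one of \<open>2 ^ r\<close> points is reached from the first point by one increment for each dyadic
  scale, and scale \<open>i\<close> consists of \<open>2 ^ i\<close> disjoint intervals. So free selection among \<open>2 ^ r\<close> points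
  costs only \<open>chain_const r\<close>, which is of order \<open>2 powr (r / q)\<close> and hence much smaller than \<open>2 ^ r\<close>.\<close>

lemma selected_values_le:
  fixes t :: "nat \<Rightarrow> nat"
  assumes w: "weight y D"
    and t: "\<And>i j. i < j \<Longrightarrow> j < 2 ^ r \<Longrightarrow> t i < t j"
    and k: "\<And>\<kappa> l. \<lbrakk>\<kappa> \<in> I; l < \<kappa>\<rbrakk> \<Longrightarrow> k \<kappa> l < 2 ^ r"
  shows "(\<Sum>\<kappa>\<in>I. \<Sum>l<\<kappa>. y \<kappa> * norm (a \<kappa> l (t (k \<kappa> l)))) \<le> C * D * chain_const r"
  using t k
proof (induction r arbitrary: t k)
  case 0
  have "(\<Sum>\<kappa>\<in>I. \<Sum>l<\<kappa>. y \<kappa> * norm (a \<kappa> l (t (k \<kappa> l)))) = (\<Sum>\<kappa>\<in>I. y \<kappa> * profile (t 0) \<kappa>)"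
    using 0 by (intro sum.cong) (auto simp: profile_def sum_distrib_left)
  then show ?case using weight_profile_le[OF w, of "t 0"] by (simp add: chain_const_def)
next
  case (Suc r)
  have y0: "0 \<le> y \<kappa>" if "\<kappa> \<in> I" for \<kappa> using w that by (auto simp: weight_def)
  define j where "j = (\<lambda>\<kappa> l. k \<kappa> l div 2)"
  have jl: "j \<kappa> l < 2 ^ r" if "\<kappa> \<in> I" "l < \<kappa>" for \<kappa> l using Suc.prems(2)[OF that] by (simp add: j_def)
  let ?d = "\<lambda>\<kappa> l. a \<kappa> l (t (2 * j \<kappa> l + 1)) - a \<kappa> l (t (2 * j \<kappa> l))"
  have le: "norm (a \<kappa> l (t (k \<kappa> l))) \<le> norm (a \<kappa> l (t (2 * j \<kappa> l))) + norm (?d \<kappa> l)" for \<kappa> l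
  proof (cases "even (k \<kappa> l)")
    case True
    then show ?thesis by (simp add: j_def)
  next
    case False
    then have "k \<kappa> l = 2 * j \<kappa> l + 1" by (simp add: j_def)
    then show ?thesis
      using norm_triangle_ineq[of "a \<kappa> l (t (2 * j \<kappa> l))" "?d \<kappa> l"] by simp
  qed
  have "(\<Sum>\<kappa>\<in>I. \<Sum>l<\<kappa>. y \<kappa> * norm (a \<kappa> l (t (k \<kappa> l))))
      \<le> (\<Sum>\<kappa>\<in>I. \<Sum>l<\<kappa>. y \<kappa> * (norm (a \<kappa> l (t (2 * j \<kappa> l))) + norm (?d \<kappa> l)))"
    by (intro sum_mono mult_left_mono le y0)
  also have "\<dots> = (\<Sum>\<kappa>\<in>I. \<Sum>l<\<kappa>. y \<kappa> * norm (a \<kappa> l (t (2 * j \<kappa> l)))) + (\<Sum>\<kappa>\<in>I. \<Sum>l<\<kappa>. y \<kappa> * norm (?d \<kappa> l))"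
    by (simp add: distrib_left sum.distrib)
  also have "(\<Sum>\<kappa>\<in>I. \<Sum>l<\<kappa>. y \<kappa> * norm (a \<kappa> l (t (2 * j \<kappa> l)))) \<le> C * D * chain_const r"
    using Suc.IH[of "\<lambda>i. t (2 * i)" j] Suc.prems(1) jl by simp
  also have "(\<Sum>\<kappa>\<in>I. \<Sum>l<\<kappa>. y \<kappa> * norm (?d \<kappa> l)) \<le> C * D * real (2 ^ r) powr (1 / q)"
    using Suc.prems(1) jl by (intro selected_increments_le w) auto
  also have "C * D * chain_const r + C * D * real (2 ^ r) powr (1 / q) = C * D * chain_const (Suc r)"
    by (simp add: chain_const_def distrib_left powr_realpow[symmetric] powr_powr)
  finally show ?case by simp
qed

lemma selected_values_le_set:
  assumes w: "weight y D" and S: "finite S" "card S \<le> 2 ^ r"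
    and \<tau>: "\<And>\<kappa> l. \<lbrakk>\<kappa> \<in> I; l < \<kappa>\<rbrakk> \<Longrightarrow> \<tau> \<kappa> l \<in> S"
  shows "(\<Sum>\<kappa>\<in>I. \<Sum>l<\<kappa>. y \<kappa> * norm (a \<kappa> l (\<tau> \<kappa> l))) \<le> C * D * chain_const r"
proof -
  define N where "N = Suc (Max (insert 0 S))"
  have SN: "s < N" if "s \<in> S" for s
    using that S Max_ge[of "insert 0 S" s] by (simp add: N_def less_Suc_eq_le)
  \<comment> \<open>Further points enlarge \<open>S\<close> to exactly \<open>2 ^ r\<close> points.\<close>
  define S' where "S' = S \<union> {N..<N + (2 ^ r - card S)}"
  have fS': "finite S'" using S by (simp add: S'_def)
  have "card S' = card S + (2 ^ r - card S)"
    unfolding S'_def using S SN by (subst card_Un_disjoint) fastforce+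
  then have card: "card S' = 2 ^ r" using S by simp
  define t where "t = (\<lambda>i. sorted_list_of_set S' ! i)"
  have t: "t i < t j" if "i < j" "j < 2 ^ r" for i j
    unfolding t_def using that card fS' by (intro sorted_wrt_nth_less[OF strict_sorted_list_of_set]) auto
  define k where "k = (\<lambda>\<kappa> l. SOME i. i < 2 ^ r \<and> t i = \<tau> \<kappa> l)"
  have k: "k \<kappa> l < 2 ^ r \<and> t (k \<kappa> l) = \<tau> \<kappa> l" if "\<kappa> \<in> I" "l < \<kappa>" for \<kappa> l
  proof -
    have "\<tau> \<kappa> l \<in> set (sorted_list_of_set S')" using \<tau>[OF that] fS' by (simp add: S'_def)
    then have "\<exists>i. i < 2 ^ r \<and> t i = \<tau> \<kappa> l" using card by (auto simp: in_set_conv_nth t_def)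
    then show ?thesis unfolding k_def by (rule someI_ex)
  qed
  have "(\<Sum>\<kappa>\<in>I. \<Sum>l<\<kappa>. y \<kappa> * norm (a \<kappa> l (\<tau> \<kappa> l))) = (\<Sum>\<kappa>\<in>I. \<Sum>l<\<kappa>. y \<kappa> * norm (a \<kappa> l (t (k \<kappa> l))))"
    using k by (intro sum.cong) auto
  also have "\<dots> \<le> C * D * chain_const r"
    using k by (intro selected_values_le w t) auto
  finally show ?thesis .
qed

end

text \<open>Sums over all samples \<open>s\<close> of \<open>R\<close> points of \<open>P\<close> are, up to a power of \<open>card P\<close>, expectations over
  independent, uniformly distributed points.\<close>

lemma sum_PiE_single:
  fixes f :: "'a \<Rightarrow> real"
  assumes "finite P" "k < R"
  shows "(\<Sum>s\<in>PiE {..<R} (\<lambda>_. P). f (s k)) = real (card P) ^ (R - 1) * (\<Sum>t\<in>P. f t)"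
proof -
  let ?h = "\<lambda>i t. if i = k then f t else 1"
  have "(\<Sum>s\<in>PiE {..<R} (\<lambda>_. P). f (s k)) = (\<Sum>s\<in>PiE {..<R} (\<lambda>_. P). \<Prod>i<R. ?h i (s i))"
    using assms by (intro sum.cong refl) (simp add: prod.delta)
  also have "\<dots> = (\<Prod>i<R. \<Sum>t\<in>P. ?h i t)"
    using assms by (intro prod_sum_PiE[symmetric]) auto
  also have "\<dots> = (\<Sum>t\<in>P. f t) * (\<Prod>i\<in>{..<R} - {k}. \<Sum>t\<in>P. ?h i t)"
    using assms by (subst prod.remove[of _ k]) auto
  also have "(\<Prod>i\<in>{..<R} - {k}. \<Sum>t\<in>P. ?h i t) = (\<Prod>i\<in>{..<R} - {k}. real (card P))"
    by (intro prod.cong) auto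
  finally show ?thesis using assms by (simp add: mult.commute)
qed

lemma sum_PiE_pair:
  fixes f g :: "'a \<Rightarrow> real"
  assumes "finite P" "k < R" "l < R" "k \<noteq> l"
  shows "(\<Sum>s\<in>PiE {..<R} (\<lambda>_. P). f (s k) * g (s l)) = real (card P) ^ (R - 2) * ((\<Sum>t\<in>P. f t) * (\<Sum>t\<in>P. g t))"
proof -
  let ?h = "\<lambda>i t. if i = k then f t else if i = l then g t else 1"
  have pr: "(\<Prod>i<R. H i) = H k * (H l * (\<Prod>i\<in>{..<R} - {k} - {l}. H i))" for H :: "nat \<Rightarrow> real"
    using assms by (subst prod.remove[of _ k], simp, simp, subst prod.remove[of _ l]) auto
  have "(\<Sum>s\<in>PiE {..<R} (\<lambda>_. P). f (s k) * g (s l)) = (\<Sum>s\<in>PiE {..<R} (\<lambda>_. P). \<Prod>i<R. ?h i (s i))"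
  proof (intro sum.cong refl)
    fix s
    have "(\<Prod>i\<in>{..<R} - {k} - {l}. ?h i (s i)) = 1" by (intro prod.neutral) auto
    then show "f (s k) * g (s l) = (\<Prod>i<R. ?h i (s i))" using assms by (simp add: pr)
  qed
  also have "\<dots> = (\<Prod>i<R. \<Sum>t\<in>P. ?h i t)"
    using assms by (intro prod_sum_PiE[symmetric]) auto
  also have "\<dots> = (\<Sum>t\<in>P. f t) * ((\<Sum>t\<in>P. g t) * (\<Prod>i\<in>{..<R} - {k} - {l}. \<Sum>t\<in>P. ?h i t))"
    using assms by (simp add: pr)
  also have "(\<Prod>i\<in>{..<R} - {k} - {l}. \<Sum>t\<in>P. ?h i t) = (\<Prod>i\<in>{..<R} - {k} - {l}. real (card P))"
    by (intro prod.cong) auto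
  also have "\<dots> = real (card P) ^ (R - 2)"
    using assms by (simp add: card_Diff_subset numeral_2_eq_2)
  finally show ?thesis by (simp add: mult_ac)
qed

text \<open>A sample mostly hits the small set \<open>T\<close> at most once, so that on average its maximum sees at least half of the
  sum over \<open>T\<close>. In Bonferroni's form: if \<open>h\<close> points of the sample lie in \<open>T\<close>, the sum of \<open>f\<close> over them times \<open>2 - h\<close> is
  at most the maximum, and the mean of this quantity involves only pairs of points.\<close>

lemma sample_max_ge:
  fixes f :: "'a \<Rightarrow> real"
  assumes P: "finite P" "T \<subseteq> P" and f: "\<And>t. t \<in> P \<Longrightarrow> 0 \<le> f t"
    and R: "0 < R" and small: "2 * real R * real (card T) \<le> real (card P)"
    and m: "\<And>s k. \<lbrakk>s \<in> PiE {..<R} (\<lambda>_. P); k < R\<rbrakk> \<Longrightarrow> f (s k) \<le> m s"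
  shows "real R * real (card P) ^ (R - 1) * (\<Sum>t\<in>T. f t) \<le> 2 * (\<Sum>s\<in>PiE {..<R} (\<lambda>_. P). m s)"
proof -
  let ?E = "PiE {..<R} (\<lambda>_. P)"
  define u where "u = (\<lambda>t. if t \<in> T then 1 else 0 :: real)"
  define F where "F = (\<lambda>t. f t * u t)"
  have F0: "0 \<le> F t" if "t \<in> P" for t using f[OF that] by (simp add: F_def u_def)
  have sumF: "(\<Sum>t\<in>P. F t) = (\<Sum>t\<in>T. f t)"
    unfolding F_def u_def using P by (simp add: sum.inter_restrict[symmetric] Int_absorb1 if_distrib cong: if_cong)
  have sumu: "(\<Sum>t\<in>P. u t) = real (card T)"
    unfolding u_def using P by (simp add: sum.inter_restrict[symmetric] Int_absorb1)
  have pt: "(\<Sum>k<R. F (s k) - (\<Sum>l\<in>{..<R} - {k}. F (s k) * u (s l))) \<le> m s" if s: "s \<in> ?E" for s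
  proof -
    have sP: "s k \<in> P" if "k < R" for k using s that by auto
    have m0: "0 \<le> m s" using f[OF sP[OF R]] m[OF s R] by simp
    define H where "H = {k\<in>{..<R}. s k \<in> T}"
    have fH: "finite H" by (simp add: H_def)
    have summand: "F (s k) - (\<Sum>l\<in>{..<R} - {k}. F (s k) * u (s l)) = (if k \<in> H then f (s k) * (2 - real (card H)) else 0)"
      if k: "k < R" for k
    proof (cases "k \<in> H")
      case True
      have "(\<Sum>l\<in>{..<R} - {k}. u (s l)) = real (card (H - {k}))"
        unfolding u_def by (subst sum.inter_filter[symmetric]) (auto simp: H_def intro!: arg_cong[where f = card])
      also have "\<dots> = real (card H) - 1"
        using True fH by (simp add: card_Diff_singleton card_gt_0_iff of_nat_diff Suc_leI) (metis card_gt_0_iff empty_iff of_nat_1 of_nat_diff Suc_leI One_nat_def)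
      finally have "(\<Sum>l\<in>{..<R} - {k}. F (s k) * u (s l)) = F (s k) * (real (card H) - 1)"
        by (simp flip: sum_distrib_left)
      then show ?thesis using True by (simp add: F_def u_def H_def algebra_simps)
    next
      case False
      then have "F (s k) = 0" using k by (simp add: F_def u_def H_def)
      then show ?thesis using False by simp
    qed
    have "(\<Sum>k<R. F (s k) - (\<Sum>l\<in>{..<R} - {k}. F (s k) * u (s l)))
        = (\<Sum>k<R. if k \<in> H then f (s k) * (2 - real (card H)) else 0)"
      by (intro sum.cong refl) (use summand in auto)
    also have "\<dots> = (\<Sum>k\<in>H. f (s k)) * (2 - real (card H))"
      unfolding sum_distrib_right by (subst sum.inter_restrict[symmetric]) (auto simp: H_def intro!: sum.cong)
    also have "\<dots> \<le> m s"
    proof -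
      consider "card H = 0" | "card H = 1" | "card H \<ge> 2" by linarith
      then show ?thesis
      proof cases
        case 1
        then show ?thesis using m0 fH by simp
      next
        case 2
        then obtain k where "H = {k}" by (auto simp: card_1_singleton_iff)
        then show ?thesis using m[OF s, of k] by (auto simp: H_def)
      next
        case 3
        have "0 \<le> (\<Sum>k\<in>H. f (s k))" using f sP by (intro sum_nonneg) (auto simp: H_def)
        then have "(\<Sum>k\<in>H. f (s k)) * (2 - real (card H)) \<le> 0" using 3 by (intro mult_nonneg_nonpos) auto
        then show ?thesis using m0 by simp
      qed
    qed
    finally show ?thesis .
  qed
  let ?n = "real (card P)" and ?S = "\<Sum>t\<in>T. f t"
  have S0: "0 \<le> ?S" using f P by (intro sum_nonneg) auto
  have "(\<Sum>s\<in>?E. \<Sum>k<R. F (s k) - (\<Sum>l\<in>{..<R} - {k}. F (s k) * u (s l)))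
      = (\<Sum>k<R. (\<Sum>s\<in>?E. F (s k)) - (\<Sum>l\<in>{..<R} - {k}. \<Sum>s\<in>?E. F (s k) * u (s l)))"
    by (subst sum.swap, rule sum.cong[OF refl], simp only: sum_subtractf, subst sum.swap, rule refl)
  also have "\<dots> = (\<Sum>k<R. ?n ^ (R - 1) * ?S - (\<Sum>l\<in>{..<R} - {k}. ?n ^ (R - 2) * (?S * real (card T))))"
    using P by (intro sum.cong refl arg_cong2[where f = minus]) (auto simp: sum_PiE_single sum_PiE_pair sumF sumu)
  also have "\<dots> = real R * (?n ^ (R - 1) * ?S - real (R - 1) * (?n ^ (R - 2) * (?S * real (card T))))"
    using R by (simp add: of_nat_diff)
  finally have eq: "(\<Sum>s\<in>?E. \<Sum>k<R. F (s k) - (\<Sum>l\<in>{..<R} - {k}. F (s k) * u (s l)))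
      = real R * (?n ^ (R - 1) * ?S - real (R - 1) * (?n ^ (R - 2) * (?S * real (card T))))" .
  have half: "real (R - 1) * (?n ^ (R - 2) * (?S * real (card T))) \<le> ?n ^ (R - 1) * ?S / 2"
  proof (cases "R = 1")
    case True
    then show ?thesis using S0 by simp
  next
    case False
    then have pow: "?n ^ (R - 1) = ?n ^ (R - 2) * ?n"
      using R by (simp add: power_Suc2[symmetric] Suc_diff_Suc numeral_2_eq_2)
    have "2 * (real (R - 1) * real (card T)) \<le> ?n"
      using small mult_right_mono[of "real (R - 1)" "real R" "real (card T)"] by simp
    then have "(?n ^ (R - 2) * ?S) * (2 * (real (R - 1) * real (card T))) \<le> (?n ^ (R - 2) * ?S) * ?n"
      using S0 by (intro mult_left_mono) auto
    moreover have "(?n ^ (R - 2) * ?S) * (2 * (real (R - 1) * real (card T)))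
        = 2 * (real (R - 1) * (?n ^ (R - 2) * (?S * real (card T))))"
      by (simp only: mult_ac)
    moreover have "(?n ^ (R - 2) * ?S) * ?n = ?n ^ (R - 1) * ?S"
      unfolding pow by (simp only: mult_ac)
    ultimately show ?thesis by linarith
  qed
  have "real R * (?n ^ (R - 1) * ?S / 2) \<le> (\<Sum>s\<in>?E. \<Sum>k<R. F (s k) - (\<Sum>l\<in>{..<R} - {k}. F (s k) * u (s l)))"
    unfolding eq using half by (intro mult_left_mono) linarith+
  also have "\<dots> \<le> (\<Sum>s\<in>?E. m s)" by (intro sum_mono pt)
  finally show ?thesis by simp
qed

context operator_matrix
begin

text \<open>Sets of relative size \<open>2 powr (- r - 1)\<close>, chosen separately for each entry, carry little of the mass of the
  matrix, however many points there are. A sample of \<open>2 ^ r\<close> points sees half of that mass as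
  maxima, by \<open>sample_max_ge\<close>, and \<open>selected_values_le_set\<close> bounds what a sample can see.\<close>

lemma small_sets_mass_le:
  assumes w: "weight y D" and P: "finite P" "P \<noteq> {}"
    and T: "\<And>\<kappa> l. T \<kappa> l \<subseteq> P" "\<And>\<kappa> l. 2 * 2 ^ r * real (card (T \<kappa> l)) \<le> real (card P)"
  shows "(\<Sum>\<kappa>\<in>I. \<Sum>l<\<kappa>. y \<kappa> * (\<Sum>t\<in>T \<kappa> l. norm (a \<kappa> l t))) / card P \<le> 2 * C * D * chain_const r / 2 ^ r"
proof -
  define R :: nat where "R = 2 ^ r"
  have R: "0 < R" by (simp add: R_def)
  let ?E = "PiE {..<R} (\<lambda>_. P)"
  have y0: "0 \<le> y \<kappa>" if "\<kappa> \<in> I" for \<kappa> using w that by (auto simp: weight_def)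
  define m where "m = (\<lambda>s \<kappa> l. Max ((\<lambda>k. norm (a \<kappa> l (s k))) ` {..<R}))"
  have m: "(\<Sum>\<kappa>\<in>I. \<Sum>l<\<kappa>. y \<kappa> * m s \<kappa> l) \<le> C * D * chain_const r" for s
  proof -
    have "\<exists>k<R. m s \<kappa> l = norm (a \<kappa> l (s k))" for \<kappa> l
    proof -
      have "m s \<kappa> l \<in> (\<lambda>k. norm (a \<kappa> l (s k))) ` {..<R}"
        unfolding m_def using R by (intro Max_in) auto
      then show ?thesis by auto
    qed
    then obtain k where k: "\<And>\<kappa> l. k \<kappa> l < R \<and> m s \<kappa> l = norm (a \<kappa> l (s (k \<kappa> l)))" by metis
    have "(\<Sum>\<kappa>\<in>I. \<Sum>l<\<kappa>. y \<kappa> * norm (a \<kappa> l (s (k \<kappa> l)))) \<le> C * D * chain_const r"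
    proof (rule selected_values_le_set[OF w])
      show "card (s ` {..<R}) \<le> 2 ^ r" using card_image_le[of "{..<R}" s] by (simp add: R_def)
    qed (use k in auto)
    then show ?thesis using k by simp
  qed
  have lower: "real R * real (card P) ^ (R - 1) * (\<Sum>t\<in>T \<kappa> l. norm (a \<kappa> l t)) \<le> 2 * (\<Sum>s\<in>?E. m s \<kappa> l)" for \<kappa> l
    using T[of \<kappa> l] P R by (intro sample_max_ge) (auto simp: R_def m_def intro!: Max_ge)
  have "real R * real (card P) ^ (R - 1) * (\<Sum>\<kappa>\<in>I. \<Sum>l<\<kappa>. y \<kappa> * (\<Sum>t\<in>T \<kappa> l. norm (a \<kappa> l t)))
      = (\<Sum>\<kappa>\<in>I. \<Sum>l<\<kappa>. y \<kappa> * (real R * real (card P) ^ (R - 1) * (\<Sum>t\<in>T \<kappa> l. norm (a \<kappa> l t))))"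
    by (simp add: sum_distrib_left mult_ac)
  also have "\<dots> \<le> (\<Sum>\<kappa>\<in>I. \<Sum>l<\<kappa>. y \<kappa> * (2 * (\<Sum>s\<in>?E. m s \<kappa> l)))"
    by (intro sum_mono mult_left_mono lower y0)
  also have "\<dots> = 2 * (\<Sum>s\<in>?E. \<Sum>\<kappa>\<in>I. \<Sum>l<\<kappa>. y \<kappa> * m s \<kappa> l)"
  proof -
    have "(\<Sum>s\<in>?E. \<Sum>\<kappa>\<in>I. \<Sum>l<\<kappa>. y \<kappa> * m s \<kappa> l) = (\<Sum>\<kappa>\<in>I. \<Sum>l<\<kappa>. \<Sum>s\<in>?E. y \<kappa> * m s \<kappa> l)"
      by (subst sum.swap, rule sum.cong[OF refl], rule sum.swap)
    then show ?thesis by (simp add: sum_distrib_left mult_ac)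
  qed
  also have "\<dots> \<le> 2 * (\<Sum>s\<in>?E. C * D * chain_const r)"
    by (intro mult_left_mono sum_mono m) auto
  also have "\<dots> = 2 * (real (card P) ^ R * (C * D * chain_const r))"
    by (simp add: card_PiE)
  also have "real (card P) ^ R = real (card P) ^ (R - 1) * real (card P)"
    using R by (simp add: power_Suc2[symmetric])
  finally have "real (card P) ^ (R - 1) * (real R * (\<Sum>\<kappa>\<in>I. \<Sum>l<\<kappa>. y \<kappa> * (\<Sum>t\<in>T \<kappa> l. norm (a \<kappa> l t))))
      \<le> real (card P) ^ (R - 1) * (2 * real (card P) * (C * D * chain_const r))"
    by (simp add: mult_ac)
  moreover have cp: "0 < real (card P)" using P by (simp add: card_gt_0_iff)
  ultimately have "real R * (\<Sum>\<kappa>\<in>I. \<Sum>l<\<kappa>. y \<kappa> * (\<Sum>t\<in>T \<kappa> l. norm (a \<kappa> l t)))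
      \<le> 2 * real (card P) * (C * D * chain_const r)"
    by (simp add: mult_le_cancel_left)
  then show ?thesis using cp R by (simp add: R_def field_simps)
qed

end

section \<open>Dyadic averages\<close>

text \<open>The mean of \<open>f\<close> over the left end points of the \<open>2 ^ d\<close> intervals of length \<open>2 ^ h\<close> into which the interval of
  length \<open>2 ^ (h + d)\<close> starting at \<open>s\<close> is divided.\<close>

definition dmean :: "nat \<Rightarrow> nat \<Rightarrow> nat \<Rightarrow> (nat \<Rightarrow> 'v) \<Rightarrow> 'v::real_vector" where
  "dmean h d s f = (\<Sum>j<2 ^ d. f (s + j * 2 ^ h)) /\<^sub>R 2 ^ d"

lemma dyadic_point_bounds:
  fixes s h d j :: nat
  assumes "j < 2 ^ d"
  shows "s + j * 2 ^ h + 2 ^ h \<le> s + 2 ^ (h + d)"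
proof -
  have "(j + 1) * 2 ^ h \<le> 2 ^ d * (2 ^ h :: nat)" using assms by (intro mult_right_mono) auto
  then show ?thesis by (simp add: power_add algebra_simps)
qed

lemma dmean_mono:
  fixes f g :: "nat \<Rightarrow> real"
  assumes "\<And>t. \<lbrakk>s \<le> t; t + 2 ^ h \<le> s + 2 ^ (h + d)\<rbrakk> \<Longrightarrow> f t \<le> g t"
  shows "dmean h d s f \<le> dmean h d s g"
  unfolding dmean_def using assms dyadic_point_bounds[of _ d s h]
  by (intro scaleR_left_mono sum_mono) auto

lemma dmean_add: "dmean h d s (\<lambda>t. f t + g t) = dmean h d s f + dmean h d s g"
  by (simp add: dmean_def sum.distrib scaleR_add_right)

lemma dmean_diff: "dmean h d s (\<lambda>t. f t - g t) = dmean h d s f - dmean h d s g"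
  by (simp add: dmean_def sum_subtractf scaleR_diff_right)

lemma dmean_const: "dmean h d s (\<lambda>_. c) = c"
  by (simp add: dmean_def sum_constant_scaleR)

lemma dmean_sum: "dmean h d s (\<lambda>t. \<Sum>i\<in>A. f i t) = (\<Sum>i\<in>A. dmean h d s (f i))"
proof -
  have "(\<Sum>j<2 ^ d. \<Sum>i\<in>A. f i (s + j * 2 ^ h)) = (\<Sum>i\<in>A. \<Sum>j<2 ^ d. f i (s + j * 2 ^ h))"
    by (rule sum.swap)
  then show ?thesis by (simp add: dmean_def scaleR_sum_right)
qed

lemma dmean_mult:
  fixes f :: "nat \<Rightarrow> 'v::real_normed_algebra"
  shows "dmean h d s (\<lambda>t. c * f t) = c * dmean h d s f"
  by (simp add: dmean_def sum_distrib_left)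

lemma dmean_nonneg: "(\<And>t. 0 \<le> f t) \<Longrightarrow> 0 \<le> (dmean h d s f :: real)"
  by (simp add: dmean_def sum_nonneg)

lemma norm_dmean: "norm (dmean h d s f) \<le> dmean h d s (\<lambda>t. norm (f t))"
  by (simp add: dmean_def divide_right_mono norm_sum divide_inverse mult.commute mult_left_mono)

lemma dmean_0: "dmean h 0 s f = f s"
  by (simp add: dmean_def)

lemma dmean_1: "dmean h 1 s f = (f s + f (s + 2 ^ h)) /\<^sub>R 2"
  by (simp add: dmean_def numeral_2_eq_2)

lemma dmean_tower: "dmean h (d + e) s f = dmean (h + d) e s (\<lambda>s'. dmean h d s' f)"
proof -
  have "(\<Sum>j<2 ^ (d + e). f (s + j * 2 ^ h)) = (\<Sum>i<2 ^ e. sum (\<lambda>j. f (s + j * 2 ^ h)) {i * 2 ^ d..<i * 2 ^ d + 2 ^ d})"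
    by (subst sum.nat_group) (simp add: power_add mult.commute)
  also have "\<dots> = (\<Sum>i<2 ^ e. \<Sum>j<2 ^ d. f (s + i * 2 ^ (h + d) + j * 2 ^ h))"
  proof (rule sum.cong[OF refl])
    fix i
    show "sum (\<lambda>j. f (s + j * 2 ^ h)) {i * 2 ^ d..<i * 2 ^ d + 2 ^ d}
        = (\<Sum>j<2 ^ d. f (s + i * 2 ^ (h + d) + j * 2 ^ h))"
      by (rule sum.reindex_bij_witness[of _ "\<lambda>j. j + i * 2 ^ d" "\<lambda>j. j - i * 2 ^ d"])
        (auto simp: power_add algebra_simps)
  qed
  finally have eq: "(\<Sum>j<2 ^ (d + e). f (s + j * 2 ^ h)) = (\<Sum>i<2 ^ e. \<Sum>j<2 ^ d. f (s + i * 2 ^ (h + d) + j * 2 ^ h))" .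
  have "inverse (2 ^ (d + e)) = inverse (2 ^ e) * inverse (2 ^ d :: real)"
    by (simp add: power_add)
  then show ?thesis
    by (simp only: dmean_def eq scaleR_sum_right[symmetric] scaleR_scaleR[symmetric])
qed

text \<open>The conditional expectation of \<open>f\<close> on the dyadic interval of length \<open>2 ^ h\<close> starting at \<open>s\<close>; \<open>halfdiff\<close> is
  twice the corresponding martingale difference, and meaningful for \<open>h \<ge> 1\<close>.\<close>

abbreviation avg :: "nat \<Rightarrow> nat \<Rightarrow> (nat \<Rightarrow> 'v::real_vector) \<Rightarrow> 'v" where
  "avg h s f \<equiv> dmean 0 h s f"

definition halfdiff :: "nat \<Rightarrow> nat \<Rightarrow> (nat \<Rightarrow> 'v::real_vector) \<Rightarrow> 'v" where
  "halfdiff h s f = avg (h - 1) s f - avg (h - 1) (s + 2 ^ (h - 1)) f"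

lemma avg_halves:
  assumes "1 \<le> h"
  shows "avg h s f = (avg (h - 1) s f + avg (h - 1) (s + 2 ^ (h - 1)) f) /\<^sub>R 2"
  using dmean_tower[of 0 "h - 1" 1 s f] assms by (simp add: dmean_1[simplified])

lemma norm_halfdiff_le:
  assumes "1 \<le> h"
  shows "norm (halfdiff h s f) \<le> 2 * avg h s (\<lambda>t. norm (f t))"
proof -
  have "norm (halfdiff h s f) \<le> norm (avg (h - 1) s f) + norm (avg (h - 1) (s + 2 ^ (h - 1)) f)"
    unfolding halfdiff_def by (rule norm_triangle_ineq4)
  also have "\<dots> \<le> avg (h - 1) s (\<lambda>t. norm (f t)) + avg (h - 1) (s + 2 ^ (h - 1)) (\<lambda>t. norm (f t))"
    by (intro add_mono norm_dmean)
  also have "\<dots> = 2 * avg h s (\<lambda>t. norm (f t))" by (simp add: avg_halves[OF assms])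
  finally show ?thesis .
qed

text \<open>Here \<open>u h t\<close> is a quantity attached to the interval of length \<open>2 ^ h\<close> starting at \<open>t\<close>. It is averaged over a
  window: the \<open>m\<close> coarsest dyadic generations of subintervals of the interval of length \<open>2 ^ H\<close> starting at \<open>s\<close>.\<close>

definition wmean :: "nat \<Rightarrow> nat \<Rightarrow> nat \<Rightarrow> (nat \<Rightarrow> nat \<Rightarrow> real) \<Rightarrow> real" where
  "wmean m H s u = (\<Sum>i<m. dmean (H - i) i s (u (H - i))) / m"

lemma wmean_mono:
  assumes "m \<le> H"
    and "\<And>h t. \<lbrakk>1 \<le> h; h \<le> H; H - m \<le> h; s \<le> t; t + 2 ^ h \<le> s + 2 ^ H\<rbrakk> \<Longrightarrow> u h t \<le> v h t"
  shows "wmean m H s u \<le> wmean m H s v"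
  unfolding wmean_def
proof (intro divide_right_mono sum_mono dmean_mono)
  fix i t assume "i \<in> {..<m}" "s \<le> t" "t + 2 ^ (H - i) \<le> s + 2 ^ (H - i + i)"
  then show "u (H - i) t \<le> v (H - i) t" using assms(1) by (intro assms(2)) auto
qed auto

lemma wmean_add: "wmean m H s (\<lambda>h t. u h t + v h t) = wmean m H s u + wmean m H s v"
  by (simp add: wmean_def dmean_add sum.distrib add_divide_distrib)

lemma wmean_mult: "wmean m H s (\<lambda>h t. c * u h t) = c * wmean m H s u"
  by (simp add: wmean_def dmean_mult flip: sum_distrib_left)

lemma wmean_sum: "wmean m H s (\<lambda>h t. \<Sum>i\<in>A. u i h t) = (\<Sum>i\<in>A. wmean m H s (u i))"
proof -
  have "(\<Sum>j<m. \<Sum>i\<in>A. dmean (H - j) j s (u i (H - j))) = (\<Sum>i\<in>A. \<Sum>j<m. dmean (H - j) j s (u i (H - j)))"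
    by (rule sum.swap)
  then show ?thesis by (simp add: wmean_def dmean_sum sum_divide_distrib)
qed

lemma wmean_const: "0 < m \<Longrightarrow> wmean m H s (\<lambda>_ _. c) = c"
  by (simp add: wmean_def dmean_const)

lemma wmean_avg:
  assumes "0 < m" "m \<le> H"
  shows "wmean m H s (\<lambda>h t. avg h t f) = avg H s f"
proof -
  have "dmean (H - i) i s (\<lambda>t. avg (H - i) t f) = avg H s f" if "i < m" for i
    using dmean_tower[of 0 "H - i" i s f] that assms by simp
  then show ?thesis using assms by (simp add: wmean_def)
qed

text \<open>Orthogonality of martingale differences; each step is the parallelogram law.\<close>

lemma halfdiff_energy:
  fixes f :: "nat \<Rightarrow> 'v::real_inner"
  assumes "m \<le> H"
  shows "(\<Sum>i<m. dmean (H - i) i s (\<lambda>t. (norm (halfdiff (H - i) t f))\<^sup>2))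
    = 4 * (dmean (H - m) m s (\<lambda>t. (norm (avg (H - m) t f))\<^sup>2) - (norm (avg H s f))\<^sup>2)"
  using assms
proof (induction m)
  case 0
  then show ?case by (simp add: dmean_0)
next
  case (Suc m)
  define h where "h = H - m"
  have h: "1 \<le> h" "H - Suc m = h - 1" using Suc.prems by (auto simp: h_def)
  have par: "dmean (h - 1) 1 t (\<lambda>t. (norm (avg (h - 1) t f))\<^sup>2) = (norm (avg h t f))\<^sup>2 + (norm (halfdiff h t f))\<^sup>2 / 4" for t
  proof -
    let ?x = "avg (h - 1) t f" and ?y = "avg (h - 1) (t + 2 ^ (h - 1)) f"
    have e1: "(norm (avg h t f))\<^sup>2 = (norm (?x + ?y))\<^sup>2 / 4"
      by (simp add: avg_halves[OF h(1)] power2_eq_square)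
    have e2: "(norm (?x + ?y))\<^sup>2 + (norm (?x - ?y))\<^sup>2 = 2 * (norm ?x)\<^sup>2 + 2 * (norm ?y)\<^sup>2"
      by (simp add: power2_norm_eq_inner inner_add inner_diff inner_commute)
    have e3: "dmean (h - 1) 1 t (\<lambda>t. (norm (avg (h - 1) t f))\<^sup>2) = ((norm ?x)\<^sup>2 + (norm ?y)\<^sup>2) / 2"
      by (simp only: dmean_1 real_scaleR_def divide_inverse mult.commute)
    have aux: "D = N + M / 4" if "N = P / 4" "P + M = 2 * a + 2 * b" "D = (a + b) / 2" for D N P M a b :: real
      using that by (simp add: field_simps)
    show ?thesis unfolding halfdiff_def by (rule aux[OF e1 e2 e3])
  qed
  have "dmean (h - 1) (Suc m) s (\<lambda>t. (norm (avg (h - 1) t f))\<^sup>2)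
      = dmean h m s (\<lambda>t. dmean (h - 1) 1 t (\<lambda>t. (norm (avg (h - 1) t f))\<^sup>2))"
    using dmean_tower[of "h - 1" 1 m s "\<lambda>t. (norm (avg (h - 1) t f))\<^sup>2"] h by simp
  also have "\<dots> = dmean h m s (\<lambda>t. (norm (avg h t f))\<^sup>2) + dmean h m s (\<lambda>t. (norm (halfdiff h t f))\<^sup>2) / 4"
    unfolding par dmean_add using dmean_mult[of h m s "1/4" "\<lambda>t. (norm (halfdiff h t f))\<^sup>2"] by simp
  finally have step: "dmean (h - 1) (Suc m) s (\<lambda>t. (norm (avg (h - 1) t f))\<^sup>2)
      = dmean h m s (\<lambda>t. (norm (avg h t f))\<^sup>2) + dmean h m s (\<lambda>t. (norm (halfdiff h t f))\<^sup>2) / 4" .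
  have IH: "(\<Sum>i<m. dmean (H - i) i s (\<lambda>t. (norm (halfdiff (H - i) t f))\<^sup>2))
      = 4 * (dmean h m s (\<lambda>t. (norm (avg h t f))\<^sup>2) - (norm (avg H s f))\<^sup>2)"
    using Suc unfolding h_def by simp
  show ?case
    unfolding sum.lessThan_Suc IH h(2) step h_def[symmetric] by (simp add: algebra_simps)
qed

text \<open>The squares of the differences add up to at most \<open>4 * B\<^sup>2\<close> over all \<open>m\<close> generations, so that their mean is
  at most \<open>4 * B\<^sup>2 / m\<close>; then apply the Cauchy-Schwarz inequality in the form \<open>2 * \<alpha> * v \<le> v\<^sup>2 + \<alpha>\<^sup>2\<close>.\<close>

lemma wmean_halfdiff_le:
  fixes f :: "nat \<Rightarrow> 'v::real_inner"
  assumes m: "0 < m" "m \<le> H" and f: "\<And>t. norm (f t) \<le> B"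
  shows "wmean m H s (\<lambda>h t. norm (halfdiff h t f)) \<le> 2 * B / sqrt m"
proof -
  have B0: "0 \<le> B" using order_trans[OF norm_ge_zero f] .
  have aB: "(norm (avg h t f))\<^sup>2 \<le> B\<^sup>2" for h t
  proof (rule power_mono)
    have "norm (avg h t f) \<le> avg h t (\<lambda>t. norm (f t))" by (rule norm_dmean)
    also have "\<dots> \<le> avg h t (\<lambda>_. B)" by (intro dmean_mono f)
    finally show "norm (avg h t f) \<le> B" by (simp add: dmean_const)
  qed simp
  have "(\<Sum>i<m. dmean (H - i) i s (\<lambda>t. (norm (halfdiff (H - i) t f))\<^sup>2))
      \<le> 4 * dmean (H - m) m s (\<lambda>t. (norm (avg (H - m) t f))\<^sup>2)"
    unfolding halfdiff_energy[OF m(2)] by simp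
  also have "\<dots> \<le> 4 * dmean (H - m) m s (\<lambda>_. B\<^sup>2)" by (intro mult_left_mono dmean_mono aB) auto
  finally have sq: "wmean m H s (\<lambda>h t. (norm (halfdiff h t f))\<^sup>2) \<le> 4 * B\<^sup>2 / m"
    using m by (simp add: wmean_def dmean_const divide_right_mono)
  show ?thesis
  proof (cases "B = 0")
    case True
    then have f0: "f t = 0" for t using f[of t] by simp
    have "halfdiff h t f = 0" for h t
      by (simp add: halfdiff_def dmean_def f0)
    then show ?thesis using True m by (simp add: wmean_const)
  next
    case False
    define \<alpha> where "\<alpha> = 2 * B / sqrt m"
    have \<alpha>: "0 < \<alpha>" using False B0 m by (simp add: \<alpha>_def)
    have "wmean m H s (\<lambda>h t. norm (halfdiff h t f))
        \<le> wmean m H s (\<lambda>h t. 1 / (2 * \<alpha>) * (norm (halfdiff h t f))\<^sup>2 + \<alpha> / 2)"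
    proof (rule wmean_mono[OF m(2)])
      fix h t
      have "0 \<le> (norm (halfdiff h t f) - \<alpha>)\<^sup>2" by simp
      then show "norm (halfdiff h t f) \<le> 1 / (2 * \<alpha>) * (norm (halfdiff h t f))\<^sup>2 + \<alpha> / 2"
        using \<alpha> by (simp add: power2_eq_square field_simps)
    qed
    also have "\<dots> = 1 / (2 * \<alpha>) * wmean m H s (\<lambda>h t. (norm (halfdiff h t f))\<^sup>2) + \<alpha> / 2"
      using m by (simp only: wmean_add wmean_mult wmean_const)
    also have "\<dots> \<le> 1 / (2 * \<alpha>) * (4 * B\<^sup>2 / m) + \<alpha> / 2"
      using sq \<alpha> by (intro add_mono mult_left_mono) auto
    also have "4 * B\<^sup>2 / m = \<alpha> * \<alpha>"
      using m by (simp add: \<alpha>_def power2_eq_square)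
    also have "1 / (2 * \<alpha>) * (\<alpha> * \<alpha>) + \<alpha> / 2 = \<alpha>" using \<alpha> by simp
    finally show ?thesis by (simp add: \<alpha>_def)
  qed
qed

section \<open>The summing basis does not factor through sums of \<open>\<ell>\<^sub>\<infinity>\<close>-spaces\<close>

context james_setting
begin

text \<open>The graph of \<open>x powr q\<close> lies above its tangent at \<open>X\<close>, by Young's inequality.\<close>

lemma powr_tangent:
  fixes x X :: real
  assumes "0 \<le> x" "0 \<le> X"
  shows "X powr q + q * X powr (q - 1) * (x - X) \<le> x powr q"
proof -
  have "x * X powr (q - 1) \<le> x powr q / q + (X powr (q - 1)) powr p / p"
    using assms p1 q1 pq by (intro Youngs_inequality) auto
  then have "q * (x * X powr (q - 1)) \<le> q * (x powr q / q + X powr q / p)"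
    using q1 by (intro mult_left_mono) (auto simp: powr_powr pq')
  also have "\<dots> = x powr q + (q - 1) * X powr q"
  proof -
    have "q * (X powr q / p) = q / p * X powr q" by simp
    then show ?thesis using q1 unfolding qp by (simp add: distrib_left)
  qed
  finally show ?thesis
    using assms powr_mult_base[of X "q - 1"] by (simp add: algebra_simps)
qed

text \<open>The factor beyond which \<open>x powr q\<close> is at least twice the linear term of the tangent.\<close>

definition jump :: real where "jump = (2 * q) powr (1 / (q - 1))"

lemma jump_powr: "jump powr (q - 1) = 2 * q"
  using q1 by (simp add: jump_def powr_powr)

lemma jump_pos: "0 < jump"
  using q1 by (simp add: jump_def)

lemma powr_tangent_jump:
  fixes x X :: real
  assumes "0 \<le> x" "0 \<le> X"
  shows "X powr q + q * X powr (q - 1) * (x - X) + (if jump * X < x then x powr q else 0) / 2 \<le> x powr q"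
proof (cases "jump * X < x")
  case False
  then show ?thesis using powr_tangent[OF assms] by simp
next
  case True
  have "jump powr (q - 1) * X powr (q - 1) \<le> x powr (q - 1)"
    using True assms q1 jump_pos by (subst powr_mult[symmetric]) (auto intro!: powr_mono2)
  then have "2 * q * X powr (q - 1) * x \<le> x powr (q - 1) * x"
    using assms by (intro mult_right_mono) (auto simp: jump_powr)
  also have "\<dots> = x powr q" using assms powr_mult_base[of x "q - 1"] by (simp add: mult.commute)
  finally have 1: "2 * (q * X powr (q - 1) * x) \<le> x powr q" by (simp add: mult_ac)
  have "q * X powr (q - 1) * X = q * X powr q"
    using assms powr_mult_base[of X "q - 1"] by (simp add: mult_ac)
  moreover have "X powr q \<le> q * X powr q" using q1 mult_right_mono[of 1 q "X powr q"] by simp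
  moreover have "(if jump * X < x then x powr q else 0) = x powr q" using True by simp
  ultimately show ?thesis using 1 unfolding right_diff_distrib by linarith
qed

text \<open>Values that exceed the mean by the factor \<open>jump\<close> contribute half of their \<open>q\<close>-th powers to the defect in
  Jensen's inequality.\<close>

lemma jensen_jump:
  fixes f :: "nat \<Rightarrow> real"
  assumes f: "\<And>t. 0 \<le> f t"
  shows "(dmean h d s f) powr q + dmean h d s (\<lambda>t. if jump * dmean h d s f < f t then f t powr q else 0) / 2
    \<le> dmean h d s (\<lambda>t. f t powr q)"
proof -
  define X where "X = dmean h d s f"
  have X: "0 \<le> X" unfolding X_def by (rule dmean_nonneg[OF f])
  have "dmean h d s (\<lambda>t. (X powr q + q * X powr (q - 1) * (f t - X)) + 1 / 2 * (if jump * X < f t then f t powr q else 0))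
      \<le> dmean h d s (\<lambda>t. f t powr q)"
    using powr_tangent_jump[OF f X] by (intro dmean_mono) simp
  then show ?thesis
    unfolding dmean_add dmean_const dmean_mult dmean_diff by (simp add: X_def)
qed

end

context operator_matrix
begin

definition xbar :: "nat \<Rightarrow> nat \<Rightarrow> nat \<Rightarrow> real" where
  "xbar h s \<kappa> = avg h s (\<lambda>t. profile t \<kappa>)"

text \<open>By Jensen's inequality the mean energy grows from coarse to fine generations, and it is bounded by
  \<open>C powr q\<close>. So in most windows it hardly changes.\<close>

definition energy :: "nat \<Rightarrow> nat \<Rightarrow> real" where
  "energy h s = (\<Sum>\<kappa>\<in>I. xbar h s \<kappa> powr q)"

lemma xbar_nonneg: "0 \<le> xbar h s \<kappa>"
  unfolding xbar_def by (intro dmean_nonneg profile_nonneg)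

lemma xbar_tower: "xbar (h + d) s \<kappa> = dmean h d s (\<lambda>t. xbar h t \<kappa>)"
  unfolding xbar_def using dmean_tower[of 0 h d s] by simp

lemma energy_jump:
  "energy (h + d) s + dmean h d s (\<lambda>t. \<Sum>\<kappa>\<in>I. if jump * xbar (h + d) s \<kappa> < xbar h t \<kappa> then xbar h t \<kappa> powr q else 0) / 2
    \<le> dmean h d s (energy h)"
proof -
  have "(\<Sum>\<kappa>\<in>I. xbar (h + d) s \<kappa> powr q
      + dmean h d s (\<lambda>t. if jump * xbar (h + d) s \<kappa> < xbar h t \<kappa> then xbar h t \<kappa> powr q else 0) / 2)
      \<le> (\<Sum>\<kappa>\<in>I. dmean h d s (\<lambda>t. xbar h t \<kappa> powr q))"
    unfolding xbar_tower by (intro sum_mono jensen_jump xbar_nonneg)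
  then show ?thesis
    by (simp add: energy_def[abs_def] dmean_sum sum.distrib sum_divide_distrib)
qed

lemma energy_mono: "energy (h + d) s \<le> dmean h d s (energy h)"
proof -
  have "0 \<le> dmean h d s (\<lambda>t. \<Sum>\<kappa>\<in>I. if jump * xbar (h + d) s \<kappa> < xbar h t \<kappa> then xbar h t \<kappa> powr q else 0)"
    by (intro dmean_nonneg sum_nonneg) auto
  then show ?thesis using energy_jump[of h d s] by simp
qed

lemma energy_0_le: "energy 0 s \<le> C powr q"
  using profile_powr_le[of s] by (simp add: energy_def xbar_def dmean_0)

lemma energy_nonneg: "0 \<le> energy h s"
  unfolding energy_def by (intro sum_nonneg) auto

lemma energy_le: "energy h s \<le> C powr q"
proof -
  have "energy (0 + h) s \<le> dmean 0 h s (energy 0)" by (rule energy_mono)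
  also have "\<dots> \<le> dmean 0 h s (\<lambda>_. C powr q)" by (intro dmean_mono energy_0_le)
  finally show ?thesis by (simp add: dmean_const)
qed

lemma xbar_sum: "xbar h s \<kappa> = (\<Sum>l<\<kappa>. avg h s (\<lambda>t. norm (a \<kappa> l t)))"
  unfolding xbar_def profile_def by (rule dmean_sum)

text \<open>The norm, on the summand \<open>\<kappa>\<close>, of the difference between the mean rows over the two halves of an interval.\<close>

definition osc :: "nat \<Rightarrow> nat \<Rightarrow> nat \<Rightarrow> real" where
  "osc h s \<kappa> = (\<Sum>l<\<kappa>. norm (halfdiff h s (a \<kappa> l)))"

lemma osc_nonneg: "0 \<le> osc h s \<kappa>"
  by (simp add: osc_def sum_nonneg)

lemma osc_le: "1 \<le> h \<Longrightarrow> osc h s \<kappa> \<le> 2 * xbar h s \<kappa>"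
  unfolding osc_def xbar_sum sum_distrib_left by (intro sum_mono norm_halfdiff_le)

text \<open>In each column split off the points where the entry exceeds its mean over the window by the factor \<open>2 * 2 ^ r\<close>.
  They form a set of relative size \<open>2 powr (- r - 1)\<close>, whose mass is small by \<open>small_sets_mass_le\<close>; the
  bounded rest oscillates little on average by orthogonality. The weight is the one that is dual in \<open>\<ell>\<^sub>p\<close> to the
  mean profile of the window.\<close>

lemma wmean_osc_le:
  assumes m: "0 < m" "m \<le> H"
  shows "wmean m H s (\<lambda>h t. \<Sum>\<kappa>\<in>I. xbar H s \<kappa> powr (q - 1) * osc h t \<kappa>)
    \<le> 4 * C powr q * (2 ^ r / sqrt m + chain_const r / 2 ^ r)"
proof -
  define y where "y = (\<lambda>\<kappa>. xbar H s \<kappa> powr (q - 1))"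
  define A where "A = (\<lambda>\<kappa> l. avg H s (\<lambda>t. norm (a \<kappa> l t)))"
  define P where "P = {s..<s + 2 ^ H}"
  define T where "T = (\<lambda>\<kappa> l. {t\<in>P. 2 * 2 ^ r * A \<kappa> l < norm (a \<kappa> l t)})"
  define b where "b = (\<lambda>\<kappa> l t. if norm (a \<kappa> l t) \<le> 2 * 2 ^ r * A \<kappa> l then a \<kappa> l t else 0)"
  define b' where "b' = (\<lambda>\<kappa> l t. if norm (a \<kappa> l t) \<le> 2 * 2 ^ r * A \<kappa> l then 0 else a \<kappa> l t)"
  have A0: "0 \<le> A \<kappa> l" for \<kappa> l unfolding A_def by (intro dmean_nonneg) simp
  have y0: "0 \<le> y \<kappa>" for \<kappa> by (simp add: y_def)
  have cardP: "card P = 2 ^ H" by (simp add: P_def)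
  have avgP: "avg H s f = (\<Sum>t\<in>P. f t) / 2 ^ H" for f :: "nat \<Rightarrow> real"
  proof -
    have "(\<Sum>j<2 ^ H. f (s + j)) = (\<Sum>t\<in>P. f t)"
      unfolding P_def by (rule sum.reindex_bij_witness[of _ "\<lambda>t. t - s" "\<lambda>j. s + j"]) auto
    then show ?thesis by (simp add: dmean_def divide_inverse mult.commute)
  qed
  have weight: "weight y (C powr (q - 1))"
  proof -
    have "(\<Sum>\<kappa>\<in>I. y \<kappa> powr p) = energy H s" by (simp add: y_def powr_powr pq' energy_def)
    then show ?thesis using energy_le[of H s] by (simp add: weight_def y_def powr_powr pq')
  qed
  have smallT: "2 * 2 ^ r * real (card (T \<kappa> l)) \<le> real (card P)" for \<kappa> l
  proof (cases "A \<kappa> l = 0")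
    case True
    have "(\<Sum>t\<in>P. norm (a \<kappa> l t)) = 0" using True unfolding A_def avgP by simp
    then have "norm (a \<kappa> l t) = 0" if "t \<in> P" for t
      using that by (subst (asm) sum_nonneg_eq_0_iff) (auto simp: P_def)
    then have "T \<kappa> l = {}" using True by (auto simp: T_def)
    then show ?thesis by simp
  next
    case False
    then have Apos: "0 < A \<kappa> l" using A0[of \<kappa> l] by simp
    have "real (card (T \<kappa> l)) * (2 * 2 ^ r * A \<kappa> l) \<le> (\<Sum>t\<in>T \<kappa> l. norm (a \<kappa> l t))"
      using sum_mono[of "T \<kappa> l" "\<lambda>_. 2 * 2 ^ r * A \<kappa> l" "\<lambda>t. norm (a \<kappa> l t)"] by (auto simp: T_def)
    also have "\<dots> \<le> (\<Sum>t\<in>P. norm (a \<kappa> l t))"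
      by (intro sum_mono2) (auto simp: T_def P_def)
    also have "\<dots> = real (card P) * A \<kappa> l" by (simp add: A_def avgP cardP)
    finally have "A \<kappa> l * (2 * 2 ^ r * real (card (T \<kappa> l))) \<le> A \<kappa> l * real (card P)"
      by (simp add: mult_ac)
    then show ?thesis using Apos by simp
  qed
  have large: "(\<Sum>\<kappa>\<in>I. \<Sum>l<\<kappa>. y \<kappa> * avg H s (\<lambda>t. norm (b' \<kappa> l t))) \<le> 2 * C * C powr (q - 1) * chain_const r / 2 ^ r"
  proof -
    have "avg H s (\<lambda>t. norm (b' \<kappa> l t)) = (\<Sum>t\<in>T \<kappa> l. norm (a \<kappa> l t)) / card P" for \<kappa> l
    proof -
      have "(\<Sum>t\<in>P. norm (b' \<kappa> l t)) = (\<Sum>t\<in>T \<kappa> l. norm (a \<kappa> l t))"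
        unfolding T_def b'_def
        by (subst sum.inter_filter) (auto simp: P_def not_le intro!: sum.cong)
      then show ?thesis by (simp add: avgP cardP)
    qed
    then have "(\<Sum>\<kappa>\<in>I. \<Sum>l<\<kappa>. y \<kappa> * avg H s (\<lambda>t. norm (b' \<kappa> l t)))
        = (\<Sum>\<kappa>\<in>I. \<Sum>l<\<kappa>. y \<kappa> * (\<Sum>t\<in>T \<kappa> l. norm (a \<kappa> l t))) / card P"
      by (simp add: sum_divide_distrib sum_distrib_left)
    also have "\<dots> \<le> 2 * C * C powr (q - 1) * chain_const r / 2 ^ r"
      by (rule small_sets_mass_le[OF weight _ _ _ smallT]) (auto simp: P_def T_def)
    finally show ?thesis .
  qed
  have point: "wmean m H s (\<lambda>h t. norm (halfdiff h t (a \<kappa> l)))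
      \<le> 2 * (2 * 2 ^ r * A \<kappa> l) / sqrt m + 2 * avg H s (\<lambda>t. norm (b' \<kappa> l t))" for \<kappa> l
  proof -
    have "wmean m H s (\<lambda>h t. norm (halfdiff h t (a \<kappa> l)))
        \<le> wmean m H s (\<lambda>h t. norm (halfdiff h t (b \<kappa> l)) + 2 * avg h t (\<lambda>t. norm (b' \<kappa> l t)))"
    proof (rule wmean_mono[OF m(2)])
      fix h t :: nat assume h: "1 \<le> h"
      have "a \<kappa> l = (\<lambda>t. b \<kappa> l t + b' \<kappa> l t)" by (auto simp: b_def b'_def)
      then have "halfdiff h t (a \<kappa> l) = halfdiff h t (b \<kappa> l) + halfdiff h t (b' \<kappa> l)"
        by (simp add: halfdiff_def dmean_add)
      then show "norm (halfdiff h t (a \<kappa> l)) \<le> norm (halfdiff h t (b \<kappa> l)) + 2 * avg h t (\<lambda>t. norm (b' \<kappa> l t))"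
        using norm_triangle_ineq[of "halfdiff h t (b \<kappa> l)" "halfdiff h t (b' \<kappa> l)"] norm_halfdiff_le[OF h, of t "b' \<kappa> l"]
        by simp
    qed
    also have "\<dots> = wmean m H s (\<lambda>h t. norm (halfdiff h t (b \<kappa> l))) + 2 * avg H s (\<lambda>t. norm (b' \<kappa> l t))"
      by (simp only: wmean_add wmean_mult wmean_avg[OF m])
    also have "wmean m H s (\<lambda>h t. norm (halfdiff h t (b \<kappa> l))) \<le> 2 * (2 * 2 ^ r * A \<kappa> l) / sqrt m"
      using A0[of \<kappa> l] by (intro wmean_halfdiff_le m) (auto simp: b_def)
    finally show ?thesis by simp
  qed
  have "wmean m H s (\<lambda>h t. \<Sum>\<kappa>\<in>I. y \<kappa> * osc h t \<kappa>)
      = (\<Sum>\<kappa>\<in>I. \<Sum>l<\<kappa>. y \<kappa> * wmean m H s (\<lambda>h t. norm (halfdiff h t (a \<kappa> l))))"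
    by (simp add: osc_def wmean_sum wmean_mult sum_distrib_left)
  also have "\<dots> \<le> (\<Sum>\<kappa>\<in>I. \<Sum>l<\<kappa>. y \<kappa> * (2 * (2 * 2 ^ r * A \<kappa> l) / sqrt m + 2 * avg H s (\<lambda>t. norm (b' \<kappa> l t))))"
    by (intro sum_mono mult_left_mono point y0)
  also have "\<dots> = 4 * 2 ^ r / sqrt m * (\<Sum>\<kappa>\<in>I. \<Sum>l<\<kappa>. y \<kappa> * A \<kappa> l)
      + 2 * (\<Sum>\<kappa>\<in>I. \<Sum>l<\<kappa>. y \<kappa> * avg H s (\<lambda>t. norm (b' \<kappa> l t)))"
    by (simp add: sum.distrib distrib_left sum_distrib_left sum_divide_distrib mult_ac)
  also have "(\<Sum>\<kappa>\<in>I. \<Sum>l<\<kappa>. y \<kappa> * A \<kappa> l) = energy H s"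
    unfolding energy_def
  proof (rule sum.cong[OF refl])
    fix \<kappa>
    have "(\<Sum>l<\<kappa>. y \<kappa> * A \<kappa> l) = y \<kappa> * xbar H s \<kappa>" by (simp add: xbar_sum A_def sum_distrib_left)
    also have "\<dots> = xbar H s \<kappa> powr q"
      using powr_mult_base[OF xbar_nonneg, of H s \<kappa> "q - 1"] by (simp add: y_def mult.commute)
    finally show "(\<Sum>l<\<kappa>. y \<kappa> * A \<kappa> l) = xbar H s \<kappa> powr q" .
  qed
  also have "4 * 2 ^ r / sqrt m * energy H s + 2 * (\<Sum>\<kappa>\<in>I. \<Sum>l<\<kappa>. y \<kappa> * avg H s (\<lambda>t. norm (b' \<kappa> l t)))
      \<le> 4 * 2 ^ r / sqrt m * C powr q + 2 * (2 * C * C powr (q - 1) * chain_const r / 2 ^ r)"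
    by (intro add_mono mult_left_mono energy_le large) auto
  also have "\<dots> = 4 * C powr q * (2 ^ r / sqrt m + chain_const r / 2 ^ r)"
  proof -
    have e: "C * C powr (q - 1) = C powr q" using C0 powr_mult_base[of C "q - 1"] by simp
    have "2 * (2 * C * C powr (q - 1) * chain_const r / 2 ^ r) = 4 * (C * C powr (q - 1)) * (chain_const r / 2 ^ r)"
      by simp
    then have f: "2 * (2 * C * C powr (q - 1) * chain_const r / 2 ^ r) = 4 * C powr q * (chain_const r / 2 ^ r)"
      unfolding e .
    show ?thesis unfolding f distrib_left by simp
  qed
  finally show ?thesis by (simp add: y_def)
qed

text \<open>Summands \<open>\<kappa>\<close> whose mean profile jumps within the window are paid for by the growth of the energy, by
  \<open>energy_jump\<close>. For all others the oscillation is at most a multiple of the mean profile of the window, so that its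
  \<open>q\<close>-th power is bounded linearly by the weighted oscillation of \<open>wmean_osc_le\<close>. If the energy is almost
  constant on the window, the oscillation is therefore small somewhere.\<close>

lemma window_bound:
  assumes m: "0 < m" "m \<le> H"
    and \<delta>: "\<And>h t. \<lbrakk>1 \<le> h; s \<le> t; t + 2 ^ h \<le> s + 2 ^ H\<rbrakk> \<Longrightarrow> \<delta> \<le> (\<Sum>\<kappa>\<in>I. osc h t \<kappa> powr q)"
  shows "\<delta> \<le> 2 powr q * 2 * (dmean (H - m) m s (energy (H - m)) - energy H s)
    + (2 * jump) powr (q - 1) * (4 * C powr q * (2 ^ r / sqrt m + chain_const r / 2 ^ r))"
proof -
  let ?bad = "\<lambda>h t. \<Sum>\<kappa>\<in>I. if jump * xbar H s \<kappa> < xbar h t \<kappa> then xbar h t \<kappa> powr q else 0"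
  let ?good = "\<lambda>h t. \<Sum>\<kappa>\<in>I. xbar H s \<kappa> powr (q - 1) * osc h t \<kappa>"
  let ?L = "(2 * jump) powr (q - 1)"
  have pt: "(\<Sum>\<kappa>\<in>I. osc h t \<kappa> powr q) \<le> 2 powr q * ?bad h t + ?L * ?good h t" if h: "1 \<le> h" for h t
    unfolding sum_distrib_left sum.distrib[symmetric]
  proof (rule sum_mono)
    fix \<kappa>
    show "osc h t \<kappa> powr q \<le> 2 powr q * (if jump * xbar H s \<kappa> < xbar h t \<kappa> then xbar h t \<kappa> powr q else 0)
        + ?L * (xbar H s \<kappa> powr (q - 1) * osc h t \<kappa>)"
    proof (cases "jump * xbar H s \<kappa> < xbar h t \<kappa>")
      case True
      have "osc h t \<kappa> powr q \<le> (2 * xbar h t \<kappa>) powr q"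
        using q1 osc_le[OF h] osc_nonneg by (intro powr_mono2) auto
      then show ?thesis
        using True xbar_nonneg osc_nonneg[of h t \<kappa>] by (simp add: powr_mult add_increasing2)
    next
      case False
      have "osc h t \<kappa> \<le> 2 * jump * xbar H s \<kappa>" using False osc_le[OF h, of t \<kappa>] by simp
      then have "osc h t \<kappa> powr (q - 1) \<le> (2 * jump * xbar H s \<kappa>) powr (q - 1)"
        using q1 osc_nonneg by (intro powr_mono2) auto
      also have "\<dots> = ?L * xbar H s \<kappa> powr (q - 1)"
        using jump_pos xbar_nonneg by (simp add: powr_mult)
      finally have "osc h t \<kappa> * osc h t \<kappa> powr (q - 1) \<le> osc h t \<kappa> * (?L * xbar H s \<kappa> powr (q - 1))"
        by (intro mult_left_mono osc_nonneg)
      then show ?thesis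
        using False powr_mult_base[OF osc_nonneg, of h t \<kappa> "q - 1"] by (simp add: mult_ac)
    qed
  qed
  have "\<delta> = wmean m H s (\<lambda>_ _. \<delta>)" using m by (simp add: wmean_const)
  also have "\<dots> \<le> wmean m H s (\<lambda>h t. 2 powr q * ?bad h t + ?L * ?good h t)"
  proof (rule wmean_mono[OF m(2)])
    fix h t assume "1 \<le> h" "s \<le> t" "t + 2 ^ h \<le> s + 2 ^ H"
    then show "\<delta> \<le> 2 powr q * ?bad h t + ?L * ?good h t" using \<delta> pt order_trans by blast
  qed
  also have "\<dots> = 2 powr q * wmean m H s ?bad + ?L * wmean m H s ?good"
    by (simp only: wmean_add wmean_mult)
  also have "\<dots> \<le> 2 powr q * (2 * (dmean (H - m) m s (energy (H - m)) - energy H s))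
      + ?L * (4 * C powr q * (2 ^ r / sqrt m + chain_const r / 2 ^ r))"
  proof (intro add_mono mult_left_mono wmean_osc_le m)
    have lev: "dmean (H - i) i s (?bad (H - i)) \<le> 2 * (dmean (H - m) m s (energy (H - m)) - energy H s)"
      if i: "i < m" for i
    proof -
      have "energy H s + dmean (H - i) i s (?bad (H - i)) / 2 \<le> dmean (H - i) i s (energy (H - i))"
        using energy_jump[of "H - i" i s] i m by simp
      also have "\<dots> \<le> dmean (H - i) i s (\<lambda>t. dmean (H - m) (m - i) t (energy (H - m)))"
      proof (rule dmean_mono)
        fix t
        show "energy (H - i) t \<le> dmean (H - m) (m - i) t (energy (H - m))"
          using energy_mono[of "H - m" "m - i" t] i m by simp
      qed
      also have "\<dots> = dmean (H - m) m s (energy (H - m))"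
        using dmean_tower[of "H - m" "m - i" i s "energy (H - m)"] i m by simp
      finally show ?thesis by simp
    qed
    have "(\<Sum>i<m. dmean (H - i) i s (?bad (H - i))) \<le> (\<Sum>i<m. 2 * (dmean (H - m) m s (energy (H - m)) - energy H s))"
      by (intro sum_mono lev) simp
    then show "wmean m H s ?bad \<le> 2 * (dmean (H - m) m s (energy (H - m)) - energy H s)"
      using m by (simp add: wmean_def field_simps)
  qed auto
  finally show ?thesis by (simp only: mult.assoc)
qed

text \<open>Over \<open>W\<close> successive windows the growth of the energy telescopes and is bounded in total.\<close>

lemma windows_bound:
  assumes m: "0 < m"
    and \<delta>: "\<And>h t. \<lbrakk>1 \<le> h; s \<le> t; t + 2 ^ h \<le> s + 2 ^ (m * W)\<rbrakk> \<Longrightarrow> \<delta> \<le> (\<Sum>\<kappa>\<in>I. osc h t \<kappa> powr q)"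
  shows "real W * (\<delta> - (2 * jump) powr (q - 1) * (4 * C powr q * (2 ^ r / sqrt m + chain_const r / 2 ^ r)))
    \<le> 2 powr q * 2 * C powr q"
proof -
  define n where "n = m * W"
  define F where "F = (\<lambda>h. dmean h (n - h) s (energy h))"
  define E where "E = (2 * jump) powr (q - 1) * (4 * C powr q * (2 ^ r / sqrt m + chain_const r / 2 ^ r))"
  have step: "\<delta> - E \<le> 2 powr q * 2 * (F (m * w) - F (m * Suc w))" if w: "w < W" for w
  proof -
    define H where "H = m * Suc w"
    have H: "m \<le> H" "H \<le> n" "H - m = m * w"
      using w mult_le_mono2[of "Suc w" W m] by (auto simp: H_def n_def)
    have "dmean H (n - H) s (\<lambda>_. \<delta> - E)
        \<le> dmean H (n - H) s (\<lambda>t. 2 powr q * 2 * (dmean (H - m) m t (energy (H - m)) - energy H t))"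
    proof (rule dmean_mono)
      fix t assume t: "s \<le> t" "t + 2 ^ H \<le> s + 2 ^ (H + (n - H))"
      have "\<delta> \<le> 2 powr q * 2 * (dmean (H - m) m t (energy (H - m)) - energy H t) + E"
        unfolding E_def
      proof (rule window_bound[OF m H(1)])
        fix h t' assume "1 \<le> h" "t \<le> t'" "t' + 2 ^ h \<le> t + 2 ^ H"
        then show "\<delta> \<le> (\<Sum>\<kappa>\<in>I. osc h t' \<kappa> powr q)"
          using t H(2) by (intro \<delta>) (auto simp: n_def)
      qed
      then show "\<delta> - E \<le> 2 powr q * 2 * (dmean (H - m) m t (energy (H - m)) - energy H t)" by simp
    qed
    also have "\<dots> = 2 powr q * 2 * (F (H - m) - F H)"
    proof -
      have "dmean H (n - H) s (\<lambda>t. dmean (H - m) m t (energy (H - m))) = F (H - m)"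
      proof -
        have "m + (n - H) = n - (H - m)" "H - m + m = H" using H by simp_all
        then show ?thesis
          using dmean_tower[of "H - m" m "n - H" s "energy (H - m)"] unfolding F_def by metis
      qed
      then show ?thesis by (simp only: dmean_mult dmean_diff F_def)
    qed
    finally show ?thesis unfolding H(3) H_def by (simp add: dmean_const)
  qed
  have "real W * (\<delta> - E) = (\<Sum>w<W. \<delta> - E)" by simp
  also have "\<dots> \<le> (\<Sum>w<W. 2 powr q * 2 * (F (m * w) - F (m * Suc w)))"
    by (intro sum_mono step) simp
  also have "\<dots> = 2 powr q * 2 * (F 0 - F n)"
    using sum_lessThan_telescope'[of "\<lambda>w. F (m * w)" W] by (simp add: n_def flip: sum_distrib_left)
  also have "\<dots> \<le> 2 powr q * 2 * C powr q"
  proof (intro mult_left_mono)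
    have "F 0 \<le> dmean 0 n s (\<lambda>_. C powr q)" unfolding F_def by (simp, intro dmean_mono energy_0_le)
    moreover have "0 \<le> F n" unfolding F_def by (intro dmean_nonneg energy_nonneg)
    ultimately show "F 0 - F n \<le> C powr q" by (simp add: dmean_const)
  qed auto
  finally show ?thesis by (simp add: E_def)
qed

text \<open>Suppose that the matrix nearly maps vectors \<open>b j\<close> of norm \<open>B\<close> to the summing basis. For the last point \<open>j\<close> of the
  left half of an interval the image of \<open>b j\<close> is close to 1 on the left half and to 0 on the right half.
  Its half-difference is thus at least \<open>1 / 2\<close>, and Hoelder's inequality shifts this bound to the matrix.\<close>

lemma osc_lower_bound:
  assumes B: "0 < B"
    and b: "\<And>j. j < 2 ^ n \<Longrightarrow> \<exists>y. (\<forall>\<kappa>\<in>I. 0 \<le> y \<kappa> \<and> (\<forall>l<\<kappa>. norm (b j \<kappa> l) \<le> y \<kappa>)) \<and> (\<Sum>\<kappa>\<in>I. y \<kappa> powr p) \<le> B powr p"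
    and near: "\<And>j t. \<lbrakk>j < 2 ^ n; t < 2 ^ n\<rbrakk> \<Longrightarrow> norm (comb I a (b j) (s + t) - (if t \<le> j then 1 else 0)) \<le> 1 / 4"
    and h: "1 \<le> h" "s \<le> t" "t + 2 ^ h \<le> s + 2 ^ n"
  shows "(1 / (2 * B)) powr q \<le> (\<Sum>\<kappa>\<in>I. osc h t \<kappa> powr q)"
proof -
  define k where "k = h - 1"
  have k: "h = Suc k" using h(1) by (simp add: k_def)
  have two: "(2::nat) ^ h = 2 ^ k + 2 ^ k" by (simp add: k)
  define j where "j = t - s + 2 ^ k - 1"
  have kpos: "(0::nat) < 2 ^ k" by simp
  have j: "j < 2 ^ n" using h(2,3) two kpos unfolding j_def by linarith
  obtain y where y: "\<And>\<kappa>. \<kappa> \<in> I \<Longrightarrow> 0 \<le> y \<kappa>" "\<And>\<kappa> l. \<lbrakk>\<kappa> \<in> I; l < \<kappa>\<rbrakk> \<Longrightarrow> norm (b j \<kappa> l) \<le> y \<kappa>"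
    "(\<Sum>\<kappa>\<in>I. y \<kappa> powr p) \<le> B powr p"
    using b[OF j] by blast
  define X where "X = comb I a (b j)"
  have left: "norm (avg k t X - 1) \<le> 1 / 4"
  proof -
    have "avg k t X - 1 = avg k t (\<lambda>u. X u - 1)" by (simp add: dmean_diff dmean_const)
    also have "norm \<dots> \<le> avg k t (\<lambda>u. norm (X u - 1))" by (rule norm_dmean)
    also have "\<dots> \<le> avg k t (\<lambda>_. 1 / 4)"
    proof (rule dmean_mono)
      fix u assume u: "t \<le> u" "u + 2 ^ 0 \<le> t + 2 ^ (0 + k)"
      then have "u - s \<le> j" "u - s < 2 ^ n" "s + (u - s) = u" using h(2) j unfolding j_def by auto
      then show "norm (X u - 1) \<le> 1 / 4" using near[OF j, of "u - s"] by (simp add: X_def)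
    qed
    finally show ?thesis by (simp add: dmean_const)
  qed
  have right: "norm (avg k (t + 2 ^ k) X) \<le> 1 / 4"
  proof -
    have "norm (avg k (t + 2 ^ k) X) \<le> avg k (t + 2 ^ k) (\<lambda>u. norm (X u))" by (rule norm_dmean)
    also have "\<dots> \<le> avg k (t + 2 ^ k) (\<lambda>_. 1 / 4)"
    proof (rule dmean_mono)
      fix u assume u: "t + 2 ^ k \<le> u" "u + 2 ^ 0 \<le> t + 2 ^ k + 2 ^ (0 + k)"
      then have "\<not> u - s \<le> j" "u - s < 2 ^ n" "s + (u - s) = u"
        using h(2,3) two kpos unfolding j_def by auto
      then show "norm (X u) \<le> 1 / 4" using near[OF j, of "u - s"] by (simp add: X_def)
    qed
    finally show ?thesis by (simp add: dmean_const)
  qed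
  have "1 \<le> norm (halfdiff h t X) + norm (avg k t X - 1) + norm (avg k (t + 2 ^ k) X)"
  proof -
    have "(1::'k) = halfdiff h t X - (avg k t X - 1) + avg k (t + 2 ^ k) X" by (simp add: halfdiff_def k)
    then have "norm (1::'k) = norm (halfdiff h t X - (avg k t X - 1) + avg k (t + 2 ^ k) X)" by metis
    also have "\<dots> \<le> norm (halfdiff h t X - (avg k t X - 1)) + norm (avg k (t + 2 ^ k) X)"
      by (rule norm_triangle_ineq)
    also have "norm (halfdiff h t X - (avg k t X - 1)) \<le> norm (halfdiff h t X) + norm (avg k t X - 1)"
      by (rule norm_triangle_ineq4)
    finally show ?thesis by simp
  qed
  then have half: "1 / 2 \<le> norm (halfdiff h t X)" using left right by simp
  have "halfdiff h t X = (\<Sum>\<kappa>\<in>I. \<Sum>l<\<kappa>. b j \<kappa> l * halfdiff h t (a \<kappa> l))"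
    by (simp add: X_def comb_def halfdiff_def dmean_sum dmean_mult right_diff_distrib sum_subtractf)
  then have "norm (halfdiff h t X) \<le> (\<Sum>\<kappa>\<in>I. norm (\<Sum>l<\<kappa>. b j \<kappa> l * halfdiff h t (a \<kappa> l)))"
    by (simp add: norm_sum)
  also have "\<dots> \<le> (\<Sum>\<kappa>\<in>I. y \<kappa> * osc h t \<kappa>)"
  proof (rule sum_mono)
    fix \<kappa> assume \<kappa>: "\<kappa> \<in> I"
    have "norm (\<Sum>l<\<kappa>. b j \<kappa> l * halfdiff h t (a \<kappa> l)) \<le> (\<Sum>l<\<kappa>. norm (b j \<kappa> l * halfdiff h t (a \<kappa> l)))"
      by (rule norm_sum)
    also have "\<dots> \<le> (\<Sum>l<\<kappa>. y \<kappa> * norm (halfdiff h t (a \<kappa> l)))"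
      using y(2)[OF \<kappa>] by (intro sum_mono) (simp add: norm_mult mult_right_mono)
    finally show "norm (\<Sum>l<\<kappa>. b j \<kappa> l * halfdiff h t (a \<kappa> l)) \<le> y \<kappa> * osc h t \<kappa>"
      by (simp add: osc_def sum_distrib_left)
  qed
  also have "\<dots> \<le> (\<Sum>\<kappa>\<in>I. y \<kappa> powr p) powr (1 / p) * (\<Sum>\<kappa>\<in>I. osc h t \<kappa> powr q) powr (1 / q)"
    using y(1) osc_nonneg by (intro Hoelder_sum p1 pq) auto
  also have "\<dots> \<le> B * (\<Sum>\<kappa>\<in>I. osc h t \<kappa> powr q) powr (1 / q)"
  proof (intro mult_right_mono)
    have "(\<Sum>\<kappa>\<in>I. y \<kappa> powr p) powr (1 / p) \<le> (B powr p) powr (1 / p)"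
      using y(3) p1 by (intro powr_mono2) (auto simp: sum_nonneg)
    then show "(\<Sum>\<kappa>\<in>I. y \<kappa> powr p) powr (1 / p) \<le> B" using B p1 by (simp add: powr_powr)
  qed auto
  finally have "1 / (2 * B) \<le> (\<Sum>\<kappa>\<in>I. osc h t \<kappa> powr q) powr (1 / q)"
    using half B by (simp add: field_simps)
  then have "(1 / (2 * B)) powr q \<le> ((\<Sum>\<kappa>\<in>I. osc h t \<kappa> powr q) powr (1 / q)) powr q"
    using q1 B by (intro powr_mono2) auto
  then show ?thesis using q1 by (simp add: powr_powr sum_nonneg)
qed

end

context james_setting
begin

text \<open>The chaining constant is of smaller order than \<open>2 ^ r\<close> because \<open>1 / q < 1\<close>.\<close>

lemma chain_const_small:
  assumes "0 < e"
  shows "\<exists>r. (1 + (\<Sum>i<r. 2 powr (real i / q))) / 2 ^ r < e"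
proof -
  define c where "c = 2 powr (- 1 / p)"
  have c: "0 < c" "c < 1" using p1 by (auto simp: c_def powr_less_one)
  have le: "(1 + (\<Sum>i<r. 2 powr (real i / q))) / 2 ^ r \<le> (1 / 2) ^ r + real r * c ^ r" for r
  proof -
    have "(\<Sum>i<r. 2 powr (real i / q)) \<le> (\<Sum>i<r. 2 powr (real r / q))"
      using q1 by (intro sum_mono powr_mono divide_right_mono) auto
    then have "(1 + (\<Sum>i<r. 2 powr (real i / q))) / 2 ^ r \<le> (1 + real r * 2 powr (real r / q)) / 2 ^ r"
      by (intro divide_right_mono) auto
    also have "\<dots> = (1 / 2) ^ r + real r * (2 powr (real r / q) / 2 ^ r)"
      by (simp add: add_divide_distrib power_divide)
    also have "2 powr (real r / q) / 2 ^ r = c ^ r"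
    proof -
      have e: "real r / q - real r = - 1 / p * real r"
      proof -
        have "real r / q - real r = real r * (1 / q - 1)" by (simp add: right_diff_distrib)
        also have "1 / q - 1 = - 1 / p" using pq by simp
        finally show ?thesis by simp
      qed
      have "2 powr (real r / q) / 2 ^ r = 2 powr (real r / q - real r)"
        by (simp add: powr_diff powr_realpow)
      also have "\<dots> = (2 powr (- 1 / p)) powr real r" unfolding e by (simp only: powr_powr)
      also have "\<dots> = c ^ r" using c by (simp only: c_def[symmetric] powr_realpow)
      finally show ?thesis .
    qed
    finally show ?thesis by simp
  qed
  have "(\<lambda>r. (1 / 2) ^ r + real r * c ^ r) \<longlonglongrightarrow> 0 + 0"
    using c by (intro tendsto_add LIMSEQ_power_zero powser_times_n_limit_0) auto
  then have "eventually (\<lambda>r. (1 / 2) ^ r + real r * c ^ r < e) sequentially"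
    using assms by (intro order_tendstoD(2)) auto
  then obtain r where "(1 / 2) ^ r + real r * c ^ r < e" by (auto simp: eventually_sequentially)
  then show ?thesis using le[of r] by (intro exI[of _ r]) linarith
qed

text \<open>Vectors of bounded norm in a finite \<open>p\<close>-sum of spaces \<open>\<ell>\<^sub>\<infinity>\<^sup>\<kappa>\<close>, of any size, are not mapped close to a long piece of
  the summing basis by operators of bounded norm: \<open>windows_bound\<close> limits the number of windows on which the
  lower bound \<open>osc_lower_bound\<close> can hold. First \<open>r\<close> is chosen to make the chaining term small, then the length \<open>m\<close> of
  the windows to make the orthogonality term small, and at last the number \<open>W\<close> of windows.\<close>

theorem summing_basis_not_factored:
  assumes C: "0 < C" and B: "0 < B"
  shows "\<exists>n. \<forall>I a b s. operator_matrix p I a C \<longrightarrow>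
    (\<forall>j<2 ^ n. \<exists>y. (\<forall>\<kappa>\<in>I. 0 \<le> y \<kappa> \<and> (\<forall>l<\<kappa>. norm (b j \<kappa> l) \<le> y \<kappa>)) \<and> (\<Sum>\<kappa>\<in>I. y \<kappa> powr p) \<le> B powr p) \<longrightarrow>
    \<not> (\<forall>j<2 ^ n. \<forall>t<2 ^ n. norm (comb I a (b j) (s + t) - (if t \<le> j then 1 else 0 :: 'k)) \<le> 1 / 4)"
proof -
  define \<delta> where "\<delta> = (1 / (2 * B)) powr q"
  define G where "G = (2 * jump) powr (q - 1) * (4 * C powr q)"
  have \<delta>: "0 < \<delta>" using B by (simp add: \<delta>_def)
  have G: "0 < G" using C jump_pos by (simp add: G_def)
  obtain r where r: "(1 + (\<Sum>i<r. 2 powr (real i / q))) / 2 ^ r < \<delta> / (4 * G)"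
    using chain_const_small[of "\<delta> / (4 * G)"] \<delta> G by auto
  have "(\<lambda>m. 2 ^ r / sqrt (real m)) \<longlonglongrightarrow> 0"
    by (rule tendsto_divide_0[OF tendsto_const])
      (auto intro!: filterlim_compose[OF filterlim_at_top_imp_at_infinity[OF sqrt_at_top]] filterlim_real_sequentially)
  then have "eventually (\<lambda>m. 2 ^ r / sqrt (real m) < \<delta> / (4 * G)) sequentially"
    using \<delta> G by (intro order_tendstoD(2)) auto
  then obtain m0 where m0: "\<And>m. m0 \<le> m \<Longrightarrow> 2 ^ r / sqrt (real m) < \<delta> / (4 * G)"
    by (auto simp: eventually_sequentially)
  define m where "m = Suc m0"
  have m: "0 < m" "2 ^ r / sqrt (real m) < \<delta> / (4 * G)" using m0[of m] by (auto simp: m_def)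
  obtain W :: nat where W: "2 powr q * 2 * C powr q < real W * (\<delta> / 2)"
    using reals_Archimedean3[of "\<delta> / 2"] \<delta> half_gt_zero by blast
  show ?thesis
  proof (intro exI[of _ "m * W"] allI impI notI)
    fix I and a :: "nat \<Rightarrow> nat \<Rightarrow> nat \<Rightarrow> 'k" and b s
    assume "operator_matrix p I a C"
    then interpret M: operator_matrix p K I a C .
    assume b: "\<forall>j<2 ^ (m * W). \<exists>y. (\<forall>\<kappa>\<in>I. 0 \<le> y \<kappa> \<and> (\<forall>l<\<kappa>. norm (b j \<kappa> l) \<le> y \<kappa>)) \<and> (\<Sum>\<kappa>\<in>I. y \<kappa> powr p) \<le> B powr p"
      and near: "\<forall>j<2 ^ (m * W). \<forall>t<2 ^ (m * W). norm (comb I a (b j) (s + t) - (if t \<le> j then 1 else 0 :: 'k)) \<le> 1 / 4"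
    have "real W * (\<delta> - (2 * jump) powr (q - 1) * (4 * C powr q * (2 ^ r / sqrt m + M.chain_const r / 2 ^ r)))
        \<le> 2 powr q * 2 * C powr q"
    proof (rule M.windows_bound[OF m(1), of s])
      fix h t assume "1 \<le> h" "s \<le> t" "t + 2 ^ h \<le> s + 2 ^ (m * W)"
      then show "\<delta> \<le> (\<Sum>\<kappa>\<in>I. M.osc h t \<kappa> powr q)"
        unfolding \<delta>_def using b near by (intro M.osc_lower_bound[OF B, where b = b]) auto
    qed
    moreover have "\<delta> / 2 \<le> \<delta> - (2 * jump) powr (q - 1) * (4 * C powr q * (2 ^ r / sqrt m + M.chain_const r / 2 ^ r))"
    proof -
      have "2 ^ r / sqrt m + M.chain_const r / 2 ^ r \<le> \<delta> / (2 * G)"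
        using m(2) r by (simp add: M.chain_const_def)
      then have "G * (2 ^ r / sqrt m + M.chain_const r / 2 ^ r) \<le> G * (\<delta> / (2 * G))"
        using G by (intro mult_left_mono) auto
      also have "\<dots> = \<delta> / 2" using G by simp
      finally show ?thesis by (simp add: G_def mult.assoc)
    qed
    then have "real W * (\<delta> / 2) \<le> real W * (\<delta> - (2 * jump) powr (q - 1) * (4 * C powr q * (2 ^ r / sqrt m + M.chain_const r / 2 ^ r)))"
      by (intro mult_left_mono) auto
    ultimately show False using W by linarith
  qed
qed

end

section \<open>Direct sums\<close>

lemma direct_sum_upper:
  assumes "x \<in> vecs (direct_sum p J X)" "finite F" "F \<subseteq> J" "0 < p"
  shows "(\<Sum>j\<in>F. nrm (X j) (x j) powr p) \<le> nrm (direct_sum p J X) x powr p"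
proof -
  have "(\<Sum>j\<in>F. nrm (X j) (x j) powr p) \<le> (\<Sum>\<^sub>\<infinity>j\<in>J. nrm (X j) (x j) powr p)"
    using assms by (intro finite_sum_le_infsum) (auto simp: direct_sum_def)
  also have "\<dots> = nrm (direct_sum p J X) x powr p"
    using assms by (simp add: direct_sum_def powr_powr infsum_nonneg)
  finally show ?thesis .
qed

lemma direct_sum_boundI:
  assumes "\<And>j. j \<in> J \<Longrightarrow> x j \<in> vecs (X j)" "\<And>j. j \<notin> J \<Longrightarrow> x j = 0" "0 \<le> C" "0 < p"
    and le: "\<And>F. \<lbrakk>finite F; F \<subseteq> J\<rbrakk> \<Longrightarrow> (\<Sum>j\<in>F. nrm (X j) (x j) powr p) \<le> C powr p"
  shows "x \<in> vecs (direct_sum p J X)" "nrm (direct_sum p J X) x \<le> C"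
proof -
  have s: "(\<lambda>j. nrm (X j) (x j) powr p) summable_on J"
  proof (rule nonneg_bdd_above_summable_on)
    show "bdd_above (sum (\<lambda>j. nrm (X j) (x j) powr p) ` {F. F \<subseteq> J \<and> finite F})"
      using le by (auto simp: bdd_above_def)
  qed simp
  then show "x \<in> vecs (direct_sum p J X)" using assms by (simp add: direct_sum_def)
  have "(\<Sum>\<^sub>\<infinity>j\<in>J. nrm (X j) (x j) powr p) \<le> C powr p"
    using s le by (intro infsum_le_finite_sums)
  then have "(\<Sum>\<^sub>\<infinity>j\<in>J. nrm (X j) (x j) powr p) powr (1 / p) \<le> (C powr p) powr (1 / p)"
    using assms by (intro powr_mono2) (auto simp: infsum_nonneg)
  then show "nrm (direct_sum p J X) x \<le> C"
    using assms by (simp add: direct_sum_def powr_powr)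
qed

lemma direct_sum_vecsD:
  assumes "x \<in> vecs (direct_sum p J X)"
  shows "j \<in> J \<Longrightarrow> x j \<in> vecs (X j)" "j \<notin> J \<Longrightarrow> x j = 0"
  using assms by (auto simp: direct_sum_def)

lemma direct_sum_norm_ge_0: "0 \<le> nrm (direct_sum p J X) x"
  by (simp add: direct_sum_def)

lemma normed_direct_sum:
  fixes X :: "'j \<Rightarrow> ('k::real_normed_field, 'a::ab_group_add) nspace"
  assumes p: "1 \<le> p" and X: "\<And>j. j \<in> J \<Longrightarrow> normed_nspace (X j)"
    and off: "\<And>j c. j \<notin> J \<Longrightarrow> scal (X j) c 0 = 0"
  shows "normed_nspace (direct_sum p J X)"
proof -
  let ?S = "direct_sum p J X"
  have p0: "0 < p" using p by simp
  have sc: "scal ?S c x = (\<lambda>j. scal (X j) c (x j))" for c x by (simp add: direct_sum_def)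
  have scale_le: "scal ?S c x \<in> vecs ?S \<and> nrm ?S (scal ?S c x) \<le> norm c * nrm ?S x" if x: "x \<in> vecs ?S" for c x
  proof -
    have "(\<Sum>j\<in>F. nrm (X j) (scal ?S c x j) powr p) \<le> (norm c * nrm ?S x) powr p" if F: "finite F" "F \<subseteq> J" for F
    proof -
      have "(\<Sum>j\<in>F. nrm (X j) (scal ?S c x j) powr p) = norm c powr p * (\<Sum>j\<in>F. nrm (X j) (x j) powr p)"
        unfolding sum_distrib_left
      proof (rule sum.cong[OF refl])
        fix j assume "j \<in> F"
        then have j: "j \<in> J" using F by blast
        then have xj: "x j \<in> vecs (X j)" using direct_sum_vecsD[OF x] by blast
        show "nrm (X j) (scal ?S c x j) powr p = norm c powr p * nrm (X j) (x j) powr p"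
          using normed_nspace.nrm_scal[OF X[OF j] xj] normed_nspace.nrm_ge_0[OF X[OF j] xj]
          by (simp add: sc powr_mult)
      qed
      also have "\<dots> \<le> norm c powr p * nrm ?S x powr p"
        by (intro mult_left_mono direct_sum_upper x F p0) auto
      finally show ?thesis by (simp add: powr_mult direct_sum_norm_ge_0)
    qed
    then show ?thesis
      using direct_sum_boundI[of J "scal ?S c x" X "norm c * nrm ?S x" p] p0 off
        direct_sum_vecsD[OF x] normed_nspace.scal_vecs[OF X]
      by (simp add: sc direct_sum_norm_ge_0)
  qed
  have add_le: "x + y \<in> vecs ?S \<and> nrm ?S (x + y) \<le> nrm ?S x + nrm ?S y"
    if x: "x \<in> vecs ?S" and y: "y \<in> vecs ?S" for x y
  proof -
    have "(\<Sum>j\<in>F. nrm (X j) ((x + y) j) powr p) \<le> (nrm ?S x + nrm ?S y) powr p" if F: "finite F" "F \<subseteq> J" for F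
    proof -
      have n0: "0 \<le> nrm (X j) (z j)" if "z \<in> vecs ?S" "j \<in> F" for z j
        using normed_nspace.nrm_ge_0[OF X] direct_sum_vecsD[OF that(1)] that F by blast
      have root: "(\<Sum>j\<in>F. nrm (X j) (z j) powr p) powr (1 / p) \<le> nrm ?S z" if z: "z \<in> vecs ?S" for z
      proof -
        have "(\<Sum>j\<in>F. nrm (X j) (z j) powr p) powr (1 / p) \<le> (nrm ?S z powr p) powr (1 / p)"
          using p by (intro powr_mono2 direct_sum_upper z F p0) (auto simp: sum_nonneg)
        then show ?thesis using p0 by (simp add: powr_powr direct_sum_norm_ge_0)
      qed
      have "(\<Sum>j\<in>F. nrm (X j) ((x + y) j) powr p) \<le> (\<Sum>j\<in>F. (nrm (X j) (x j) + nrm (X j) (y j)) powr p)"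
      proof (intro sum_mono powr_mono2)
        fix j assume j: "j \<in> F"
        then have "j \<in> J" using F by blast
        then show "nrm (X j) ((x + y) j) \<le> nrm (X j) (x j) + nrm (X j) (y j)"
          using normed_nspace.nrm_triangle[OF X direct_sum_vecsD(1)[OF x] direct_sum_vecsD(1)[OF y]] by simp
        have "(x + y) j \<in> vecs (X j)"
          using \<open>j \<in> J\<close> normed_nspace.add_vecs[OF X direct_sum_vecsD(1)[OF x] direct_sum_vecsD(1)[OF y]] by simp
        then show "0 \<le> nrm (X j) ((x + y) j)" using normed_nspace.nrm_ge_0[OF X] \<open>j \<in> J\<close> by blast
      qed (use p in auto)
      also have "\<dots> = ((\<Sum>j\<in>F. (nrm (X j) (x j) + nrm (X j) (y j)) powr p) powr (1 / p)) powr p"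
        using p0 by (simp add: powr_powr sum_nonneg)
      also have "\<dots> \<le> (nrm ?S x + nrm ?S y) powr p"
      proof (rule powr_mono2)
        have "(\<Sum>j\<in>F. (nrm (X j) (x j) + nrm (X j) (y j)) powr p) powr (1 / p)
            \<le> (\<Sum>j\<in>F. nrm (X j) (x j) powr p) powr (1 / p) + (\<Sum>j\<in>F. nrm (X j) (y j) powr p) powr (1 / p)"
          using n0 x y by (intro Minkowski_sum p) auto
        then show "(\<Sum>j\<in>F. (nrm (X j) (x j) + nrm (X j) (y j)) powr p) powr (1 / p) \<le> nrm ?S x + nrm ?S y"
          using root[OF x] root[OF y] by linarith
      qed (use p in auto)
      finally show ?thesis .
    qed
    then show ?thesis
      using direct_sum_boundI[of J "x + y" X "nrm ?S x + nrm ?S y" p] p0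
        direct_sum_vecsD[OF x] direct_sum_vecsD[OF y] normed_nspace.add_vecs[OF X]
      by (simp add: direct_sum_norm_ge_0)
  qed
  have zero: "0 \<in> vecs ?S \<and> nrm ?S 0 = 0"
    using direct_sum_boundI[of J 0 X 0 p] p0 normed_nspace.zero_vecs[OF X] normed_nspace.nrm_0[OF X]
      direct_sum_norm_ge_0[of p J X 0] by (simp add: subset_iff)
  have point: "x j = 0" if x: "x \<in> vecs ?S" "nrm ?S x = 0" for x j
  proof (cases "j \<in> J")
    case True
    have "nrm (X j) (x j) powr p \<le> 0"
      using direct_sum_upper[OF x(1), of "{j}"] True p0 x(2) by simp
    then have "nrm (X j) (x j) = 0" by (simp add: powr_def split: if_splits)
    then show ?thesis using normed_nspace.nrm_eq_0[OF X[OF True]] direct_sum_vecsD[OF x(1)] True by blast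
  qed (use direct_sum_vecsD[OF x(1)] in blast)
  show ?thesis
  proof
    fix x y :: "'j \<Rightarrow> 'a" and c d :: 'k assume x: "x \<in> vecs ?S"
    have xj: "x j \<in> vecs (X j)" if "j \<in> J" for j using direct_sum_vecsD[OF x] that by blast
    have xo: "x j = 0" if "j \<notin> J" for j using direct_sum_vecsD[OF x] that by blast
    show "scal ?S c x \<in> vecs ?S" using scale_le[OF x] by blast
    show "scal ?S (- 1) x = - x"
    proof
      show "scal ?S (- 1) x j = (- x) j" for j
        using normed_nspace.scal_minus1[OF X xj] xo off by (cases "j \<in> J") (auto simp: sc)
    qed
    show cd: "scal ?S c (scal ?S d x) = scal ?S (c * d) x" for c d
    proof
      show "scal ?S c (scal ?S d x) j = scal ?S (c * d) x j" for j
        using normed_nspace.scal_scal[OF X xj] xo off by (cases "j \<in> J") (auto simp: sc)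
    qed
    show "x = 0" if "nrm ?S x = 0" using point[OF x that] by auto
    show "nrm ?S (scal ?S c x) = norm c * nrm ?S x"
    proof (cases "c = 0")
      case True
      then show ?thesis using scale_le[OF x, of c] direct_sum_norm_ge_0[of p J X "scal ?S c x"] by simp
    next
      case False
      have "scal ?S 1 x = x"
      proof
        fix j
        show "scal ?S 1 x j = x j"
        proof (cases "j \<in> J")
          case True
          interpret Xj: normed_nspace "X j" by (rule X[OF True])
          show ?thesis
            using Xj.scal_scal[OF xj[OF True], of "- 1" "- 1"] xj[OF True]
            by (simp add: sc Xj.scal_minus1 Xj.uminus_vecs)
        qed (simp add: sc xo off)
      qed
      then have inv: "scal ?S (inverse c) (scal ?S c x) = x" using False by (simp add: cd)
      then have "nrm ?S x \<le> norm (inverse c) * nrm ?S (scal ?S c x)"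
        using scale_le[of "scal ?S c x" "inverse c"] scale_le[OF x, of c] by simp
      then have "norm c * nrm ?S x \<le> norm c * (norm (inverse c) * nrm ?S (scal ?S c x))"
        by (intro mult_left_mono) auto
      also have "\<dots> = nrm ?S (scal ?S c x)"
        using False by (simp add: norm_inverse mult.assoc[symmetric])
      finally show ?thesis using scale_le[OF x, of c] by simp
    qed
    assume y: "y \<in> vecs ?S"
    show "x + y \<in> vecs ?S" "nrm ?S (x + y) \<le> nrm ?S x + nrm ?S y" using add_le[OF x y] by auto
    show "scal ?S c (x + y) = scal ?S c x + scal ?S c y"
    proof
      show "scal ?S c (x + y) j = (scal ?S c x + scal ?S c y) j" for j
        using normed_nspace.scal_add[OF X xj] xo off direct_sum_vecsD[OF y] by (cases "j \<in> J") (auto simp: sc)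
    qed
  qed (use zero in auto)
qed

lemma normed_scalar_space: "normed_nspace (scalar_space :: ('k::real_normed_field, 'k) nspace)"
  by standard (auto simp: scalar_space_def algebra_simps norm_mult norm_triangle_ineq)

lemma linf_norm_le_iff:
  assumes "1 \<le> n"
  shows "nrm (linf_space n) x \<le> c \<longleftrightarrow> (\<forall>i<n. norm (x i) \<le> c)"
  using assms by (auto simp: linf_space_def lessThan_empty_iff)

lemma linf_coord_le: "i < n \<Longrightarrow> norm (x i) \<le> nrm (linf_space n) x"
  using linf_norm_le_iff[of n x "nrm (linf_space n) x"] by auto

lemma normed_linf_space:
  assumes n: "1 \<le> n"
  shows "normed_nspace (linf_space n :: ('k::real_normed_field, nat \<Rightarrow> 'k) nspace)"
proof
  fix x y :: "nat \<Rightarrow> 'k" and c d :: 'k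
  let ?X = "linf_space n :: ('k, nat \<Rightarrow> 'k) nspace"
  show "nrm ?X (x + y) \<le> nrm ?X x + nrm ?X y"
    unfolding linf_norm_le_iff[OF n] plus_fun_apply
    by (auto intro!: order_trans[OF norm_triangle_ineq] add_mono linf_coord_le)
  have ge0: "0 \<le> nrm ?X x" using order_trans[OF norm_ge_zero linf_coord_le[of 0 n x]] n by simp
  have le: "nrm ?X (scal ?X c x) \<le> norm c * nrm ?X x" for c x
    unfolding linf_norm_le_iff[OF n]
  proof (intro allI impI)
    fix i assume "i < n"
    then show "norm (scal ?X c x i) \<le> norm c * nrm ?X x"
      using mult_left_mono[OF linf_coord_le[of i n x], of "norm c"] by (simp add: linf_space_def norm_mult)
  qed
  have inv: "scal ?X (inverse c) (scal ?X c x) = x" if "c \<noteq> 0"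
    using that by (simp add: linf_space_def fun_eq_iff)
  show "nrm ?X (scal ?X c x) = norm c * nrm ?X x"
  proof (cases "c = 0")
    case True
    have "0 \<le> nrm ?X (scal ?X c x)"
      using order_trans[OF norm_ge_zero linf_coord_le[of 0 n "scal ?X c x"]] n by simp
    then show ?thesis using True le[of c x] by simp
  next
    case False
    have "norm c * nrm ?X x \<le> norm c * (norm (inverse c) * nrm ?X (scal ?X c x))"
      using le[of "inverse c" "scal ?X c x"] inv[OF False] by (intro mult_left_mono) auto
    also have "\<dots> = nrm ?X (scal ?X c x)" using False by (simp add: norm_inverse mult.assoc[symmetric])
    finally show ?thesis using le[of c x] by simp
  qed
  show "x = 0" if "x \<in> vecs ?X" "nrm ?X x = 0"
  proof
    show "x i = 0 i" for i
      using that linf_coord_le[of i n x] by (cases "i < n") (auto simp: linf_space_def)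
  qed
qed (auto simp: linf_space_def algebra_simps fun_eq_iff)

lemma sum_le_by_injection:
  fixes f h :: "_ \<Rightarrow> real"
  assumes "finite F" "inj_on \<phi> {i\<in>F. f i \<noteq> 0}" "\<phi> ` {i\<in>F. f i \<noteq> 0} \<subseteq> S"
    and "\<And>i. \<lbrakk>i \<in> F; f i \<noteq> 0\<rbrakk> \<Longrightarrow> f i \<le> h (\<phi> i)"
    and "\<And>F'. \<lbrakk>finite F'; F' \<subseteq> S\<rbrakk> \<Longrightarrow> (\<Sum>j\<in>F'. h j) \<le> D"
  shows "(\<Sum>i\<in>F. f i) \<le> D"
proof -
  have "(\<Sum>i\<in>F. f i) = (\<Sum>i\<in>{i\<in>F. f i \<noteq> 0}. f i)"
    using assms(1) by (intro sum.mono_neutral_right) auto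
  also have "\<dots> \<le> (\<Sum>i\<in>{i\<in>F. f i \<noteq> 0}. h (\<phi> i))" using assms(4) by (intro sum_mono) auto
  also have "\<dots> = (\<Sum>j\<in>\<phi> ` {i\<in>F. f i \<noteq> 0}. h j)" using assms(2) by (simp add: sum.reindex)
  also have "\<dots> \<le> D" using assms by (intro assms(5)) auto
  finally show ?thesis .
qed

context james_setting
begin

abbreviation L :: "('k, nat \<Rightarrow> 'k) nspace" where "L \<equiv> lp_space p"
abbreviation G :: "('k, nat \<Rightarrow> nat \<Rightarrow> 'k) nspace" where "G \<equiv> G_space p"

lemma normed_L: "normed_nspace L"
  unfolding lp_space_def using p1 by (intro normed_direct_sum normed_scalar_space) auto

lemma normed_G: "normed_nspace G"
  unfolding G_space_def using p1 by (intro normed_direct_sum normed_linf_space) (auto simp: linf_space_def)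

sublocale L: normed_nspace L by (rule normed_L)
sublocale G: normed_nspace G by (rule normed_G)
sublocale JL: normed_pair J L ..
sublocale LJ: normed_pair L J ..
sublocale JG: normed_pair J G ..
sublocale GJ: normed_pair G J ..
sublocale LG: normed_pair L G ..
sublocale GL: normed_pair G L ..

lemma scal_L: "scal L c x = (\<lambda>i. c * x i)"
  by (simp add: lp_space_def direct_sum_def scalar_space_def)

lemma scal_G: "scal G c g = (\<lambda>\<kappa> l. c * g \<kappa> l)"
  by (simp add: G_space_def direct_sum_def linf_space_def)

lemma L_upper: "\<lbrakk>x \<in> vecs L; finite F\<rbrakk> \<Longrightarrow> (\<Sum>i\<in>F. norm (x i) powr p) \<le> nrm L x powr p"
  using direct_sum_upper[of x p UNIV "\<lambda>_. scalar_space" F] p1 by (simp add: lp_space_def scalar_space_def)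

lemma L_boundI:
  assumes "0 \<le> C" "\<And>F. finite F \<Longrightarrow> (\<Sum>i\<in>F. norm (x i) powr p) \<le> C powr p"
  shows "x \<in> vecs L" "nrm L x \<le> C"
  using direct_sum_boundI[of UNIV x "\<lambda>_. scalar_space" C p] assms p1
  by (simp_all add: lp_space_def scalar_space_def)

text \<open>The norm of component \<open>\<kappa>\<close>, extended by 0 to the component \<open>\<kappa> = 0\<close>, which does not belong to \<open>G\<^sub>p\<close>.\<close>

definition bnorm :: "(nat \<Rightarrow> nat \<Rightarrow> 'k) \<Rightarrow> nat \<Rightarrow> real" where
  "bnorm g \<kappa> = (if 1 \<le> \<kappa> then nrm (linf_space \<kappa> :: ('k, nat \<Rightarrow> 'k) nspace) (g \<kappa>) else 0)"

lemma bnorm_coord_le: "l < \<kappa> \<Longrightarrow> norm (g \<kappa> l) \<le> bnorm g \<kappa>"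
  by (simp add: bnorm_def linf_coord_le)

lemma bnorm_le: "\<lbrakk>0 \<le> c; \<And>l. l < \<kappa> \<Longrightarrow> norm (g \<kappa> l) \<le> c\<rbrakk> \<Longrightarrow> bnorm g \<kappa> \<le> c"
  by (simp add: bnorm_def linf_norm_le_iff)

lemma bnorm_nonneg: "0 \<le> bnorm g \<kappa>"
  using order_trans[OF norm_ge_zero linf_coord_le[of 0 \<kappa> "g \<kappa>"]] by (simp add: bnorm_def)

lemma G_off: "\<lbrakk>g \<in> vecs G; \<kappa> \<le> l\<rbrakk> \<Longrightarrow> g \<kappa> l = 0"
  using direct_sum_vecsD[of g p "{1..}" linf_space \<kappa>]
  by (cases "1 \<le> \<kappa>") (auto simp: G_space_def linf_space_def)

lemma G_upper:
  assumes g: "g \<in> vecs G" and F: "finite F"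
  shows "(\<Sum>\<kappa>\<in>F. bnorm g \<kappa> powr p) \<le> nrm G g powr p"
proof -
  have "(\<Sum>\<kappa>\<in>F. bnorm g \<kappa> powr p) = (\<Sum>\<kappa>\<in>F \<inter> {1..}. nrm (linf_space \<kappa> :: ('k, nat \<Rightarrow> 'k) nspace) (g \<kappa>) powr p)"
    using F p1 by (intro sum.mono_neutral_cong_right) (auto simp: bnorm_def)
  also have "\<dots> \<le> nrm G g powr p"
    using direct_sum_upper[of g p "{1..}" linf_space "F \<inter> {1..}"] g F p1 by (simp add: G_space_def)
  finally show ?thesis .
qed

lemma G_boundI:
  assumes off: "\<And>\<kappa> l. \<kappa> \<le> l \<Longrightarrow> g \<kappa> l = 0" and C: "0 \<le> C"
    and y: "\<And>\<kappa> l. l < \<kappa> \<Longrightarrow> norm (g \<kappa> l) \<le> y \<kappa>" "\<And>\<kappa>. 0 \<le> y \<kappa>"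
    and le: "\<And>F. finite F \<Longrightarrow> (\<Sum>\<kappa>\<in>F. y \<kappa> powr p) \<le> C powr p"
  shows "g \<in> vecs G" "nrm G g \<le> C"
proof -
  have "(\<Sum>\<kappa>\<in>F. nrm (linf_space \<kappa> :: ('k, nat \<Rightarrow> 'k) nspace) (g \<kappa>) powr p) \<le> C powr p"
    if F: "finite F" "F \<subseteq> {1..}" for F
  proof -
    have "(\<Sum>\<kappa>\<in>F. nrm (linf_space \<kappa> :: ('k, nat \<Rightarrow> 'k) nspace) (g \<kappa>) powr p) = (\<Sum>\<kappa>\<in>F. bnorm g \<kappa> powr p)"
      using F by (intro sum.cong) (auto simp: bnorm_def)
    also have "\<dots> \<le> (\<Sum>\<kappa>\<in>F. y \<kappa> powr p)"
      using y p1 by (intro sum_mono powr_mono2 bnorm_le) (auto simp: bnorm_nonneg)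
    finally show ?thesis using le[OF F(1)] by simp
  qed
  moreover have "g 0 = 0" using off by (auto simp: fun_eq_iff)
  ultimately show "g \<in> vecs G" "nrm G g \<le> C"
    using direct_sum_boundI[of "{1..}" g linf_space C p] off C p1
    by (auto simp: G_space_def linf_space_def not_less_eq_eq)
qed

subsection \<open>\<open>\<ell>\<^sub>p\<close> and \<open>G\<^sub>p\<close> are isomorphic to their squares, and \<open>G\<^sub>p\<close> contains \<open>\<ell>\<^sub>p\<close>\<close>

text \<open>Moving components injectively to other positions, with entries cut off or filled up by zeros according to the
  dimensions, does not increase the norm.\<close>

lemma G_reindex:
  assumes g: "g \<in> vecs G"
    and off: "\<And>\<kappa> l. \<kappa> \<le> l \<Longrightarrow> g' \<kappa> l = 0"
    and le: "\<And>\<kappa>. bnorm g' \<kappa> \<noteq> 0 \<Longrightarrow> bnorm g' \<kappa> \<le> bnorm g (\<phi> \<kappa>)"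
    and inj: "inj_on \<phi> {\<kappa>. bnorm g' \<kappa> \<noteq> 0}"
  shows "g' \<in> vecs G" "nrm G g' \<le> nrm G g"
proof -
  have "(\<Sum>\<kappa>\<in>F. bnorm g' \<kappa> powr p) \<le> nrm G g powr p" if F: "finite F" for F
  proof (rule sum_le_by_injection[where \<phi> = \<phi> and S = UNIV and h = "\<lambda>\<kappa>. bnorm g \<kappa> powr p"])
    show "inj_on \<phi> {\<kappa>\<in>F. bnorm g' \<kappa> powr p \<noteq> 0}" using inj by (auto simp: inj_on_def)
    show "bnorm g' \<kappa> powr p \<le> bnorm g (\<phi> \<kappa>) powr p" if "bnorm g' \<kappa> powr p \<noteq> 0" for \<kappa>
      using that p1 le bnorm_nonneg by (intro powr_mono2) auto
    show "(\<Sum>j\<in>F'. bnorm g j powr p) \<le> nrm G g powr p" if "finite F'" for F'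
      using that by (rule G_upper[OF g])
  qed (use F in auto)
  then show "g' \<in> vecs G" "nrm G g' \<le> nrm G g"
    using G_boundI[of g' "nrm G g" "bnorm g'"] off bnorm_coord_le bnorm_nonneg G.nrm_ge_0[OF g] by auto
qed

lemma L_reindex:
  assumes x: "x \<in> vecs L"
    and le: "\<And>i. x' i \<noteq> 0 \<Longrightarrow> norm (x' i) \<le> norm (x (\<phi> i))"
    and inj: "inj_on \<phi> {i. x' i \<noteq> 0}"
  shows "x' \<in> vecs L" "nrm L x' \<le> nrm L x"
proof -
  have "(\<Sum>i\<in>F. norm (x' i) powr p) \<le> nrm L x powr p" if F: "finite F" for F
  proof (rule sum_le_by_injection[where \<phi> = \<phi> and S = UNIV and h = "\<lambda>i. norm (x i) powr p"])
    show "inj_on \<phi> {i\<in>F. norm (x' i) powr p \<noteq> 0}" using inj by (auto simp: inj_on_def)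
    show "norm (x' i) powr p \<le> norm (x (\<phi> i)) powr p" if "norm (x' i) powr p \<noteq> 0" for i
      using that p1 le by (intro powr_mono2) auto
    show "(\<Sum>j\<in>F'. norm (x j) powr p) \<le> nrm L x powr p" if "finite F'" for F'
      using that by (rule L_upper[OF x])
  qed (use F in auto)
  then show "x' \<in> vecs L" "nrm L x' \<le> nrm L x"
    using L_boundI[of "nrm L x" x'] L.nrm_ge_0[OF x] by auto
qed

lemma factor_L_op_ideal: "op_ideal J (factor_ops L J)"
proof -
  define U :: "nat \<Rightarrow> (nat \<Rightarrow> 'k) \<Rightarrow> nat \<Rightarrow> 'k" where "U = (\<lambda>r x i. if i mod 2 = r then x (i div 2) else 0)"
  define V :: "nat \<Rightarrow> (nat \<Rightarrow> 'k) \<Rightarrow> nat \<Rightarrow> 'k" where "V = (\<lambda>r x i. x (2 * i + r))"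
  have U: "U r x \<in> vecs L \<and> nrm L (U r x) \<le> nrm L x" if x: "x \<in> vecs L" for r x
  proof -
    have "inj_on (\<lambda>i. i div 2) {i. U r x i \<noteq> 0}"
    proof (rule inj_onI)
      fix i j :: nat
      assume ij: "i \<in> {i. U r x i \<noteq> 0}" "j \<in> {i. U r x i \<noteq> 0}" "i div 2 = j div 2"
      then have "i mod 2 = j mod 2" by (auto simp: U_def split: if_splits)
      then show "i = j" using ij(3) by (metis div_mult_mod_eq)
    qed
    then show ?thesis using L_reindex[OF x, of "U r x" "\<lambda>i. i div 2"] by (auto simp: U_def)
  qed
  have V: "V r x \<in> vecs L \<and> nrm L (V r x) \<le> nrm L x" if x: "x \<in> vecs L" for r x
    using L_reindex[OF x, of "V r x" "\<lambda>i. 2 * i + r"] by (auto simp: V_def inj_on_def)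
  have UB: "restrict_op L (U r) \<in> bounded_ops L L" for r
    by (rule L.restrict_op_bounded[where C = 1]) (use U in \<open>auto simp: U_def scal_L fun_eq_iff\<close>)
  have VB: "restrict_op L (V r) \<in> bounded_ops L L" for r
    by (rule L.restrict_op_bounded[where C = 1]) (use V in \<open>auto simp: V_def scal_L fun_eq_iff\<close>)
  show ?thesis
    by (rule J.factor_op_ideal[OF normed_L UB[of 0] UB[of 1] VB[of 0] VB[of 1]])
      (use U in \<open>auto simp: restrict_op_def U_def V_def fun_eq_iff L.zero_vecs\<close>)
qed

lemma factor_G_op_ideal: "op_ideal J (factor_ops G J)"
proof -
  \<comment> \<open>Component \<open>\<kappa>\<close> is placed into the larger components \<open>2 * \<kappa>\<close> and \<open>2 * \<kappa> + 1\<close>.\<close>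
  define U :: "nat \<Rightarrow> (nat \<Rightarrow> nat \<Rightarrow> 'k) \<Rightarrow> nat \<Rightarrow> nat \<Rightarrow> 'k"
    where "U = (\<lambda>r g \<kappa>. if \<kappa> mod 2 = r then g (\<kappa> div 2) else 0)"
  define V :: "nat \<Rightarrow> (nat \<Rightarrow> nat \<Rightarrow> 'k) \<Rightarrow> nat \<Rightarrow> nat \<Rightarrow> 'k"
    where "V = (\<lambda>r g \<kappa> l. if l < \<kappa> then g (2 * \<kappa> + r) l else 0)"
  have U: "U r g \<in> vecs G \<and> nrm G (U r g) \<le> nrm G g" if g: "g \<in> vecs G" for r g
  proof -
    have b: "bnorm (U r g) \<kappa> \<le> (if \<kappa> mod 2 = r then bnorm g (\<kappa> div 2) else 0)" for \<kappa>
    proof (rule bnorm_le)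
      fix l
      show "norm (U r g \<kappa> l) \<le> (if \<kappa> mod 2 = r then bnorm g (\<kappa> div 2) else 0)"
        using bnorm_coord_le[of l "\<kappa> div 2" g] G_off[OF g, of "\<kappa> div 2" l] bnorm_nonneg[of g "\<kappa> div 2"]
        by (cases "l < \<kappa> div 2") (auto simp: U_def)
    qed (simp add: bnorm_nonneg)
    have inj: "inj_on (\<lambda>\<kappa>. \<kappa> div 2) {\<kappa>. bnorm (U r g) \<kappa> \<noteq> 0}"
    proof (rule inj_onI)
      fix i j :: nat
      assume ij: "i \<in> {\<kappa>. bnorm (U r g) \<kappa> \<noteq> 0}" "j \<in> {\<kappa>. bnorm (U r g) \<kappa> \<noteq> 0}" "i div 2 = j div 2"
      then have "i mod 2 = j mod 2"
        using b[of i] b[of j] bnorm_nonneg[of "U r g" i] bnorm_nonneg[of "U r g" j] by (auto split: if_splits)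
      then show "i = j" using ij(3) by (metis div_mult_mod_eq)
    qed
    have off: "U r g \<kappa> l = 0" if "\<kappa> \<le> l" for \<kappa> l
      using that G_off[OF g, of "\<kappa> div 2" l] by (simp add: U_def)
    have le: "bnorm (U r g) \<kappa> \<le> bnorm g (\<kappa> div 2)" for \<kappa>
      using b[of \<kappa>] bnorm_nonneg[of g "\<kappa> div 2"] by (auto split: if_splits)
    show ?thesis using G_reindex[OF g off le inj] by blast
  qed
  have V: "V r g \<in> vecs G \<and> nrm G (V r g) \<le> nrm G g" if g: "g \<in> vecs G" for r g
  proof -
    have le: "bnorm (V r g) \<kappa> \<le> bnorm g (2 * \<kappa> + r)" for \<kappa>
      by (intro bnorm_le bnorm_nonneg) (simp add: V_def bnorm_coord_le)
    have inj: "inj_on (\<lambda>\<kappa>. 2 * \<kappa> + r) {\<kappa>. bnorm (V r g) \<kappa> \<noteq> 0}" by (auto simp: inj_on_def)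
    show ?thesis using G_reindex[OF g _ le inj] by (auto simp: V_def)
  qed
  have UB: "restrict_op G (U r) \<in> bounded_ops G G" for r
    by (rule G.restrict_op_bounded[where C = 1]) (use U in \<open>auto simp: U_def scal_G fun_eq_iff\<close>)
  have VB: "restrict_op G (V r) \<in> bounded_ops G G" for r
    by (rule G.restrict_op_bounded[where C = 1]) (use V in \<open>auto simp: V_def scal_G fun_eq_iff\<close>)
  have VU: "V r (U r g) = g" if "g \<in> vecs G" "r < 2" for r g
    using that G_off[OF that(1)] by (auto simp: V_def U_def fun_eq_iff)
  have VU0: "V r (U s g) = 0" if "r \<noteq> s" "r < 2" for r s g
    using that by (auto simp: V_def U_def fun_eq_iff)
  show ?thesis
    by (rule J.factor_op_ideal[OF normed_G UB[of 0] UB[of 1] VB[of 0] VB[of 1]])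
      (use U VU VU0 in \<open>auto simp: restrict_op_def\<close>)
qed

definition LtoG :: "(nat \<Rightarrow> 'k) \<Rightarrow> nat \<Rightarrow> nat \<Rightarrow> 'k" where
  "LtoG = restrict_op L (\<lambda>x \<kappa> l. if 1 \<le> \<kappa> \<and> l = 0 then x (\<kappa> - 1) else 0)"

definition GtoL :: "(nat \<Rightarrow> nat \<Rightarrow> 'k) \<Rightarrow> nat \<Rightarrow> 'k" where
  "GtoL = restrict_op G (\<lambda>g i. g (Suc i) 0)"

lemma LtoG_bounded: "LtoG \<in> bounded_ops L G"
  unfolding LtoG_def
proof (rule L.restrict_op_bounded[where C = 1])
  fix x assume x: "x \<in> vecs L"
  define g where "g = (\<lambda>\<kappa> (l::nat). if 1 \<le> \<kappa> \<and> l = 0 then x (\<kappa> - 1) else 0 :: 'k)"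
  define y where "y = (\<lambda>\<kappa>. if 1 \<le> \<kappa> then norm (x (\<kappa> - 1)) else 0)"
  have le: "(\<Sum>\<kappa>\<in>F. y \<kappa> powr p) \<le> nrm L x powr p" if F: "finite F" for F
  proof (rule sum_le_by_injection[where \<phi> = "\<lambda>\<kappa>. \<kappa> - 1" and S = UNIV and h = "\<lambda>i. norm (x i) powr p"])
    have pos: "1 \<le> \<kappa>" if "y \<kappa> powr p \<noteq> 0" for \<kappa> using that by (auto simp: y_def split: if_splits)
    show "inj_on (\<lambda>\<kappa>. \<kappa> - 1) {\<kappa>\<in>F. y \<kappa> powr p \<noteq> 0}"
    proof (rule inj_onI)
      fix i j assume "i \<in> {\<kappa>\<in>F. y \<kappa> powr p \<noteq> 0}" "j \<in> {\<kappa>\<in>F. y \<kappa> powr p \<noteq> 0}" "i - 1 = j - 1"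
      then show "i = j" using pos[of i] pos[of j] by simp
    qed
    show "(\<Sum>i\<in>F'. norm (x i) powr p) \<le> nrm L x powr p" if "finite F'" for F' using that by (rule L_upper[OF x])
  qed (use F in \<open>auto simp: y_def\<close>)
  have off: "g \<kappa> l = 0" if "\<kappa> \<le> l" for \<kappa> l using that by (auto simp: g_def)
  have gy: "norm (g \<kappa> l) \<le> y \<kappa>" "0 \<le> y \<kappa>" for \<kappa> l by (simp_all add: g_def y_def)
  show "(\<lambda>\<kappa> l. if 1 \<le> \<kappa> \<and> l = 0 then x (\<kappa> - 1) else 0) \<in> vecs G"
    "nrm G (\<lambda>\<kappa> l. if 1 \<le> \<kappa> \<and> l = 0 then x (\<kappa> - 1) else 0) \<le> 1 * nrm L x"
    unfolding g_def[symmetric] mult_1 by (rule G_boundI[OF off L.nrm_ge_0[OF x] gy le]; simp)+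
qed (auto simp: scal_L scal_G fun_eq_iff)

lemma GtoL_bounded: "GtoL \<in> bounded_ops G L"
  unfolding GtoL_def
proof (rule G.restrict_op_bounded[where C = 1])
  fix g assume g: "g \<in> vecs G"
  let ?x = "\<lambda>i. g (Suc i) 0"
  have "(\<Sum>i\<in>F. norm (?x i) powr p) \<le> nrm G g powr p" if "finite F" for F
    by (rule sum_le_by_injection[where \<phi> = Suc and S = UNIV and h = "\<lambda>\<kappa>. bnorm g \<kappa> powr p"])
      (use that G_upper[OF g] bnorm_coord_le p1 in \<open>auto intro!: powr_mono2\<close>)
  then show "?x \<in> vecs L" "nrm L ?x \<le> 1 * nrm G g"
    using L_boundI[of "nrm G g" ?x] G.nrm_ge_0[OF g] by auto
qed (auto simp: scal_L scal_G fun_eq_iff)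

lemma GtoL_LtoG: "x \<in> vecs L \<Longrightarrow> GtoL (LtoG x) = x"
  using bounded_ops_vecs[OF LtoG_bounded, of x] by (simp add: GtoL_def) (simp add: LtoG_def)

lemma factor_L_subset_factor_G: "factor_ops L J \<subseteq> factor_ops G J"
proof
  fix P assume "P \<in> factor_ops L J"
  then obtain S T where P: "P = S \<circ> T" "T \<in> bounded_ops J L" "S \<in> bounded_ops L J"
    by (auto simp: factor_ops_def)
  have "P = (S \<circ> GtoL) \<circ> (LtoG \<circ> T)"
  proof
    fix x
    show "P x = ((S \<circ> GtoL) \<circ> (LtoG \<circ> T)) x"
      using P bounded_ops_vecs[OF P(2), of x] bounded_ops_off[OF P(2), of x] GtoL_LtoG L.zero_vecs
      by (cases "x \<in> vecs J") auto
  qed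
  moreover have "S \<circ> GtoL \<in> bounded_ops G J" "LtoG \<circ> T \<in> bounded_ops J G"
    using bounded_ops_comp(1)[OF normed_G normed_L normed_james P(3) GtoL_bounded]
      bounded_ops_comp(1)[OF normed_james normed_L normed_G LtoG_bounded P(2)] by auto
  ultimately show "P \<in> factor_ops G J" unfolding factor_ops_def by blast
qed

end

section \<open>A complemented copy of \<open>G\<^sub>p\<close> in the James space\<close>

text \<open>Block \<open>n\<close> consists of the \<open>2 ^ n + 1\<close> indices from \<open>blk_off n\<close> to \<open>blk_off n + 2 ^ n\<close>: both end points of a
  grid of \<open>2 ^ n\<close> intervals are included.\<close>

primrec blk_off :: "nat \<Rightarrow> nat" where
  "blk_off 0 = 0"
| "blk_off (Suc n) = blk_off n + 2 ^ n + 1"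

definition blk :: "nat \<Rightarrow> nat" where
  "blk i = (LEAST n. i < blk_off (Suc n))"

lemma blk_off_strict_mono: "strict_mono blk_off"
  by (simp add: strict_mono_Suc_iff)

lemma le_blk_off: "n \<le> blk_off n"
  by (induction n) auto

lemma blk_eqI:
  assumes "blk_off n \<le> i" "i \<le> blk_off n + 2 ^ n"
  shows "blk i = n"
  unfolding blk_def
proof (rule Least_equality)
  show "i < blk_off (Suc n)" using assms by simp
  fix m assume m: "i < blk_off (Suc m)"
  show "n \<le> m"
  proof (rule ccontr)
    assume "\<not> n \<le> m"
    then have "blk_off (Suc m) \<le> blk_off n"
      using strict_mono_less_eq[OF blk_off_strict_mono, of "Suc m" n] by simp
    then show False using m assms by simp
  qed
qed

lemma blk_bounds: "blk_off (blk i) \<le> i" "i \<le> blk_off (blk i) + 2 ^ blk i"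
proof -
  have "i < blk_off (Suc i)" using le_blk_off[of "Suc i"] by simp
  then have *: "i < blk_off (Suc (blk i))" unfolding blk_def by (rule LeastI)
  then show "i \<le> blk_off (blk i) + 2 ^ blk i" by simp
  show "blk_off (blk i) \<le> i"
  proof (cases "blk i")
    case (Suc m)
    then have "\<not> i < blk_off (Suc m)" using not_less_Least[of m "\<lambda>n. i < blk_off (Suc n)"] by (simp add: blk_def)
    then show ?thesis using Suc by simp
  qed simp
qed

lemma blk_eq_iff: "blk i = n \<longleftrightarrow> blk_off n \<le> i \<and> i \<le> blk_off n + 2 ^ n"
  using blk_eqI blk_bounds by blast

lemma mono_blk: "mono blk"
proof (rule monoI)
  fix i j :: nat assume ij: "i \<le> j"
  show "blk i \<le> blk j"
  proof (rule ccontr)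
    assume "\<not> blk i \<le> blk j"
    then have "blk_off (Suc (blk j)) \<le> blk_off (blk i)"
      using strict_mono_less_eq[OF blk_off_strict_mono, of "Suc (blk j)" "blk i"] by simp
    then show False using blk_bounds[of i] blk_bounds[of j] ij by simp
  qed
qed

lemma filterlim_blk: "filterlim blk at_top sequentially"
  unfolding filterlim_at_top
proof
  fix n
  have "n \<le> blk i" if "blk_off n \<le> i" for i
    using that monoD[OF mono_blk that] blk_eqI[of n "blk_off n"] by simp
  then show "eventually (\<lambda>i. n \<le> blk i) sequentially" by (auto simp: eventually_sequentially)
qed

abbreviation blk_end :: "nat \<Rightarrow> nat" where
  "blk_end i \<equiv> blk_off (blk i) + 2 ^ blk i"

lemma blk_blk_end: "blk (blk_end i) = blk i"
  by (rule blk_eqI) auto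

subsection \<open>Tent functions\<close>

text \<open>\<open>tent h s\<close> is the distance from \<open>s\<close> to the nearest multiple of \<open>2 * h\<close>, divided by \<open>h\<close>.\<close>

definition tent :: "nat \<Rightarrow> nat \<Rightarrow> real" where
  "tent h s = real (min (s mod (2 * h)) (2 * h - s mod (2 * h))) / real h"

lemma tent_up: "\<lbrakk>0 < h; u \<le> h\<rbrakk> \<Longrightarrow> tent h (k * (2 * h) + u) = real u / real h"
  by (auto simp: tent_def)

lemma tent_down: "\<lbrakk>0 < h; h \<le> u; u \<le> 2 * h\<rbrakk> \<Longrightarrow> tent h (k * (2 * h) + u) = real (2 * h - u) / real h"
  by (cases "u = 2 * h") (auto simp: tent_def)

lemma tent_multiple: "0 < h \<Longrightarrow> tent h (k * (2 * h)) = 0"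
  using tent_up[of h 0 k] by simp

lemma tent_nonneg: "0 \<le> tent h s"
  by (simp add: tent_def)

lemma tent_le_1: "tent h s \<le> 1"
  by (cases "h = 0") (auto simp: tent_def min_def)

lemma tent_diff_le_1: "\<bar>tent h s - tent h t\<bar> \<le> 1"
  using tent_nonneg[of h s] tent_nonneg[of h t] tent_le_1[of h s] tent_le_1[of h t] by linarith

lemma tent_decompose:
  fixes s :: nat
  assumes "0 < h"
  obtains k u where "s = k * (2 * h) + u" "u < 2 * h"
proof (rule that)
  show "s = s div (2 * h) * (2 * h) + s mod (2 * h)" by (simp only: div_mult_mod_eq)
qed (use assms in simp)

lemma tent_Suc:
  assumes h: "0 < h"
  shows "\<bar>tent h (Suc s) - tent h s\<bar> \<le> 1 / real h"
proof -
  obtain k u where s: "s = k * (2 * h) + u" "u < 2 * h" using tent_decompose[OF h] .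
  show ?thesis
  proof (cases "u < h")
    case True
    then have "tent h s = real u / real h" "tent h (Suc s) = real (Suc u) / real h"
      using tent_up[OF h, of u k] tent_up[OF h, of "Suc u" k] s by auto
    then show ?thesis by (simp flip: diff_divide_distrib)
  next
    case False
    then have "tent h s = real (2 * h - u) / real h" "tent h (Suc s) = real (2 * h - Suc u) / real h"
      using tent_down[OF h, of u k] tent_down[OF h, of "Suc u" k] s by auto
    then have "tent h (Suc s) - tent h s = - 1 / real h"
      using s(2) h by (simp add: of_nat_diff field_simps)
    then show ?thesis by simp
  qed
qed

lemma tent_lipschitz:
  assumes h: "0 < h" and "s \<le> t"
  shows "\<bar>tent h t - tent h s\<bar> \<le> real (t - s) / real h"
  using assms(2)
proof (induction t rule: dec_induct)
  case (step t)
  have "\<bar>tent h (Suc t) - tent h s\<bar> \<le> \<bar>tent h (Suc t) - tent h t\<bar> + \<bar>tent h t - tent h s\<bar>" by simp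
  also have "\<dots> \<le> 1 / real h + real (t - s) / real h" using tent_Suc[OF h, of t] step by simp
  also have "\<dots> = real (Suc t - s) / real h" using step by (simp add: Suc_diff_le add_divide_distrib)
  finally show ?case .
qed simp

text \<open>Second differences over grid intervals of length \<open>2 * w\<close> are biorthogonal to the tents of all dyadic widths. On
  wider tents they vanish because these are affine there, on narrower tents because all three nodes are
  zeros of the tent.\<close>

definition diff2 :: "nat \<Rightarrow> nat \<Rightarrow> (nat \<Rightarrow> 'a::comm_ring_1) \<Rightarrow> 'a" where
  "diff2 w s x = 2 * x (s + w) - x s - x (s + 2 * w)"

lemma diff2_tent_coarse:
  assumes w: "0 < w" and h: "h = c * (2 * w)" and s: "s = m * (2 * w)" and c: "0 < c"
  shows "diff2 w s (tent h) = 0"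
proof -
  have h0: "0 < h" using assms by simp
  define k where "k = m div (2 * c)"
  define r where "r = m mod (2 * c)"
  have m: "m = k * (2 * c) + r" "r < 2 * c" using c by (simp_all only: k_def r_def div_mult_mod_eq) simp
  define u where "u = r * (2 * w)"
  have sk: "s = k * (2 * h) + u" by (simp add: s m(1) h u_def algebra_simps)
  have e: "s + w = k * (2 * h) + (u + w)" "s + 2 * w = k * (2 * h) + (u + 2 * w)" using sk by auto
  show ?thesis
  proof (cases "r < c")
    case True
    then have "Suc r * (2 * w) \<le> c * (2 * w)" by (intro mult_right_mono) auto
    then have "u + 2 * w \<le> h" by (simp add: u_def h)
    then show ?thesis
      using tent_up[OF h0, of u k] tent_up[OF h0, of "u + w" k] tent_up[OF h0, of "u + 2 * w" k]
      by (simp add: diff2_def e sk[symmetric] add_divide_distrib)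
  next
    case False
    then have "c * (2 * w) \<le> r * (2 * w)" by (intro mult_right_mono) auto
    moreover have "Suc r * (2 * w) \<le> (2 * c) * (2 * w)" using m(2) by (intro mult_right_mono) auto
    ultimately have b: "h \<le> u" "u + 2 * w \<le> 2 * h" by (simp_all add: u_def h)
    then show ?thesis
      using tent_down[OF h0, of u k] tent_down[OF h0, of "u + w" k] tent_down[OF h0, of "u + 2 * w" k]
      by (simp add: diff2_def e sk[symmetric] of_nat_diff) (simp add: field_simps h0)
  qed
qed

lemma diff2_tent_same:
  assumes "0 < w"
  shows "diff2 w (k * (2 * w)) (tent w) = 2"
  using tent_up[OF assms, of w k] tent_multiple[OF assms, of k] tent_multiple[OF assms, of "Suc k"] assms
  by (simp add: diff2_def algebra_simps)

lemma diff2_tent_fine: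
  assumes h: "0 < h" and w: "w = c * (2 * h)"
  shows "diff2 w (k * (2 * w)) (tent h) = 0"
proof -
  have "k * (2 * w) = (k * 2 * c) * (2 * h)" "k * (2 * w) + w = (k * 2 * c + c) * (2 * h)"
    "k * (2 * w) + 2 * w = (k * 2 * c + 2 * c) * (2 * h)"
    by (simp_all add: w algebra_simps)
  then show ?thesis using tent_multiple[OF h] unfolding diff2_def by (metis diff_self mult_zero_right)
qed

lemma diff2_tent:
  assumes "i < n" "j < n"
  shows "diff2 (2 ^ (n - Suc i)) (k * 2 ^ (n - i)) (tent (2 ^ (n - Suc j))) = (if i = j then 2 else 0)"
proof -
  have two: "(2::nat) ^ (n - i) = 2 * 2 ^ (n - Suc i)" using assms
    by (metis Suc_diff_Suc power_Suc)
  have pw: "(2::nat) ^ (n - Suc a) = 2 ^ (b - Suc a) * (2 * 2 ^ (n - Suc b))" if "a < b" "b < n" for a b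
  proof -
    have "n - Suc a = (b - Suc a) + Suc (n - Suc b)" using that by simp
    then show ?thesis by (metis power_add power_Suc)
  qed
  consider "i = j" | "j < i" | "i < j" by linarith
  then show ?thesis
  proof cases
    case 1
    then show ?thesis using diff2_tent_same[of "2 ^ (n - Suc i)" k] unfolding 1[symmetric] two by simp
  next
    case 2
    then show ?thesis
      using diff2_tent_coarse[of "2 ^ (n - Suc i)" _ _ _ k] pw[OF 2 assms(1)] by (simp add: two)
  next
    case 3
    then show ?thesis
      using diff2_tent_fine[of "2 ^ (n - Suc j)" _ _ k] pw[OF 3 assms(2)] by (simp add: two)
  qed
qed

lemma sum_powr2_less: "\<lbrakk>(0::real) < \<theta>; i \<le> m\<rbrakk> \<Longrightarrow>
    (\<Sum>j<i. 2 powr (\<theta> * real j)) \<le> 2 powr (\<theta> * real m) / (2 powr \<theta> - 1)"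
proof -
  assume \<theta>: "0 < \<theta>" and im: "i \<le> m"
  define r :: real where "r = 2 powr \<theta>"
  have r: "1 < r" using \<theta> by (simp add: r_def)
  have "2 powr (\<theta> * real j) = r ^ j" for j
    by (simp add: r_def powr_powr[symmetric] powr_realpow)
  then have "(\<Sum>j<i. 2 powr (\<theta> * real j)) = (\<Sum>j<i. r ^ j)" by simp
  also have "\<dots> = (r ^ i - 1) / (r - 1)" using r by (intro geometric_sum) auto
  also have "\<dots> \<le> r ^ m / (r - 1)"
    using r im by (intro divide_right_mono) (auto intro: order_trans[OF _ power_increasing[OF im]])
  also have "r ^ m = 2 powr (\<theta> * real m)"
    by (simp add: r_def powr_powr[symmetric] powr_realpow)
  finally show ?thesis by (simp add: r_def)
qed

lemma sum_powr2_tail: "(0::real) < \<theta> \<Longrightarrow>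
    (\<Sum>j=i..<n. 2 powr (- \<theta> * real j)) \<le> 2 powr (- \<theta> * real i) / (1 - 2 powr (- \<theta>))"
proof -
  assume \<theta>: "0 < \<theta>"
  define r :: real where "r = 2 powr (- \<theta>)"
  have r: "0 < r" "r < 1" using \<theta> by (auto simp: r_def powr_less_one)
  have pw: "2 powr (- \<theta> * real j) = r ^ j" for j
    unfolding r_def using powr_powr[of 2 "- \<theta>" "real j"] powr_realpow[of "2 powr (- \<theta>)" j] by simp
  have "(\<Sum>j=i..<n. r ^ j) \<le> r ^ i / (1 - r)"
  proof (cases "i \<le> n")
    case True
    then have "(\<Sum>j=i..<n. r ^ j) = (\<Sum>j<n - i. r ^ (i + j))"
      by (intro sum.reindex_bij_witness[of _ "\<lambda>j. i + j" "\<lambda>j. j - i"]) auto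
    also have "\<dots> = r ^ i * ((r ^ (n - i) - 1) / (r - 1))"
      using r by (simp add: power_add geometric_sum flip: sum_distrib_left)
    also have "(r ^ (n - i) - 1) / (r - 1) = (1 - r ^ (n - i)) / (1 - r)"
      using r by (metis minus_diff_eq minus_divide_divide)
    also have "r ^ i * ((1 - r ^ (n - i)) / (1 - r)) \<le> r ^ i * (1 / (1 - r))"
      using r by (intro mult_left_mono divide_right_mono) auto
    finally show ?thesis by simp
  qed (use r in simp)
  then show ?thesis unfolding pw by (simp add: r_def)
qed

context james_setting
begin

definition holder_const :: real where
  "holder_const = 4 / (2 powr (1 / q) - 1) + 1 / (1 - 2 powr (- (1 / p)))"

lemma holder_const_nonneg: "0 \<le> holder_const"
proof -
  have "1 \<le> 2 powr (1 / q)" using q1 by (simp add: ge_one_powr_ge_zero)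
  moreover have "2 powr (- (1 / p)) \<le> 1" using powr_mono[of "- (1 / p)" 0 2] p1 by simp
  ultimately show ?thesis unfolding holder_const_def by (intro add_nonneg_nonneg divide_nonneg_nonneg) auto
qed

text \<open>An increment at distance \<open>d\<close> of a tent of height \<open>2 powr (- i / p)\<close> is bounded by its slope for wide tents and by
  its height for narrow ones. Both bounds form geometric series that peak where the width is of order \<open>d\<close>. So a series
  of tents of all scales with bounded coefficients, as in Weierstrass's function, is Hoelder continuous with
  exponent \<open>1 / p\<close>.\<close>

lemma tents_holder:
  assumes d: "0 < d" "d \<le> 2 ^ n"
  shows "(\<Sum>i<n. 2 powr (- real i / p) * min 1 (real d / 2 ^ (n - Suc i))) \<le> holder_const * (real d / 2 ^ n) powr (1 / p)"
proof -
  define u where "u = real d / 2 ^ n"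
  have u: "0 < u" "u \<le> 1" using d by (simp_all add: u_def)
  have scale: "real d / 2 ^ (n - Suc i) = 2 * 2 ^ i * u" if "i < n" for i
  proof -
    have "n = Suc i + (n - Suc i)" using that by simp
    then have "(2::real) ^ n = 2 ^ Suc i * 2 ^ (n - Suc i)" by (metis power_add)
    then show ?thesis by (simp add: u_def)
  qed
  define k where "k = (LEAST k. k = n \<or> 1 < 2 ^ k * u)"
  have kex: "k = n \<or> 1 < 2 ^ k * u" unfolding k_def by (rule LeastI[of _ n]) simp
  have kn: "k \<le> n" unfolding k_def by (rule Least_le) simp
  have below: "2 ^ i * u \<le> 1" if "i < k" for i
    using not_less_Least[of i "\<lambda>k. k = n \<or> 1 < 2 ^ k * u"] that by (simp add: k_def not_less)
  have "(\<Sum>i<n. 2 powr (- real i / p) * min 1 (real d / 2 ^ (n - Suc i)))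
      = (\<Sum>i<k. 2 powr (- real i / p) * min 1 (real d / 2 ^ (n - Suc i)))
        + (\<Sum>i=k..<n. 2 powr (- real i / p) * min 1 (real d / 2 ^ (n - Suc i)))"
    using kn by (subst sum.union_disjoint[symmetric]) (auto intro!: sum.cong)
  also have "\<dots> \<le> 4 / (2 powr (1 / q) - 1) * u powr (1 / p) + 1 / (1 - 2 powr (- (1 / p))) * u powr (1 / p)"
  proof (rule add_mono)
    have "(\<Sum>i<k. 2 powr (- real i / p) * min 1 (real d / 2 ^ (n - Suc i))) \<le> (\<Sum>i<k. 2 * u * 2 powr (1 / q * real i))"
    proof (rule sum_mono)
      fix i assume i: "i \<in> {..<k}"
      have e: "real i - real i / p = 1 / q * real i"
      proof -
        have "real i - real i / p = real i * (1 - 1 / p)" by (simp add: right_diff_distrib)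
        also have "1 - 1 / p = 1 / q" using pq by simp
        finally show ?thesis by simp
      qed
      have "2 powr (- real i / p) * min 1 (real d / 2 ^ (n - Suc i)) \<le> 2 powr (- real i / p) * (2 * 2 ^ i * u)"
        using i kn scale[of i] by (intro mult_left_mono) auto
      also have "\<dots> = 2 * u * (2 powr (- real i / p) * 2 powr real i)" by (simp add: powr_realpow)
      also have "2 powr (- real i / p) * 2 powr real i = 2 powr (1 / q * real i)"
        using powr_add[of 2 "- real i / p" "real i"] by (simp only: e[symmetric] minus_divide_left[symmetric] add.commute[of "- (real i / p)"] add_uminus_conv_diff)
      finally show "2 powr (- real i / p) * min 1 (real d / 2 ^ (n - Suc i)) \<le> 2 * u * 2 powr (1 / q * real i)" .
    qed
    also have "\<dots> \<le> 4 / (2 powr (1 / q) - 1) * u powr (1 / p)"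
    proof (cases k)
      case 0
      have "1 \<le> 2 powr (1 / q)" using q1 by (simp add: ge_one_powr_ge_zero)
      then show ?thesis using 0 by simp
    next
      case (Suc m)
      have den: "0 < 2 powr (1 / q) - 1" using q1 by simp
      have "(\<Sum>i<k. 2 * u * 2 powr (1 / q * real i)) \<le> 2 * u * (2 powr (1 / q * real k) / (2 powr (1 / q) - 1))"
        unfolding sum_distrib_left[symmetric] using u q1 by (intro mult_left_mono sum_powr2_less) auto
      also have "2 powr (1 / q * real k) \<le> 2 * u powr (- (1 / q))"
      proof -
        have "2 powr real k \<le> 2 / u" using below[of m] Suc u by (simp add: field_simps powr_realpow[symmetric] powr_add)
        then have "(2 powr real k) powr (1 / q) \<le> (2 / u) powr (1 / q)" using q1 by (intro powr_mono2) auto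
        also have "\<dots> = 2 powr (1 / q) * u powr (- (1 / q))" using u by (simp add: powr_divide powr_minus_divide)
        also have "\<dots> \<le> 2 powr 1 * u powr (- (1 / q))" using q1 by (intro mult_right_mono powr_mono) auto
        finally show ?thesis by (simp add: powr_powr mult.commute)
      qed
      then have "2 * u * (2 powr (1 / q * real k) / (2 powr (1 / q) - 1)) \<le> 2 * u * (2 * u powr (- (1 / q)) / (2 powr (1 / q) - 1))"
        using u den by (intro mult_left_mono divide_right_mono) auto
      also have "\<dots> = 4 / (2 powr (1 / q) - 1) * (u powr 1 * u powr (- (1 / q)))" using u by simp
      also have "u powr 1 * u powr (- (1 / q)) = u powr (1 / p)"
      proof -
        have "1 + - (1 / q) = 1 / p" using pq by simp
        then show ?thesis using powr_add[of u 1 "- (1 / q)"] by simp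
      qed
      finally show ?thesis .
    qed
    finally show "(\<Sum>i<k. 2 powr (- real i / p) * min 1 (real d / 2 ^ (n - Suc i))) \<le> 4 / (2 powr (1 / q) - 1) * u powr (1 / p)" .
    have den: "0 < 1 - 2 powr (- (1 / p))" using p1 by (simp add: powr_less_one)
    show "(\<Sum>i=k..<n. 2 powr (- real i / p) * min 1 (real d / 2 ^ (n - Suc i))) \<le> 1 / (1 - 2 powr (- (1 / p))) * u powr (1 / p)"
    proof (cases "k = n")
      case True
      then show ?thesis using den by simp
    next
      case False
      then have k1: "1 < 2 powr real k * u" using kex by (simp add: powr_realpow)
      have "(\<Sum>i=k..<n. 2 powr (- real i / p) * min 1 (real d / 2 ^ (n - Suc i))) \<le> (\<Sum>i=k..<n. 2 powr (- (1 / p) * real i))"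
      proof (rule sum_mono)
        fix i
        show "2 powr (- real i / p) * min 1 (real d / 2 ^ (n - Suc i)) \<le> 2 powr (- (1 / p) * real i)"
          using mult_left_mono[of "min 1 (real d / 2 ^ (n - Suc i))" 1 "2 powr (- real i / p)"] by simp
      qed
      also have "\<dots> \<le> 2 powr (- (1 / p) * real k) / (1 - 2 powr (- (1 / p)))"
        using p1 by (intro sum_powr2_tail) auto
      also have "2 powr (- (1 / p) * real k) \<le> u powr (1 / p)"
      proof -
        have "2 powr (- real k) \<le> u" using k1 u by (simp add: powr_minus field_simps)
        then have "(2 powr (- real k)) powr (1 / p) \<le> u powr (1 / p)" using p1 by (intro powr_mono2) auto
        then show ?thesis by (simp add: powr_powr)
      qed
      then have "2 powr (- (1 / p) * real k) / (1 - 2 powr (- (1 / p))) \<le> u powr (1 / p) / (1 - 2 powr (- (1 / p)))"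
        using den by (intro divide_right_mono) auto
      finally show ?thesis by simp
    qed
  qed
  also have "\<dots> = holder_const * u powr (1 / p)" by (simp add: holder_const_def distrib_right)
  finally show ?thesis by (simp add: u_def)
qed

end

context james_setting
begin

lemma block_null:
  fixes x :: "nat \<Rightarrow> 'k"
  assumes x: "\<And>i. norm (x i) powr p \<le> c (blk i)" and c: "\<And>n. 0 \<le> c n" and D: "\<And>M. (\<Sum>n<M. c n) \<le> D"
  shows "x \<longlonglongrightarrow> 0"
proof -
  have "summable c"
  proof (rule bounded_imp_summable)
    show "sum c {..n} \<le> D" for n using D[of "Suc n"] by (simp add: lessThan_Suc_atMost)
  qed (rule c)
  then have "c \<longlonglongrightarrow> 0" by (rule summable_LIMSEQ_zero)
  then have "(\<lambda>i. c (blk i)) \<longlonglongrightarrow> 0" by (rule filterlim_compose[OF _ filterlim_blk])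
  then have "(\<lambda>i. c (blk i) powr (1 / p)) \<longlonglongrightarrow> 0 powr (1 / p)"
    using p1 c by (intro tendsto_powr2) auto
  moreover have "norm (x i) \<le> c (blk i) powr (1 / p)" for i
  proof -
    have "(norm (x i) powr p) powr (1 / p) \<le> c (blk i) powr (1 / p)" using x p1 by (intro powr_mono2) auto
    then show ?thesis using p1 by (simp add: powr_powr)
  qed
  ultimately show ?thesis
    by (intro Lim_null_comparison[of x "\<lambda>i. c (blk i) powr (1 / p)"]) auto
qed

abbreviation block :: "nat \<Rightarrow> nat set" where
  "block n \<equiv> {i. blk i = n}"

lemma block_upper:
  assumes c: "\<And>ns n. \<lbrakk>sorted_wrt (<) ns; set ns \<subseteq> block n\<rbrakk> \<Longrightarrow> list_var p x ns \<le> c n"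
    and d: "\<And>i. norm (x i) powr p \<le> c (blk i)"
    and c0: "\<And>n. 0 \<le> c n" and D: "\<And>M. (\<Sum>n<M. c n) \<le> D powr p" "0 \<le> D"
  shows "x \<in> vecs J" "nrm J x \<le> blockc * D"
proof -
  have c': "\<forall>ns n. sorted_wrt (<) ns \<longrightarrow> (\<forall>i\<in>set ns. blk i = n) \<longrightarrow> list_var p x ns \<le> c n"
    using c by (simp add: subset_iff)
  have x0: "x \<longlonglongrightarrow> 0" by (rule block_null[OF d c0 D(1)])
  show "x \<in> vecs J" "nrm J x \<le> blockc * D"
    using james_upper_estimate[OF mono_blk x0 c' d c0 D] by auto
qed

subsection \<open>The projection onto the sequences that vanish at the ends of all blocks\<close>

text \<open>On every block the value at the last index is subtracted. Up to an equivalent norm, the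
  sequences that vanish at the ends of all blocks form an \<open>\<ell>\<^sub>p\<close>-sum of finite-dimensional spaces,
  the \<open>n\<close>-th of which is a James space of dimension \<open>2 ^ n\<close>.\<close>

definition block_proj :: "(nat \<Rightarrow> 'k) \<Rightarrow> nat \<Rightarrow> 'k" where
  "block_proj = restrict_op J (\<lambda>x i. x i - x (blk_end i))"

lemma list_var_block_proj:
  assumes "set ns \<subseteq> block n"
  shows "list_var p (\<lambda>i. x i - x (blk_end i)) ns = list_var p (x :: nat \<Rightarrow> 'k) ns"
proof -
  have "list_var p (\<lambda>i. x i - x (blk_end i)) ns = list_var p (\<lambda>i. x i - x (blk_off n + 2 ^ n)) ns"
    using assms by (intro list_var_cong) auto
  then show ?thesis by (simp add: list_var_eq_sum)
qed

lemma block_proj_coord: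
  assumes x: "x \<in> vecs J"
  shows "norm (x i - x (blk_end i)) powr p \<le> block_var p x (block (blk i))"
proof (cases "i = blk_end i")
  case True
  then have "x i - x (blk_end i) = 0" by simp
  then show ?thesis using block_var_nonneg[OF x] by simp
next
  case False
  then have "i < blk_end i" using blk_bounds[of i] by simp
  then have "list_var p x [i, blk_end i] \<le> block_var p x (block (blk i))"
    by (intro list_var_le_block_var x) (auto simp: blk_blk_end)
  then show ?thesis by simp
qed

lemma block_proj_bounded: "block_proj \<in> bounded_ops J J"
  unfolding block_proj_def
proof (rule J.restrict_op_bounded[where C = blockc])
  fix x assume x: "x \<in> vecs J"
  show "(\<lambda>i. x i - x (blk_end i)) \<in> vecs J" "nrm J (\<lambda>i. x i - x (blk_end i)) \<le> blockc * nrm J x"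
    using block_upper[of "\<lambda>i. x i - x (blk_end i)" "\<lambda>n. block_var p x (block n)" "nrm J x"]
      list_var_block_proj[of _ _ x] list_var_le_block_var[OF x] block_proj_coord[OF x] block_var_nonneg[OF x]
      james_lower_estimate[OF mono_blk x] james_norm_ge_0[OF x] by simp_all
qed (auto simp: fun_eq_iff scal_james algebra_simps)

subsection \<open>The embedding of \<open>G\<^sub>p\<close> and its left inverse\<close>

text \<open>The coefficients \<open>g n 0, \<dots>, g n (n - 1)\<close> are those of a sum of tents on block \<open>n\<close>, the tents for index \<open>j\<close> having
  width \<open>2 ^ (n - j)\<close> and height \<open>2 powr (- j / p)\<close>.\<close>

definition embed_fun :: "(nat \<Rightarrow> nat \<Rightarrow> 'k) \<Rightarrow> nat \<Rightarrow> 'k" where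
  "embed_fun g i = (\<Sum>j<blk i. of_real (2 powr (- real j / p) * tent (2 ^ (blk i - Suc j)) (i - blk_off (blk i))) * g (blk i) j)"

lemma embed_fun_diff:
  assumes "blk i = n" "blk k = n" "i < k"
  shows "norm (embed_fun g i - embed_fun g k) \<le> holder_const * (real (k - i) / 2 ^ n) powr (1 / p) * bnorm g n"
proof -
  define s where "s = i - blk_off n"
  define t where "t = k - blk_off n"
  have st: "s \<le> t" "t - s = k - i" "0 < k - i" "k - i \<le> 2 ^ n"
    using assms by (auto simp: blk_eq_iff s_def t_def)
  have e: "embed_fun g i - embed_fun g k
      = (\<Sum>j<n. of_real (2 powr (- real j / p) * (tent (2 ^ (n - Suc j)) s - tent (2 ^ (n - Suc j)) t)) * g n j)"
    using assms by (simp add: embed_fun_def s_def t_def sum_subtractf algebra_simps)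
  have "norm (embed_fun g i - embed_fun g k)
      \<le> (\<Sum>j<n. 2 powr (- real j / p) * min 1 (real (k - i) / 2 ^ (n - Suc j)) * bnorm g n)"
    unfolding e
  proof (rule sum_norm_le)
    fix j assume j: "j \<in> {..<n}"
    have "\<bar>tent (2 ^ (n - Suc j)) s - tent (2 ^ (n - Suc j)) t\<bar> \<le> min 1 (real (k - i) / 2 ^ (n - Suc j))"
      using tent_diff_le_1 tent_lipschitz[of "2 ^ (n - Suc j)" s t] st by (simp add: abs_minus_commute)
    then have "\<bar>2 powr (- real j / p) * (tent (2 ^ (n - Suc j)) s - tent (2 ^ (n - Suc j)) t)\<bar>
        \<le> 2 powr (- real j / p) * min 1 (real (k - i) / 2 ^ (n - Suc j))"
      by (simp add: abs_mult mult_left_mono)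
    then show "norm (of_real (2 powr (- real j / p) * (tent (2 ^ (n - Suc j)) s - tent (2 ^ (n - Suc j)) t)) * g n j)
        \<le> 2 powr (- real j / p) * min 1 (real (k - i) / 2 ^ (n - Suc j)) * bnorm g n"
      unfolding norm_mult norm_of_real using j by (intro mult_mono bnorm_coord_le) auto
  qed
  also have "\<dots> = (\<Sum>j<n. 2 powr (- real j / p) * min 1 (real (k - i) / 2 ^ (n - Suc j))) * bnorm g n"
    by (simp add: sum_distrib_right)
  also have "\<dots> \<le> holder_const * (real (k - i) / 2 ^ n) powr (1 / p) * bnorm g n"
    using st by (intro mult_right_mono tents_holder bnorm_nonneg) auto
  finally show ?thesis .
qed

lemma embed_fun_end: "embed_fun g (blk_end i) = 0"
proof -
  have "tent (2 ^ (n - Suc j)) (2 ^ n) = 0" if "j < n" for n j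
  proof -
    have "n = j + Suc (n - Suc j)" using that by simp
    then have "(2::nat) ^ n = 2 ^ j * (2 * 2 ^ (n - Suc j))" by (metis power_add power_Suc)
    then show ?thesis using tent_multiple[of "2 ^ (n - Suc j)" "2 ^ j"] by simp
  qed
  then show ?thesis by (simp add: embed_fun_def blk_blk_end)
qed

lemma embed_fun_powr_le:
  assumes "blk i = n" "blk k = n" "i < k"
  shows "norm (embed_fun g i - embed_fun g k) powr p \<le> (holder_const * bnorm g n) powr p * (real (k - i) / 2 ^ n)"
proof -
  have "norm (embed_fun g i - embed_fun g k) powr p
      \<le> (holder_const * (real (k - i) / 2 ^ n) powr (1 / p) * bnorm g n) powr p"
    using p1 by (intro powr_mono2 embed_fun_diff assms) auto
  also have "\<dots> = (holder_const * bnorm g n) powr p * (real (k - i) / 2 ^ n)"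
    using p1 holder_const_nonneg bnorm_nonneg by (simp add: powr_mult powr_powr mult_ac)
  finally show ?thesis .
qed

text \<open>Hoelder continuity with exponent \<open>1 / p\<close> bounds the \<open>p\<close>-th powers of increments by the lengths of the
  intervals, which add up to at most the length of the block. Hence the \<open>p\<close>-variation is bounded by the maximum of the
  coefficients, independently of their number.\<close>

lemma embed_fun_block_var:
  assumes "sorted_wrt (<) ns" "set ns \<subseteq> block n"
  shows "list_var p (embed_fun g) ns \<le> (holder_const * bnorm g n) powr p"
proof (cases "ns = []")
  case False
  let ?K = "(holder_const * bnorm g n) powr p"
  have "list_var p (embed_fun g) ns \<le> ?K * ((real (last ns) - real (hd ns)) / 2 ^ n)"
    using assms False
  proof (induction ns)
    case (Cons a ns)
    show ?case
    proof (cases ns)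
      case (Cons b r)
      then have ab: "a < b" "blk a = n" "blk b = n" using Cons.prems by auto
      have "list_var p (embed_fun g) (a # ns) = norm (embed_fun g a - embed_fun g b) powr p + list_var p (embed_fun g) ns"
        by (simp add: Cons)
      also have "\<dots> \<le> ?K * (real (b - a) / 2 ^ n) + ?K * ((real (last ns) - real (hd ns)) / 2 ^ n)"
        using ab Cons.prems Cons by (intro add_mono embed_fun_powr_le Cons.IH) auto
      also have "\<dots> = ?K * ((real (last (a # ns)) - real (hd (a # ns))) / 2 ^ n)"
        using ab by (simp add: Cons of_nat_diff distrib_left[symmetric] add_divide_distrib[symmetric])
      finally show ?thesis .
    qed simp
  qed simp
  also have "\<dots> \<le> ?K * 1"
  proof (rule mult_left_mono)
    have "last ns \<in> block n" "hd ns \<in> block n" using assms(2) last_in_set[OF False] hd_in_set[OF False] by auto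
    then have "blk_off n \<le> hd ns" "last ns \<le> blk_off n + 2 ^ n" by (simp_all add: blk_eq_iff)
    then have "last ns \<le> hd ns + 2 ^ n" by linarith
    then have "real (last ns) \<le> real (hd ns + 2 ^ n)" by (simp only: of_nat_le_iff)
    then show "(real (last ns) - real (hd ns)) / 2 ^ n \<le> 1" by simp
  qed simp
  finally show ?thesis by simp
qed simp

lemma embed_fun_coord: "norm (embed_fun g i) powr p \<le> (holder_const * bnorm g (blk i)) powr p"
proof (cases "i = blk_end i")
  case True
  then show ?thesis using embed_fun_end[of g i] by simp
next
  case False
  then have i: "i < blk_end i" using blk_bounds[of i] by simp
  have "norm (embed_fun g i) powr p = norm (embed_fun g i - embed_fun g (blk_end i)) powr p"
    by (simp add: embed_fun_end)
  also have "\<dots> \<le> (holder_const * bnorm g (blk i)) powr p * (real (blk_end i - i) / 2 ^ blk i)"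
    using i by (intro embed_fun_powr_le) (auto simp: blk_blk_end)
  also have "\<dots> \<le> (holder_const * bnorm g (blk i)) powr p * 1"
  proof (rule mult_left_mono)
    have "blk_end i - i \<le> 2 ^ blk i" using blk_bounds[of i] by simp
    then have "real (blk_end i - i) \<le> real (2 ^ blk i)" by (simp only: of_nat_le_iff)
    then show "real (blk_end i - i) / 2 ^ blk i \<le> 1" by simp
  qed simp
  finally show ?thesis by simp
qed

definition embed :: "(nat \<Rightarrow> nat \<Rightarrow> 'k) \<Rightarrow> nat \<Rightarrow> 'k" where
  "embed = restrict_op G embed_fun"

lemma embed_bounded: "embed \<in> bounded_ops G J"
  unfolding embed_def
proof (rule G.restrict_op_bounded[where C = "blockc * holder_const"])
  fix g assume g: "g \<in> vecs G"
  have D: "(\<Sum>n<M. (holder_const * bnorm g n) powr p) \<le> (holder_const * nrm G g) powr p" for M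
  proof -
    have "(\<Sum>n<M. (holder_const * bnorm g n) powr p) = holder_const powr p * (\<Sum>n<M. bnorm g n powr p)"
      using holder_const_nonneg bnorm_nonneg by (simp add: powr_mult sum_distrib_left)
    also have "\<dots> \<le> holder_const powr p * nrm G g powr p"
      by (intro mult_left_mono G_upper g) auto
    finally show ?thesis using holder_const_nonneg G.nrm_ge_0[OF g] by (simp add: powr_mult)
  qed
  have D0: "0 \<le> holder_const * nrm G g" using holder_const_nonneg G.nrm_ge_0[OF g] by simp
  show "embed_fun g \<in> vecs J" "nrm J (embed_fun g) \<le> blockc * holder_const * nrm G g"
    using block_upper[of "embed_fun g" "\<lambda>n. (holder_const * bnorm g n) powr p", OF _ _ _ D D0]
      embed_fun_block_var embed_fun_coord by (simp_all add: mult.assoc)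
qed (auto simp: fun_eq_iff scal_james scal_G embed_fun_def sum.distrib sum_distrib_left algebra_simps)

text \<open>The mean of the second differences over the \<open>2 ^ j\<close> grid intervals of the scale of index \<open>j\<close>, normalised so
  that it recovers coefficient \<open>j\<close> of a sum of tents: the tent of height \<open>2 powr (- j / p)\<close> has second difference
  twice its height, and \<open>2 powr (- j / q) / 2 = 2 powr (j / p) / 2 / 2 ^ j\<close>.\<close>

definition coefs_fun :: "(nat \<Rightarrow> 'k) \<Rightarrow> nat \<Rightarrow> nat \<Rightarrow> 'k" where
  "coefs_fun x n j = (if j < n then of_real (2 powr (- real j / q) / 2) *
     (\<Sum>k<2 ^ j. diff2 (2 ^ (n - Suc j)) (k * 2 ^ (n - j)) (\<lambda>s. x (blk_off n + s))) else 0)"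

lemma sum_pairs: "(\<Sum>k<(m::nat). d (2 * k) + d (2 * k + 1)) = (\<Sum>t<2 * m. d t :: real)"
  by (induction m) auto

text \<open>By Hoelder's inequality the sum of \<open>2 ^ (j + 1)\<close> increments is at most \<open>2 powr ((j + 1) / q)\<close> times the
  root of the \<open>p\<close>-variation, which the normalisation compensates.\<close>

lemma coefs_fun_le:
  assumes x: "x \<in> vecs J" and j: "j < n"
  shows "norm (coefs_fun x n j) \<le> block_var p x (block n) powr (1 / p)"
proof -
  define w :: nat where "w = 2 ^ (n - Suc j)"
  define X where "X = (\<lambda>s. x (blk_off n + s))"
  define d where "d = (\<lambda>t. norm (X (t * w) - X (Suc t * w)))"
  have w2: "2 ^ (n - j) = 2 * w" using j by (metis Suc_diff_Suc power_Suc w_def)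
  have wn: "2 ^ Suc j * w = 2 ^ n"
    using j by (simp add: w_def flip: power_add power_Suc)
  have w0: "0 < w" by (simp add: w_def)
  have d2: "norm (diff2 w (k * (2 * w)) X) \<le> d (2 * k) + d (2 * k + 1)" for k
  proof -
    have "diff2 w (k * (2 * w)) X = (X (Suc (2 * k) * w) - X (2 * k * w)) + (X (Suc (2 * k) * w) - X (Suc (2 * k + 1) * w))"
      by (simp add: diff2_def algebra_simps)
    then show ?thesis
      using norm_triangle_ineq[of "X (Suc (2 * k) * w) - X (2 * k * w)" "X (Suc (2 * k) * w) - X (Suc (2 * k + 1) * w)"]
      by (simp add: d_def norm_minus_commute)
  qed
  have "norm (\<Sum>k<2 ^ j. diff2 w (k * (2 * w)) X) \<le> (\<Sum>k<2 ^ j. d (2 * k) + d (2 * k + 1))"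
    by (intro sum_norm_le d2)
  also have "\<dots> = (\<Sum>t<2 ^ Suc j. d t)" by (simp only: sum_pairs power_Suc)
  also have "\<dots> \<le> real (2 ^ Suc j) powr (1 / q) * (\<Sum>t<2 ^ Suc j. d t powr p) powr (1 / p)"
    using sum_le_card_powr[OF p1 pq, of "{..<2 ^ Suc j}" d] by (simp add: d_def)
  also have "(\<Sum>t<2 ^ Suc j. d t powr p) \<le> block_var p x (block n)"
  proof -
    define ns where "ns = map (\<lambda>t. blk_off n + t * w) [0..<Suc (2 ^ Suc j)]"
    have "(\<Sum>t<2 ^ Suc j. d t powr p) = list_var p x ns"
      unfolding list_var_eq_sum by (intro sum.cong) (auto simp: ns_def d_def X_def simp del: upt_Suc)
    also have "\<dots> \<le> block_var p x (block n)"
    proof (rule list_var_le_block_var[OF x])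
      show "sorted_wrt (<) ns" using w0 by (auto simp: ns_def sorted_wrt_iff_nth_less simp del: upt_Suc)
      show "set ns \<subseteq> block n"
      proof
        fix i assume "i \<in> set ns"
        then obtain t where t: "i = blk_off n + t * w" "t \<in> set [0..<Suc (2 ^ Suc j)]"
          by (auto simp only: ns_def set_map)
        then have "t \<le> 2 ^ Suc j" by (simp only: atLeastLessThan_upt[symmetric] atLeastLessThan_iff less_Suc_eq_le)
        then have "t * w \<le> 2 ^ n" unfolding wn[symmetric] by (intro mult_right_mono) auto
        then show "i \<in> block n" using t by (auto intro: blk_eqI)
      qed
    qed
    finally show ?thesis .
  qed
  then have "real (2 ^ Suc j) powr (1 / q) * (\<Sum>t<2 ^ Suc j. d t powr p) powr (1 / p)
      \<le> real (2 ^ Suc j) powr (1 / q) * block_var p x (block n) powr (1 / p)"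
    using p1 by (intro mult_left_mono powr_mono2) (auto simp: sum_nonneg)
  finally have le: "norm (\<Sum>k<2 ^ j. diff2 w (k * (2 * w)) X)
      \<le> real (2 ^ Suc j) powr (1 / q) * block_var p x (block n) powr (1 / p)" .
  have "norm (coefs_fun x n j) = 2 powr (- real j / q) / 2 * norm (\<Sum>k<2 ^ j. diff2 w (k * (2 * w)) X)"
    using j by (simp add: coefs_fun_def norm_mult w_def[symmetric] w2 X_def[symmetric])
  also have "\<dots> \<le> 2 powr (- real j / q) / 2 * (real (2 ^ Suc j) powr (1 / q) * block_var p x (block n) powr (1 / p))"
    by (intro mult_left_mono le) auto
  also have "\<dots> = (2 powr (- real j / q) * real (2 ^ Suc j) powr (1 / q)) / 2 * block_var p x (block n) powr (1 / p)"
    by simp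
  also have "\<dots> \<le> 1 * block_var p x (block n) powr (1 / p)"
  proof (rule mult_right_mono)
    have "real (2 ^ Suc j) powr (1 / q) = 2 powr ((real j + 1) / q)"
    proof -
      have "real (2 ^ Suc j) = 2 powr real (Suc j)" using powr_realpow[of 2 "Suc j"] by simp
      then have "real (2 ^ Suc j) powr (1 / q) = 2 powr (real (Suc j) * (1 / q))" by (simp only: powr_powr)
      also have "real (Suc j) * (1 / q) = (real j + 1) / q" by simp
      finally show ?thesis .
    qed
    then have "2 powr (- real j / q) * real (2 ^ Suc j) powr (1 / q) = 2 powr (- real j / q + (real j + 1) / q)"
      by (simp only: powr_add)
    also have "- real j / q + (real j + 1) / q = 1 / q" by (simp add: add_divide_distrib)
    also have "2 powr (1 / q) \<le> 2 powr (1::real)" using q1 by (intro powr_mono) auto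
    finally show "(2 powr (- real j / q) * real (2 ^ Suc j) powr (1 / q)) / 2 \<le> 1" by simp
  qed simp
  finally show ?thesis by simp
qed

definition coefs :: "(nat \<Rightarrow> 'k) \<Rightarrow> nat \<Rightarrow> nat \<Rightarrow> 'k" where
  "coefs = restrict_op J coefs_fun"

lemma coefs_bounded: "coefs \<in> bounded_ops J G"
  unfolding coefs_def
proof (rule J.restrict_op_bounded[where C = 1])
  fix x assume x: "x \<in> vecs J"
  have bv: "(\<Sum>n\<in>F. (block_var p x (block n) powr (1 / p)) powr p) \<le> nrm J x powr p" if F: "finite F" for F
  proof -
    obtain M where M: "F \<subseteq> {..<M}" using finite_nat_bounded[OF F] by blast
    have "(\<Sum>n\<in>F. (block_var p x (block n) powr (1 / p)) powr p) = (\<Sum>n\<in>F. block_var p x (block n))"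
      using p1 block_var_nonneg[OF x] by (simp add: powr_powr)
    also have "\<dots> \<le> (\<Sum>n<M. block_var p x (block n))"
      using M block_var_nonneg[OF x] by (intro sum_mono2) auto
    also have "\<dots> \<le> nrm J x powr p" by (rule james_lower_estimate[OF mono_blk x])
    finally show ?thesis .
  qed
  have off: "coefs_fun x \<kappa> l = 0" if "\<kappa> \<le> l" for \<kappa> l using that by (simp add: coefs_fun_def)
  show "coefs_fun x \<in> vecs G" "nrm G (coefs_fun x) \<le> 1 * nrm J x"
    using G_boundI[OF off james_norm_ge_0[OF x] coefs_fun_le[OF x] _ bv] by auto
qed (auto simp: fun_eq_iff scal_james scal_G coefs_fun_def diff2_def sum.distrib sum_subtractf sum_distrib_left algebra_simps)

lemma grid_le: "\<lbrakk>j < n; k < 2 ^ j\<rbrakk> \<Longrightarrow> k * 2 ^ (n - j) + 2 * 2 ^ (n - Suc j) \<le> (2::nat) ^ n"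
proof -
  assume j: "j < n" and k: "k < 2 ^ j"
  have "Suc k * 2 ^ (n - j) \<le> 2 ^ j * (2 ^ (n - j) :: nat)" using k by (intro mult_right_mono) auto
  also have "\<dots> = 2 ^ n" using j by (simp flip: power_add)
  also have "Suc k * 2 ^ (n - j) = k * 2 ^ (n - j) + 2 * 2 ^ (n - Suc j)"
    using j by (simp flip: power_Suc add: Suc_diff_Suc)
  finally show ?thesis .
qed

lemma coefs_embed:
  assumes g: "g \<in> vecs G"
  shows "coefs (embed g) = g"
proof -
  have "coefs_fun (embed_fun g) n j = g n j" if j: "j < n" for n j
  proof -
    have ef: "embed_fun g (blk_off n + s) = (\<Sum>i<n. of_real (2 powr (- real i / p) * tent (2 ^ (n - Suc i)) s) * g n i)"
      if "s \<le> 2 ^ n" for s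
      using that blk_eqI[of n "blk_off n + s"] by (simp add: embed_fun_def)
    have "diff2 (2 ^ (n - Suc j)) (k * 2 ^ (n - j)) (\<lambda>s. embed_fun g (blk_off n + s))
        = of_real (2 powr (- real j / p) * 2) * g n j" if k: "k < 2 ^ j" for k
    proof -
      let ?w = "2 ^ (n - Suc j) :: nat" and ?s = "k * 2 ^ (n - j)"
      have "diff2 ?w ?s (\<lambda>s. embed_fun g (blk_off n + s))
          = (\<Sum>i<n. of_real (2 powr (- real i / p) * diff2 ?w ?s (tent (2 ^ (n - Suc i)))) * g n i)"
        using grid_le[OF j k]
        by (simp add: diff2_def ef sum_subtractf[symmetric] sum_distrib_left algebra_simps)
      also have "\<dots> = (\<Sum>i<n. if i = j then of_real (2 powr (- real j / p) * 2) * g n j else 0)"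
        using diff2_tent[OF j] by (intro sum.cong refl) auto
      also have "\<dots> = of_real (2 powr (- real j / p) * 2) * g n j" using j by simp
      finally show ?thesis .
    qed
    then have "coefs_fun (embed_fun g) n j
        = of_real (2 powr (- real j / q) / 2 * (2 ^ j * (2 powr (- real j / p) * 2))) * g n j"
      using j by (simp add: coefs_fun_def)
    also have "2 powr (- real j / q) / 2 * (2 ^ j * (2 powr (- real j / p) * 2)) = 2 powr (real j + (- real j / p) + (- real j / q))"
      by (simp only: powr_add) (simp add: powr_realpow)
    also have "real j + (- real j / p) + (- real j / q) = 0"
    proof -
      have "real j + (- real j / p) + (- real j / q) = real j * (1 - (1 / p + 1 / q))" by (simp add: algebra_simps)
      then show ?thesis using pq by simp
    qed
    finally show ?thesis by simp
  qed
  then have "coefs_fun (embed_fun g) = g"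
    using G_off[OF g] by (auto simp: fun_eq_iff coefs_fun_def not_less)
  then show ?thesis
    using g bounded_ops_vecs[OF embed_bounded g] by (simp add: coefs_def) (simp add: embed_def)
qed

lemma coefs_block_proj:
  assumes x: "x \<in> vecs J"
  shows "coefs (block_proj x) = coefs x"
proof -
  have "coefs_fun (\<lambda>i. x i - x (blk_end i)) n j = coefs_fun x n j" for n j
  proof (cases "j < n")
    case True
    have bp: "blk (blk_off n + s) = n" if "s \<le> 2 ^ n" for s using that by (intro blk_eqI) auto
    have "diff2 (2 ^ (n - Suc j)) (k * 2 ^ (n - j)) (\<lambda>s. x (blk_off n + s) - x (blk_end (blk_off n + s)))
        = diff2 (2 ^ (n - Suc j)) (k * 2 ^ (n - j)) (\<lambda>s. x (blk_off n + s))" if k: "k < 2 ^ j" for k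
      using grid_le[OF True k] by (simp add: diff2_def bp)
    then show ?thesis by (simp add: coefs_fun_def)
  qed (simp add: coefs_fun_def)
  then show ?thesis
    using x bounded_ops_vecs[OF block_proj_bounded x]
    by (simp add: coefs_def) (simp add: block_proj_def fun_eq_iff)
qed

end

section \<open>Pointwise convergence and functionals\<close>

context james_setting
begin

lemma james_of_lp:
  assumes "\<And>M. (\<Sum>i<M. norm (x i) powr p) \<le> D powr p" "0 \<le> D" "x \<longlonglongrightarrow> 0"
  shows "x \<in> vecs J" "nrm J x \<le> blockc * D"
proof -
  have lv: "list_var p x ns \<le> norm (x n) powr p" if "sorted_wrt (<) ns" "\<forall>i\<in>set ns. i = n" for ns n
  proof -
    have "length ns < 2"
    proof (rule ccontr)
      assume "\<not> length ns < 2"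
      then have l: "0 < length ns" "1 < length ns" by linarith+
      have "ns ! 0 < ns ! 1" using l by (intro sorted_wrt_nth_less[OF that(1)]) auto
      moreover have "ns ! 0 = n" "ns ! 1 = n" using that(2) nth_mem[OF l(1)] nth_mem[OF l(2)] by blast+
      ultimately show False by simp
    qed
    then show ?thesis by (simp add: list_var_eq_sum)
  qed
  show "x \<in> vecs J" "nrm J x \<le> blockc * D"
    using james_upper_estimate[of "\<lambda>i. i" x "\<lambda>i. norm (x i) powr p" D] assms lv by (simp_all add: mono_def)
qed

lemma trunc_norm_le:
  shows "trunc n x \<in> vecs J" "nrm J (trunc n x) \<le> blockc * (\<Sum>i<n. norm (x i) powr p) powr (1 / p)"
proof -
  have sum: "(\<Sum>i<M. norm (trunc n x i) powr p) \<le> ((\<Sum>i<n. norm (x i) powr p) powr (1 / p)) powr p" for M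
  proof -
    have "(\<Sum>i<M. norm (trunc n x i) powr p) = (\<Sum>i\<in>{..<M} \<inter> {..<n}. norm (x i) powr p)"
      using p1 by (intro sum.mono_neutral_cong_right) (auto simp: trunc_def)
    also have "\<dots> \<le> (\<Sum>i<n. norm (x i) powr p)" by (intro sum_mono2) auto
    finally show ?thesis using p1 by (simp add: powr_powr sum_nonneg)
  qed
  have "trunc n x \<longlonglongrightarrow> 0"
    by (rule tendsto_eventually) (auto simp: trunc_def eventually_sequentially intro!: exI[of _ n])
  then show "trunc n x \<in> vecs J" "nrm J (trunc n x) \<le> blockc * (\<Sum>i<n. norm (x i) powr p) powr (1 / p)"
    using james_of_lp[OF sum] by auto
qed

text \<open>On finitely many coordinates pointwise convergence is norm convergence.\<close>

lemma trunc_norm_tendsto: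
  assumes "\<And>i. (\<lambda>k. z k i) \<longlonglongrightarrow> 0"
  shows "(\<lambda>k. nrm J (trunc n (z k))) \<longlonglongrightarrow> 0"
proof -
  have "(\<lambda>k. blockc * (\<Sum>i<n. norm (z k i) powr p) powr (1 / p)) \<longlonglongrightarrow> blockc * (\<Sum>i<n. 0 powr p) powr (1 / p)"
    using p1 assms by (intro tendsto_intros tendsto_powr2 tendsto_norm_zero always_eventually allI sum_nonneg) auto
  then have "(\<lambda>k. blockc * (\<Sum>i<n. norm (z k i) powr p) powr (1 / p)) \<longlonglongrightarrow> 0" using p1 by simp
  then show ?thesis
    by (rule Lim_null_comparison[rotated]) (auto simp: abs_of_nonneg james_norm_ge_0 trunc_norm_le)
qed

lemma pointwise_subsequence:
  assumes "\<And>k. x k \<in> vecs J" "\<And>k. nrm J (x k) \<le> M"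
  obtains r y where "strict_mono (r :: nat \<Rightarrow> nat)" "\<And>i. (\<lambda>k. x (r k) i) \<longlonglongrightarrow> y i"
proof -
  have "norm (x k i) \<le> M" for k i using james_coord_le[of "x k" i] assms[of k] by linarith
  then obtain r where r: "strict_mono (r :: nat \<Rightarrow> nat)" "\<And>i. \<exists>l. (\<lambda>k. x (r k) i) \<longlonglongrightarrow> l"
    using function_convergent_subsequence[of "UNIV :: nat set" x M] countableI_type by (metis UNIV_I)
  then obtain y where "\<And>i. (\<lambda>k. x (r k) i) \<longlonglongrightarrow> y i" by metis
  then show thesis using that r by blast
qed

text \<open>Variation along a fixed list is continuous for pointwise convergence. Convergence of the limit
  to 0 does not follow from the rest; this is the point where weak compactness enters.\<close>

lemma pointwise_limit:
  assumes x: "\<And>k. x k \<in> vecs J" "\<And>k. nrm J (x k) \<le> M" and lim: "\<And>i. (\<lambda>k. x k i) \<longlonglongrightarrow> y i" and y: "y \<longlonglongrightarrow> 0"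
  shows "y \<in> vecs J" "nrm J y \<le> M"
proof -
  have M0: "0 \<le> M" using james_norm_ge_0[OF x(1)] x(2) order_trans by blast
  have "list_var p y ns \<le> M powr p" if ns: "sorted_wrt (<) ns" for ns
  proof (rule tendsto_upperbound)
    show "(\<lambda>k. list_var p (x k) ns) \<longlonglongrightarrow> list_var p y ns" using p1 lim by (intro tendsto_list_var) auto
    have "list_var p (x k) ns \<le> M powr p" for k
      using james_upper_powr[OF x(1) ns, of k] powr_mono2[OF _ james_norm_ge_0[OF x(1)] x(2), of p k] p1 by linarith
    then show "\<forall>\<^sub>F k in sequentially. list_var p (x k) ns \<le> M powr p" by simp
  qed simp
  then show "y \<in> vecs J" "nrm J y \<le> M" using james_boundI[OF y M0] by auto
qed

lemma null_if_near_null: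
  fixes y :: "nat \<Rightarrow> 'k"
  assumes "\<And>e. e > 0 \<Longrightarrow> \<exists>a. a \<longlonglongrightarrow> 0 \<and> (\<forall>i. norm (y i - a i) \<le> e)"
  shows "y \<longlonglongrightarrow> 0"
proof (rule LIMSEQ_I)
  fix r :: real assume r: "0 < r"
  then obtain a where a: "a \<longlonglongrightarrow> 0" "\<And>i. norm (y i - a i) \<le> r / 2" using assms[of "r / 2"] by auto
  obtain N where N: "\<And>i. N \<le> i \<Longrightarrow> norm (a i - 0) < r / 2" using LIMSEQ_D[OF a(1), of "r / 2"] r by auto
  have "norm (y i - 0) < r" if "N \<le> i" for i
    using norm_triangle_ineq[of "y i - a i" "a i"] a(2)[of i] N[OF that] by simp
  then show "\<exists>N. \<forall>i\<ge>N. norm (y i - 0) < r" by blast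
qed

lemma mcomplete_james: "J.metric.mcomplete"
  unfolding J.metric.mcomplete_def
proof (intro allI impI)
  fix \<sigma> assume c: "J.metric.MCauchy \<sigma>"
  then have v: "\<And>n. \<sigma> n \<in> vecs J" by (auto simp: J.metric.MCauchy_def)
  have C: "\<exists>N. \<forall>n\<ge>N. \<forall>k\<ge>N. nrm J (\<sigma> n - \<sigma> k) < e" if "e > 0" for e
    using c that v unfolding J.metric.MCauchy_def J.ndist_def by (auto; metis)
  have "Cauchy (\<lambda>n. \<sigma> n i)" for i
  proof (rule CauchyI)
    fix e :: real assume "0 < e"
    then obtain N where N: "\<forall>n\<ge>N. \<forall>k\<ge>N. nrm J (\<sigma> n - \<sigma> k) < e" using C by blast
    have "norm (\<sigma> n i - \<sigma> k i) < e" if "N \<le> n" "N \<le> k" for n k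
      using james_coord_le[OF J.diff_vecs[OF v v], of n k i] N that by fastforce
    then show "\<exists>M. \<forall>m\<ge>M. \<forall>n\<ge>M. norm (\<sigma> m i - \<sigma> n i) < e" by blast
  qed
  then have "\<forall>i. \<exists>l. (\<lambda>n. \<sigma> n i) \<longlonglongrightarrow> l" by (simp add: Cauchy_convergent_iff convergent_def)
  then obtain y where y: "\<And>i. (\<lambda>n. \<sigma> n i) \<longlonglongrightarrow> y i" by metis
  have unif: "norm (y i - \<sigma> n i) \<le> e"
    if N: "\<forall>n\<ge>N. \<forall>k\<ge>N. nrm J (\<sigma> n - \<sigma> k) < e" "N \<le> n" for e N n i
  proof (rule tendsto_upperbound)
    show "(\<lambda>k. norm (\<sigma> k i - \<sigma> n i)) \<longlonglongrightarrow> norm (y i - \<sigma> n i)" by (intro tendsto_intros y)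
    have "norm (\<sigma> k i - \<sigma> n i) \<le> e" if "N \<le> k" for k
      using james_coord_le[OF J.diff_vecs[OF v v], of k n i] N that by fastforce
    then show "\<forall>\<^sub>F k in sequentially. norm (\<sigma> k i - \<sigma> n i) \<le> e" by (auto simp: eventually_sequentially)
  qed simp
  have y0: "y \<longlonglongrightarrow> 0"
  proof (rule null_if_near_null)
    fix e :: real assume "0 < e"
    then obtain N where "\<forall>n\<ge>N. \<forall>k\<ge>N. nrm J (\<sigma> n - \<sigma> k) < e" using C by blast
    then show "\<exists>a. a \<longlonglongrightarrow> 0 \<and> (\<forall>i. norm (y i - a i) \<le> e)"
      using unif[of N e N] james_vecs_tendsto[OF v, of N] by auto
  qed
  have lim: "\<sigma> n - y \<in> vecs J \<and> nrm J (\<sigma> n - y) \<le> e"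
    if N: "\<forall>n\<ge>N. \<forall>k\<ge>N. nrm J (\<sigma> n - \<sigma> k) < e" "N \<le> n" for e N n
  proof -
    have 1: "\<sigma> n - \<sigma> (N + k) \<in> vecs J" for k by (intro J.diff_vecs v)
    have 2: "nrm J (\<sigma> n - \<sigma> (N + k)) \<le> e" for k using N by (simp add: less_imp_le)
    have 3: "(\<lambda>k. (\<sigma> n - \<sigma> (N + k)) i) \<longlonglongrightarrow> (\<sigma> n - y) i" for i
      using tendsto_diff[OF tendsto_const LIMSEQ_ignore_initial_segment[OF y[of i], of N], of "\<sigma> n i"]
      by (simp add: add.commute)
    have 4: "(\<sigma> n - y) \<longlonglongrightarrow> 0"
      using tendsto_diff[OF james_vecs_tendsto[OF v, of n] y0] by (simp add: fun_diff_def)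
    show ?thesis using pointwise_limit[OF 1 2 3 4] by blast
  qed
  have yv: "y \<in> vecs J"
  proof -
    obtain N where "\<forall>n\<ge>N. \<forall>k\<ge>N. nrm J (\<sigma> n - \<sigma> k) < 1" using C[of 1] by auto
    then have "\<sigma> N - y \<in> vecs J" using lim by blast
    then show ?thesis using J.diff_vecs[OF v, of "\<sigma> N - y" N] by simp
  qed
  have "limitin J.metric.mtopology \<sigma> y sequentially"
    unfolding J.metric.limit_metric_sequentially
  proof (intro conjI allI impI yv)
    fix e :: real assume "0 < e"
    then obtain N where "\<forall>n\<ge>N. \<forall>k\<ge>N. nrm J (\<sigma> n - \<sigma> k) < e / 2" using C[of "e / 2"] by auto
    then have "\<forall>n\<ge>N. nrm J (\<sigma> n - y) \<le> e / 2" using lim by blast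
    then show "\<exists>N. \<forall>n\<ge>N. \<sigma> n \<in> vecs J \<and> J.ndist (\<sigma> n) y < e"
      using v yv \<open>0 < e\<close> by (intro exI[of _ N]) (auto simp: J.ndist_def)
  qed
  then show "\<exists>x. limitin J.metric.mtopology \<sigma> x sequentially" by blast
qed

subsection \<open>Functionals\<close>

abbreviation scalars :: "('k, 'k) nspace" where "scalars \<equiv> scalar_space"

lemma normed_pair_J_scalars: "normed_pair J scalars"
  by (simp add: normed_pair_def normed_james normed_scalar_space)

lemma functional_bound:
  assumes "f \<in> bounded_ops J scalars"
  obtains F where "0 < F" "\<And>x. x \<in> vecs J \<Longrightarrow> norm (f x) \<le> F * nrm J x"
  using normed_pair.bounded_ops_bound[OF normed_pair_J_scalars assms] by (auto simp: scalar_space_def)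

lemma functional_diff: "\<lbrakk>f \<in> bounded_ops J scalars; x \<in> vecs J; y \<in> vecs J\<rbrakk> \<Longrightarrow> f (x - y) = f x - f y"
  by (rule normed_pair.bounded_ops_diff[OF normed_pair_J_scalars])

lemma coordinate_functional: "restrict_op J (\<lambda>x. x i) \<in> bounded_ops J scalars"
  by (rule J.restrict_op_bounded[where C = 1]) (auto simp: scalar_space_def scal_james james_coord_le)

text \<open>Each of the vectors occupies a block of its own, so that the upper \<open>p\<close>-estimate applies.\<close>

lemma successive_sum_le:
  assumes N: "strict_mono N" "N 0 = 0"
    and z: "\<And>k. z k \<in> vecs J" "\<And>k. nrm J (z k) \<le> B"
    and supp: "\<And>k i. z k i \<noteq> 0 \<Longrightarrow> N k \<le> i \<and> i < N (Suc k)"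
  shows "nrm J (\<Sum>k<m. z k) \<le> blockc * (real m powr (1 / p) * B)"
proof -
  have B0: "0 \<le> B" using james_norm_ge_0[OF z(1)] z(2) order_trans by blast
  define \<beta> where "\<beta> = (\<lambda>i. LEAST k. i < N (Suc k))"
  have ex: "i < N (Suc (\<beta> i))" for i
  proof -
    have "i < N (Suc i)" using strict_mono_imp_increasing[OF N(1), of "Suc i"] by simp
    then show ?thesis unfolding \<beta>_def by (rule LeastI)
  qed
  have \<beta>: "mono \<beta>"
  proof (rule monoI)
    fix i j :: nat assume "i \<le> j"
    then have "i < N (Suc (\<beta> j))" using ex[of j] by simp
    then show "\<beta> i \<le> \<beta> j" unfolding \<beta>_def[of] by (simp add: \<beta>_def Least_le)
  qed
  have eq: "\<beta> i = k" if "N k \<le> i" "i < N (Suc k)" for i k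
    unfolding \<beta>_def
  proof (rule Least_equality)
    fix l assume "i < N (Suc l)"
    then have "N k < N (Suc l)" using that by simp
    then show "k \<le> l" using strict_mono_less[OF N(1)] by simp
  qed (rule that)
  let ?X = "\<Sum>k<m. z k"
  have Xi: "?X i = (if \<beta> i < m then z (\<beta> i) i else 0)" for i
  proof -
    have "?X i = (\<Sum>k<m. z k i)" by (induction m) auto
    also have "\<dots> = (\<Sum>k<m. if k = \<beta> i then z (\<beta> i) i else 0)"
    proof (intro sum.cong refl)
      fix k
      show "z k i = (if k = \<beta> i then z (\<beta> i) i else 0)" using supp[of k i] eq[of k i] by auto
    qed
    finally show ?thesis by simp
  qed
  define c where "c = (\<lambda>k. if k < m then B powr p else 0)"
  have Xv: "?X \<in> vecs J" by (intro J.sum_vecs z)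
  have lv: "list_var p ?X ns \<le> c k" if ns: "sorted_wrt (<) ns" "\<forall>i\<in>set ns. \<beta> i = k" for ns k
  proof (cases "k < m")
    case True
    have "list_var p ?X ns = list_var p (z k) ns"
      using ns True by (intro list_var_cong) (simp add: Xi)
    also have "\<dots> \<le> nrm J (z k) powr p" by (rule james_upper_powr[OF z(1) ns(1)])
    also have "\<dots> \<le> B powr p" using p1 by (intro powr_mono2 james_norm_ge_0 z) auto
    finally show ?thesis using True by (simp add: c_def)
  next
    case False
    have "list_var p ?X ns = list_var p (\<lambda>_. 0 :: 'k) ns"
      using ns False by (intro list_var_cong) (simp add: Xi)
    then show ?thesis using False by (simp add: c_def list_var_eq_sum)
  qed
  have d: "norm (?X i) powr p \<le> c (\<beta> i)" for i
  proof (cases "\<beta> i < m")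
    case True
    have "norm (z (\<beta> i) i) \<le> B" using james_coord_le[OF z(1)] z(2) order_trans by blast
    then show ?thesis using True p1 by (simp add: Xi c_def powr_mono2)
  qed (simp add: Xi c_def)
  have D: "(\<Sum>k<M. c k) \<le> (real m powr (1 / p) * B) powr p" for M
  proof -
    have "(\<Sum>k<M. c k) = (\<Sum>k\<in>{..<M} \<inter> {..<m}. B powr p)"
      by (intro sum.mono_neutral_cong_right) (auto simp: c_def)
    also have "\<dots> \<le> (\<Sum>k<m. B powr p)" by (intro sum_mono2) auto
    also have "\<dots> = (real m powr (1 / p) * B) powr p"
      using p1 B0 by (simp add: powr_mult powr_powr)
    finally show ?thesis .
  qed
  show ?thesis
    by (rule james_upper_estimate(2)[OF \<beta> james_vecs_tendsto[OF Xv] _ d _ D])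
      (use lv B0 in \<open>auto simp: c_def\<close>)
qed

text \<open>The unit vector basis is shrinking: otherwise a functional would be of size at least \<open>e * m\<close> on
  the sum of \<open>m\<close> successive vectors, whose norm is only of order \<open>m powr (1 / p)\<close>.\<close>

lemma functional_tail:
  assumes f: "f \<in> bounded_ops J scalars" and e: "0 < e"
  shows "\<exists>n. \<forall>x\<in>vecs J. norm (f (x - trunc n x)) \<le> e * nrm J x"
proof (rule ccontr)
  assume neg: "\<not> ?thesis"
  obtain F where F: "0 < F" "\<And>x. x \<in> vecs J \<Longrightarrow> norm (f x) \<le> F * nrm J x" using functional_bound[OF f] by blast
  define B where "B = 2 * blockc"
  have "\<exists>m z. n < m \<and> z \<in> vecs J \<and> nrm J z \<le> B \<and> (\<forall>i. z i \<noteq> 0 \<longrightarrow> n \<le> i \<and> i < m) \<and> (\<exists>r\<ge>e. f z = of_real r)" for n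
  proof -
    obtain x where x: "x \<in> vecs J" and big: "e * nrm J x < norm (f (x - trunc n x))"
      using neg by (auto simp: not_le)
    have tv: "\<And>m. trunc m x \<in> vecs J" using trunc_vecs[OF x] by blast
    have xpos: "0 < nrm J x"
    proof (rule ccontr)
      assume "\<not> 0 < nrm J x"
      then have "x = 0" using J.nrm_eq_0[OF x] james_norm_ge_0[OF x] by simp
      then have "x - trunc n x = 0" by (simp add: trunc_def fun_eq_iff)
      then show False using big \<open>x = 0\<close> normed_pair.bounded_ops_zero[OF normed_pair_J_scalars f] J.nrm_0 by simp
    qed
    define \<epsilon> where "\<epsilon> = norm (f (x - trunc n x)) - e * nrm J x"
    have "0 < \<epsilon> / F" using big F(1) by (simp add: \<epsilon>_def)
    then obtain m0 where m0: "\<And>m. m0 \<le> m \<Longrightarrow> nrm J (x - trunc m x) < \<epsilon> / F" using trunc_tendsto[OF x] by blast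
    define m where "m = max m0 (Suc n)"
    define z where "z = trunc m x - trunc n x"
    have zv: "z \<in> vecs J" unfolding z_def by (intro J.diff_vecs tv)
    have supp: "n \<le> i \<and> i < m" if "z i \<noteq> 0" for i
      using that by (auto simp: z_def trunc_def m_def split: if_splits)
    have "f z = f (x - trunc n x) - f (x - trunc m x)"
      using functional_diff[OF f] x tv by (simp add: z_def)
    moreover have "norm (f (x - trunc m x)) < \<epsilon>"
    proof -
      have "norm (f (x - trunc m x)) \<le> F * nrm J (x - trunc m x)" by (intro F J.diff_vecs x tv)
      also have "\<dots> < F * (\<epsilon> / F)" using m0[of m] F(1) by (intro mult_strict_left_mono) (auto simp: m_def)
      finally show ?thesis using F(1) by simp
    qed
    ultimately have fz: "e * nrm J x \<le> norm (f z)"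
      using norm_triangle_ineq2[of "f (x - trunc n x)" "f (x - trunc m x)"] by (simp add: \<epsilon>_def)
    have nz: "nrm J z \<le> B * nrm J x"
      using J.nrm_diff_le[OF tv tv, of m n] trunc_vecs(2)[OF x, of m] trunc_vecs(2)[OF x, of n]
      by (simp add: z_def B_def)
    define c where "c = phase (f z) / of_real (nrm J x)"
    define w where "w = scal J c z"
    have nc: "norm c \<le> 1 / nrm J x" using norm_phase[of "f z"] xpos by (simp add: c_def norm_divide divide_right_mono)
    have wv: "w \<in> vecs J" unfolding w_def by (rule J.scal_vecs[OF zv])
    have "nrm J w \<le> 1 / nrm J x * (B * nrm J x)"
      unfolding w_def J.nrm_scal[OF zv] using nc nz james_norm_ge_0[OF zv] xpos by (intro mult_mono) auto
    then have "nrm J w \<le> B" using xpos by simp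
    moreover have "f w = of_real (norm (f z) / nrm J x)"
      using bounded_ops_scal[OF f zv, of c] phase_mult[of "f z"] by (simp add: w_def c_def scalar_space_def)
    moreover have "e \<le> norm (f z) / nrm J x" using fz xpos by (simp add: field_simps)
    moreover have "n < m" by (simp add: m_def)
    moreover have "n \<le> i \<and> i < m" if "w i \<noteq> 0" for i using that supp[of i] by (auto simp: w_def scal_james)
    ultimately show ?thesis using wv by blast
  qed
  then obtain nxt Z R where nxt: "\<And>n. n < nxt n" and Z: "\<And>n. Z n \<in> vecs J" "\<And>n. nrm J (Z n) \<le> B"
    and supp: "\<And>n i. Z n i \<noteq> 0 \<Longrightarrow> n \<le> i \<and> i < nxt n" and R: "\<And>n. e \<le> R n" "\<And>n. f (Z n) = of_real (R n)"
    by metis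
  define N where "N = (\<lambda>k. (nxt ^^ k) 0)"
  have N: "strict_mono N" "N 0 = 0" "\<And>k. N (Suc k) = nxt (N k)" by (auto simp: N_def strict_mono_Suc_iff nxt)
  have B0: "0 \<le> B" using james_norm_ge_0[OF Z(1)] Z(2) order_trans by blast
  define D where "D = F * blockc * B"
  have D0: "0 \<le> D" using F(1) B0 by (simp add: D_def)
  have le: "real m * e \<le> D * real m powr (1 / p)" for m
  proof -
    let ?X = "\<Sum>k<m. Z (N k)"
    have "f ?X = (\<Sum>k<m. f (Z (N k)))"
      by (rule J.sum_restrict_op[OF bounded_ops_add[OF f] Z(1)])
    also have "\<dots> = of_real (\<Sum>k<m. R (N k))" by (simp add: R)
    finally have eq: "f ?X = of_real (\<Sum>k<m. R (N k))" .
    have "real m * e = (\<Sum>k<m. e)" by simp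
    also have "\<dots> \<le> (\<Sum>k<m. R (N k))" by (intro sum_mono R)
    also have "\<dots> \<le> norm (f ?X)" unfolding eq norm_of_real by simp
    also have "\<dots> \<le> F * nrm J ?X" by (intro F J.sum_vecs Z)
    also have "\<dots> \<le> F * (blockc * (real m powr (1 / p) * B))"
      using F(1) Z supp by (intro mult_left_mono successive_sum_le[OF N(1,2)]) (auto simp: N(3))
    finally show ?thesis by (simp add: D_def mult_ac)
  qed
  obtain m :: nat where m: "(D / e) powr q < real m" using reals_Archimedean2 by blast
  then have mpos: "0 < real m" using powr_ge_zero[of "D / e" q] by linarith
  have "real m powr (1 / p) * real m powr (1 / q) = real m" using mpos pq by (simp flip: powr_add)
  then have "real m powr (1 / p) * (real m powr (1 / q) * e) \<le> real m powr (1 / p) * D"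
    using le[of m] by (simp add: mult_ac)
  then have "real m powr (1 / q) \<le> D / e" using mpos e by (simp add: field_simps)
  then have "(real m powr (1 / q)) powr q \<le> (D / e) powr q" using q1 by (intro powr_mono2) auto
  then show False using m mpos q1 by (simp add: powr_powr)
qed

text \<open>On bounded sets pointwise convergence to an element of \<open>J\<close> is weak convergence: a functional is small on
  tails, uniformly on the bounded set, and initial segments converge in norm.\<close>

lemma functional_pointwise:
  assumes f: "f \<in> bounded_ops J scalars" and x: "\<And>k. x k \<in> vecs J" "\<And>k. nrm J (x k) \<le> M"
    and lim: "\<And>i. (\<lambda>k. x k i) \<longlonglongrightarrow> y i" and y: "y \<in> vecs J"
  shows "(\<lambda>k. f (x k)) \<longlonglongrightarrow> f y"
proof (rule LIMSEQ_I)
  fix r :: real assume r: "0 < r"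
  obtain F where F: "0 < F" "\<And>x. x \<in> vecs J \<Longrightarrow> norm (f x) \<le> F * nrm J x" using functional_bound[OF f] by blast
  define A where "A = M + nrm J y + 1"
  have A: "0 < A" using james_norm_ge_0[OF x(1), of 0] x(2)[of 0] james_norm_ge_0[OF y] by (simp add: A_def)
  define z where "z = (\<lambda>k. x k - y)"
  have z: "z k \<in> vecs J" "nrm J (z k) \<le> A" for k
    using J.diff_vecs[OF x(1) y] J.nrm_diff_le[OF x(1)[of k] y] x(2)[of k] by (auto simp: z_def A_def)
  obtain n where n: "\<And>x. x \<in> vecs J \<Longrightarrow> norm (f (x - trunc n x)) \<le> r / (2 * A) * nrm J x"
    using functional_tail[OF f, of "r / (2 * A)"] r A by auto
  have "(\<lambda>k. nrm J (trunc n (z k))) \<longlonglongrightarrow> 0"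
    using lim by (intro trunc_norm_tendsto) (simp add: z_def LIM_zero_iff)
  then have "eventually (\<lambda>k. nrm J (trunc n (z k)) < r / (2 * F)) sequentially"
    using r F(1) by (intro order_tendstoD) auto
  then obtain K where K: "\<And>k. K \<le> k \<Longrightarrow> nrm J (trunc n (z k)) < r / (2 * F)" by (auto simp: eventually_sequentially)
  have "norm (f (x k) - f y) < r" if "K \<le> k" for k
  proof -
    have "f (x k) - f y = f (z k - trunc n (z k)) + f (trunc n (z k))"
      using functional_diff[OF f] x y z trunc_norm_le(1) by (simp add: z_def)
    then have "norm (f (x k) - f y) \<le> norm (f (z k - trunc n (z k))) + norm (f (trunc n (z k)))"
      by (simp add: norm_triangle_ineq)
    also have "norm (f (z k - trunc n (z k))) \<le> r / 2"
    proof -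
      have "norm (f (z k - trunc n (z k))) \<le> r / (2 * A) * A"
        by (rule order_trans[OF n[OF z(1)] mult_left_mono[OF z(2)]]) (use r A in simp)
      then show ?thesis using A by simp
    qed
    also have "norm (f (trunc n (z k))) < r / 2"
    proof -
      have "norm (f (trunc n (z k))) \<le> F * nrm J (trunc n (z k))" by (intro F trunc_norm_le)
      also have "\<dots> < F * (r / (2 * F))" using K[OF that] F(1) by (intro mult_strict_left_mono)
      finally show ?thesis using F(1) by simp
    qed
    finally show ?thesis by simp
  qed
  then show "\<exists>K. \<forall>k\<ge>K. norm (f (x k) - f y) < r" by blast
qed

end

section \<open>Compact operators\<close>

context james_setting
begin

lemma unit_ballD: "x \<in> unit_ball J \<Longrightarrow> x \<in> vecs J" "x \<in> unit_ball J \<Longrightarrow> nrm J x \<le> 1"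
  by (auto simp: unit_ball_def)

lemma op_ball_bound:
  assumes "T \<in> bounded_ops J J" "x \<in> unit_ball J"
  shows "T x \<in> vecs J" "nrm J (T x) \<le> J.self.opnorm T"
proof -
  show "T x \<in> vecs J" using assms by (simp add: bounded_ops_vecs unit_ballD)
  have "nrm J (T x) \<le> J.self.opnorm T * nrm J x" by (intro J.self.opnorm_bound assms unit_ballD)
  also have "\<dots> \<le> J.self.opnorm T * 1" by (intro mult_left_mono unit_ballD assms J.self.opnorm_ge_0)
  finally show "nrm J (T x) \<le> J.self.opnorm T" by simp
qed

lemma opnorm_le_ball:
  assumes "\<And>x. x \<in> unit_ball J \<Longrightarrow> nrm J (T x) \<le> e"
  shows "J.self.opnorm T \<le> e"
  unfolding op_space_def nspace.simps
  by (rule cSUP_least) (use assms J.self.zero_in_unit_ball in auto)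

lemma scale_into_ball:
  assumes S: "S \<in> bounded_ops J J" and x: "x \<in> unit_ball J"
  shows "scal J (of_real (1 / (J.self.opnorm S + 1))) (S x) \<in> unit_ball J"
proof -
  have n: "0 \<le> J.self.opnorm S" by (rule J.self.opnorm_ge_0[OF S])
  have "nrm J (S x) \<le> J.self.opnorm S + 1" using op_ball_bound(2)[OF S x] by simp
  moreover have "norm (of_real (1 / (J.self.opnorm S + 1)) :: 'k) = 1 / (J.self.opnorm S + 1)"
    unfolding norm_of_real using n by simp
  ultimately have "norm (of_real (1 / (J.self.opnorm S + 1)) :: 'k) * nrm J (S x) \<le> 1"
    using n by (simp only:) (simp add: field_simps)
  then show ?thesis
    using op_ball_bound(1)[OF S x] unfolding unit_ball_def by (simp only: mem_Collect_eq J.nrm_scal J.scal_vecs simp_thms)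
qed

definition norm_Cauchy :: "(nat \<Rightarrow> nat \<Rightarrow> 'k) \<Rightarrow> bool" where
  "norm_Cauchy u \<longleftrightarrow> (\<forall>e>0. \<exists>N. \<forall>k\<ge>N. \<forall>l\<ge>N. nrm J (u k - u l) < e)"

lemma norm_Cauchy_subseq:
  assumes "norm_Cauchy u" "strict_mono r"
  shows "norm_Cauchy (u \<circ> r)"
  unfolding norm_Cauchy_def
proof (intro allI impI)
  fix e :: real assume "0 < e"
  then obtain N where N: "\<forall>k\<ge>N. \<forall>l\<ge>N. nrm J (u k - u l) < e" using assms(1) by (auto simp: norm_Cauchy_def)
  have "N \<le> r k" if "N \<le> k" for k using that strict_mono_imp_increasing[OF assms(2), of k] by simp
  then show "\<exists>N. \<forall>k\<ge>N. \<forall>l\<ge>N. nrm J ((u \<circ> r) k - (u \<circ> r) l) < e" using N by (auto intro!: exI[of _ N])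
qed

lemma mtotally_bounded_image_iff:
  assumes T: "T \<in> bounded_ops J J"
  shows "J.metric.mtotally_bounded (T ` unit_ball J) \<longleftrightarrow>
    (\<forall>x :: nat \<Rightarrow> nat \<Rightarrow> 'k. (\<forall>k. x k \<in> unit_ball J) \<longrightarrow> (\<exists>r. strict_mono r \<and> norm_Cauchy (\<lambda>k. T (x (r k)))))"
proof -
  have V: "T ` unit_ball J \<subseteq> vecs J" using op_ball_bound(1)[OF T] by auto
  have MC: "J.metric.MCauchy \<sigma> \<longleftrightarrow> norm_Cauchy \<sigma>" if "range \<sigma> \<subseteq> vecs J" for \<sigma>
  proof -
    have "J.ndist (\<sigma> k) (\<sigma> l) = nrm J (\<sigma> k - \<sigma> l)" for k l using that by (auto simp: J.ndist_def)
    then show ?thesis using that by (auto simp: J.metric.MCauchy_def norm_Cauchy_def)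
  qed
  have "J.metric.mtotally_bounded (T ` unit_ball J) \<longleftrightarrow>
      (\<forall>\<sigma> :: nat \<Rightarrow> nat \<Rightarrow> 'k. range \<sigma> \<subseteq> T ` unit_ball J \<longrightarrow> (\<exists>r. strict_mono r \<and> norm_Cauchy (\<sigma> \<circ> r)))"
    unfolding J.metric.mtotally_bounded_sequentially
  proof (intro iffI conjI allI impI V)
    fix \<sigma> :: "nat \<Rightarrow> nat \<Rightarrow> 'k" assume r: "range \<sigma> \<subseteq> T ` unit_ball J"
    then have rr: "range (\<sigma> \<circ> r) \<subseteq> vecs J" for r :: "nat \<Rightarrow> nat" using V by auto
    show "\<exists>r. strict_mono r \<and> norm_Cauchy (\<sigma> \<circ> r)"
      if c: "T ` unit_ball J \<subseteq> vecs J \<and> (\<forall>\<sigma> :: nat \<Rightarrow> nat \<Rightarrow> 'k. range \<sigma> \<subseteq> T ` unit_ball J \<longrightarrow> (\<exists>r. strict_mono r \<and> J.metric.MCauchy (\<sigma> \<circ> r)))"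
    proof -
      obtain r' where "strict_mono r'" "J.metric.MCauchy (\<sigma> \<circ> r')"
        using conjunct2[OF c, rule_format, OF r] by blast
      then show ?thesis unfolding MC[OF rr] by (intro exI[of _ r'] conjI)
    qed
    show "\<exists>r. strict_mono r \<and> J.metric.MCauchy (\<sigma> \<circ> r)"
      if c: "\<forall>\<sigma> :: nat \<Rightarrow> nat \<Rightarrow> 'k. range \<sigma> \<subseteq> T ` unit_ball J \<longrightarrow> (\<exists>r. strict_mono r \<and> norm_Cauchy (\<sigma> \<circ> r))"
    proof -
      obtain r' where "strict_mono r'" "norm_Cauchy (\<sigma> \<circ> r')"
        using c[rule_format, OF r] by blast
      then show ?thesis unfolding MC[OF rr, symmetric] by (intro exI[of _ r'] conjI)
    qed
  qed
  also have "\<dots> \<longleftrightarrow> (\<forall>x :: nat \<Rightarrow> nat \<Rightarrow> 'k. (\<forall>k. x k \<in> unit_ball J) \<longrightarrow> (\<exists>r. strict_mono r \<and> norm_Cauchy (\<lambda>k. T (x (r k)))))"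
  proof (intro iffI allI impI)
    fix x :: "nat \<Rightarrow> nat \<Rightarrow> 'k"
    assume a: "\<forall>\<sigma> :: nat \<Rightarrow> nat \<Rightarrow> 'k. range \<sigma> \<subseteq> T ` unit_ball J \<longrightarrow> (\<exists>r. strict_mono r \<and> norm_Cauchy (\<sigma> \<circ> r))"
      and x: "\<forall>k. x k \<in> unit_ball J"
    have "range (\<lambda>k. T (x k)) \<subseteq> T ` unit_ball J" using x by auto
    then obtain r where "strict_mono r" "norm_Cauchy ((\<lambda>k. T (x k)) \<circ> r)" using a by blast
    then show "\<exists>r. strict_mono r \<and> norm_Cauchy (\<lambda>k. T (x (r k)))" by (auto simp: comp_def)
  next
    fix \<sigma> :: "nat \<Rightarrow> nat \<Rightarrow> 'k"
    assume a: "\<forall>x :: nat \<Rightarrow> nat \<Rightarrow> 'k. (\<forall>k. x k \<in> unit_ball J) \<longrightarrow> (\<exists>r. strict_mono r \<and> norm_Cauchy (\<lambda>k. T (x (r k))))"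
      and r: "range \<sigma> \<subseteq> T ` unit_ball J"
    then have "\<forall>k. \<exists>x. x \<in> unit_ball J \<and> \<sigma> k = T x" by (auto simp: image_iff subset_iff)
    then obtain x where x: "\<And>k. x k \<in> unit_ball J" "\<And>k. \<sigma> k = T (x k)" by metis
    then show "\<exists>r. strict_mono r \<and> norm_Cauchy (\<sigma> \<circ> r)" using a by (auto simp: comp_def)
  qed
  finally show ?thesis .
qed

lemma compact_ops_iff:
  "T \<in> compact_ops J \<longleftrightarrow> T \<in> bounded_ops J J \<and>
    (\<forall>x :: nat \<Rightarrow> nat \<Rightarrow> 'k. (\<forall>k. x k \<in> unit_ball J) \<longrightarrow> (\<exists>r. strict_mono r \<and> norm_Cauchy (\<lambda>k. T (x (r k)))))"
proof -
  have "T \<in> compact_ops J \<longleftrightarrow> T \<in> bounded_ops J J \<and> J.metric.mtotally_bounded (T ` unit_ball J)"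
  proof (cases "T \<in> bounded_ops J J")
    case True
    have V: "T ` unit_ball J \<subseteq> vecs J" using op_ball_bound(1)[OF True] by auto
    show ?thesis
      using J.metric.mtotally_bounded_eq_compact_closure_of[OF mcomplete_james, of "T ` unit_ball J"] V True
      by (auto simp: compact_ops_def J.norm_topology_eq)
  qed (simp add: compact_ops_def)
  then show ?thesis using mtotally_bounded_image_iff by blast
qed

text \<open>The image of the ball is close to a finite set, on which truncations converge uniformly; and truncations are
  uniformly bounded.\<close>

lemma compact_ops_trunc:
  assumes T: "T \<in> compact_ops J" and e: "0 < e"
  shows "\<exists>n. \<forall>x\<in>unit_ball J. nrm J (T x - trunc n (T x)) \<le> e"
proof -
  have TB: "T \<in> bounded_ops J J" using T by (simp add: compact_ops_iff)
  have tb: "J.metric.mtotally_bounded (T ` unit_ball J)"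
    using T mtotally_bounded_image_iff[OF TB] by (simp add: compact_ops_iff)
  define \<epsilon> where "\<epsilon> = e / (2 + blockc)"
  have bp: "0 \<le> blockc" by simp
  have \<epsilon>: "0 < \<epsilon>" using e by (simp add: \<epsilon>_def add_pos_nonneg)
  obtain F where F: "finite F" "F \<subseteq> T ` unit_ball J" "T ` unit_ball J \<subseteq> (\<Union>u\<in>F. J.metric.mball u \<epsilon>)"
    using tb[unfolded J.metric.mtotally_bounded_def, rule_format, OF \<epsilon>] by (elim exE conjE)
  have Fv: "u \<in> vecs J" if "u \<in> F" for u using that F(2) op_ball_bound(1)[OF TB] by auto
  have "\<forall>u\<in>F. \<exists>n. \<forall>m\<ge>n. nrm J (u - trunc m u) < \<epsilon>" by (intro ballI trunc_tendsto Fv \<epsilon>)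
  then obtain n where n': "\<forall>u\<in>F. \<forall>m\<ge>n u. nrm J (u - trunc m u) < \<epsilon>" by (rule bchoice[THEN exE])
  have n: "nrm J (u - trunc m u) < \<epsilon>" if "u \<in> F" "n u \<le> m" for u m using n' that by blast
  define N where "N = Max (insert 0 (n ` F))"
  have N: "n u \<le> N" if "u \<in> F" for u using that F(1) by (simp add: N_def)
  have "nrm J (T x - trunc N (T x)) \<le> e" if x: "x \<in> unit_ball J" for x
  proof -
    obtain u where u: "u \<in> F" "T x \<in> J.metric.mball u \<epsilon>" using F(3) x by auto
    have v: "T x \<in> vecs J" "u \<in> vecs J" using u op_ball_bound(1)[OF TB x] Fv by auto
    define d where "d = T x - u"
    have d: "d \<in> vecs J" "nrm J d < \<epsilon>"
      using u v J.diff_vecs J.nrm_diff_commute[of "T x" u] by (auto simp: d_def J.metric.in_mball J.ndist_def)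
    have eq: "T x - trunc N (T x) = (d - trunc N d) + (u - trunc N u)"
      by (simp add: d_def trunc_def fun_eq_iff)
    have tv: "trunc N d \<in> vecs J" "trunc N u \<in> vecs J" by (rule trunc_norm_le)+
    have "nrm J (T x - trunc N (T x)) \<le> nrm J (d - trunc N d) + nrm J (u - trunc N u)"
      unfolding eq by (intro J.nrm_triangle J.diff_vecs d v tv)
    also have "nrm J (d - trunc N d) \<le> nrm J d + nrm J (trunc N d)" by (intro J.nrm_diff_le d tv)
    also have "nrm J (trunc N d) \<le> blockc * nrm J d" by (rule trunc_vecs(2)[OF d(1)])
    also have "blockc * nrm J d \<le> blockc * \<epsilon>" using d(2) by (intro mult_left_mono bp) simp
    also have "nrm J (u - trunc N u) \<le> \<epsilon>" using n[OF u(1) N[OF u(1)]] by simp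
    also have "nrm J d + blockc * \<epsilon> + \<epsilon> \<le> \<epsilon> * (2 + blockc)" using d(2) by (simp add: algebra_simps)
    also have "\<dots> = e" using bp by (simp add: \<epsilon>_def add_pos_nonneg less_imp_neq[THEN not_sym])
    finally show ?thesis by simp
  qed
  then show ?thesis by blast
qed

text \<open>Conversely, images of a sequence have a pointwise convergent subsequence. It converges in norm on initial
  segments, and the rest is uniformly small.\<close>

lemma compact_opsI:
  assumes TB: "T \<in> bounded_ops J J"
    and tr: "\<And>e. 0 < e \<Longrightarrow> \<exists>n. \<forall>x\<in>unit_ball J. nrm J (T x - trunc n (T x)) \<le> e"
  shows "T \<in> compact_ops J"
  unfolding compact_ops_iff
proof (intro conjI TB allI impI)
  fix x :: "nat \<Rightarrow> nat \<Rightarrow> 'k" assume x: "\<forall>k. x k \<in> unit_ball J"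
  have b: "T (x k) \<in> vecs J" "nrm J (T (x k)) \<le> J.self.opnorm T" for k using op_ball_bound[OF TB] x by auto
  obtain r y where r: "strict_mono (r :: nat \<Rightarrow> nat)" "\<And>i. (\<lambda>k. T (x (r k)) i) \<longlonglongrightarrow> y i"
    using pointwise_subsequence[of "\<lambda>k. T (x k)", OF b] by blast
  define u where "u = (\<lambda>k. T (x (r k)))"
  have uv: "u k \<in> vecs J" for k using b by (simp add: u_def)
  have "norm_Cauchy u"
    unfolding norm_Cauchy_def
  proof (intro allI impI)
    fix e :: real assume e: "0 < e"
    obtain n where n: "\<And>k. nrm J (u k - trunc n (u k)) \<le> e / 5" using tr[of "e / 5"] e x by (auto simp: u_def)
    let ?z = "\<lambda>k i. u k i - y i"
    have "(\<lambda>k. nrm J (trunc n (?z k))) \<longlonglongrightarrow> 0"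
      using r(2) by (intro trunc_norm_tendsto) (simp add: u_def LIM_zero_iff)
    then have "eventually (\<lambda>k. nrm J (trunc n (?z k)) < e / 5) sequentially"
      using e by (intro order_tendstoD) auto
    then obtain N where N: "\<And>k. N \<le> k \<Longrightarrow> nrm J (trunc n (?z k)) < e / 5" by (auto simp: eventually_sequentially)
    have "nrm J (u k - u l) < e" if kl: "N \<le> k" "N \<le> l" for k l
    proof -
      let ?a = "u k - trunc n (u k)" and ?b = "u l - trunc n (u l)"
      let ?c = "trunc n (?z k)" and ?d = "trunc n (?z l)"
      have v: "?a \<in> vecs J" "?b \<in> vecs J" "?c \<in> vecs J" "?d \<in> vecs J"
        by (intro J.diff_vecs uv trunc_norm_le)+
      have eq: "u k - u l = (?a - ?b) + (?c - ?d)" by (simp add: trunc_def fun_eq_iff)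
      have "nrm J (u k - u l) \<le> nrm J (?a - ?b) + nrm J (?c - ?d)"
        unfolding eq by (intro J.nrm_triangle J.diff_vecs v)
      also have "\<dots> \<le> (nrm J ?a + nrm J ?b) + (nrm J ?c + nrm J ?d)"
        by (intro add_mono J.nrm_diff_le v)
      also have "\<dots> < e" using n[of k] n[of l] N[OF kl(1)] N[OF kl(2)] e by linarith
      finally show ?thesis .
    qed
    then show "\<exists>N. \<forall>k\<ge>N. \<forall>l\<ge>N. nrm J (u k - u l) < e" by blast
  qed
  then show "\<exists>r. strict_mono r \<and> norm_Cauchy (\<lambda>k. T (x (r k)))" using r(1) by (auto simp: u_def)
qed

lemma compact_op_ideal: "op_ideal J (compact_ops J)"
  unfolding op_ideal_def
proof (intro conjI ballI)
  show "compact_ops J \<subseteq> bounded_ops J J" by (auto simp: compact_ops_iff)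
  show "0 \<in> compact_ops J"
  proof (rule compact_opsI[OF J.self.bounded_ops_0])
    fix e :: real assume e: "0 < e"
    have "(0 :: (nat \<Rightarrow> 'k) \<Rightarrow> nat \<Rightarrow> 'k) x - trunc n (0 x) = 0" for x n by (simp add: trunc_def fun_eq_iff)
    then show "\<exists>n. \<forall>x\<in>unit_ball J. nrm J (0 x - trunc n (0 x)) \<le> e" using J.nrm_0 e by simp
  qed
next
  fix S T assume S: "S \<in> compact_ops J" and T: "T \<in> compact_ops J"
  show "S + T \<in> compact_ops J"
    unfolding compact_ops_iff
  proof (intro conjI allI impI)
    show "S + T \<in> bounded_ops J J" using S T by (simp add: compact_ops_iff J.self.bounded_ops_plus)
    fix x :: "nat \<Rightarrow> nat \<Rightarrow> 'k" assume x: "\<forall>k. x k \<in> unit_ball J"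
    obtain r where r: "strict_mono r" "norm_Cauchy (\<lambda>k. S (x (r k)))" using S x unfolding compact_ops_iff by blast
    have "\<forall>k. x (r k) \<in> unit_ball J" using x by blast
    then obtain s where s: "strict_mono s" "norm_Cauchy (\<lambda>k. T (x (r (s k))))"
      using T unfolding compact_ops_iff by (elim conjE allE[of _ "\<lambda>k. x (r k)"]) auto
    have S': "norm_Cauchy (\<lambda>k. S (x (r (s k))))" using norm_Cauchy_subseq[OF r(2) s(1)] by (simp add: comp_def)
    have "norm_Cauchy (\<lambda>k. (S + T) (x (r (s k))))"
      unfolding norm_Cauchy_def
    proof (intro allI impI)
      fix e :: real assume e: "0 < e"
      obtain N where N: "\<forall>k\<ge>N. \<forall>l\<ge>N. nrm J (S (x (r (s k))) - S (x (r (s l)))) < e / 2"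
        using S' e unfolding norm_Cauchy_def by (meson half_gt_zero)
      obtain N' where N': "\<forall>k\<ge>N'. \<forall>l\<ge>N'. nrm J (T (x (r (s k))) - T (x (r (s l)))) < e / 2"
        using s(2) e unfolding norm_Cauchy_def by (meson half_gt_zero)
      have "nrm J ((S + T) (x (r (s k))) - (S + T) (x (r (s l)))) < e" if "max N N' \<le> k" "max N N' \<le> l" for k l
      proof -
        have v: "S (x k) \<in> vecs J" "T (x k) \<in> vecs J" for k
          using S T x op_ball_bound(1) by (auto simp: compact_ops_iff)
        have eq: "(S + T) (x (r (s k))) - (S + T) (x (r (s l))) = (S (x (r (s k))) - S (x (r (s l)))) + (T (x (r (s k))) - T (x (r (s l))))"
          by simp
        have "nrm J ((S + T) (x (r (s k))) - (S + T) (x (r (s l))))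
            \<le> nrm J (S (x (r (s k))) - S (x (r (s l)))) + nrm J (T (x (r (s k))) - T (x (r (s l))))"
          unfolding eq by (intro J.nrm_triangle J.diff_vecs v)
        moreover have "nrm J (S (x (r (s k))) - S (x (r (s l)))) < e / 2" using N that by simp
        moreover have "nrm J (T (x (r (s k))) - T (x (r (s l)))) < e / 2" using N' that by simp
        ultimately show ?thesis by simp
      qed
      then show "\<exists>N. \<forall>k\<ge>N. \<forall>l\<ge>N. nrm J ((S + T) (x (r (s k))) - (S + T) (x (r (s l)))) < e" by blast
    qed
    then show "\<exists>r. strict_mono r \<and> norm_Cauchy (\<lambda>k. (S + T) (x (r k)))"
      using strict_mono_o[OF r(1) s(1)] by (intro exI[of _ "r \<circ> s"]) (simp add: comp_def)
  qed
next
  fix T S assume T: "T \<in> compact_ops J" and S: "S \<in> bounded_ops J J"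
  have TB: "T \<in> bounded_ops J J" using T by (simp add: compact_ops_iff)
  have n: "0 \<le> J.self.opnorm S" by (rule J.self.opnorm_ge_0[OF S])
  show "S \<circ> T \<in> compact_ops J"
    unfolding compact_ops_iff
  proof (intro conjI allI impI J.comp_bounded_ops S TB)
    fix x :: "nat \<Rightarrow> nat \<Rightarrow> 'k" assume x: "\<forall>k. x k \<in> unit_ball J"
    obtain r where r: "strict_mono r" "norm_Cauchy (\<lambda>k. T (x (r k)))" using T x unfolding compact_ops_iff by blast
    have v: "T (x k) \<in> vecs J" for k using op_ball_bound(1)[OF TB] x by blast
    have "norm_Cauchy (\<lambda>k. (S \<circ> T) (x (r k)))"
      unfolding norm_Cauchy_def
    proof (intro allI impI)
      fix e :: real assume e: "0 < e"
      then have "0 < e / (J.self.opnorm S + 1)" using n by simp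
      then obtain N where N: "\<forall>k\<ge>N. \<forall>l\<ge>N. nrm J (T (x (r k)) - T (x (r l))) < e / (J.self.opnorm S + 1)"
        using r(2) unfolding norm_Cauchy_def by blast
      have "nrm J ((S \<circ> T) (x (r k)) - (S \<circ> T) (x (r l))) < e" if "N \<le> k" "N \<le> l" for k l
      proof -
        let ?d = "T (x (r k)) - T (x (r l))"
        have dv: "?d \<in> vecs J" by (intro J.diff_vecs v)
        have "(S \<circ> T) (x (r k)) - (S \<circ> T) (x (r l)) = S ?d" using J.self.bounded_ops_diff[OF S] v by simp
        then have "nrm J ((S \<circ> T) (x (r k)) - (S \<circ> T) (x (r l))) \<le> J.self.opnorm S * nrm J ?d"
          using J.self.opnorm_bound[OF S dv] by simp
        also have "\<dots> \<le> (J.self.opnorm S + 1) * nrm J ?d" using james_norm_ge_0[OF dv] by (intro mult_right_mono) auto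
        also have "\<dots> < e" using N that n by (simp add: field_simps)
        finally show ?thesis .
      qed
      then show "\<exists>N. \<forall>k\<ge>N. \<forall>l\<ge>N. nrm J ((S \<circ> T) (x (r k)) - (S \<circ> T) (x (r l))) < e" by blast
    qed
    then show "\<exists>r. strict_mono r \<and> norm_Cauchy (\<lambda>k. (S \<circ> T) (x (r k)))" using r(1) by blast
  qed
  show "T \<circ> S \<in> compact_ops J"
  proof (rule compact_opsI[OF J.comp_bounded_ops[OF TB S]])
    fix e :: real assume e: "0 < e"
    define c where "c = 1 / (J.self.opnorm S + 1)"
    have c: "0 < c" using n by (simp add: c_def)
    obtain m where m: "\<And>x. x \<in> unit_ball J \<Longrightarrow> nrm J (T x - trunc m (T x)) \<le> c * e"
      using compact_ops_trunc[OF T, of "c * e"] c e by auto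
    have "nrm J ((T \<circ> S) x - trunc m ((T \<circ> S) x)) \<le> e" if x: "x \<in> unit_ball J" for x
    proof -
      let ?w = "T (S x) - trunc m (T (S x))"
      have Sx: "S x \<in> vecs J" using op_ball_bound(1)[OF S x] .
      have wv: "?w \<in> vecs J" by (intro J.diff_vecs trunc_norm_le bounded_ops_vecs[OF TB Sx])
      have "T (scal J (of_real c) (S x)) - trunc m (T (scal J (of_real c) (S x))) = scal J (of_real c) ?w"
        using bounded_ops_scal[OF TB Sx] by (simp add: scal_james trunc_def fun_eq_iff algebra_simps)
      then have "nrm J (scal J (of_real c) ?w) \<le> c * e" using m[OF scale_into_ball[OF S x]] by (simp add: c_def)
      then have "c * nrm J ?w \<le> c * e" using c by (simp add: J.nrm_scal[OF wv])
      then show ?thesis using c by simp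
    qed
    then show "\<exists>n. \<forall>x\<in>unit_ball J. nrm J ((T \<circ> S) x - trunc n ((T \<circ> S) x)) \<le> e" by blast
  qed
qed

lemma compact_closed_ideal: "compact_ops J \<in> closed_ideals J"
proof (rule J.closed_idealsI[OF compact_op_ideal])
  fix T assume T: "T \<in> bounded_ops J J" and near: "\<And>e. 0 < e \<Longrightarrow> \<exists>S\<in>compact_ops J. J.self.opnorm (T - S) < e"
  show "T \<in> compact_ops J"
  proof (rule compact_opsI[OF T])
    fix e :: real assume e: "0 < e"
    define \<epsilon> where "\<epsilon> = e / (2 + blockc)"
    have bp: "0 \<le> blockc" by simp
    have \<epsilon>: "0 < \<epsilon>" using e by (simp add: \<epsilon>_def add_pos_nonneg)
    obtain S where S: "S \<in> compact_ops J" "J.self.opnorm (T - S) < \<epsilon>" using near[OF \<epsilon>] by blast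
    have SB: "S \<in> bounded_ops J J" using S by (simp add: compact_ops_iff)
    have TS: "T - S \<in> bounded_ops J J" using J.ops.diff_vecs[of T S] T SB by simp
    obtain n where n: "\<And>x. x \<in> unit_ball J \<Longrightarrow> nrm J (S x - trunc n (S x)) \<le> \<epsilon>"
      using compact_ops_trunc[OF S(1) \<epsilon>] by blast
    have "nrm J (T x - trunc n (T x)) \<le> e" if x: "x \<in> unit_ball J" for x
    proof -
      let ?d = "(T - S) x"
      have d: "?d \<in> vecs J" "nrm J ?d \<le> \<epsilon>" using op_ball_bound[OF TS x] S(2) by auto
      have v: "S x \<in> vecs J" "trunc n ?d \<in> vecs J" "trunc n (S x) \<in> vecs J"
        using op_ball_bound(1)[OF SB x] trunc_norm_le(1) by auto
      have eq: "T x - trunc n (T x) = (?d - trunc n ?d) + (S x - trunc n (S x))"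
        by (simp add: trunc_def fun_eq_iff)
      have "nrm J (T x - trunc n (T x)) \<le> nrm J (?d - trunc n ?d) + nrm J (S x - trunc n (S x))"
        unfolding eq by (intro J.nrm_triangle J.diff_vecs d v)
      also have "nrm J (?d - trunc n ?d) \<le> nrm J ?d + nrm J (trunc n ?d)" by (intro J.nrm_diff_le d v)
      also have "nrm J (trunc n ?d) \<le> blockc * nrm J ?d" by (rule trunc_vecs(2)[OF d(1)])
      also have "blockc * nrm J ?d \<le> blockc * \<epsilon>" by (intro mult_left_mono d bp)
      also have "nrm J (S x - trunc n (S x)) \<le> \<epsilon>" by (rule n[OF x])
      also have "nrm J ?d + blockc * \<epsilon> + \<epsilon> \<le> \<epsilon> * (2 + blockc)" using d(2) by (simp add: algebra_simps)
      also have "\<dots> = e" using bp by (simp add: \<epsilon>_def add_pos_nonneg less_imp_neq[THEN not_sym])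
      finally show ?thesis by simp
    qed
    then show "\<exists>n. \<forall>x\<in>unit_ball J. nrm J (T x - trunc n (T x)) \<le> e" by blast
  qed
qed

lemma trunc_bounded_JL: "T \<in> bounded_ops J J \<Longrightarrow> restrict_op J (\<lambda>x. trunc n (T x)) \<in> bounded_ops J L"
proof (rule J.restrict_op_bounded[where C = "real n powr (1 / p) * J.self.opnorm T"])
  fix x assume T: "T \<in> bounded_ops J J" and x: "x \<in> vecs J"
  have Tx: "T x \<in> vecs J" by (rule bounded_ops_vecs[OF T x])
  have C0: "0 \<le> real n powr (1 / p) * nrm J (T x)" using james_norm_ge_0[OF Tx] by simp
  have "(\<Sum>i\<in>F. norm (trunc n (T x) i) powr p) \<le> (real n powr (1 / p) * nrm J (T x)) powr p" if "finite F" for F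
  proof -
    have "(\<Sum>i\<in>F. norm (trunc n (T x) i) powr p) = (\<Sum>i\<in>F \<inter> {..<n}. norm (T x i) powr p)"
      using p1 that by (intro sum.mono_neutral_cong_right) (auto simp: trunc_def)
    also have "\<dots> \<le> (\<Sum>i<n. norm (T x i) powr p)" by (intro sum_mono2) auto
    also have "\<dots> \<le> (\<Sum>i<n. nrm J (T x) powr p)"
      using p1 by (intro sum_mono powr_mono2 james_coord_le[OF Tx]) auto
    also have "\<dots> = (real n powr (1 / p) * nrm J (T x)) powr p"
      using p1 james_norm_ge_0[OF Tx] by (simp add: powr_mult powr_powr)
    finally show ?thesis .
  qed
  then have L: "trunc n (T x) \<in> vecs L" "nrm L (trunc n (T x)) \<le> real n powr (1 / p) * nrm J (T x)"
    using L_boundI[OF C0] by auto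
  show "trunc n (T x) \<in> vecs L" by (rule L)
  have "real n powr (1 / p) * nrm J (T x) \<le> real n powr (1 / p) * (J.self.opnorm T * nrm J x)"
    by (intro mult_left_mono J.self.opnorm_bound T x) auto
  then show "nrm L (trunc n (T x)) \<le> real n powr (1 / p) * J.self.opnorm T * nrm J x" using L(2) by (simp add: mult.assoc)
next
  fix c x and y :: "nat \<Rightarrow> 'k" assume T: "T \<in> bounded_ops J J" and x: "x \<in> vecs J"
  show "trunc n (T (scal J c x)) = scal L c (trunc n (T x))"
    using bounded_ops_scal[OF T x] by (simp add: scal_james scal_L trunc_def fun_eq_iff)
  assume y: "y \<in> vecs J"
  show "trunc n (T (x + y)) = trunc n (T x) + trunc n (T y)"
    using bounded_ops_add[OF T x y] by (simp add: trunc_add)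
qed

lemma trunc_bounded_LJ: "restrict_op L (trunc n) \<in> bounded_ops L J"
proof (rule L.restrict_op_bounded[where C = blockc])
  fix x assume x: "x \<in> vecs L"
  show "trunc n x \<in> vecs J" by (rule trunc_norm_le)
  have "(\<Sum>i<n. norm (x i) powr p) powr (1 / p) \<le> (nrm L x powr p) powr (1 / p)"
    using p1 by (intro powr_mono2 L_upper x) (auto simp: sum_nonneg)
  also have "\<dots> = nrm L x" using p1 L.nrm_ge_0[OF x] by (simp add: powr_powr)
  finally have "blockc * (\<Sum>i<n. norm (x i) powr p) powr (1 / p) \<le> blockc * nrm L x" by (intro mult_left_mono) auto
  then show "nrm J (trunc n x) \<le> blockc * nrm L x" using trunc_norm_le(2)[of n x] by simp
qed (auto simp: trunc_def fun_eq_iff scal_L scal_james)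

text \<open>Truncations have finite rank and factor through \<open>\<ell>\<^sub>p\<close>.\<close>

lemma compact_subset_closed_factor_L: "compact_ops J \<subseteq> closed_factor_ops L J"
proof
  fix T assume T: "T \<in> compact_ops J"
  then have TB: "T \<in> bounded_ops J J" by (simp add: compact_ops_iff)
  show "T \<in> closed_factor_ops L J"
    unfolding J.closed_factor_ops_iff[OF normed_L]
  proof (intro conjI allI impI TB)
    fix e :: real assume e: "0 < e"
    obtain n where n: "\<And>x. x \<in> unit_ball J \<Longrightarrow> nrm J (T x - trunc n (T x)) \<le> e / 2"
      using compact_ops_trunc[OF T, of "e / 2"] e by auto
    let ?A = "restrict_op J (\<lambda>x. trunc n (T x))" and ?B = "restrict_op L (trunc n)"
    have "(T - (?B \<circ> ?A)) x = T x - trunc n (T x)" if "x \<in> vecs J" for x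
      using bounded_ops_vecs[OF trunc_bounded_JL[OF TB, of n] that] that by (simp add: trunc_def fun_eq_iff)
    then have "J.self.opnorm (T - (?B \<circ> ?A)) \<le> e / 2"
      using n unit_ballD by (intro opnorm_le_ball) auto
    then have "J.self.opnorm (T - (?B \<circ> ?A)) < e" using e by simp
    then show "\<exists>A\<in>bounded_ops J L. \<exists>B\<in>bounded_ops L J. J.self.opnorm (T - (B \<circ> A)) < e"
      using trunc_bounded_JL[OF TB] trunc_bounded_LJ by blast
  qed
qed

lemma zero_strict_subset_compact: "{0} \<subset> compact_ops J"
proof -
  let ?T = "restrict_op J (trunc 1)"
  have TB: "?T \<in> bounded_ops J J"
    by (rule J.restrict_op_bounded[where C = blockc]) (auto simp: trunc_vecs trunc_add trunc_scal)
  have "?T \<in> compact_ops J"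
  proof (rule compact_opsI[OF TB])
    fix e :: real assume "0 < e"
    have "?T x - trunc 1 (?T x) = 0" for x by (auto simp: restrict_op_def trunc_def fun_eq_iff)
    then show "\<exists>n. \<forall>x\<in>unit_ball J. nrm J (?T x - trunc n (?T x)) \<le> e"
      using J.nrm_0 \<open>0 < e\<close> by (intro exI[of _ 1]) simp
  qed
  moreover have "?T \<noteq> 0"
  proof -
    have v: "trunc 1 (\<lambda>_. 1) \<in> vecs J" by (rule trunc_norm_le)
    have "?T (trunc 1 (\<lambda>_. 1)) 0 = 1" using v by (simp add: trunc_def)
    then show ?thesis by (metis zero_fun_apply zero_neq_one)
  qed
  moreover have "0 \<in> compact_ops J" using compact_op_ideal by (simp add: op_ideal_def)
  ultimately show ?thesis by blast
qed

end

section \<open>Weakly compact operators\<close>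

context james_setting
begin

lemma topspace_weak: "topspace (weak_topology J) = vecs J"
proof -
  have "vecs J = {x \<in> vecs J. (restrict_op J (\<lambda>x. x 0) :: (nat \<Rightarrow> 'k) \<Rightarrow> 'k) x \<in> UNIV}" by simp
  then have "vecs J \<in> {{x \<in> vecs J. f x \<in> U} | f U. f \<in> bounded_ops J scalars \<and> open U}"
    using coordinate_functional[of 0] by blast
  then show ?thesis unfolding weak_topology_def topology_generated_by_topspace by blast
qed

lemma openin_weak: "\<lbrakk>f \<in> bounded_ops J scalars; open U\<rbrakk> \<Longrightarrow> openin (weak_topology J) {x \<in> vecs J. f x \<in> U}"
  unfolding weak_topology_def by (rule topology_generated_by_Basis) blast

text \<open>Coordinates are functionals: the weak topology refines the topology of pointwise convergence.\<close>

lemma continuous_map_weak_id: "continuous_map (weak_topology J) euclidean (\<lambda>x. x)"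
proof -
  have "continuous_map (weak_topology J) euclidean (\<lambda>x. x k)" for k
    unfolding continuous_map_def
  proof (intro conjI allI impI)
    fix U :: "'k set" assume "openin euclidean U"
    then have "openin (weak_topology J) {x \<in> vecs J. restrict_op J (\<lambda>x. x k) x \<in> U}"
      by (intro openin_weak coordinate_functional) simp
    then show "openin (weak_topology J) {x \<in> topspace (weak_topology J). x k \<in> U}"
      by (simp add: topspace_weak cong: conj_cong)
  qed auto
  then show ?thesis
    unfolding euclidean_product_topology[symmetric] continuous_map_componentwise_UNIV by blast
qed

lemma tendsto_pointwise:
  fixes x :: "nat \<Rightarrow> nat \<Rightarrow> 'k"
  shows "x \<longlonglongrightarrow> y \<Longrightarrow> (\<lambda>k. x k i) \<longlonglongrightarrow> y i"
  using continuous_on_tendsto_compose[of UNIV "\<lambda>f :: nat \<Rightarrow> 'k. f i" x y sequentially]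
    continuous_on_product_coordinates[of i] by simp

text \<open>The bidual of \<open>J\<close> consists of the pointwise limits of bounded sequences in \<open>J\<close>; these converge, but not
  necessarily to 0. An operator is weakly compact if and only if its second adjoint has values in \<open>J\<close>, and
  this is what the predicate says in terms of sequences.\<close>

definition null_limits :: "((nat \<Rightarrow> 'k) \<Rightarrow> nat \<Rightarrow> 'k) \<Rightarrow> bool" where
  "null_limits T \<longleftrightarrow> (\<forall>x y. (\<forall>k::nat. x k \<in> unit_ball J) \<longrightarrow> (\<forall>i. (\<lambda>k. T (x k) i) \<longlonglongrightarrow> y i) \<longrightarrow> y \<longlonglongrightarrow> 0)"

lemma null_limitsD:
  "\<lbrakk>null_limits T; \<And>k. x k \<in> unit_ball J; \<And>i. (\<lambda>k. T (x k) i) \<longlonglongrightarrow> y i\<rbrakk> \<Longrightarrow> y \<longlonglongrightarrow> 0"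
  unfolding null_limits_def by blast

text \<open>By compactness the images of a sequence have a weak cluster point in \<open>J\<close>. As coordinates are weakly
  continuous, it agrees with the pointwise limit.\<close>

lemma weakly_compact_imp_null_limits:
  assumes T: "T \<in> weakly_compact_ops J"
  shows "null_limits T"
  unfolding null_limits_def
proof (intro allI impI)
  fix x :: "nat \<Rightarrow> nat \<Rightarrow> 'k" and y
  assume x: "\<forall>k. x k \<in> unit_ball J" and lim: "\<forall>i. (\<lambda>k. T (x k) i) \<longlonglongrightarrow> y i"
  have TB: "T \<in> bounded_ops J J" using T by (simp add: weakly_compact_ops_def)
  let ?C = "weak_topology J closure_of (T ` unit_ball J)"
  have C: "compactin (weak_topology J) ?C" using T by (simp add: weakly_compact_ops_def)
  have sub: "T ` unit_ball J \<subseteq> ?C"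
    using op_ball_bound(1)[OF TB] by (intro closure_of_subset) (auto simp: topspace_weak)
  have "\<exists>z\<in>?C. \<forall>V. openin (weak_topology J) V \<longrightarrow> z \<in> V \<longrightarrow> infinite {k. T (x k) \<in> V}"
  proof (rule ccontr)
    assume neg: "\<not> ?thesis"
    define \<U> where "\<U> = {V. openin (weak_topology J) V \<and> finite {k. T (x k) \<in> V}}"
    have "?C \<subseteq> \<Union>\<U>" using neg by (auto simp: \<U>_def)
    then obtain \<F> where \<F>: "finite \<F>" "\<F> \<subseteq> \<U>" "?C \<subseteq> \<Union>\<F>"
      using C unfolding compactin_def by (metis (mono_tags, lifting) \<U>_def mem_Collect_eq)
    have "(UNIV :: nat set) \<subseteq> (\<Union>V\<in>\<F>. {k. T (x k) \<in> V})"
    proof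
      fix k
      have "T (x k) \<in> \<Union>\<F>" using x sub \<F>(3) by blast
      then show "k \<in> (\<Union>V\<in>\<F>. {k. T (x k) \<in> V})" by blast
    qed
    moreover have "finite (\<Union>V\<in>\<F>. {k. T (x k) \<in> V})" using \<F> by (auto simp: \<U>_def)
    ultimately show False using infinite_UNIV_nat finite_subset by blast
  qed
  then obtain z where z: "z \<in> ?C" "\<And>V. \<lbrakk>openin (weak_topology J) V; z \<in> V\<rbrakk> \<Longrightarrow> infinite {k. T (x k) \<in> V}" by blast
  have zv: "z \<in> vecs J" using z(1) closure_of_subset_topspace[of "weak_topology J"] topspace_weak by blast
  have "y i = z i" for i
  proof (rule ccontr)
    assume ne: "y i \<noteq> z i"
    define d where "d = dist (y i) (z i) / 2"
    have d: "0 < d" using ne by (simp add: d_def)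
    have "openin (weak_topology J) {u \<in> vecs J. restrict_op J (\<lambda>x. x i) u \<in> ball (z i) d}"
      by (intro openin_weak coordinate_functional) simp
    then have inf: "infinite {k. T (x k) \<in> {u \<in> vecs J. restrict_op J (\<lambda>x. x i) u \<in> ball (z i) d}}"
      using zv d by (intro z(2)) auto
    obtain N where N: "\<And>k. N \<le> k \<Longrightarrow> dist (T (x k) i) (y i) < d"
      using lim d unfolding lim_sequentially by blast
    have "{k. T (x k) \<in> {u \<in> vecs J. restrict_op J (\<lambda>x. x i) u \<in> ball (z i) d}} \<subseteq> {..<N}"
    proof
      fix k assume "k \<in> {k. T (x k) \<in> {u \<in> vecs J. restrict_op J (\<lambda>x. x i) u \<in> ball (z i) d}}"
      then have "dist (z i) (T (x k) i) < d" by auto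
      then have "\<not> dist (T (x k) i) (y i) < d"
        using dist_triangle[of "y i" "z i" "T (x k) i"] by (simp add: d_def dist_commute)
      then show "k \<in> {..<N}" using N by (meson lessThan_iff not_le)
    qed
    then show False using inf finite_subset by blast
  qed
  then have "y = z" by auto
  then show "y \<longlonglongrightarrow> 0" using james_vecs_tendsto[OF zv] by simp
qed

text \<open>The closure of the image of the ball for pointwise convergence is compact, by Tychonoff's theorem, and
  contained in \<open>J\<close>. By \<open>functional_pointwise\<close> functionals are continuous on this bounded set, so it is weakly
  compact, too.\<close>

lemma null_limits_imp_weakly_compact:
  assumes TB: "T \<in> bounded_ops J J" and nl: "null_limits T"
  shows "T \<in> weakly_compact_ops J"
proof -
  define S where "S = T ` unit_ball J"
  define R where "R = J.self.opnorm T"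
  have Sv: "s \<in> vecs J" "nrm J s \<le> R" if "s \<in> S" for s
    using that op_ball_bound[OF TB] by (auto simp: S_def R_def)
  have cl: "l \<in> vecs J \<and> nrm J l \<le> R" if lS: "l \<in> closure S" for l
  proof -
    obtain s :: "nat \<Rightarrow> nat \<Rightarrow> 'k" where s: "\<And>n. s n \<in> S" "s \<longlonglongrightarrow> l" using lS unfolding closure_sequential by blast
    have lim: "\<And>i. (\<lambda>k. s k i) \<longlonglongrightarrow> l i" using tendsto_pointwise[OF s(2)] .
    have "\<forall>n. \<exists>x. x \<in> unit_ball J \<and> s n = T x" using s(1) by (auto simp: S_def)
    then obtain x where x: "\<And>n. x n \<in> unit_ball J" "\<And>n. s n = T (x n)" by metis
    have "l \<longlonglongrightarrow> 0" using lim by (intro null_limitsD[OF nl x(1)]) (simp add: x(2))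
    then show ?thesis using pointwise_limit[OF Sv[OF s(1)] lim] by blast
  qed
  have comp: "compact (closure S)"
  proof -
    have "compactin (product_topology (\<lambda>_ :: nat. euclidean) UNIV) (PiE UNIV (\<lambda>_. cball (0::'k) R))"
      unfolding compactin_PiE by simp
    then have "compact (PiE (UNIV :: nat set) (\<lambda>_. cball (0::'k) R))"
      by (simp add: euclidean_product_topology)
    moreover have "closure S \<subseteq> PiE UNIV (\<lambda>_. cball 0 R)"
    proof
      fix l assume "l \<in> closure S"
      then have "norm (l i) \<le> R" for i using cl[of l] james_coord_le[of l i] by auto
      then show "l \<in> PiE UNIV (\<lambda>_. cball 0 R)" by (auto simp: PiE_UNIV_domain)
    qed
    ultimately show ?thesis using closed_Int_compact[OF closed_closure] by (metis Int_absorb2 inf_commute compact_Int_closed closed_closure)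
  qed
  have cont: "continuous_on (closure S) f" if f: "f \<in> bounded_ops J scalars" for f
    unfolding continuous_on_sequentially
  proof (intro allI ballI impI)
    fix u l assume l: "l \<in> closure S" and u: "(\<forall>n. u n \<in> closure S) \<and> u \<longlonglongrightarrow> l"
    have "(\<lambda>n. f (u n)) \<longlonglongrightarrow> f l"
      using u cl l by (intro functional_pointwise[OF f, of u R]) (auto intro: tendsto_pointwise)
    then show "(f \<circ> u) \<longlonglongrightarrow> f l" by (simp add: comp_def)
  qed
  have cm: "continuous_map (top_of_set (closure S)) (weak_topology J) (\<lambda>x. x)"
    unfolding weak_topology_def continuous_on_generated_topo_iff
  proof (intro conjI allI impI)
    fix V assume "V \<in> {{x \<in> vecs J. f x \<in> U} | f U. f \<in> bounded_ops J scalars \<and> open U}"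
    then obtain f U where V: "V = {x \<in> vecs J. f x \<in> U}" "f \<in> bounded_ops J scalars" "open U" by blast
    have "(\<lambda>x. x) -` V \<inter> topspace (top_of_set (closure S)) = closure S \<inter> f -` U"
      using cl by (auto simp: V(1))
    then show "openin (top_of_set (closure S)) ((\<lambda>x. x) -` V \<inter> topspace (top_of_set (closure S)))"
      using continuous_openin_preimage_gen[OF cont[OF V(2)] V(3)] by simp
  next
    have "vecs J \<subseteq> \<Union> {{x \<in> vecs J. f x \<in> U} | f U. f \<in> bounded_ops J scalars \<and> open U}"
      using topspace_weak unfolding weak_topology_def topology_generated_by_topspace by simp
    then show "(\<lambda>x. x) ` topspace (top_of_set (closure S)) \<subseteq> \<Union> {{x \<in> vecs J. f x \<in> U} | f U. f \<in> bounded_ops J scalars \<and> open U}"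
      using cl by auto
  qed
  have "compactin (top_of_set (closure S)) (closure S)" using comp by (simp add: compactin_subtopology)
  then have cw: "compactin (weak_topology J) (closure S)" using image_compactin[OF _ cm] by fastforce
  have "closedin (weak_topology J) {x \<in> topspace (weak_topology J). x \<in> closure S}"
    by (rule closedin_continuous_map_preimage[OF continuous_map_weak_id]) simp
  moreover have "{x \<in> topspace (weak_topology J). x \<in> closure S} = closure S"
    using cl by (auto simp: topspace_weak)
  ultimately have "closedin (weak_topology J) (closure S)" by simp
  then have "weak_topology J closure_of S \<subseteq> closure S" by (intro closure_of_minimal closure_subset)
  then have "compactin (weak_topology J) (weak_topology J closure_of S)"
    by (intro closed_compactin[OF cw]) auto
  then show ?thesis using TB by (simp add: weakly_compact_ops_def S_def)
qed

lemma weakly_compact_ops_iff: "T \<in> weakly_compact_ops J \<longleftrightarrow> T \<in> bounded_ops J J \<and> null_limits T"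
  using weakly_compact_imp_null_limits null_limits_imp_weakly_compact by (auto simp: weakly_compact_ops_def)

lemma op_pointwise_subsequence:
  assumes T: "T \<in> bounded_ops J J" and x: "\<And>k::nat. x k \<in> unit_ball J"
  obtains r a where "strict_mono (r :: nat \<Rightarrow> nat)" "\<And>i. (\<lambda>k. T (x (r k)) i) \<longlonglongrightarrow> a i"
  using pointwise_subsequence[of "\<lambda>k. T (x k)", OF op_ball_bound[OF T x]] by blast

text \<open>Sequences \<open>T (x k)\<close> have pointwise convergent subsequences. For \<open>S \<circ> T\<close> their limit lies in \<open>J\<close> and the
  subsequence converges weakly, which \<open>S\<close> respects.\<close>

lemma weakly_compact_op_ideal: "op_ideal J (weakly_compact_ops J)"
  unfolding op_ideal_def
proof (intro conjI ballI)
  show "weakly_compact_ops J \<subseteq> bounded_ops J J" by (auto simp: weakly_compact_ops_iff)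
  have "null_limits 0"
    unfolding null_limits_def
  proof (intro allI impI)
    fix x :: "nat \<Rightarrow> nat \<Rightarrow> 'k" and y :: "nat \<Rightarrow> 'k" assume "\<forall>i. (\<lambda>k. 0 (x k) i) \<longlonglongrightarrow> (y i :: 'k)"
    then have "y i = 0" for i by (simp add: LIMSEQ_const_iff)
    then have "y = (\<lambda>_. 0)" by auto
    then show "y \<longlonglongrightarrow> 0" by simp
  qed
  then show "0 \<in> weakly_compact_ops J" by (simp add: weakly_compact_ops_iff J.self.bounded_ops_0)
next
  fix S T assume "S \<in> weakly_compact_ops J" "T \<in> weakly_compact_ops J"
  then have S: "S \<in> bounded_ops J J" "null_limits S" and T: "T \<in> bounded_ops J J" "null_limits T"
    by (auto simp: weakly_compact_ops_iff)
  have "null_limits (S + T)"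
    unfolding null_limits_def
  proof (intro allI impI)
    fix x :: "nat \<Rightarrow> nat \<Rightarrow> 'k" and y
    assume x: "\<forall>k. x k \<in> unit_ball J" and lim: "\<forall>i. (\<lambda>k. (S + T) (x k) i) \<longlonglongrightarrow> y i"
    obtain r a where r: "strict_mono r" "\<And>i. (\<lambda>k. S (x (r k)) i) \<longlonglongrightarrow> a i"
      using op_pointwise_subsequence[OF S(1), of x] x by blast
    have xr: "x (r k) \<in> unit_ball J" for k using x by blast
    have a0: "a \<longlonglongrightarrow> 0" by (rule null_limitsD[OF S(2) xr r(2)])
    have "(\<lambda>k. T (x (r k)) i) \<longlonglongrightarrow> y i - a i" for i
      using tendsto_diff[OF LIMSEQ_subseq_LIMSEQ[OF lim[rule_format, of i] r(1)] r(2)[of i]] by (simp add: comp_def)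
    then have "(\<lambda>i. y i - a i) \<longlonglongrightarrow> 0" by (intro null_limitsD[OF T(2) xr])
    from tendsto_add[OF this a0] show "y \<longlonglongrightarrow> 0" by simp
  qed
  then show "S + T \<in> weakly_compact_ops J" using S T by (simp add: weakly_compact_ops_iff J.self.bounded_ops_plus)
next
  fix T S assume "T \<in> weakly_compact_ops J" and S: "S \<in> bounded_ops J J"
  then have T: "T \<in> bounded_ops J J" "null_limits T" by (auto simp: weakly_compact_ops_iff)
  have "null_limits (S \<circ> T)"
    unfolding null_limits_def
  proof (intro allI impI)
    fix x :: "nat \<Rightarrow> nat \<Rightarrow> 'k" and y
    assume x: "\<forall>k. x k \<in> unit_ball J" and lim: "\<forall>i. (\<lambda>k. (S \<circ> T) (x k) i) \<longlonglongrightarrow> y i"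
    obtain r a where r: "strict_mono r" "\<And>i. (\<lambda>k. T (x (r k)) i) \<longlonglongrightarrow> a i"
      using op_pointwise_subsequence[OF T(1), of x] x by blast
    have xr: "x (r k) \<in> unit_ball J" for k using x by blast
    have a0: "a \<longlonglongrightarrow> 0" by (rule null_limitsD[OF T(2) xr r(2)])
    have av: "a \<in> vecs J" using pointwise_limit(1)[OF op_ball_bound[OF T(1) xr] r(2) a0] .
    have "y i = S a i" for i
    proof -
      define f where "f = restrict_op J (\<lambda>x. x i) \<circ> S"
      have f: "f \<in> bounded_ops J scalars"
        unfolding f_def by (rule bounded_ops_comp(1)[OF normed_james normed_james normed_scalar_space coordinate_functional S])
      have "(\<lambda>k. f (T (x (r k)))) \<longlonglongrightarrow> f a"
        by (rule functional_pointwise[OF f op_ball_bound[OF T(1) xr] r(2) av])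
      moreover have "f u = S u i" if "u \<in> vecs J" for u using that bounded_ops_vecs[OF S] by (simp add: f_def)
      ultimately have "(\<lambda>k. S (T (x (r k))) i) \<longlonglongrightarrow> S a i" using op_ball_bound(1)[OF T(1) xr] av by simp
      moreover have "(\<lambda>k. S (T (x (r k))) i) \<longlonglongrightarrow> y i"
        using LIMSEQ_subseq_LIMSEQ[OF lim[rule_format, of i] r(1)] by (simp add: comp_def)
      ultimately show ?thesis using LIMSEQ_unique by blast
    qed
    then have "y = S a" by auto
    then show "y \<longlonglongrightarrow> 0" using james_vecs_tendsto[OF bounded_ops_vecs[OF S av]] by simp
  qed
  then show "S \<circ> T \<in> weakly_compact_ops J" using S T by (simp add: weakly_compact_ops_iff J.comp_bounded_ops)
  define c where "c = 1 / (J.self.opnorm S + 1)"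
  have c: "c \<noteq> 0" using J.self.opnorm_ge_0[OF S] by (simp add: c_def)
  have "null_limits (T \<circ> S)"
    unfolding null_limits_def
  proof (intro allI impI)
    fix x :: "nat \<Rightarrow> nat \<Rightarrow> 'k" and y
    assume x: "\<forall>k. x k \<in> unit_ball J" and lim: "\<forall>i. (\<lambda>k. (T \<circ> S) (x k) i) \<longlonglongrightarrow> y i"
    have ub: "scal J (of_real c) (S (x k)) \<in> unit_ball J" for k
      unfolding c_def using x by (intro scale_into_ball S) blast
    have "T (scal J (of_real c) (S (x k))) i = of_real c * (T \<circ> S) (x k) i" for k i
      using bounded_ops_scal[OF T(1) op_ball_bound(1)[OF S x[rule_format]]] by (simp add: scal_james)
    then have "(\<lambda>k. T (scal J (of_real c) (S (x k))) i) \<longlonglongrightarrow> of_real c * y i" for i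
      using tendsto_mult[OF tendsto_const lim[rule_format, of i], of "of_real c"] by simp
    then have "(\<lambda>i. of_real c * y i) \<longlonglongrightarrow> 0" by (intro null_limitsD[OF T(2) ub])
    from tendsto_mult[OF tendsto_const this, of "inverse (of_real c)"] show "y \<longlonglongrightarrow> 0"
      using c by (simp add: mult.assoc[symmetric])
  qed
  then show "T \<circ> S \<in> weakly_compact_ops J" using S T by (simp add: weakly_compact_ops_iff J.comp_bounded_ops)
qed

text \<open>Uniform limits of null sequences are null sequences.\<close>

lemma weakly_compact_closed_ideal: "weakly_compact_ops J \<in> closed_ideals J"
proof (rule J.closed_idealsI[OF weakly_compact_op_ideal])
  fix T assume T: "T \<in> bounded_ops J J"
    and near: "\<And>e. 0 < e \<Longrightarrow> \<exists>S\<in>weakly_compact_ops J. J.self.opnorm (T - S) < e"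
  have "null_limits T"
    unfolding null_limits_def
  proof (intro allI impI)
    fix x :: "nat \<Rightarrow> nat \<Rightarrow> 'k" and y
    assume x: "\<forall>k. x k \<in> unit_ball J" and lim: "\<forall>i. (\<lambda>k. T (x k) i) \<longlonglongrightarrow> y i"
    show "y \<longlonglongrightarrow> 0"
    proof (rule null_if_near_null)
      fix e :: real assume e: "0 < e"
      obtain S where S: "S \<in> weakly_compact_ops J" "J.self.opnorm (T - S) < e" using near[OF e] by blast
      then have SB: "S \<in> bounded_ops J J" "null_limits S" by (auto simp: weakly_compact_ops_iff)
      have TS: "T - S \<in> bounded_ops J J" using J.ops.diff_vecs[of T S] T SB by simp
      obtain r a where r: "strict_mono r" "\<And>i. (\<lambda>k. S (x (r k)) i) \<longlonglongrightarrow> a i"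
        using op_pointwise_subsequence[OF SB(1), of x] x by blast
      have xr: "x (r k) \<in> unit_ball J" for k using x by blast
      have a0: "a \<longlonglongrightarrow> 0" by (rule null_limitsD[OF SB(2) xr r(2)])
      have "norm (y i - a i) \<le> e" for i
      proof (rule tendsto_upperbound)
        show "(\<lambda>k. norm (T (x (r k)) i - S (x (r k)) i)) \<longlonglongrightarrow> norm (y i - a i)"
          using LIMSEQ_subseq_LIMSEQ[OF lim[rule_format, of i] r(1)]
          by (intro tendsto_intros r(2)) (simp add: comp_def)
        have "norm (T (x (r k)) i - S (x (r k)) i) \<le> e" for k
          using james_coord_le[OF op_ball_bound(1)[OF TS xr], of k i] op_ball_bound(2)[OF TS xr, of k] S(2) by simp
        then show "\<forall>\<^sub>F k in sequentially. norm (T (x (r k)) i - S (x (r k)) i) \<le> e" by simp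
      qed simp
      then show "\<exists>a. a \<longlonglongrightarrow> 0 \<and> (\<forall>i. norm (y i - a i) \<le> e)" using a0 by blast
    qed
  qed
  then show "T \<in> weakly_compact_ops J" using T by (simp add: weakly_compact_ops_iff)
qed

text \<open>The range of \<open>block_proj\<close> is a reflexive \<open>\<ell>\<^sub>p\<close>-sum of finite-dimensional spaces. In concrete terms: block norms
  of the limit are again \<open>p\<close>-summable, and as the limit vanishes at the ends of the blocks, they bound its values.\<close>

lemma block_proj_weakly_compact: "block_proj \<in> weakly_compact_ops J"
  unfolding weakly_compact_ops_iff
proof (intro conjI block_proj_bounded)
  show "null_limits block_proj"
    unfolding null_limits_def
  proof (intro allI impI)
    fix x :: "nat \<Rightarrow> nat \<Rightarrow> 'k" and y
    assume x: "\<forall>k. x k \<in> unit_ball J" and lim: "\<forall>i. (\<lambda>k. block_proj (x k) i) \<longlonglongrightarrow> y i"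
    define c where "c = (\<lambda>n. block_var p y (block n))"
    have v: "x k \<in> vecs J" "nrm J (x k) \<le> 1" for k using x unit_ballD by blast+
    have yend: "y (blk_end i) = 0" for i
    proof -
      have "block_proj (x k) (blk_end i) = 0" for k using v by (simp add: block_proj_def blk_blk_end)
      then show ?thesis using lim[rule_format, of "blk_end i"] by (simp add: LIMSEQ_const_iff)
    qed
    \<comment> \<open>Lists in distinct blocks concatenate, so the block norms of every vector of the sequence have \<open>\<ell>\<^sub>p\<close>-norm at most 1.\<close>
    have fam: "(\<Sum>n<M. list_var p y (ns n)) \<le> 1"
      if ns: "\<And>n. sorted_wrt (<) (ns n)" "\<And>n. set (ns n) \<subseteq> block n" for M and ns :: "nat \<Rightarrow> nat list"
    proof (rule tendsto_upperbound)
      show "(\<lambda>k. \<Sum>n<M. list_var p (block_proj (x k)) (ns n)) \<longlonglongrightarrow> (\<Sum>n<M. list_var p y (ns n))"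
        using p1 lim by (intro tendsto_sum tendsto_list_var) auto
      have "(\<Sum>n<M. list_var p (block_proj (x k)) (ns n)) \<le> 1" for k
      proof -
        have "(\<Sum>n<M. list_var p (block_proj (x k)) (ns n)) = (\<Sum>n<M. list_var p (x k) (ns n))"
          using v(1)[of k] list_var_block_proj[OF ns(2)] by (simp add: block_proj_def)
        also have "\<dots> \<le> (\<Sum>n<M. block_var p (x k) (block n))"
          using ns by (intro sum_mono list_var_le_block_var v) auto
        also have "\<dots> \<le> nrm J (x k) powr p" by (rule james_lower_estimate[OF mono_blk v(1)])
        also have "\<dots> \<le> 1 powr p" using v p1 james_norm_ge_0 by (intro powr_mono2) auto
        finally show ?thesis by simp
      qed
      then show "\<forall>\<^sub>F k in sequentially. (\<Sum>n<M. list_var p (block_proj (x k)) (ns n)) \<le> 1" by simp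
    qed simp
    show "y \<longlonglongrightarrow> 0"
    proof (rule block_null)
      define i where "i = (\<lambda>n. SOME i. blk i = n \<and> (\<forall>j. blk j = n \<longrightarrow> norm (y j) \<le> norm (y i)))"
      have i: "blk (i n) = n \<and> (\<forall>j. blk j = n \<longrightarrow> norm (y j) \<le> norm (y (i n)))" for n
      proof -
        have "finite (block n)"
          by (rule finite_subset[of _ "{..blk_off n + 2 ^ n}"]) (auto simp: blk_eq_iff)
        moreover have "block n \<noteq> {}" using blk_eqI[of n "blk_off n"] by auto
        ultimately have "Max ((\<lambda>j. norm (y j)) ` block n) \<in> (\<lambda>j. norm (y j)) ` block n"
          by (intro Max_in finite_imageI) blast+
        then obtain m where m: "Max ((\<lambda>j. norm (y j)) ` block n) = norm (y m)" "m \<in> block n" by (rule imageE)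
        have "norm (y j) \<le> norm (y m)" if "blk j = n" for j
          using Max_ge[of "(\<lambda>j. norm (y j)) ` block n" "norm (y j)"] that m(1) \<open>finite (block n)\<close> by simp
        then have "blk m = n \<and> (\<forall>j. blk j = n \<longrightarrow> norm (y j) \<le> norm (y m))" using m(2) by simp
        then show ?thesis unfolding i_def by (rule someI)
      qed
      let ?c = "\<lambda>n. norm (y (i n)) powr p"
      show "norm (y j) powr p \<le> ?c (blk j)" for j using i p1 by (intro powr_mono2) auto
      show "(\<Sum>n<M. ?c n) \<le> 1" for M
      proof -
        define ns where "ns = (\<lambda>n. if i n = blk_off n + 2 ^ n then [] else [i n, blk_off n + 2 ^ n])"
        have "sorted_wrt (<) (ns n)" "set (ns n) \<subseteq> block n" for n
          using i[of n] blk_bounds(2)[of "i n"] blk_blk_end[of "i n"] by (auto simp: ns_def)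
        then have "(\<Sum>n<M. list_var p y (ns n)) \<le> 1" by (rule fam)
        moreover have "list_var p y (ns n) = ?c n" for n
          using yend[of "i n"] i[of n] by (auto simp: ns_def)
        ultimately show ?thesis by simp
      qed
    qed simp
  qed
qed

lemma summing_vectors: "trunc n (\<lambda>_. 1) \<in> vecs J" "nrm J (trunc n (\<lambda>_. 1)) \<le> blockc"
proof -
  define \<beta> :: "nat \<Rightarrow> nat" where "\<beta> = (\<lambda>i. if i < n then 0 else 1)"
  define c :: "nat \<Rightarrow> real" where "c = (\<lambda>k. if k = 0 then 1 else 0)"
  have \<beta>: "mono \<beta>" by (auto simp: \<beta>_def mono_def)
  show v: "trunc n (\<lambda>_. 1) \<in> vecs J" by (rule trunc_norm_le)
  have lv: "\<forall>ns k. sorted_wrt (<) ns \<longrightarrow> (\<forall>i\<in>set ns. \<beta> i = k) \<longrightarrow> list_var p (trunc n (\<lambda>_. 1)) ns \<le> c k"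
  proof (intro allI impI)
    fix ns k assume ns: "sorted_wrt (<) ns" "\<forall>i\<in>set ns. \<beta> i = k"
    have "list_var p (trunc n (\<lambda>_. 1)) ns = list_var p (\<lambda>_. if k = 0 then 1 else 0 :: 'k) ns"
    proof (rule list_var_cong)
      fix i assume "i \<in> set ns"
      then have "\<beta> i = k" using ns by blast
      then show "trunc n (\<lambda>_. 1) i = (if k = 0 then 1 else 0)" by (auto simp: trunc_def \<beta>_def split: if_splits)
    qed
    then show "list_var p (trunc n (\<lambda>_. 1)) ns \<le> c k" by (simp add: list_var_eq_sum c_def)
  qed
  have D: "(\<Sum>k<M. c k) \<le> 1 powr p" for M
    by (cases M) (auto simp: c_def sum.lessThan_Suc_shift simp del: sum.lessThan_Suc)
  have "nrm J (trunc n (\<lambda>_. 1)) \<le> blockc * 1"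
    by (rule james_upper_estimate(2)[OF \<beta> james_vecs_tendsto[OF v] lv _ _ D]) (auto simp: trunc_def \<beta>_def c_def)
  then show "nrm J (trunc n (\<lambda>_. 1)) \<le> blockc" by simp
qed

text \<open>The identity is not weakly compact: the bounded vectors \<open>(1, \<dots>, 1, 0, 0, \<dots>)\<close> tend to the constant
  sequence 1.\<close>

lemma weakly_compact_strict_subset: "weakly_compact_ops J \<subset> bounded_ops J J"
proof -
  let ?I = "restrict_op J (\<lambda>x. x)"
  have "\<not> null_limits ?I"
  proof
    assume nl: "null_limits ?I"
    have b: "0 < blockc" using powr_ge_zero[of 2 p] by (simp add: add_pos_nonneg order_less_imp_not_eq2)
    define c where "c = (of_real (1 / blockc) :: 'k)"
    have nc: "norm c = 1 / blockc" unfolding c_def norm_of_real using b by simp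
    have c: "c \<noteq> 0" using nc b by auto
    define x where "x = (\<lambda>k. scal J c (trunc k (\<lambda>_. 1)))"
    have xv: "x k \<in> vecs J" for k unfolding x_def by (intro J.scal_vecs summing_vectors)
    have "nrm J (x k) \<le> 1" for k
    proof -
      have "nrm J (x k) = 1 / blockc * nrm J (trunc k (\<lambda>_. 1))"
        unfolding x_def J.nrm_scal[OF summing_vectors(1)] nc by simp
      also have "\<dots> \<le> 1 / blockc * blockc" using b by (intro mult_left_mono summing_vectors) auto
      finally show ?thesis using b by simp
    qed
    then have ub: "x k \<in> unit_ball J" for k using xv by (simp add: unit_ball_def)
    have "(\<lambda>k. ?I (x k) i) \<longlonglongrightarrow> c" for i
    proof (rule tendsto_eventually)
      have "?I (x k) i = c" if "Suc i \<le> k" for k using that xv by (simp add: x_def scal_james trunc_def)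
      then show "\<forall>\<^sub>F k in sequentially. ?I (x k) i = c" by (auto simp: eventually_sequentially)
    qed
    then have "(\<lambda>_::nat. c) \<longlonglongrightarrow> 0" by (rule null_limitsD[OF nl ub])
    then show False using c by (simp add: LIMSEQ_const_iff)
  qed
  then show ?thesis using J.id_bounded_ops by (auto simp: weakly_compact_ops_iff)
qed

text \<open>On \<open>G\<^sub>p\<close> the identity is \<open>coefs \<circ> block_proj \<circ> embed\<close>, so everything that factors through \<open>G\<^sub>p\<close> factors
  through the weakly compact operator \<open>block_proj\<close>.\<close>

lemma factor_G_subset_weakly_compact: "closed_factor_ops G J \<subseteq> weakly_compact_ops J"
proof -
  have "factor_ops G J \<subseteq> weakly_compact_ops J"
  proof
    fix P assume "P \<in> factor_ops G J"
    then obtain S T where P: "P = S \<circ> T" "T \<in> bounded_ops J G" "S \<in> bounded_ops G J"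
      by (auto simp: factor_ops_def)
    have SB: "S \<circ> coefs \<in> bounded_ops J J" and AT: "embed \<circ> T \<in> bounded_ops J J"
      using bounded_ops_comp(1)[OF normed_james normed_G normed_james P(3) coefs_bounded]
        bounded_ops_comp(1)[OF normed_james normed_G normed_james embed_bounded P(2)] by auto
    have "P = (S \<circ> coefs) \<circ> (block_proj \<circ> (embed \<circ> T))"
    proof
      fix x
      show "P x = ((S \<circ> coefs) \<circ> (block_proj \<circ> (embed \<circ> T))) x"
      proof -
        have Tx: "T x \<in> vecs G"
          using bounded_ops_vecs[OF P(2)] bounded_ops_off[OF P(2)] G.zero_vecs by (cases "x \<in> vecs J") auto
        show ?thesis
          using coefs_embed[OF Tx] coefs_block_proj[OF bounded_ops_vecs[OF embed_bounded Tx]] by (simp add: P(1))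
      qed
    qed
    then show "P \<in> weakly_compact_ops J"
      using weakly_compact_op_ideal block_proj_weakly_compact SB AT unfolding op_ideal_def by metis
  qed
  moreover have "closedin (norm_topology (op_space J J)) (weakly_compact_ops J)"
    using weakly_compact_closed_ideal by (simp add: closed_ideals_def)
  ultimately show ?thesis unfolding closed_factor_ops_def by (rule closure_of_minimal)
qed

end

section \<open>Operators factoring through \<open>\<ell>\<^sub>p\<close>\<close>

subsection \<open>Signed sums in \<open>\<ell>\<^sub>p\<close>\<close>

text \<open>The sum of the values at \<open>m - t\<close> and \<open>m + t\<close> has positive derivative for \<open>t > 0\<close>.\<close>

lemma powr_midpoint_strict:
  fixes a b p :: real
  assumes p: "1 < p" and ab: "0 \<le> a" "a < b"
  shows "((a + b) / 2) powr p < (a powr p + b powr p) / 2"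
proof -
  define m where "m = (a + b) / 2"
  define h where "h = (b - a) / 2"
  let ?f = "\<lambda>t. (m + t) powr p + (m - t) powr p"
  have h: "0 < h" "h \<le> m" "m - h = a" "m + h = b" using ab by (auto simp: m_def h_def field_simps)
  have "?f 0 < ?f h"
  proof (rule DERIV_pos_imp_increasing_open[OF h(1)])
    fix t assume t: "0 < t" "t < h"
    have d: "(?f has_real_derivative p * (m + t) powr (p - 1) - p * (m - t) powr (p - 1)) (at t)"
      using t h by (auto intro!: derivative_eq_intros)
    moreover have "(m - t) powr (p - 1) < (m + t) powr (p - 1)"
      using t h p by (intro powr_less_mono2) auto
    ultimately show "\<exists>y. (?f has_real_derivative y) (at t) \<and> 0 < y" using p by (intro exI conjI) auto
  next
    show "continuous_on {0..h} ?f"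
      using p h by (intro continuous_intros continuous_on_powr') auto
  qed
  then show ?thesis using h by (simp add: m_def)
qed

lemma norm_le_sign_average: "norm (x :: 'a::real_normed_vector) \<le> (norm (x + y) + norm (x - y)) / 2"
proof -
  have "norm (x + y + (x - y)) \<le> norm (x + y) + norm (x - y)" by (rule norm_triangle_ineq)
  then show ?thesis by (simp flip: scaleR_2)
qed

lemma sign_average_ge:
  fixes x y :: "'a::real_normed_vector"
  assumes p: "1 < p"
  shows "norm x powr p \<le> (norm (x + y) powr p + norm (x - y) powr p) / 2"
proof -
  have "norm x powr p \<le> ((norm (x + y) + norm (x - y)) / 2) powr p"
    using p norm_le_sign_average[of x y] by (intro powr_mono2) auto
  also have "\<dots> \<le> (norm (x + y) powr p + norm (x - y) powr p) / 2"
    using powr_convex_combination[of p "norm (x + y)" "norm (x - y)" "1 / 2" "1 / 2"] p by (simp add: field_simps)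
  finally show ?thesis .
qed

text \<open>If \<open>norm (x + y)\<close> and \<open>norm (x - y)\<close> differ, strict convexity of the \<open>p\<close>-th power applies to them; if they are equal,
  the parallelogram law makes both larger than \<open>norm x\<close>.\<close>

lemma sign_average_gt:
  fixes x y :: "'a::real_inner"
  assumes p: "1 < p" and y: "y \<noteq> 0"
  shows "norm x powr p < (norm (x + y) powr p + norm (x - y) powr p) / 2"
proof (cases "norm (x + y) = norm (x - y)")
  case True
  have "(norm (x + y))\<^sup>2 + (norm (x - y))\<^sup>2 = 2 * (norm x)\<^sup>2 + 2 * (norm y)\<^sup>2"
    by (simp add: power2_norm_eq_inner inner_simps)
  moreover have "0 < (norm y)\<^sup>2" using y by simp
  ultimately have "(norm x)\<^sup>2 < (norm (x + y))\<^sup>2" unfolding True by linarith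
  then have "norm x < norm (x + y)" by (rule power_less_imp_less_base) simp
  then show ?thesis using True p powr_less_mono2[of p "norm x" "norm (x + y)"] by simp
next
  case False
  define a where "a = min (norm (x + y)) (norm (x - y))"
  define b where "b = max (norm (x + y)) (norm (x - y))"
  have ab: "0 \<le> a" "a < b" using False by (auto simp: a_def b_def)
  have "norm x powr p \<le> ((a + b) / 2) powr p"
    using p norm_le_sign_average[of x y] by (intro powr_mono2) (auto simp: a_def b_def min_def max_def)
  also have "\<dots> < (a powr p + b powr p) / 2" by (rule powr_midpoint_strict[OF p ab])
  also have "\<dots> = (norm (x + y) powr p + norm (x - y) powr p) / 2" by (auto simp: a_def b_def min_def max_def)
  finally show ?thesis .
qed

text \<open>By homogeneity \<open>norm y = 1\<close> may be assumed; then the pairs form a compact set, on which the positive difference of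
  \<open>sign_average_gt\<close> attains its minimum.\<close>

lemma sign_gap:
  assumes p: "1 < p" and \<eta>: "0 < \<eta>"
  shows "\<exists>\<gamma>>0. \<forall>x y :: 'a::euclidean_space. \<eta> * norm x \<le> norm y \<longrightarrow>
    norm x powr p + \<gamma> * norm y powr p \<le> (norm (x + y) powr p + norm (x - y) powr p) / 2"
proof -
  define f where "f = (\<lambda>z :: 'a \<times> 'a. (norm (fst z + snd z) powr p + norm (fst z - snd z) powr p) / 2 - norm (fst z) powr p)"
  define K where "K = cball (0 :: 'a) (1 / \<eta>) \<times> sphere (0 :: 'a) 1"
  have "compact K" by (simp add: K_def compact_Times)
  moreover have "K \<noteq> {}" using \<eta> by (auto simp: K_def intro: less_imp_le)
  moreover have "continuous_on K f"
    unfolding f_def using p by (intro continuous_intros continuous_on_powr') auto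
  ultimately obtain z where z: "z \<in> K" "\<And>w. w \<in> K \<Longrightarrow> f z \<le> f w"
    using continuous_attains_inf[of K f] by blast
  have "snd z \<noteq> 0" using z(1) by (auto simp: K_def)
  then have pos: "0 < f z" using sign_average_gt[OF p, of "snd z" "fst z"] by (simp add: f_def)
  have "norm x powr p + f z * norm y powr p \<le> (norm (x + y) powr p + norm (x - y) powr p) / 2"
    if xy: "\<eta> * norm x \<le> norm y" for x y :: 'a
  proof (cases "y = 0")
    case False
    define s where "s = norm y"
    have s: "0 < s" using False by (simp add: s_def)
    have sc: "norm ((1 / s) *\<^sub>R v) powr p = norm v powr p / s powr p" for v :: 'a
      using s by (simp add: powr_divide)
    have "((1 / s) *\<^sub>R x, (1 / s) *\<^sub>R y) \<in> K"
      using xy s \<eta> False by (simp add: K_def s_def field_simps)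
    from z(2)[OF this] have "f z \<le> (norm ((1 / s) *\<^sub>R (x + y)) powr p + norm ((1 / s) *\<^sub>R (x - y)) powr p) / 2
        - norm ((1 / s) *\<^sub>R x) powr p"
      by (simp only: f_def fst_conv snd_conv scaleR_right_distrib scaleR_right_diff_distrib)
    then have "f z \<le> ((norm (x + y) powr p + norm (x - y) powr p) / 2 - norm x powr p) / s powr p"
      unfolding sc by (simp add: add_divide_distrib diff_divide_distrib)
    then show ?thesis using s by (simp add: pos_le_divide_eq s_def algebra_simps)
  qed (use xy p \<eta> in simp)
  then show ?thesis using pos by blast
qed

text \<open>Adding a vector \<open>y\<close> that is not small to a vector \<open>x\<close> of bounded norm, with the better sign, makes the norm in
  \<open>\<ell>\<^sub>p\<close> grow by a fixed amount. The constant \<open>\<eta>\<close> is chosen so that the coordinates to which \<open>sign_gap\<close> does not apply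
  carry at most half of the mass of \<open>y\<close>.\<close>

lemma sign_growth:
  assumes p: "1 < p" and c: "0 < c" and D: "0 \<le> D"
  shows "\<exists>\<delta>>0. \<forall>F (x :: nat \<Rightarrow> 'a::euclidean_space) y. finite F \<longrightarrow> (\<Sum>i\<in>F. norm (x i) powr p) \<le> D \<longrightarrow>
    c \<le> (\<Sum>i\<in>F. norm (y i) powr p) \<longrightarrow>
    (\<Sum>i\<in>F. norm (x i) powr p) + \<delta> \<le> (\<Sum>i\<in>F. norm (x i + y i) powr p) \<or>
    (\<Sum>i\<in>F. norm (x i) powr p) + \<delta> \<le> (\<Sum>i\<in>F. norm (x i - y i) powr p)"
proof -
  define \<eta> where "\<eta> = (c / (2 * (D + 1))) powr (1 / p)"
  have \<eta>: "0 < \<eta>" "\<eta> powr p = c / (2 * (D + 1))" using c D p by (auto simp: \<eta>_def powr_powr)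
  obtain \<gamma> where \<gamma>: "0 < \<gamma>" "\<And>x y :: 'a. \<eta> * norm x \<le> norm y \<Longrightarrow>
      norm x powr p + \<gamma> * norm y powr p \<le> (norm (x + y) powr p + norm (x - y) powr p) / 2"
    using sign_gap[OF p \<eta>(1)] by blast
  have avg: "(\<Sum>i\<in>F. norm (x i) powr p) + \<gamma> * (c / 2)
      \<le> ((\<Sum>i\<in>F. norm (x i + y i) powr p) + (\<Sum>i\<in>F. norm (x i - y i) powr p)) / 2"
    if F: "finite F" and x: "(\<Sum>i\<in>F. norm (x i) powr p) \<le> D" and y: "c \<le> (\<Sum>i\<in>F. norm (y i) powr p)"
    for F and x y :: "nat \<Rightarrow> 'a"
  proof -
    have pt: "norm (y i) powr p - \<eta> powr p * norm (x i) powr p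
        \<le> ((norm (x i + y i) powr p + norm (x i - y i) powr p) / 2 - norm (x i) powr p) / \<gamma>" for i
    proof (cases "\<eta> * norm (x i) \<le> norm (y i)")
      case True
      have "norm (y i) powr p \<le> ((norm (x i + y i) powr p + norm (x i - y i) powr p) / 2 - norm (x i) powr p) / \<gamma>"
        unfolding pos_le_divide_eq[OF \<gamma>(1)] mult.commute[of _ \<gamma>] using \<gamma>(2)[OF True] by linarith
      then show ?thesis by (smt (verit) mult_nonneg_nonneg powr_ge_zero)
    next
      case False
      have "norm (y i) powr p \<le> (\<eta> * norm (x i)) powr p" using False p by (intro powr_mono2) auto
      also have "\<dots> = \<eta> powr p * norm (x i) powr p" using \<eta> by (simp add: powr_mult)
      finally have "norm (y i) powr p - \<eta> powr p * norm (x i) powr p \<le> 0" by simp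
      also have "0 \<le> ((norm (x i + y i) powr p + norm (x i - y i) powr p) / 2 - norm (x i) powr p) / \<gamma>"
        using sign_average_ge[OF p, of "x i" "y i"] \<gamma>(1) by (intro divide_nonneg_pos) auto
      finally show ?thesis .
    qed
    have "\<eta> powr p * (\<Sum>i\<in>F. norm (x i) powr p) \<le> \<eta> powr p * (D + 1)" using x by (intro mult_left_mono) auto
    also have "\<dots> = c / 2" using \<eta>(2) D by (simp add: field_simps)
    finally have "c / 2 \<le> (\<Sum>i\<in>F. norm (y i) powr p - \<eta> powr p * norm (x i) powr p)"
      using y by (simp add: sum_subtractf sum_distrib_left)
    also have "\<dots> \<le> (\<Sum>i\<in>F. ((norm (x i + y i) powr p + norm (x i - y i) powr p) / 2 - norm (x i) powr p) / \<gamma>)"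
      by (intro sum_mono pt)
    also have "\<dots> = (((\<Sum>i\<in>F. norm (x i + y i) powr p) + (\<Sum>i\<in>F. norm (x i - y i) powr p)) / 2
        - (\<Sum>i\<in>F. norm (x i) powr p)) / \<gamma>"
      by (simp add: sum_subtractf sum.distrib flip: sum_divide_distrib)
    finally show ?thesis using \<gamma>(1) by (simp add: pos_le_divide_eq algebra_simps)
  qed
  have "(\<Sum>i\<in>F. norm (x i) powr p) + \<gamma> * (c / 2) \<le> (\<Sum>i\<in>F. norm (x i + y i) powr p) \<or>
      (\<Sum>i\<in>F. norm (x i) powr p) + \<gamma> * (c / 2) \<le> (\<Sum>i\<in>F. norm (x i - y i) powr p)"
    if "finite F" "(\<Sum>i\<in>F. norm (x i) powr p) \<le> D" "c \<le> (\<Sum>i\<in>F. norm (y i) powr p)"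
    for F and x y :: "nat \<Rightarrow> 'a"
    using avg[OF that] by (simp add: field_simps) linarith
  moreover have "0 < \<gamma> * (c / 2)" using \<gamma>(1) c by simp
  ultimately show ?thesis by blast
qed

text \<open>Choosing signs greedily, the norm of the signed sum grows by a fixed amount in each step as long as it is bounded by
  \<open>D\<close>. In \<open>\<ell>\<^sub>\<infinity>\<^sup>n\<close>, on the other hand, all signed sums of the unit vectors have norm 1.\<close>

lemma signed_sums_unbounded:
  assumes p: "1 < p" and c: "0 < c" and D: "0 \<le> D"
  shows "\<exists>n. \<forall>F (u :: nat \<Rightarrow> nat \<Rightarrow> 'a::{real_normed_field, euclidean_space}). finite F \<longrightarrow>
    (\<forall>l<n. c \<le> (\<Sum>i\<in>F. norm (u l i) powr p)) \<longrightarrow>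
    (\<exists>m\<le>n. \<exists>\<sigma>. (\<forall>l. \<sigma> l \<in> {1, - 1}) \<and> D < (\<Sum>i\<in>F. norm (\<Sum>l<m. \<sigma> l * u l i) powr p))"
proof -
  obtain \<delta> where \<delta>: "0 < \<delta>" and step: "\<forall>F (x :: nat \<Rightarrow> 'a) y. finite F \<longrightarrow> (\<Sum>i\<in>F. norm (x i) powr p) \<le> D \<longrightarrow>
    c \<le> (\<Sum>i\<in>F. norm (y i) powr p) \<longrightarrow>
    (\<Sum>i\<in>F. norm (x i) powr p) + \<delta> \<le> (\<Sum>i\<in>F. norm (x i + y i) powr p) \<or>
    (\<Sum>i\<in>F. norm (x i) powr p) + \<delta> \<le> (\<Sum>i\<in>F. norm (x i - y i) powr p)"
    using sign_growth[OF p c D, where 'a = 'a] by blast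
  obtain n :: nat where n: "D / \<delta> < real n" using reals_Archimedean2 by blast
  have "\<exists>m\<le>n. \<exists>\<sigma>. (\<forall>l. \<sigma> l \<in> {1, - 1}) \<and> D < (\<Sum>i\<in>F. norm (\<Sum>l<m. \<sigma> l * u l i) powr p)"
    if F: "finite F" and u: "\<forall>l<n. c \<le> (\<Sum>i\<in>F. norm (u l i) powr p)" for F and u :: "nat \<Rightarrow> nat \<Rightarrow> 'a"
  proof (rule ccontr)
    assume neg: "\<not> ?thesis"
    have le: "(\<Sum>i\<in>F. norm (\<Sum>l<m. \<sigma> l * u l i) powr p) \<le> D"
      if "m \<le> n" "\<forall>l. \<sigma> l \<in> {1, - 1}" for m \<sigma>
      using neg that by (meson not_le)
    have "\<exists>\<sigma>. (\<forall>l. \<sigma> l \<in> {1, - 1}) \<and> real m * \<delta> \<le> (\<Sum>i\<in>F. norm (\<Sum>l<m. \<sigma> l * u l i) powr p)" if "m \<le> n" for m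
      using that
    proof (induction m)
      case 0
      show ?case using p by (intro exI[of _ "\<lambda>_. 1"]) simp
    next
      case (Suc m)
      then obtain \<sigma> where \<sigma>: "\<forall>l. \<sigma> l \<in> {1, - 1}" "real m * \<delta> \<le> (\<Sum>i\<in>F. norm (\<Sum>l<m. \<sigma> l * u l i) powr p)" by auto
      define x where "x = (\<lambda>i. \<Sum>l<m. \<sigma> l * u l i)"
      have "(\<Sum>i\<in>F. norm (x i) powr p) \<le> D" unfolding x_def using Suc.prems \<sigma> by (intro le) auto
      then have "(\<Sum>i\<in>F. norm (x i) powr p) + \<delta> \<le> (\<Sum>i\<in>F. norm (x i + u m i) powr p) \<or>
          (\<Sum>i\<in>F. norm (x i) powr p) + \<delta> \<le> (\<Sum>i\<in>F. norm (x i - u m i) powr p)"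
        using step[rule_format, of F x "u m"] F u Suc.prems by auto
      then have "\<exists>s\<in>{1, - 1}. (\<Sum>i\<in>F. norm (x i) powr p) + \<delta> \<le> (\<Sum>i\<in>F. norm (x i + s * u m i) powr p)" by auto
      then obtain s where s: "s \<in> {1, - 1}" "(\<Sum>i\<in>F. norm (x i) powr p) + \<delta> \<le> (\<Sum>i\<in>F. norm (x i + s * u m i) powr p)" by blast
      have "(\<Sum>l<Suc m. (\<sigma>(m := s)) l * u l i) = x i + s * u m i" for i
        unfolding x_def by (simp add: sum.lessThan_Suc)
      then have "real (Suc m) * \<delta> \<le> (\<Sum>i\<in>F. norm (\<Sum>l<Suc m. (\<sigma>(m := s)) l * u l i) powr p)"
        using s(2) \<sigma>(2) by (simp only: x_def) (simp add: algebra_simps)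
      moreover have "\<forall>l. (\<sigma>(m := s)) l \<in> {1, - 1}" using \<sigma>(1) s(1) by simp
      ultimately show ?case by blast
    qed
    from this[of n] obtain \<sigma> where "\<forall>l. \<sigma> l \<in> {1, - 1}" "real n * \<delta> \<le> (\<Sum>i\<in>F. norm (\<Sum>l<n. \<sigma> l * u l i) powr p)" by auto
    then have "real n * \<delta> \<le> D" using le[of n \<sigma>] by simp
    then show False using n \<delta> by (simp add: field_simps)
  qed
  then show ?thesis by blast
qed

lemma (in op_algebra) comp_in_closed_factor_ops:
  assumes Y: "normed_nspace Y" and A: "A \<in> bounded_ops X Y" and B: "B \<in> bounded_ops Y X"
  shows "B \<circ> A \<in> closed_factor_ops Y X"
proof -
  have "self.opnorm ((B \<circ> A) - (B \<circ> A)) < e" if "0 < e" for e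
    using that ops.nrm_0 by simp
  then show ?thesis
    unfolding closed_factor_ops_iff[OF Y]
    using bounded_ops_comp(1)[OF normed_nspace_axioms Y normed_nspace_axioms B A] A B by blast
qed

lemma sum_fun_coord: "(\<Sum>a\<in>A. f a) i = (\<Sum>a\<in>A. f a i :: 'b::comm_monoid_add)"
  by (induction A rule: infinite_finite_induct) auto

context james_setting
begin

subsection \<open>Finitely supported vectors of \<open>G\<^sub>p\<close>\<close>

definition fin_vec :: "nat set \<Rightarrow> (nat \<Rightarrow> nat \<Rightarrow> 'k) \<Rightarrow> nat \<Rightarrow> nat \<Rightarrow> 'k" where
  "fin_vec I g = (\<lambda>\<kappa> l. if \<kappa> \<in> I \<and> l < \<kappa> then g \<kappa> l else 0)"

definition unit_vec :: "nat \<Rightarrow> nat \<Rightarrow> nat \<Rightarrow> nat \<Rightarrow> 'k" where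
  "unit_vec \<kappa> l = (\<lambda>\<kappa>' l'. if \<kappa>' = \<kappa> \<and> l' = l then 1 else 0)"

lemma fin_vec_G:
  assumes I: "finite I" and D: "0 \<le> D" and y: "\<And>\<kappa>. \<kappa> \<in> I \<Longrightarrow> 0 \<le> y \<kappa>"
    and g: "\<And>\<kappa> l. \<lbrakk>\<kappa> \<in> I; l < \<kappa>\<rbrakk> \<Longrightarrow> norm (g \<kappa> l) \<le> y \<kappa>" and s: "(\<Sum>\<kappa>\<in>I. y \<kappa> powr p) \<le> D powr p"
  shows "fin_vec I g \<in> vecs G" "nrm G (fin_vec I g) \<le> D"
proof -
  define z where "z = (\<lambda>\<kappa>. if \<kappa> \<in> I then y \<kappa> else 0)"
  have "(\<Sum>\<kappa>\<in>F. z \<kappa> powr p) \<le> D powr p" if F: "finite F" for F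
  proof -
    have "(\<Sum>\<kappa>\<in>F. z \<kappa> powr p) = (\<Sum>\<kappa>\<in>F \<inter> I. y \<kappa> powr p)"
      using F p1 by (intro sum.mono_neutral_cong_right) (auto simp: z_def)
    also have "\<dots> \<le> (\<Sum>\<kappa>\<in>I. y \<kappa> powr p)" using I by (intro sum_mono2) auto
    finally show ?thesis using s by simp
  qed
  then show "fin_vec I g \<in> vecs G" "nrm G (fin_vec I g) \<le> D"
    using G_boundI[of "fin_vec I g" D z] D y g by (auto simp: fin_vec_def z_def)
qed

lemma unit_vec_G:
  assumes "l < \<kappa>"
  shows "unit_vec \<kappa> l \<in> vecs G" "1 \<le> nrm G (unit_vec \<kappa> l)" "nrm G (unit_vec \<kappa> l) \<le> 1"
proof -
  have e: "unit_vec \<kappa> l = fin_vec {\<kappa>} (unit_vec \<kappa> l)" using assms by (auto simp: fun_eq_iff unit_vec_def fin_vec_def)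
  show v: "unit_vec \<kappa> l \<in> vecs G" "nrm G (unit_vec \<kappa> l) \<le> 1"
    using fin_vec_G[of "{\<kappa>}" 1 "\<lambda>_. 1" "unit_vec \<kappa> l"] e by (simp_all add: unit_vec_def)
  have "1 \<le> bnorm (unit_vec \<kappa> l) \<kappa>" using bnorm_coord_le[OF assms, of "unit_vec \<kappa> l"] by (simp add: unit_vec_def)
  then have "1 powr p \<le> bnorm (unit_vec \<kappa> l) \<kappa> powr p" using p1 by (intro powr_mono2) auto
  also have "\<dots> \<le> nrm G (unit_vec \<kappa> l) powr p" using G_upper[OF v(1), of "{\<kappa>}"] by simp
  finally have "\<not> nrm G (unit_vec \<kappa> l) < 1"
    using powr_less_mono2[of p "nrm G (unit_vec \<kappa> l)" 1] p1 G.nrm_ge_0[OF v(1)] by auto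
  then show "1 \<le> nrm G (unit_vec \<kappa> l)" by simp
qed

lemma op_fin_vec:
  assumes T: "T \<in> bounded_ops G Y" and I: "finite I"
  shows "T (fin_vec I g) = (\<Sum>\<kappa>\<in>I. \<Sum>l<\<kappa>. scal Y (g \<kappa> l) (T (unit_vec \<kappa> l)))"
proof -
  define f where "f = (\<lambda>(\<kappa>, l). scal G (g \<kappa> l) (unit_vec \<kappa> l))"
  define A where "A = (SIGMA \<kappa>:I. {..<\<kappa>})"
  have A: "finite A" using I by (simp add: A_def)
  have "fin_vec I g \<kappa> l = (\<Sum>a\<in>A. f a) \<kappa> l" for \<kappa> l
  proof -
    have "(\<Sum>a\<in>A. f a) \<kappa> l = (\<Sum>a\<in>A. f a \<kappa> l)" by (simp add: sum_fun_coord)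
    also have "\<dots> = (\<Sum>a\<in>A. if a = (\<kappa>, l) then g \<kappa> l else 0)"
    proof (intro sum.cong refl)
      fix a assume "a \<in> A"
      show "f a \<kappa> l = (if a = (\<kappa>, l) then g \<kappa> l else 0)"
        by (cases a) (simp add: f_def scal_G unit_vec_def)
    qed
    also have "\<dots> = fin_vec I g \<kappa> l" using A by (simp add: fin_vec_def) (auto simp: A_def)
    finally show ?thesis by simp
  qed
  then have e: "fin_vec I g = (\<Sum>a\<in>A. f a)" by blast
  have "T (\<Sum>a\<in>A. f a) = (\<Sum>a\<in>A. T (f a))"
    by (rule G.sum_restrict_op[OF bounded_ops_add[OF T]]) (auto simp: f_def A_def intro!: G.scal_vecs unit_vec_G)
  also have "\<dots> = (\<Sum>(\<kappa>, l)\<in>A. scal Y (g \<kappa> l) (T (unit_vec \<kappa> l)))"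
    by (intro sum.cong) (auto simp: f_def A_def bounded_ops_scal[OF T] unit_vec_G)
  also have "\<dots> = (\<Sum>\<kappa>\<in>I. \<Sum>l<\<kappa>. scal Y (g \<kappa> l) (T (unit_vec \<kappa> l)))"
    unfolding A_def using I by (simp add: sum.Sigma)
  finally show ?thesis unfolding e .
qed

subsection \<open>Strictness of the inclusions around the operators factoring through \<open>\<ell>\<^sub>p\<close>\<close>

text \<open>The identity of \<open>\<ell>\<^sub>p\<close>, which sits inside \<open>G\<^sub>p\<close> as the first coordinates of all components, yields an operator on
  \<open>J\<close> that factors through \<open>\<ell>\<^sub>p\<close>. It fixes vectors of norm bounded below that are supported in blocks far
  out, and so is not uniformly approximated by truncations.\<close>

lemma compact_strict_subset_factor_L: "compact_ops J \<subset> closed_factor_ops L J"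
proof -
  define T where "T = (embed \<circ> LtoG) \<circ> (GtoL \<circ> coefs)"
  have AB: "embed \<circ> LtoG \<in> bounded_ops L J" "GtoL \<circ> coefs \<in> bounded_ops J L"
    using bounded_ops_comp(1)[OF normed_L normed_G normed_james embed_bounded LtoG_bounded]
      bounded_ops_comp(1)[OF normed_james normed_G normed_L GtoL_bounded coefs_bounded] by auto
  then have TB: "T \<in> bounded_ops J J"
    using bounded_ops_comp(1)[OF normed_james normed_L normed_james] by (simp add: T_def)
  have TL: "T \<in> closed_factor_ops L J"
    unfolding T_def by (rule J.comp_in_closed_factor_ops[OF normed_L AB(2,1)])
  obtain C1 where C1: "0 < C1" "\<And>g. g \<in> vecs G \<Longrightarrow> nrm J (embed g) \<le> C1 * nrm G g"
    using GJ.bounded_ops_bound[OF embed_bounded] by blast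
  obtain C2 where C2: "0 < C2" "\<And>x. x \<in> vecs J \<Longrightarrow> nrm G (coefs x) \<le> C2 * nrm J x"
    using JG.bounded_ops_bound[OF coefs_bounded] by blast
  have "T \<notin> compact_ops J"
  proof
    assume T: "T \<in> compact_ops J"
    define e where "e = 1 / (2 * (C1 * C2))"
    have e: "0 < e" using C1 C2 by (simp add: e_def)
    obtain n where n: "\<And>x. x \<in> unit_ball J \<Longrightarrow> nrm J (T x - trunc n (T x)) \<le> e"
      using compact_ops_trunc[OF T e] by blast
    define \<kappa> where "\<kappa> = Suc n"
    define g where "g = unit_vec \<kappa> 0"
    have g: "g \<in> vecs G" "1 \<le> nrm G g" "nrm G g \<le> 1" using unit_vec_G[of 0 \<kappa>] by (auto simp: g_def \<kappa>_def)
    have xv: "embed g \<in> vecs J" by (rule bounded_ops_vecs[OF embed_bounded g(1)])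
    have "LtoG (GtoL g) = g"
      using bounded_ops_vecs[OF GtoL_bounded g(1)] g(1)
      by (auto simp: LtoG_def GtoL_def g_def unit_vec_def \<kappa>_def fun_eq_iff)
    then have Tx: "T (embed g) = embed g" using coefs_embed[OF g(1)] by (simp add: T_def)
    define c where "c = (of_real (1 / C1) :: 'k)"
    have nc: "norm c = 1 / C1" unfolding c_def norm_of_real using C1 by simp
    let ?x = "scal J c (embed g)"
    have x: "?x \<in> vecs J" by (rule J.scal_vecs[OF xv])
    have nx: "nrm J ?x = nrm J (embed g) / C1" using J.nrm_scal[OF xv] nc by simp
    have "nrm J (embed g) \<le> C1 * 1" using C1(2)[OF g(1)] mult_left_mono[OF g(3), of C1] C1(1) by linarith
    then have ub: "?x \<in> unit_ball J" using x nx C1(1) by (simp add: unit_ball_def)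
    have Tx': "T ?x = ?x" using bounded_ops_scal[OF TB xv] Tx by simp
    have "trunc n ?x = 0"
    proof -
      have "blk i \<noteq> \<kappa>" if "i < n" for i
        using that blk_bounds(1)[of i] le_blk_off[of \<kappa>] by (auto simp: \<kappa>_def)
      then have "embed_fun g i = 0" if "i < n" for i
        using that by (simp add: embed_fun_def g_def unit_vec_def)
      then show ?thesis using g(1) by (auto simp: trunc_def scal_james embed_def fun_eq_iff)
    qed
    then have "nrm J (embed g) / C1 \<le> e" using n[OF ub] Tx' nx by simp
    moreover have "1 \<le> C2 * nrm J (embed g)" using C2(2)[OF xv] g coefs_embed by simp
    moreover have "C2 * nrm J (embed g) = C1 * C2 * (nrm J (embed g) / C1)" using C1(1) by simp
    moreover have "C1 * C2 * (nrm J (embed g) / C1) \<le> C1 * C2 * e" if "nrm J (embed g) / C1 \<le> e"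
      using that C1(1) C2(1) by (intro mult_left_mono) auto
    ultimately have "1 \<le> C1 * C2 * e" by linarith
    then show False using C1(1) C2(1) by (simp add: e_def)
  qed
  then show ?thesis using compact_subset_closed_factor_L TL by blast
qed

lemma embed_coefs_in_factor_G: "embed \<circ> coefs \<in> closed_factor_ops G J"
  by (rule J.comp_in_closed_factor_ops[OF normed_G coefs_bounded embed_bounded])

text \<open>If \<open>B \<circ> A\<close> with \<open>A\<close> into \<open>\<ell>\<^sub>p\<close> is close to \<open>embed \<circ> coefs\<close>, then \<open>A \<circ> embed\<close> is bounded below on the unit
  vectors of \<open>\<ell>\<^sub>\<infinity>\<^sup>n\<close> and bounded on their signed sums, uniformly in \<open>n\<close>, against \<open>signed_sums_unbounded\<close>.\<close>

lemma embed_coefs_notin_factor_L: "embed \<circ> coefs \<notin> closed_factor_ops L J"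
proof
  assume E: "embed \<circ> coefs \<in> closed_factor_ops L J"
  obtain C1 where C1: "0 < C1" "\<And>g. g \<in> vecs G \<Longrightarrow> nrm J (embed g) \<le> C1 * nrm G g"
    using GJ.bounded_ops_bound[OF embed_bounded] by blast
  obtain C2 where C2: "0 < C2" "\<And>x. x \<in> vecs J \<Longrightarrow> nrm G (coefs x) \<le> C2 * nrm J x"
    using JG.bounded_ops_bound[OF coefs_bounded] by blast
  \<comment> \<open>With this \<open>e\<close>, \<open>coefs \<circ> B \<circ> A \<circ> embed\<close> moves vectors of norm 1 by at most \<open>1 / 2\<close>.\<close>
  define e where "e = 1 / (2 * (C1 * C2))"
  have e: "0 < e" using C1 C2 by (simp add: e_def)
  obtain A B where A: "A \<in> bounded_ops J L" and B: "B \<in> bounded_ops L J"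
    and AB: "J.self.opnorm ((embed \<circ> coefs) - (B \<circ> A)) < e"
    using E e unfolding J.closed_factor_ops_iff[OF normed_L] by blast
  obtain CA where CA: "0 < CA" "\<And>x. x \<in> vecs J \<Longrightarrow> nrm L (A x) \<le> CA * nrm J x"
    using JL.bounded_ops_bound[OF A] by blast
  obtain CB where CB: "0 < CB" "\<And>x. x \<in> vecs L \<Longrightarrow> nrm J (B x) \<le> CB * nrm L x"
    using LJ.bounded_ops_bound[OF B] by blast
  have R: "(embed \<circ> coefs) - (B \<circ> A) \<in> bounded_ops J J"
    using J.ops.diff_vecs[of "embed \<circ> coefs" "B \<circ> A"] E
      bounded_ops_comp(1)[OF normed_james normed_L normed_james B A]
    by (simp add: J.closed_factor_ops_iff[OF normed_L])
  define A' where "A' = A \<circ> embed"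
  have A': "A' \<in> bounded_ops G L"
    unfolding A'_def by (rule bounded_ops_comp(1)[OF normed_G normed_james normed_L A embed_bounded])
  have A'_le: "nrm L (A' g) \<le> CA * C1 * nrm G g" if g: "g \<in> vecs G" for g
  proof -
    have "nrm L (A' g) \<le> CA * nrm J (embed g)" using CA(2)[OF bounded_ops_vecs[OF embed_bounded g]] by (simp add: A'_def)
    also have "\<dots> \<le> CA * (C1 * nrm G g)" using C1(2)[OF g] CA(1) by simp
    finally show ?thesis by simp
  qed
  define c where "c = 1 / (2 * (C2 * CB))"
  have c: "0 < c" using C2 CB by (simp add: c_def)
  have low: "c \<le> nrm L (A' (unit_vec \<kappa> l))" if l: "l < \<kappa>" for \<kappa> l
  proof -
    define g where "g = unit_vec \<kappa> l"
    have g: "g \<in> vecs G" "1 \<le> nrm G g" "nrm G g \<le> 1" using unit_vec_G[OF l] by (auto simp: g_def)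
    have xv: "embed g \<in> vecs J" by (rule bounded_ops_vecs[OF embed_bounded g(1)])
    have Av: "A' g \<in> vecs L" by (rule bounded_ops_vecs[OF A' g(1)])
    have Bv: "B (A' g) \<in> vecs J" by (rule bounded_ops_vecs[OF B Av])
    have Bc: "coefs (B (A' g)) \<in> vecs G" by (rule bounded_ops_vecs[OF coefs_bounded Bv])
    have "coefs (embed g - B (A' g)) = g - coefs (B (A' g))"
      using JG.bounded_ops_diff[OF coefs_bounded xv Bv] coefs_embed[OF g(1)] by simp
    moreover have "embed g - B (A' g) = ((embed \<circ> coefs) - (B \<circ> A)) (embed g)"
      using coefs_embed[OF g(1)] by (simp add: A'_def)
    ultimately have d: "g - coefs (B (A' g)) = coefs (((embed \<circ> coefs) - (B \<circ> A)) (embed g))" by simp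
    have "nrm G (g - coefs (B (A' g))) \<le> C2 * nrm J (((embed \<circ> coefs) - (B \<circ> A)) (embed g))"
      unfolding d by (rule C2(2)[OF bounded_ops_vecs[OF R xv]])
    also have "\<dots> \<le> C2 * (e * (C1 * 1))"
    proof (rule mult_left_mono)
      have "nrm J (((embed \<circ> coefs) - (B \<circ> A)) (embed g)) \<le> J.self.opnorm ((embed \<circ> coefs) - (B \<circ> A)) * nrm J (embed g)"
        by (rule J.self.opnorm_bound[OF R xv])
      also have "\<dots> \<le> e * (C1 * 1)"
      proof (rule mult_mono)
        show "nrm J (embed g) \<le> C1 * 1" using C1(2)[OF g(1)] mult_left_mono[OF g(3), of C1] C1(1) by linarith
      qed (use AB e J.nrm_ge_0[OF xv] in auto)
      finally show "nrm J (((embed \<circ> coefs) - (B \<circ> A)) (embed g)) \<le> e * (C1 * 1)" .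
    qed (use C2 in simp)
    also have "\<dots> = 1 / 2" using C1 C2 by (simp add: e_def)
    finally have "1 / 2 \<le> nrm G (coefs (B (A' g)))"
      using G.nrm_triangle_sub[OF g(1) Bc] g(2) by simp
    also have "\<dots> \<le> C2 * nrm J (B (A' g))" by (rule C2(2)[OF Bv])
    also have "\<dots> \<le> C2 * (CB * nrm L (A' g))" using CB(2)[OF Av] C2(1) by simp
    finally show ?thesis using C2(1) CB(1) by (simp add: c_def g_def field_simps)
  qed
  define D where "D = (CA * C1) powr p"
  have D0: "0 \<le> D" by (simp add: D_def)
  have c2: "0 < (c / 2) powr p" using c by simp
  obtain n where n: "\<forall>F (u :: nat \<Rightarrow> nat \<Rightarrow> 'k). finite F \<longrightarrow>
      (\<forall>l<n. (c / 2) powr p \<le> (\<Sum>i\<in>F. norm (u l i) powr p)) \<longrightarrow>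
      (\<exists>m\<le>n. \<exists>\<sigma>. (\<forall>l. \<sigma> l \<in> {1, - 1}) \<and> D < (\<Sum>i\<in>F. norm (\<Sum>l<m. \<sigma> l * u l i) powr p))"
    using signed_sums_unbounded[OF p1 c2 D0] by (rule exE)
  define u where "u = (\<lambda>l. A' (unit_vec n l))"
  \<comment> \<open>Half of the lower bound is already visible on finitely many coordinates.\<close>
  have "\<exists>F. finite F \<and> (c / 2) powr p \<le> (\<Sum>i\<in>F. norm (u l i) powr p)" if l: "l < n" for l
  proof (rule ccontr)
    assume "\<not> ?thesis"
    then have "(\<Sum>i\<in>F. norm (u l i) powr p) \<le> (c / 2) powr p" if "finite F" for F using that by (meson linear)
    then have "nrm L (u l) \<le> c / 2" using c by (intro L_boundI(2)) auto
    then show False using low[OF l] c by (simp add: u_def)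
  qed
  then obtain F where F: "\<And>l. l < n \<Longrightarrow> finite (F l) \<and> (c / 2) powr p \<le> (\<Sum>i\<in>F l. norm (u l i) powr p)" by metis
  define F' where "F' = (\<Union>l<n. F l)"
  have F'fin: "finite F'" using F by (auto simp: F'_def)
  have "(c / 2) powr p \<le> (\<Sum>i\<in>F'. norm (u l i) powr p)" if "l < n" for l
  proof -
    have "(\<Sum>i\<in>F l. norm (u l i) powr p) \<le> (\<Sum>i\<in>F'. norm (u l i) powr p)"
      using that F'fin by (intro sum_mono2) (auto simp: F'_def)
    then show ?thesis using F[OF that] by linarith
  qed
  then obtain m \<sigma> where m: "m \<le> n" "\<And>l. \<sigma> l \<in> {1, - 1}" "D < (\<Sum>i\<in>F'. norm (\<Sum>l<m. \<sigma> l * u l i) powr p)"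
    using n[rule_format, of F' u] F'fin by blast
  define g where "g = fin_vec {n} (\<lambda>\<kappa> l. if l < m then \<sigma> l else 0)"
  have ns: "norm (\<sigma> l) \<le> 1" for l using m(2)[of l] by auto
  have g: "g \<in> vecs G" "nrm G g \<le> 1"
    unfolding g_def using fin_vec_G[of "{n}" 1 "\<lambda>_. 1" "\<lambda>\<kappa> l. if l < m then \<sigma> l else 0"] ns by auto
  have "A' g i = (\<Sum>l<m. \<sigma> l * u l i)" for i
  proof -
    have "A' g = (\<Sum>l<n. scal L (if l < m then \<sigma> l else 0) (u l))"
      unfolding g_def op_fin_vec[OF A' finite.insertI[OF finite.emptyI]] u_def by simp
    then have "A' g i = (\<Sum>l<n. (if l < m then \<sigma> l else 0) * u l i)"
      using sum_fun_coord[of "\<lambda>l. scal L (if l < m then \<sigma> l else 0) (u l)" "{..<n}" i] by (simp add: scal_L)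
    also have "\<dots> = (\<Sum>l<m. \<sigma> l * u l i)"
      using m(1) by (intro sum.mono_neutral_cong_right) auto
    finally show ?thesis .
  qed
  then have "D < (\<Sum>i\<in>F'. norm (A' g i) powr p)" using m(3) by simp
  also have "\<dots> \<le> nrm L (A' g) powr p" by (rule L_upper[OF bounded_ops_vecs[OF A' g(1)] F'fin])
  also have "\<dots> \<le> (CA * C1) powr p"
  proof (rule powr_mono2)
    have "CA * C1 * nrm G g \<le> CA * C1 * 1" using g(2) CA(1) C1(1) by (intro mult_left_mono) auto
    then show "nrm L (A' g) \<le> CA * C1" using A'_le[OF g(1)] by simp
  qed (use p1 L.nrm_ge_0[OF bounded_ops_vecs[OF A' g(1)]] in auto)
  finally show False by (simp add: D_def)
qed

lemma factor_L_strict_subset_factor_G: "closed_factor_ops L J \<subset> closed_factor_ops G J"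
  using closure_of_mono[OF factor_L_subset_factor_G, of "norm_topology (op_space J J)"]
    embed_coefs_in_factor_G embed_coefs_notin_factor_L
  unfolding closed_factor_ops_def by blast

end

section \<open>Operators factoring through \<open>G\<^sub>p\<close>\<close>

context james_setting
begin

lemma G_tail:
  assumes g: "g \<in> vecs G" and e: "0 < e"
  shows "\<exists>r. \<forall>m\<ge>r. nrm G (g - fin_vec {..<m} g) \<le> e"
proof -
  let ?b = "\<lambda>\<kappa>. bnorm g \<kappa> powr p"
  have "summable ?b"
  proof (rule bounded_imp_summable)
    show "sum ?b {..n} \<le> nrm G g powr p" for n by (rule G_upper[OF g]) simp
  qed simp
  then obtain r where r: "\<And>m n. r \<le> m \<Longrightarrow> norm (sum ?b {m..<n}) < e powr p"
    using e unfolding summable_Cauchy by (metis powr_gt_zero less_irrefl)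
  have "nrm G (g - fin_vec {..<m} g) \<le> e" if m: "r \<le> m" for m
  proof (rule G_boundI(2)[where y = "\<lambda>\<kappa>. if \<kappa> < m then 0 else bnorm g \<kappa>"])
    fix F :: "nat set" assume F: "finite F"
    then obtain n where n: "F \<subseteq> {..<n}" by (metis finite_nat_iff_bounded)
    have "(\<Sum>\<kappa>\<in>F. (if \<kappa> < m then 0 else bnorm g \<kappa>) powr p) = sum ?b (F - {..<m})"
      using F p1 by (intro sum.mono_neutral_cong_right) auto
    also have "\<dots> \<le> sum ?b {m..<n}" using n by (intro sum_mono2) auto
    also have "\<dots> \<le> e powr p" using r[OF m, of n] by simp
    finally show "(\<Sum>\<kappa>\<in>F. (if \<kappa> < m then 0 else bnorm g \<kappa>) powr p) \<le> e powr p" .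
  qed (use e in \<open>auto simp: fin_vec_def G_off[OF g] bnorm_nonneg bnorm_coord_le\<close>)
  then show ?thesis by blast
qed

lemma op_fin_vec_comb:
  assumes S: "S \<in> bounded_ops G J" and I: "finite I"
  shows "S (fin_vec I g) = comb I (\<lambda>\<kappa> l. S (unit_vec \<kappa> l)) g"
  unfolding op_fin_vec[OF S I] comb_def by (simp add: fun_eq_iff sum_fun_coord scal_james)

lemma operator_matrix_of_op:
  assumes S: "S \<in> bounded_ops G J" and C: "0 < C" "\<And>g. g \<in> vecs G \<Longrightarrow> nrm J (S g) \<le> C * nrm G g"
    and I: "finite I"
  shows "operator_matrix p I (\<lambda>\<kappa> l. S (unit_vec \<kappa> l)) C"
proof -
  note comb = op_fin_vec_comb[OF S I]
  have bd: "S (fin_vec I g) \<in> vecs J \<and> nrm J (S (fin_vec I g)) \<le> C * D"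
    if "0 \<le> D" "\<And>\<kappa>. \<kappa> \<in> I \<Longrightarrow> 0 \<le> y \<kappa>" "\<And>\<kappa> l. \<lbrakk>\<kappa> \<in> I; l < \<kappa>\<rbrakk> \<Longrightarrow> norm (g \<kappa> l) \<le> y \<kappa>"
      "(\<Sum>\<kappa>\<in>I. y \<kappa> powr p) \<le> D powr p" for D y and g :: "nat \<Rightarrow> nat \<Rightarrow> 'k"
  proof -
    have v: "fin_vec I g \<in> vecs G" "nrm G (fin_vec I g) \<le> D" using fin_vec_G[OF I that] by auto
    have "C * nrm G (fin_vec I g) \<le> C * D" using v(2) C(1) by simp
    then show ?thesis using C(2)[OF v(1)] bounded_ops_vecs[OF S v(1)] by simp
  qed
  show ?thesis
  proof
    fix D y g ns
    assume D: "0 \<le> D" and y: "\<And>\<kappa>. \<kappa> \<in> I \<Longrightarrow> 0 \<le> (y \<kappa> :: real)" "\<And>\<kappa> l. \<lbrakk>\<kappa> \<in> I; l < \<kappa>\<rbrakk> \<Longrightarrow> norm (g \<kappa> l :: 'k) \<le> y \<kappa>"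
      "(\<Sum>\<kappa>\<in>I. y \<kappa> powr p) \<le> D powr p" and ns: "sorted_wrt (<) (ns :: nat list)"
    have v: "S (fin_vec I g) \<in> vecs J" "nrm J (S (fin_vec I g)) \<le> C * D" using bd[OF D y] by auto
    have "list_var p (S (fin_vec I g)) ns \<le> nrm J (S (fin_vec I g)) powr p" by (rule james_upper_powr[OF v(1) ns])
    also have "\<dots> \<le> (C * D) powr p" using v p1 james_norm_ge_0 by (intro powr_mono2) auto
    finally show "list_var p (comb I (\<lambda>\<kappa> l. S (unit_vec \<kappa> l)) g) ns \<le> (C * D) powr p" unfolding comb .
  next
    fix D y g t
    assume D: "0 \<le> D" and y: "\<And>\<kappa>. \<kappa> \<in> I \<Longrightarrow> 0 \<le> (y \<kappa> :: real)" "\<And>\<kappa> l. \<lbrakk>\<kappa> \<in> I; l < \<kappa>\<rbrakk> \<Longrightarrow> norm (g \<kappa> l :: 'k) \<le> y \<kappa>"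
      "(\<Sum>\<kappa>\<in>I. y \<kappa> powr p) \<le> D powr p"
    have v: "S (fin_vec I g) \<in> vecs J" "nrm J (S (fin_vec I g)) \<le> C * D" using bd[OF D y] by auto
    show "norm (comb I (\<lambda>\<kappa> l. S (unit_vec \<kappa> l)) g t) \<le> C * D"
      unfolding comb[symmetric] using james_coord_le[OF v(1), of t] v(2) by linarith
  qed (use I C in auto)
qed

text \<open>The projection fixes the vectors \<open>x j\<close>, the indicators of initial segments of a block that do not contain its end; their
  norms are bounded by \<open>2 * blockc\<close>, independently of the block. If \<open>S \<circ> T\<close> is close to \<open>block_proj\<close>, then \<open>S\<close> maps
  the vectors \<open>T (x j)\<close>, truncated to finitely many components, close to this summing basis, against
  \<open>summing_basis_not_factored\<close>. The tolerance \<open>1 / 4\<close> is spent in equal parts on the distance to \<open>block_proj\<close> and on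
  the truncation.\<close>

lemma block_proj_notin_factor_G: "block_proj \<notin> closed_factor_ops G J"
proof
  assume "block_proj \<in> closed_factor_ops G J"
  define e where "e = 1 / (16 * blockc)"
  have b: "0 < blockc" using powr_ge_zero[of 2 p] by (simp add: add_pos_nonneg order_less_imp_not_eq2)
  then have e: "0 < e" by (simp add: e_def)
  obtain T S where T: "T \<in> bounded_ops J G" and S: "S \<in> bounded_ops G J"
    and ST: "J.self.opnorm (block_proj - (S \<circ> T)) < e"
    using \<open>block_proj \<in> _\<close> e unfolding J.closed_factor_ops_iff[OF normed_G] by blast
  obtain CT where CT: "0 < CT" "\<And>x. x \<in> vecs J \<Longrightarrow> nrm G (T x) \<le> CT * nrm J x"
    using JG.bounded_ops_bound[OF T] by blast
  obtain C where C: "0 < C" "\<And>g. g \<in> vecs G \<Longrightarrow> nrm J (S g) \<le> C * nrm G g"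
    using GJ.bounded_ops_bound[OF S] by blast
  have R: "block_proj - (S \<circ> T) \<in> bounded_ops J J"
    using J.ops.diff_vecs[of block_proj "S \<circ> T"] block_proj_bounded
      bounded_ops_comp(1)[OF normed_james normed_G normed_james S T] by simp
  define B where "B = CT * (2 * blockc)"
  have B: "0 < B" using CT b by (simp add: B_def)
  obtain n where n: "\<forall>I a b s. operator_matrix p I a C \<longrightarrow>
    (\<forall>j<2 ^ n. \<exists>y. (\<forall>\<kappa>\<in>I. 0 \<le> y \<kappa> \<and> (\<forall>l<\<kappa>. norm (b j \<kappa> l) \<le> y \<kappa>)) \<and> (\<Sum>\<kappa>\<in>I. y \<kappa> powr p) \<le> B powr p) \<longrightarrow>
    \<not> (\<forall>j<2 ^ n. \<forall>t<2 ^ n. norm (comb I a (b j) (s + t) - (if t \<le> j then 1 else 0 :: 'k)) \<le> 1 / 4)"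
    using summing_basis_not_factored[OF C(1) B] by (rule exE)
  define x where "x = (\<lambda>j. trunc (blk_off n + Suc j) (\<lambda>_. 1) - trunc (blk_off n) (\<lambda>_. 1 :: 'k))"
  have x: "x j \<in> vecs J" "nrm J (x j) \<le> 2 * blockc" for j
  proof -
    show "x j \<in> vecs J" unfolding x_def by (intro J.diff_vecs summing_vectors)
    show "nrm J (x j) \<le> 2 * blockc"
      using J.nrm_diff_le[OF summing_vectors(1)[of "blk_off n + Suc j"] summing_vectors(1)[of "blk_off n"]]
        summing_vectors(2)[of "blk_off n + Suc j"] summing_vectors(2)[of "blk_off n"] by (simp add: x_def)
  qed
  have px: "block_proj (x j) = x j" if j: "j < 2 ^ n" for j
  proof -
    have "x j (blk_end i) = 0" for i
    proof (rule ccontr)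
      assume "x j (blk_end i) \<noteq> 0"
      then have r: "blk_off n \<le> blk_end i" "blk_end i \<le> blk_off n + j"
        by (auto simp: x_def trunc_def split: if_splits)
      then have "blk (blk_end i) = n" using j by (intro blk_eqI) auto
      then have "blk i = n" by (simp add: blk_blk_end)
      then show False using r(2) j by simp
    qed
    then show ?thesis using x(1) by (simp add: block_proj_def fun_eq_iff)
  qed
  have Tv: "T (x j) \<in> vecs G" for j by (rule bounded_ops_vecs[OF T x(1)])
  define d where "d = 1 / (8 * C)"
  have d: "0 < d" using C by (simp add: d_def)
  have "\<forall>j. \<exists>r. \<forall>m\<ge>r. nrm G (T (x j) - fin_vec {..<m} (T (x j))) \<le> d" by (intro allI G_tail Tv d)
  then obtain r where r: "\<And>j m. r j \<le> m \<Longrightarrow> nrm G (T (x j) - fin_vec {..<m} (T (x j))) \<le> d" by metis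
  define I where "I = {..<(\<Sum>j<2 ^ n. r j)}"
  have I: "finite I" by (simp add: I_def)
  let ?a = "\<lambda>\<kappa> l. S (unit_vec \<kappa> l)"
  have Gb: "nrm G (T (x j)) \<le> B" for j
  proof -
    have "CT * nrm J (x j) \<le> CT * (2 * blockc)" using x(2) CT(1) by (intro mult_left_mono) auto
    then show ?thesis using CT(2)[OF x(1), of j] by (simp add: B_def)
  qed
  have data: "\<exists>y. (\<forall>\<kappa>\<in>I. 0 \<le> y \<kappa> \<and> (\<forall>l<\<kappa>. norm (T (x j) \<kappa> l) \<le> y \<kappa>)) \<and> (\<Sum>\<kappa>\<in>I. y \<kappa> powr p) \<le> B powr p" for j
  proof (intro exI conjI ballI allI impI)
    have "(\<Sum>\<kappa>\<in>I. bnorm (T (x j)) \<kappa> powr p) \<le> nrm G (T (x j)) powr p" by (rule G_upper[OF Tv I])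
    also have "\<dots> \<le> B powr p" using Gb p1 G.nrm_ge_0[OF Tv] by (intro powr_mono2) auto
    finally show "(\<Sum>\<kappa>\<in>I. bnorm (T (x j)) \<kappa> powr p) \<le> B powr p" .
  qed (auto simp: bnorm_nonneg bnorm_coord_le)
  have approx: "norm (comb I ?a (T (x j)) (blk_off n + t) - (if t \<le> j then 1 else 0)) \<le> 1 / 4"
    if j: "j < 2 ^ n" for j t
  proof -
    define h where "h = fin_vec I (T (x j))"
    have rj: "r j \<le> (\<Sum>j<2 ^ n. r j)" using member_le_sum[of j "{..<2 ^ n}" r] j by simp
    have near: "nrm G (T (x j) - h) \<le> d" unfolding h_def I_def by (rule r[OF rj])
    have hv: "h \<in> vecs G"
    proof -
      obtain y where "\<forall>\<kappa>\<in>I. 0 \<le> y \<kappa> \<and> (\<forall>l<\<kappa>. norm (T (x j) \<kappa> l) \<le> y \<kappa>)" "(\<Sum>\<kappa>\<in>I. y \<kappa> powr p) \<le> B powr p"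
        using data[of j] by blast
      then show ?thesis unfolding h_def using B by (intro fin_vec_G(1)[OF I, of B y]) auto
    qed
    have Sv: "S (T (x j)) \<in> vecs J" "S h \<in> vecs J" by (intro bounded_ops_vecs[OF S] Tv hv)+
    let ?i = "blk_off n + t"
    have "norm (S (T (x j)) ?i - S h ?i) \<le> nrm J (S (T (x j)) - S h)"
      using james_coord_le[OF J.diff_vecs[OF Sv], of ?i] by simp
    also have "\<dots> = nrm J (S (T (x j) - h))" using GJ.bounded_ops_diff[OF S Tv hv] by simp
    also have "\<dots> \<le> C * d"
      using C(2)[OF G.diff_vecs[OF Tv hv]] mult_left_mono[OF near, of C] C(1) by (meson less_imp_le order_trans)
    also have "\<dots> = 1 / 8" using C by (simp add: d_def)
    finally have 1: "norm (S (T (x j)) ?i - S h ?i) \<le> 1 / 8" .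
    have "norm (x j ?i - S (T (x j)) ?i) = norm ((block_proj - (S \<circ> T)) (x j) ?i)" using px[OF j] by simp
    also have "\<dots> \<le> nrm J ((block_proj - (S \<circ> T)) (x j))" by (rule james_coord_le[OF bounded_ops_vecs[OF R x(1)]])
    also have "\<dots> \<le> J.self.opnorm (block_proj - (S \<circ> T)) * nrm J (x j)" by (rule J.self.opnorm_bound[OF R x(1)])
    also have "\<dots> \<le> e * (2 * blockc)" using ST x e J.nrm_ge_0[OF x(1)] by (intro mult_mono) auto
    also have "\<dots> = 1 / 8" using b by (simp add: e_def)
    finally have 2: "norm (x j ?i - S (T (x j)) ?i) \<le> 1 / 8" .
    have 3: "x j ?i = (if t \<le> j then 1 else 0)" by (auto simp: x_def trunc_def)
    have 4: "S h ?i = comb I ?a (T (x j)) ?i" unfolding h_def op_fin_vec_comb[OF S I] by (rule refl)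
    have "norm (S h ?i - x j ?i) \<le> 1 / 4"
      using norm_triangle_ineq[of "S h ?i - S (T (x j)) ?i" "S (T (x j)) ?i - x j ?i"] 1 2
      by (simp add: norm_minus_commute)
    then show ?thesis unfolding 3 4 .
  qed
  show False
    using n[rule_format, of I ?a "\<lambda>j. T (x j)" "blk_off n"] operator_matrix_of_op[OF S C I] data approx by blast
qed

lemma factor_G_strict_subset_weakly_compact: "closed_factor_ops G J \<subset> weakly_compact_ops J"
  using factor_G_subset_weakly_compact block_proj_weakly_compact block_proj_notin_factor_G by blast

section \<open>The chain of closed ideals\<close>

lemma zero_closed_ideal: "{0} \<in> closed_ideals J"
proof (rule J.closed_idealsI)
  show "op_ideal J {0}"
    unfolding op_ideal_def using J.self.bounded_ops_0 J.self.bounded_ops_zero by (auto simp: fun_eq_iff)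
  fix T assume T: "T \<in> bounded_ops J J" and near: "\<And>e. e > 0 \<Longrightarrow> \<exists>S\<in>{0}. J.self.opnorm (T - S) < e"
  have "\<not> 0 < J.self.opnorm T" using near[of "J.self.opnorm T"] by auto
  then have "J.self.opnorm T = 0" using J.self.opnorm_ge_0[OF T] by simp
  then show "T \<in> {0}" using J.ops.nrm_eq_0[of T] T by simp
qed

lemma bounded_ops_closed_ideal: "bounded_ops J J \<in> closed_ideals J"
  by (rule J.closed_idealsI)
    (auto simp: op_ideal_def J.self.bounded_ops_0 J.self.bounded_ops_plus J.comp_bounded_ops)

theorem closed_ideal_chain:
  "{0} \<subset> compact_ops J \<and>
   compact_ops J \<subset> closed_factor_ops L J \<and>
   closed_factor_ops L J \<subset> closed_factor_ops G J \<and>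
   closed_factor_ops G J \<subset> weakly_compact_ops J \<and>
   weakly_compact_ops J \<subset> bounded_ops J J \<and>
   {{0}, compact_ops J, closed_factor_ops L J, closed_factor_ops G J,
    weakly_compact_ops J, bounded_ops J J} \<subseteq> closed_ideals J"
  using zero_strict_subset_compact compact_strict_subset_factor_L factor_L_strict_subset_factor_G
    factor_G_strict_subset_weakly_compact weakly_compact_strict_subset
    zero_closed_ideal compact_closed_ideal weakly_compact_closed_ideal bounded_ops_closed_ideal
    J.closure_op_ideal(1)[OF factor_L_op_ideal] J.closure_op_ideal(1)[OF factor_G_op_ideal]
  by (simp add: closed_factor_ops_def)

end

theorem theorem1p2:
  fixes p :: real
  assumes "1 < p"
  shows
    "(let J = (james_space p :: (real, nat \<Rightarrow> real) nspace) in
        {0} \<subset> compact_ops J \<and>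
        compact_ops J \<subset> closed_factor_ops (lp_space p) J \<and>
        closed_factor_ops (lp_space p) J \<subset> closed_factor_ops (G_space p) J \<and>
        closed_factor_ops (G_space p) J \<subset> weakly_compact_ops J \<and>
        weakly_compact_ops J \<subset> bounded_ops J J \<and>
        {{0}, compact_ops J, closed_factor_ops (lp_space p) J, closed_factor_ops (G_space p) J,
         weakly_compact_ops J, bounded_ops J J} \<subseteq> closed_ideals J) \<and>
     (let J = (james_space p :: (complex, nat \<Rightarrow> complex) nspace) in
        {0} \<subset> compact_ops J \<and>
        compact_ops J \<subset> closed_factor_ops (lp_space p) J \<and>
        closed_factor_ops (lp_space p) J \<subset> closed_factor_ops (G_space p) J \<and>
        closed_factor_ops (G_space p) J \<subset> weakly_compact_ops J \<and>
        weakly_compact_ops J \<subset> bounded_ops J J \<and>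
        {{0}, compact_ops J, closed_factor_ops (lp_space p) J, closed_factor_ops (G_space p) J,
         weakly_compact_ops J, bounded_ops J J} \<subseteq> closed_ideals J)"
proof -
  interpret R: james_setting p "TYPE(real)" using assms by (rule james_setting.intro)
  interpret C: james_setting p "TYPE(complex)" using assms by (rule james_setting.intro)
  show ?thesis unfolding Let_def using R.closed_ideal_chain C.closed_ideal_chain by (rule conjI)
qed

end
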